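(* Let $n\ge2$, $\mathbf{d}=(d_1,\dots,d_s)$ with $1\le d_1<\dots<d_s<n$, $\lambda=\sum_{a=1}^sm_{d_a}\omega_{d_a}$ with $m_{d_a}\in\mathbb{Z}_{\ge0}$, and let $M\ge0$ be an integer. The relations $$f_{\beta_1}^{a_1}\cdots f_{\beta_r}^{a_r}\,\ell_{\lambda,M}=0\quad\text{if}\quad f_{\beta_i}\in\mathfrak{r}_{\mathbf{d}},\ \ a_1+\dots+a_r>M+\sum_{i=1}^r(\lambda,\beta_i)$$ ($r\ge1$, $\beta_i$ positive roots, $a_i\in\mathbb{Z}_{\ge0}$) are defining for the cyclic $\mathfrak{sl}_{n,\mathbf{d}}^a$-module $L^a_{\mathbf{d},\lambda,M}$; that is, they hold and the annihilator of $\ell_{\lambda,M}$ in $S(\mathfrak{r}_{\mathbf{d}}^a)$ is the smallest $\mathfrak{p}_{\mathbf{d}}$-stable ideal containing all these monomials. The vectors $f^{\mathbf{s}}\ell_{\lambda,M}$, $\mathbf{s}\in S_{\mathbf{d},\lambda,M}$, form a basis of $L^a_{\mathbf{d},\lambda,M}$.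
   Context: Everything is over $\mathbb{C}$. $E_{i,j}$ are matrix units; positive roots of $\mathfrak{sl}_n$ are $\alpha_{i,j}=\alpha_i+\dots+\alpha_j$, $1\le i\le j\le n-1$, $f_{\alpha_{i,j}}=E_{j+1,i}$, and $(\alpha_i,\omega_j)=\delta_{i,j}$. $\mathfrak{p}_{\mathbf{d}}\subset\mathfrak{sl}_n$ is the standard parabolic subalgebra containing the upper triangular Borel $\mathfrak{b}$ and the $f_{\alpha_i}$ with $i\notin\{d_1,\dots,d_s\}$. Its complementary radical $\mathfrak{r}_{\mathbf{d}}\subset\mathfrak{n}_-$ is spanned by the $E_{i,j}$ with $i>d_a\ge j$ for some $a$, so $\mathfrak{sl}_n=\mathfrak{p}_{\mathbf{d}}\oplus\mathfrak{r}_{\mathbf{d}}$. The degenerate Lie algebra $\mathfrak{sl}_{n,\mathbf{d}}^a=\mathfrak{p}_{\mathbf{d}}\oplus\mathfrak{r}_{\mathbf{d}}^a$ has $\mathfrak{p}_{\mathbf{d}}$ as a subalgebra and $\mathfrak{r}_{\mathbf{d}}^a$ ($=\mathfrak{r}_{\mathbf{d}}$ as a vector space) as an abelian ideal with $\mathfrak{p}_{\mathbf{d}}$ acting via $\mathfrak{r}_{\mathbf{d}}^a\simeq\mathfrak{sl}_n/\mathfrak{p}_{\mathbf{d}}$. $\mathfrak{p}_{\mathbf{d}}$ acts on $S(\mathfrak{r}_{\mathbf{d}}^a)=U(\mathfrak{r}_{\mathbf{d}}^a)$ by derivations extending this action. The irreducible module $L_\lambda$ with highest weight vector $\ell_\lambda$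 is generated from $\ell_\lambda$ by $U(\mathfrak{r}_{\mathbf{d}})$; it is filtered by $\mathrm{span}\{a_1\cdots a_r\ell_\lambda:a_i\in\mathfrak{r}_{\mathbf{d}},r\le s\}$, $s\ge0$, and $L_\lambda^a$ denotes the associated graded $\mathfrak{sl}_{n,\mathbf{d}}^a$-module. $V_{\mathbf{d}}=\mathbb{C}v\oplus V_{\mathbf{d}}(1)$, $V_{\mathbf{d}}(1)\simeq\mathfrak{r}_{\mathbf{d}}^a$, is the cyclic $\mathfrak{sl}_{n,\mathbf{d}}^a$-module on which $\mathfrak{p}_{\mathbf{d}}$ acts by zero on $v$ and via $\mathfrak{sl}_n/\mathfrak{p}_{\mathbf{d}}$ on $V_{\mathbf{d}}(1)$, and $x\in\mathfrak{r}_{\mathbf{d}}^a$ sends $v$ to $x\in V_{\mathbf{d}}(1)$ and kills $V_{\mathbf{d}}(1)$. $V_{\mathbf{d},M}=U(\mathfrak{r}_{\mathbf{d}}^a)v^{\otimes M}\subset V_{\mathbf{d}}^{\otimes M}$ and $L^a_{\mathbf{d},\lambda,M}=U(\mathfrak{r}_{\mathbf{d}}^a)(\ell_\lambda\otimes v^{\otimes M})\subset L_\lambda^a\otimes V_{\mathbf{d},M}$, with cyclic vector $\ell_{\lambda,M}=\ell_\lambda\otimes v^{\otimes M}$. $P=\{(i,j):1\le j<i\le n\}$ is the poset with $(i,j)\le(i_1,j_1)$ iff $i\le i_1$, $j\le j_1$; $P_d=\{(i,j)\in P:i>d\ge j\}$; $P_{\mathbf{d}}=\bigcup_aP_{d_a}$;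 $w$ is the width (maximal size of an antichain, $w(\emptyset)=0$). $S_{\mathbf{d},\lambda,M}$ is the set of $(s_\alpha)\in\mathbb{Z}_{\ge0}^{P_{\mathbf{d}}}$ with $\sum_{\alpha\in P'}s_\alpha\le M+\sum_{a=1}^sm_{d_a}w(P'\cap P_{d_a})$ for all $P'\subset P_{\mathbf{d}}$. For $\mathbf{s}\in S_{\mathbf{d},\lambda,M}$, $f^{\mathbf{s}}=\prod_{(i,j)\in P_{\mathbf{d}}}E_{i,j}^{s_{i,j}}$. *)

theory Defs
  imports
    "Jordan_Normal_Form.VS_Connect"
    "HOL-Algebra.Ideal"
    "HOL-Library.Poly_Mapping"
    "HOL-Library.Set_Algebras"
begin

text \<open>
  Matrices are the \<open>0\<close>-indexed matrices of \<^theory>\<open>Jordan_Normal_Form.Matrix\<close>; the functions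
  \<open>ent\<close> and \<open>Emat\<close> translate to the \<open>1\<close>-based labels used everywhere else.  The tuple
  \<open>d_1 < ... < d_s\<close> is given by the set \<open>D\<close> of its entries, and \<open>m d\<close> is the
  coefficient of the fundamental weight \<open>\<omega>_d\<close>; only the values \<open>m d\<close> with \<open>d \<in> D\<close> matter.
\<close>

section \<open>The Lie algebra and its degeneration\<close>

definition ent :: "complex mat \<Rightarrow> nat \<Rightarrow> nat \<Rightarrow> complex" where
  "ent x i j = x $$ (i - 1, j - 1)"

definition Emat :: "nat \<Rightarrow> nat \<Rightarrow> nat \<Rightarrow> complex mat" where
  "Emat n i j = mat n n (\<lambda>(a, b). if a + 1 = i \<and> b + 1 = j then 1 else 0)"

definition sl :: "nat \<Rightarrow> complex mat set" where
  "sl n = {x \<in> carrier_mat n n. (\<Sum>i<n. x $$ (i, i)) = 0}"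

definition commutator :: "complex mat \<Rightarrow> complex mat \<Rightarrow> complex mat" where
  "commutator x y = x * y - y * x"

definition lie_subalgebra :: "nat \<Rightarrow> complex mat set \<Rightarrow> bool" where
  "lie_subalgebra n A \<longleftrightarrow>
     A \<subseteq> sl n \<and> 0\<^sub>m n n \<in> A \<and>
     (\<forall>x\<in>A. \<forall>y\<in>A. x + y \<in> A) \<and> (\<forall>c. \<forall>x\<in>A. c \<cdot>\<^sub>m x \<in> A) \<and>
     (\<forall>x\<in>A. \<forall>y\<in>A. commutator x y \<in> A)"

definition Pos :: "nat \<Rightarrow> (nat \<times> nat) set" where
  "Pos n = {(i, j). 1 \<le> j \<and> j < i \<and> i \<le> n}"

definition Pd :: "nat \<Rightarrow> nat \<Rightarrow> (nat \<times> nat) set" where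
  "Pd n d = {(i, j) \<in> Pos n. i > d \<and> d \<ge> j}"

definition PD :: "nat \<Rightarrow> nat set \<Rightarrow> (nat \<times> nat) set" where
  "PD n D = (\<Union>d\<in>D. Pd n d)"

text \<open>The parabolic subalgebra is generated by the upper triangular Borel subalgebra and the
  \<open>f_{\<alpha>_i} = E_{i+1,i}\<close> with \<open>i \<notin> D\<close>; see \<open>parabolic_eq\<close> below for its block form.\<close>

definition parabolic :: "nat \<Rightarrow> nat set \<Rightarrow> complex mat set" where
  "parabolic n D = \<Inter>{A. lie_subalgebra n A \<and> {x \<in> sl n. upper_triangular x} \<subseteq> A \<and>
                        (\<forall>i\<in>{1..<n} - D. Emat n (i + 1) i \<in> A)}"

lemma comm_closed_block:
  assumes D: "D \<subseteq> {1..<n}" and x: "x \<in> carrier_mat n n" and y: "y \<in> carrier_mat n n"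
    and bx: "\<forall>(i, j)\<in>PD n D. ent x i j = 0" and by': "\<forall>(i, j)\<in>PD n D. ent y i j = 0"
    and ij: "(i, j) \<in> PD n D"
  shows "ent (x * y) i j = 0"
proof -
  from ij obtain d where d: "d \<in> D" "j \<le> d" "d < i" "1 \<le> j" "i \<le> n"
    by (auto simp: PD_def Pd_def Pos_def)
  have "x $$ (i - 1, k) * y $$ (k, j - 1) = 0" if "k < n" for k
  proof (cases "k + 1 \<le> d")
    case True
    then have "(i, k + 1) \<in> Pd n d" using d by (auto simp: Pd_def Pos_def)
    then have "(i, k + 1) \<in> PD n D" using d(1) by (auto simp: PD_def)
    with bx have "ent x i (k + 1) = 0" by blast
    then show ?thesis by (simp add: ent_def)
  next
    case False
    then have "(k + 1, j) \<in> Pd n d" using d that by (auto simp: Pd_def Pos_def)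
    then have "(k + 1, j) \<in> PD n D" using d(1) by (auto simp: PD_def)
    with by' have "ent y (k + 1) j = 0" by blast
    then show ?thesis by (simp add: ent_def)
  qed
  then show ?thesis
    using d x y by (auto simp: ent_def scalar_prod_def intro!: sum.neutral)
qed

lemma sum_diag_mult_commute:
  assumes "x \<in> carrier_mat n n" "y \<in> carrier_mat n n"
  shows "(\<Sum>i<n. (x * y) $$ (i, i)) = (\<Sum>i<n. (y * x) $$ (i, i :: nat) :: complex)"
proof -
  have "(\<Sum>i<n. (x * y) $$ (i, i)) = (\<Sum>i<n. \<Sum>k<n. x $$ (i, k) * y $$ (k, i))"
    using assms by (intro sum.cong) (auto simp: scalar_prod_def lessThan_atLeast0)
  also have "\<dots> = (\<Sum>k<n. \<Sum>i<n. y $$ (k, i) * x $$ (i, k))"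
    by (subst sum.swap) (simp add: mult.commute)
  also have "\<dots> = (\<Sum>i<n. (y * x) $$ (i, i))"
    using assms by (intro sum.cong) (auto simp: scalar_prod_def lessThan_atLeast0)
  finally show ?thesis .
qed

lemma lie_subalgebra_block:
  assumes D: "D \<subseteq> {1..<n}"
  shows "lie_subalgebra n {x \<in> sl n. \<forall>(i, j)\<in>PD n D. ent x i j = 0}"
proof -
  have idx: "i - 1 < n" "j - 1 < n" if "(i, j) \<in> PD n D" for i j
    using that by (auto simp: PD_def Pd_def Pos_def)
  let ?B = "{x \<in> sl n. \<forall>(i, j)\<in>PD n D. ent x i j = 0}"
  have BI: "x \<in> ?B" if "x \<in> sl n" "\<And>i j. (i, j) \<in> PD n D \<Longrightarrow> ent x i j = 0" for x
    using that by auto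
  have "commutator x y \<in> ?B" if "x \<in> ?B" "y \<in> ?B" for x y
  proof (rule BI)
    have x: "x \<in> carrier_mat n n" "\<forall>(i, j)\<in>PD n D. ent x i j = 0"
      and y: "y \<in> carrier_mat n n" "\<forall>(i, j)\<in>PD n D. ent y i j = 0"
      using that by (auto simp: sl_def)
    show "commutator x y \<in> sl n"
      using x(1) y(1) sum_diag_mult_commute[OF x(1) y(1)]
      by (auto simp: sl_def commutator_def sum_subtractf simp del: index_mult_mat(1))
    show "ent (commutator x y) i j = 0" if "(i, j) \<in> PD n D" for i j
      using comm_closed_block[OF D x(1) y(1) x(2) y(2) that]
        comm_closed_block[OF D y(1) x(1) y(2) x(2) that] idx[OF that] x(1) y(1)
      by (simp add: commutator_def ent_def)
  qed
  moreover have "x + y \<in> ?B" if "x \<in> ?B" "y \<in> ?B" for x y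
  proof (rule BI)
    show "x + y \<in> sl n" using that by (auto simp: sl_def sum.distrib)
    show "ent (x + y) i j = 0" if ij: "(i, j) \<in> PD n D" for i j
    proof -
      have "ent x i j = 0" "ent y i j = 0" using \<open>x \<in> ?B\<close> \<open>y \<in> ?B\<close> ij by auto
      then show ?thesis using \<open>x \<in> ?B\<close> \<open>y \<in> ?B\<close> idx[OF ij] by (auto simp: ent_def sl_def)
    qed
  qed
  moreover have "c \<cdot>\<^sub>m x \<in> ?B" if "x \<in> ?B" for x c
  proof (rule BI)
    show "c \<cdot>\<^sub>m x \<in> sl n" using that by (auto simp: sl_def sum_distrib_left[symmetric])
    show "ent (c \<cdot>\<^sub>m x) i j = 0" if ij: "(i, j) \<in> PD n D" for i j
    proof -
      have "ent x i j = 0" using \<open>x \<in> ?B\<close> ij by auto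
      then show ?thesis using \<open>x \<in> ?B\<close> idx[OF ij] by (auto simp: ent_def sl_def)
    qed
  qed
  moreover have "0\<^sub>m n n \<in> ?B"
  proof (rule BI)
    show "0\<^sub>m n n \<in> sl n" by (simp add: sl_def)
    show "ent (0\<^sub>m n n) i j = 0" if "(i, j) \<in> PD n D" for i j
      using idx[OF that] by (simp add: ent_def)
  qed
  moreover have "?B \<subseteq> sl n" by auto
  ultimately show ?thesis
    unfolding lie_subalgebra_def by (intro conjI ballI allI)
qed

lemma commutator_Emat:
  assumes "i \<noteq> l"
  shows "commutator (Emat n i k) (Emat n k l) = (if 1 \<le> k \<and> k \<le> n then Emat n i l else 0\<^sub>m n n)"
proof (rule eq_matI)
  fix a b assume "a < dim_row (if 1 \<le> k \<and> k \<le> n then Emat n i l else 0\<^sub>m n n)"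
    "b < dim_col (if 1 \<le> k \<and> k \<le> n then Emat n i l else 0\<^sub>m n n)"
  then have ab: "a < n" "b < n" by (auto simp: Emat_def split: if_splits)
  have mult: "(Emat n p q * Emat n q' p') $$ (a, b) =
      (\<Sum>c = 0..<n. if q = q' \<and> c + 1 = q \<and> a + 1 = p \<and> b + 1 = p' then 1 else 0)" for p q q' p'
    using ab by (auto simp: Emat_def scalar_prod_def intro!: sum.cong)
  have "(Emat n i k * Emat n k l) $$ (a, b) =
      (\<Sum>c = 0..<n. if c = k - 1 then (if 1 \<le> k \<and> a + 1 = i \<and> b + 1 = l then 1 else 0) else 0)"
    unfolding mult by (intro sum.cong) auto
  also have "\<dots> = (if 1 \<le> k \<and> k \<le> n then Emat n i l else 0\<^sub>m n n) $$ (a, b)"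
    using ab by (subst sum.delta) (auto simp: Emat_def)
  finally have 1: "(Emat n i k * Emat n k l) $$ (a, b)
      = (if 1 \<le> k \<and> k \<le> n then Emat n i l else 0\<^sub>m n n) $$ (a, b)" .
  have 2: "(Emat n k l * Emat n i k) $$ (a, b) = 0"
    unfolding mult using assms by (intro sum.neutral) auto
  have "commutator (Emat n i k) (Emat n k l) $$ (a, b)
      = (Emat n i k * Emat n k l) $$ (a, b) - (Emat n k l * Emat n i k) $$ (a, b)"
    unfolding commutator_def by (rule index_minus_mat) (use ab in \<open>simp_all add: Emat_def\<close>)
  then show "commutator (Emat n i k) (Emat n k l) $$ (a, b)
      = (if 1 \<le> k \<and> k \<le> n then Emat n i l else 0\<^sub>m n n) $$ (a, b)"
    unfolding 1 2 by simp
qed (auto simp: commutator_def Emat_def)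

lemma parabolic_eq:
  assumes D: "D \<subseteq> {1..<n}"
  shows "parabolic n D = {x \<in> sl n. \<forall>(i, j)\<in>PD n D. ent x i j = 0}"
proof
  let ?B = "{x \<in> sl n. \<forall>(i, j)\<in>PD n D. ent x i j = 0}"
  have "{x \<in> sl n. upper_triangular x} \<subseteq> ?B"
    by (auto simp: sl_def PD_def Pd_def Pos_def ent_def)
  moreover have "Emat n (i + 1) i \<in> ?B" if "i \<in> {1..<n} - D" for i
  proof -
    have "(i + 1, i) \<notin> PD n D"
      using that by (auto simp: PD_def Pd_def Pos_def) (metis le_antisym less_Suc_eq_le)
    then have "ent (Emat n (i + 1) i) a b = 0" if "(a, b) \<in> PD n D" for a b
      using that by (auto simp: Emat_def ent_def PD_def Pd_def Pos_def)
    then show ?thesis by (auto simp: Emat_def sl_def intro!: sum.neutral)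
  qed
  ultimately show "parabolic n D \<subseteq> ?B"
    unfolding parabolic_def using lie_subalgebra_block[OF D] by blast
next
  show "{x \<in> sl n. \<forall>(i, j)\<in>PD n D. ent x i j = 0} \<subseteq> parabolic n D"
    unfolding parabolic_def
  proof (intro subsetI InterI, elim CollectE conjE)
    fix x A
    assume x: "x \<in> sl n" and x0: "\<forall>(i, j)\<in>PD n D. ent x i j = 0" and A: "lie_subalgebra n A"
      and up: "{x \<in> sl n. upper_triangular x} \<subseteq> A" and f: "\<forall>i\<in>{1..<n} - D. Emat n (i + 1) i \<in> A"
    have E: "Emat n (j + 1 + k) j \<in> A" if "1 \<le> j" "j + 1 + k \<le> n" "(j + 1 + k, j) \<notin> PD n D" for j k
      using that
    proof (induction k)
      case 0
      then have "j \<in> {1..<n} - D" by (auto simp: PD_def Pd_def Pos_def)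
      with f show ?case by simp
    next
      case (Suc k)
      have "(j + 1 + k, j) \<notin> PD n D" using Suc.prems by (auto simp: PD_def Pd_def Pos_def)
      then have 1: "Emat n (j + 1 + k) j \<in> A" using Suc by simp
      have "j + 1 + k \<in> {1..<n} - D" using Suc.prems by (auto simp: PD_def Pd_def Pos_def)
      then have "Emat n (j + 1 + k + 1) (j + 1 + k) \<in> A" using f by blast
      with 1 A have "commutator (Emat n (j + 1 + k + 1) (j + 1 + k)) (Emat n (j + 1 + k) j) \<in> A"
        by (auto simp: lie_subalgebra_def)
      then show ?case using Suc.prems by (simp add: commutator_Emat)
    qed
    have xc: "x \<in> carrier_mat n n" using x by (simp add: sl_def)
    define part where
      "part Q = mat n n (\<lambda>(a, b). if b < a \<and> (a + 1, b + 1) \<notin> Q then 0 else x $$ (a, b))" for Q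
    have part_A: "part Q \<in> A" if "finite Q" "Q \<subseteq> Pos n - PD n D" for Q
      using that
    proof (induction Q rule: finite_induct)
      case empty
      have "part {} \<in> sl n" "upper_triangular (part {})"
        using x by (auto simp: part_def sl_def)
      with up show ?case by blast
    next
      case (insert q Q)
      obtain i j where q: "q = (i, j)" by (cases q)
      with insert.prems have ij: "1 \<le> j" "j < i" "i \<le> n" "(i, j) \<notin> PD n D" by (auto simp: Pos_def)
      have "Emat n i j \<in> A" using E[of j "i - j - 1"] ij by simp
      then have "part Q + x $$ (i - 1, j - 1) \<cdot>\<^sub>m Emat n i j \<in> A"
        using insert A by (auto simp: lie_subalgebra_def)
      also have "part Q + x $$ (i - 1, j - 1) \<cdot>\<^sub>m Emat n i j = part (insert q Q)"
        using ij insert.hyps q by (intro eq_matI) (auto simp: part_def Emat_def)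
      finally show ?case .
    qed
    have "finite (Pos n)"
      by (rule finite_subset[of _ "{..n} \<times> {..n}"]) (auto simp: Pos_def)
    then have "part (Pos n - PD n D) \<in> A" by (intro part_A) auto
    also have "part (Pos n - PD n D) = x"
    proof (rule eq_matI)
      fix a b assume "a < dim_row x" "b < dim_col x"
      then have ab: "a < n" "b < n" using xc by auto
      have "x $$ (a, b) = 0" if "(a + 1, b + 1) \<in> PD n D"
        using x0 that by (force simp: ent_def)
      then show "part (Pos n - PD n D) $$ (a, b) = x $$ (a, b)"
        using ab by (auto simp: part_def Pos_def)
    qed (use xc in \<open>auto simp: part_def\<close>)
    finally show "x \<in> A" .
  qed
qed

text \<open>The components of \<open>x\<close> with respect to the decomposition of \<open>sl n\<close> into the parabolic
  subalgebra and the span of the \<open>E_{i,j}\<close>, \<open>(i,j) \<in> PD n D\<close>.\<close>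

definition rpart :: "nat \<Rightarrow> nat set \<Rightarrow> complex mat \<Rightarrow> complex mat" where
  "rpart n D x = mat n n (\<lambda>(a, b). if (a + 1, b + 1) \<in> PD n D then x $$ (a, b) else 0)"

definition ppart :: "nat \<Rightarrow> nat set \<Rightarrow> complex mat \<Rightarrow> complex mat" where
  "ppart n D x = x - rpart n D x"

definition radical :: "nat \<Rightarrow> nat set \<Rightarrow> complex mat set" where
  "radical n D = {x \<in> carrier_mat n n. rpart n D x = x}"

text \<open>The bracket of the degenerate Lie algebra, on the vector space \<open>sl n\<close>: the radical is an
  abelian ideal, identified with the quotient of \<open>sl n\<close> by the parabolic subalgebra through
  \<open>rpart\<close>.\<close>

definition deg_bracket :: "nat \<Rightarrow> nat set \<Rightarrow> complex mat \<Rightarrow> complex mat \<Rightarrow> complex mat" where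
  "deg_bracket n D x y =
     commutator (ppart n D x) (ppart n D y)
     + rpart n D (commutator (ppart n D x) (rpart n D y))
     + rpart n D (commutator (rpart n D x) (ppart n D y))"


section \<open>The symmetric algebra of the radical\<close>

text \<open>Polynomials in variables indexed by pairs; \<open>fvar (i, j)\<close> stands for \<open>E_{i,j}\<close>.\<close>

type_synonym pol = "((nat \<times> nat) \<Rightarrow>\<^sub>0 nat) \<Rightarrow>\<^sub>0 complex"

definition fvar :: "nat \<times> nat \<Rightarrow> pol" where
  "fvar \<alpha> = Poly_Mapping.single (Poly_Mapping.single \<alpha> 1) 1"

definition Sym :: "nat \<Rightarrow> nat set \<Rightarrow> pol set" where
  "Sym n D = {p. \<forall>e\<in>Poly_Mapping.keys p. Poly_Mapping.keys e \<subseteq> PD n D}"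

definition Sym_ring :: "nat \<Rightarrow> nat set \<Rightarrow> pol ring" where
  "Sym_ring n D = \<lparr>carrier = Sym n D, mult = (*), one = 1, zero = 0, add = (+)\<rparr>"

definition lin_form :: "nat \<Rightarrow> nat set \<Rightarrow> complex mat \<Rightarrow> pol" where
  "lin_form n D y = (\<Sum>(i, j)\<in>PD n D. Poly_Mapping.single 0 (ent y i j) * fvar (i, j))"

text \<open>The derivation extending \<open>deg_bracket n D x\<close> for \<open>x\<close> in the parabolic subalgebra, written
  out on monomials; see \<open>deriv_fvar\<close>, \<open>deriv_add\<close>, \<open>deriv_const\<close>, \<open>deriv_mult\<close> below.\<close>

definition deriv_mono :: "nat \<Rightarrow> nat set \<Rightarrow> complex mat \<Rightarrow> ((nat \<times> nat) \<Rightarrow>\<^sub>0 nat) \<Rightarrow> pol" where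
  "deriv_mono n D x e =
     (\<Sum>\<alpha>\<in>Poly_Mapping.keys e.
        Poly_Mapping.single (e - Poly_Mapping.single \<alpha> 1) (of_nat (Poly_Mapping.lookup e \<alpha>))
        * lin_form n D (deg_bracket n D x (Emat n (fst \<alpha>) (snd \<alpha>))))"

definition deriv :: "nat \<Rightarrow> nat set \<Rightarrow> complex mat \<Rightarrow> pol \<Rightarrow> pol" where
  "deriv n D x p =
     (\<Sum>e\<in>Poly_Mapping.keys p.
        Poly_Mapping.single 0 (Poly_Mapping.lookup p e) * deriv_mono n D x e)"

lemma deriv_mono_superset:
  assumes "finite K" "Poly_Mapping.keys e \<subseteq> K"
  shows "deriv_mono n D x e =
     (\<Sum>\<alpha>\<in>K. Poly_Mapping.single (e - Poly_Mapping.single \<alpha> 1) (of_nat (Poly_Mapping.lookup e \<alpha>))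
        * lin_form n D (deg_bracket n D x (Emat n (fst \<alpha>) (snd \<alpha>))))"
  unfolding deriv_mono_def
  by (rule sum.mono_neutral_left) (use assms in \<open>auto simp: in_keys_iff\<close>)

lemma deriv_superset:
  assumes "finite K" "Poly_Mapping.keys p \<subseteq> K"
  shows "deriv n D x p =
     (\<Sum>e\<in>K. Poly_Mapping.single 0 (Poly_Mapping.lookup p e) * deriv_mono n D x e)"
  unfolding deriv_def
  by (rule sum.mono_neutral_left) (use assms in \<open>auto simp: in_keys_iff\<close>)

lemma deriv_single:
  "deriv n D x (Poly_Mapping.single e c) = Poly_Mapping.single 0 c * deriv_mono n D x e"
  by (subst deriv_superset[of "{e}"]) auto

lemma deriv_fvar:
  "deriv n D x (fvar \<alpha>) = lin_form n D (deg_bracket n D x (Emat n (fst \<alpha>) (snd \<alpha>)))"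
  by (simp add: fvar_def deriv_single deriv_mono_def)

lemma deriv_const: "deriv n D x (Poly_Mapping.single 0 c) = 0"
  by (simp add: deriv_single deriv_mono_def)

lemma deriv_add: "deriv n D x (p + q) = deriv n D x p + deriv n D x q"
proof -
  let ?K = "Poly_Mapping.keys p \<union> Poly_Mapping.keys q"
  have "deriv n D x r =
      (\<Sum>e\<in>?K. Poly_Mapping.single 0 (Poly_Mapping.lookup r e) * deriv_mono n D x e)"
    if "Poly_Mapping.keys r \<subseteq> ?K" for r
    by (rule deriv_superset) (use that in auto)
  from this[of p] this[of q] this[of "p + q", OF Poly_Mapping.keys_add] show ?thesis
    by (simp add: lookup_add single_add distrib_right sum.distrib)
qed

lemma deriv_sum: "deriv n D x (sum f A) = (\<Sum>a\<in>A. deriv n D x (f a))"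
  by (induction A rule: infinite_finite_induct)
     (use deriv_const[of n D x 0] in \<open>auto simp: deriv_add\<close>)

lemma deriv_mono_add:
  "deriv_mono n D x (e + e') =
     deriv_mono n D x e * Poly_Mapping.single e' 1 + Poly_Mapping.single e 1 * deriv_mono n D x e'"
proof -
  let ?K = "Poly_Mapping.keys e \<union> Poly_Mapping.keys e'"
  let ?d = "\<lambda>\<alpha>. Poly_Mapping.single \<alpha> (1::nat)"
  let ?l = "\<lambda>\<alpha>. lin_form n D (deg_bracket n D x (Emat n (fst \<alpha>) (snd \<alpha>)))"
  have eq: "deriv_mono n D x r =
      (\<Sum>\<alpha>\<in>?K. Poly_Mapping.single (r - ?d \<alpha>) (of_nat (Poly_Mapping.lookup r \<alpha>)) * ?l \<alpha>)"
    if "Poly_Mapping.keys r \<subseteq> ?K" for r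
    by (rule deriv_mono_superset) (use that in auto)
  have shift: "Poly_Mapping.single (a + b - ?d \<alpha>) (of_nat (Poly_Mapping.lookup a \<alpha>) :: complex)
      = Poly_Mapping.single (a - ?d \<alpha> + b) (of_nat (Poly_Mapping.lookup a \<alpha>))"
    for a b :: "(nat \<times> nat) \<Rightarrow>\<^sub>0 nat" and \<alpha>
  proof (cases "Poly_Mapping.lookup a \<alpha> = 0")
    case False
    then have "a + b - ?d \<alpha> = a - ?d \<alpha> + b"
      by (intro poly_mapping_eqI) (auto simp: lookup_add lookup_minus lookup_single when_def)
    then show ?thesis by simp
  qed simp
  have "Poly_Mapping.single (e + e' - ?d \<alpha>) (of_nat (Poly_Mapping.lookup (e + e') \<alpha>) :: complex)
     = Poly_Mapping.single (e - ?d \<alpha>) (of_nat (Poly_Mapping.lookup e \<alpha>)) * Poly_Mapping.single e' 1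
     + Poly_Mapping.single e 1 * Poly_Mapping.single (e' - ?d \<alpha>) (of_nat (Poly_Mapping.lookup e' \<alpha>))"
    for \<alpha>
    using shift[of e e' \<alpha>] shift[of e' e \<alpha>]
    by (simp add: lookup_add single_add mult_single add.commute)
  then have "deriv_mono n D x (e + e') =
     (\<Sum>\<alpha>\<in>?K. (Poly_Mapping.single (e - ?d \<alpha>) (of_nat (Poly_Mapping.lookup e \<alpha>)) * ?l \<alpha>)
                * Poly_Mapping.single e' 1
             + Poly_Mapping.single e 1
                * (Poly_Mapping.single (e' - ?d \<alpha>) (of_nat (Poly_Mapping.lookup e' \<alpha>)) * ?l \<alpha>))"
    by (subst eq[OF Poly_Mapping.keys_add], intro sum.cong) (auto simp: algebra_simps)
  then show ?thesis
    using eq[of e] eq[of e'] by (simp add: sum.distrib sum_distrib_left sum_distrib_right)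
qed

lemma deriv_mult: "deriv n D x (p * q) = deriv n D x p * q + p * deriv n D x q"
proof -
  have expand: "r = (\<Sum>e\<in>Poly_Mapping.keys r. Poly_Mapping.single e (Poly_Mapping.lookup r e))"
    for r :: pol
    by (rule poly_mapping_eqI)
       (auto simp: lookup_sum lookup_single when_def in_keys_iff)
  have mono: "deriv n D x (Poly_Mapping.single e a * Poly_Mapping.single e' b) =
      deriv n D x (Poly_Mapping.single e a) * Poly_Mapping.single e' b
      + Poly_Mapping.single e a * deriv n D x (Poly_Mapping.single e' b)" for e e' a b
  proof -
    have split: "Poly_Mapping.single f c = Poly_Mapping.single 0 c * Poly_Mapping.single f 1"
      for f :: "(nat \<times> nat) \<Rightarrow>\<^sub>0 nat" and c :: complex
      by (simp add: mult_single)
    have "deriv n D x (Poly_Mapping.single e a * Poly_Mapping.single e' b) =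
        Poly_Mapping.single 0 a * Poly_Mapping.single 0 b *
        (deriv_mono n D x e * Poly_Mapping.single e' 1
         + Poly_Mapping.single e 1 * deriv_mono n D x e')"
      by (simp add: mult_single deriv_single deriv_mono_add)
    also have "\<dots> = (Poly_Mapping.single 0 a * deriv_mono n D x e) *
          (Poly_Mapping.single 0 b * Poly_Mapping.single e' 1)
        + (Poly_Mapping.single 0 a * Poly_Mapping.single e 1) *
          (Poly_Mapping.single 0 b * deriv_mono n D x e')"
      by (simp only: distrib_left mult.assoc mult.commute mult.left_commute)
    finally show ?thesis
      by (simp only: deriv_single split[symmetric])
  qed
  let ?p = "\<lambda>e. Poly_Mapping.single e (Poly_Mapping.lookup p e)"
  let ?q = "\<lambda>e. Poly_Mapping.single e (Poly_Mapping.lookup q e)"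
  let ?P = "Poly_Mapping.keys p" and ?Q = "Poly_Mapping.keys q"
  have "deriv n D x ((\<Sum>e\<in>?P. ?p e) * (\<Sum>e\<in>?Q. ?q e)) =
     deriv n D x (\<Sum>e\<in>?P. ?p e) * (\<Sum>e\<in>?Q. ?q e) + (\<Sum>e\<in>?P. ?p e) * deriv n D x (\<Sum>e\<in>?Q. ?q e)"
    by (simp add: sum_product deriv_sum mono sum.distrib)
  then show ?thesis by (simp only: expand[symmetric])
qed

definition stable_ideal :: "nat \<Rightarrow> nat set \<Rightarrow> pol set \<Rightarrow> bool" where
  "stable_ideal n D J \<longleftrightarrow>
     ideal J (Sym_ring n D) \<and> (\<forall>x\<in>parabolic n D. \<forall>p\<in>J. deriv n D x p \<in> J)"

text \<open>For a module \<open>T\<close> on which \<open>x\<close> acts by \<open>act x\<close>, the operators of the \<open>E_{i,j}\<close>,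
  \<open>(i,j) \<in> PD n D\<close>, commute, so the order of the factors in \<open>mono_act\<close> is immaterial.\<close>

definition mono_act ::
  "nat \<Rightarrow> nat set \<Rightarrow> (complex mat \<Rightarrow> 't \<Rightarrow> 't) \<Rightarrow> ((nat \<times> nat) \<Rightarrow>\<^sub>0 nat) \<Rightarrow> 't \<Rightarrow> 't" where
  "mono_act n D act e =
     fold (\<lambda>(i, j). act (Emat n i j) ^^ Poly_Mapping.lookup e (i, j))
       [(i, j). i \<leftarrow> [1..<n + 1], j \<leftarrow> [1..<i], (i, j) \<in> PD n D]"

definition pol_act ::
  "nat \<Rightarrow> nat set \<Rightarrow> (complex, 't) module \<Rightarrow> (complex mat \<Rightarrow> 't \<Rightarrow> 't) \<Rightarrow> pol \<Rightarrow> 't \<Rightarrow> 't" where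
  "pol_act n D T act p t =
     (\<Oplus>\<^bsub>T\<^esub>e\<in>Poly_Mapping.keys p. Poly_Mapping.lookup p e \<odot>\<^bsub>T\<^esub> mono_act n D act e t)"

definition annihilator ::
  "nat \<Rightarrow> nat set \<Rightarrow> (complex, 't) module \<Rightarrow> (complex mat \<Rightarrow> 't \<Rightarrow> 't) \<Rightarrow> 't \<Rightarrow> pol set" where
  "annihilator n D T act t = {p \<in> Sym n D. pol_act n D T act p t = \<zero>\<^bsub>T\<^esub>}"

definition cyclic_submodule ::
  "nat \<Rightarrow> nat set \<Rightarrow> (complex, 't) module \<Rightarrow> (complex mat \<Rightarrow> 't \<Rightarrow> 't) \<Rightarrow> 't
    \<Rightarrow> (complex, 't) module" where
  "cyclic_submodule n D T act t = T\<lparr>carrier := (\<lambda>p. pol_act n D T act p t) ` Sym n D\<rparr>"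


section \<open>Irreducible highest weight modules and their associated graded modules\<close>

text \<open>The positive root \<open>\<alpha>_{i,j} = \<alpha>_i + ... + \<alpha>_j\<close> is encoded as the pair \<open>(i, j)\<close>, and
  \<open>root_pos (i, j)\<close> is the position of the matrix unit \<open>f_{\<alpha>_{i,j}} = E_{j+1,i}\<close>.\<close>

definition pos_roots :: "nat \<Rightarrow> (nat \<times> nat) set" where
  "pos_roots n = {(i, j). 1 \<le> i \<and> i \<le> j \<and> j \<le> n - 1}"

definition root_pos :: "nat \<times> nat \<Rightarrow> nat \<times> nat" where
  "root_pos \<beta> = (snd \<beta> + 1, fst \<beta>)"

text \<open>\<open>weight_pair D m (i, j)\<close> is \<open>(\<lambda>, \<alpha>_{i,j})\<close> for \<open>\<lambda> = \<Sum>d\<in>D. m d \<omega>_d\<close>, where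
  \<open>(\<alpha>_k, \<omega>_d)\<close> is the Kronecker delta.\<close>

definition weight_pair :: "nat set \<Rightarrow> (nat \<Rightarrow> nat) \<Rightarrow> nat \<times> nat \<Rightarrow> nat" where
  "weight_pair D m = (\<lambda>(i, j). \<Sum>d\<in>D. m d * (\<Sum>k = i..j. if k = d then 1 else 0))"

definition sl_module ::
  "nat \<Rightarrow> (complex \<Rightarrow> 'v::ab_group_add \<Rightarrow> 'v) \<Rightarrow> (complex mat \<Rightarrow> 'v \<Rightarrow> 'v) \<Rightarrow> bool" where
  "sl_module n scale \<rho> \<longleftrightarrow>
     vector_space scale \<and>
     (\<forall>x\<in>sl n. Vector_Spaces.linear scale scale (\<rho> x)) \<and>
     (\<forall>x\<in>sl n. \<forall>y\<in>sl n. \<forall>v. \<rho> (x + y) v = \<rho> x v + \<rho> y v) \<and>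
     (\<forall>c. \<forall>x\<in>sl n. \<forall>v. \<rho> (c \<cdot>\<^sub>m x) v = scale c (\<rho> x v)) \<and>
     (\<forall>x\<in>sl n. \<forall>y\<in>sl n. \<forall>v. \<rho> (commutator x y) v = \<rho> x (\<rho> y v) - \<rho> y (\<rho> x v))"

definition irreducible_module ::
  "nat \<Rightarrow> (complex \<Rightarrow> 'v::ab_group_add \<Rightarrow> 'v) \<Rightarrow> (complex mat \<Rightarrow> 'v \<Rightarrow> 'v) \<Rightarrow> bool" where
  "irreducible_module n scale \<rho> \<longleftrightarrow>
     sl_module n scale \<rho> \<and> (UNIV :: 'v set) \<noteq> {0} \<and>
     (\<forall>W. Modules.module.subspace scale W \<and> (\<forall>x\<in>sl n. \<forall>w\<in>W. \<rho> x w \<in> W)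
          \<longrightarrow> W = {0} \<or> W = UNIV)"

text \<open>The weight is prescribed on the coroots \<open>E_{k,k} - E_{k+1,k+1}\<close>, on which \<open>\<lambda>\<close> takes the
  values \<open>(\<lambda>, \<alpha>_k)\<close>.\<close>

definition highest_weight_vector ::
  "nat \<Rightarrow> nat set \<Rightarrow> (nat \<Rightarrow> nat) \<Rightarrow> (complex \<Rightarrow> 'v::ab_group_add \<Rightarrow> 'v)
    \<Rightarrow> (complex mat \<Rightarrow> 'v \<Rightarrow> 'v) \<Rightarrow> 'v \<Rightarrow> bool" where
  "highest_weight_vector n D m scale \<rho> l \<longleftrightarrow>
     l \<noteq> 0 \<and>
     (\<forall>i j. 1 \<le> i \<and> i < j \<and> j \<le> n \<longrightarrow> \<rho> (Emat n i j) l = 0) \<and>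
     (\<forall>k\<in>{1..<n}. \<rho> (Emat n k k - Emat n (k + 1) (k + 1)) l
                    = scale (of_nat (weight_pair D m (k, k))) l)"

text \<open>The filtration, shifted by one: \<open>filt _ _ _ _ _ (Suc k)\<close> is its \<open>k\<close>-th term and
  \<open>filt _ _ _ _ _ 0\<close> is the zero space.\<close>

fun filt ::
  "nat \<Rightarrow> nat set \<Rightarrow> (complex \<Rightarrow> 'v::ab_group_add \<Rightarrow> 'v) \<Rightarrow> (complex mat \<Rightarrow> 'v \<Rightarrow> 'v) \<Rightarrow> 'v
    \<Rightarrow> nat \<Rightarrow> 'v set" where
  "filt n D scale \<rho> l 0 = {0}"
| "filt n D scale \<rho> l (Suc k) =
     Modules.module.span scale
       {foldr \<rho> as l | as. set as \<subseteq> radical n D \<and> length as \<le> k}"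

text \<open>The associated graded space is the direct sum of the quotients of consecutive terms: an
  element is a finitely supported sequence of cosets.\<close>

definition gr ::
  "nat \<Rightarrow> nat set \<Rightarrow> (complex \<Rightarrow> 'v::ab_group_add \<Rightarrow> 'v) \<Rightarrow> (complex mat \<Rightarrow> 'v \<Rightarrow> 'v) \<Rightarrow> 'v
    \<Rightarrow> (complex, nat \<Rightarrow> 'v set) module" where
  "gr n D scale \<rho> l = (let F = filt n D scale \<rho> l in
     \<lparr>carrier = {g. (\<forall>k. \<exists>u\<in>F (Suc k). g k = u +o F k) \<and> finite {k. g k \<noteq> F k}},
      mult = undefined, one = undefined,
      zero = F,
      add = (\<lambda>g h k. g k + h k),
      smult = (\<lambda>c g k. scale c ` g k + F k)\<rparr>)"

text \<open>The parabolic part of \<open>x\<close> preserves the degree, the radical part raises it by one.\<close>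

definition gr_act ::
  "nat \<Rightarrow> nat set \<Rightarrow> (complex \<Rightarrow> 'v::ab_group_add \<Rightarrow> 'v) \<Rightarrow> (complex mat \<Rightarrow> 'v \<Rightarrow> 'v) \<Rightarrow> 'v
    \<Rightarrow> complex mat \<Rightarrow> (nat \<Rightarrow> 'v set) \<Rightarrow> nat \<Rightarrow> 'v set" where
  "gr_act n D scale \<rho> l x g = (\<lambda>k.
     \<rho> (ppart n D x) ` g k
     + (case k of 0 \<Rightarrow> {0} | Suc k' \<Rightarrow> \<rho> (rpart n D x) ` g k')
     + filt n D scale \<rho> l k)"

definition gr_vec ::
  "nat \<Rightarrow> nat set \<Rightarrow> (complex \<Rightarrow> 'v::ab_group_add \<Rightarrow> 'v) \<Rightarrow> (complex mat \<Rightarrow> 'v \<Rightarrow> 'v) \<Rightarrow> 'v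
    \<Rightarrow> nat \<Rightarrow> 'v set" where
  "gr_vec n D scale \<rho> l = (filt n D scale \<rho> l)(0 := l +o filt n D scale \<rho> l 0)"


section \<open>The module \<open>V\<close> and tensor products with its tensor powers\<close>

text \<open>A vector \<open>c v + y\<close> of \<open>V\<close>, with \<open>y\<close> in the radical, is the pair \<open>(c, y)\<close>.  The basis consists
  of \<open>v\<close>, labelled \<open>None\<close>, and of the \<open>E_{i,j}\<close>, labelled \<open>Some (i, j)\<close>.\<close>

definition V_act :: "nat \<Rightarrow> nat set \<Rightarrow> complex mat \<Rightarrow> complex \<times> complex mat \<Rightarrow> complex \<times> complex mat"
  where "V_act n D x = (\<lambda>(c, y). (0, c \<cdot>\<^sub>m rpart n D x + deg_bracket n D (ppart n D x) y))"

definition V_labels :: "nat \<Rightarrow> nat set \<Rightarrow> (nat \<times> nat) option set" where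
  "V_labels n D = insert None (Some ` PD n D)"

definition V_basis :: "nat \<Rightarrow> (nat \<times> nat) option \<Rightarrow> complex \<times> complex mat" where
  "V_basis n b = (case b of None \<Rightarrow> (1, 0\<^sub>m n n) | Some (i, j) \<Rightarrow> (0, Emat n i j))"

definition V_coord :: "(nat \<times> nat) option \<Rightarrow> complex \<times> complex mat \<Rightarrow> complex" where
  "V_coord b u = (case b of None \<Rightarrow> fst u | Some (i, j) \<Rightarrow> ent (snd u) i j)"

text \<open>The \<open>M\<close>-th tensor power of \<open>V\<close> has the words of length \<open>M\<close> in the labels as basis.  The
  tensor product of \<open>G\<close> with it consists of the families \<open>t\<close> of elements of \<open>G\<close> indexed by these
  words, \<open>t\<close> standing for the sum of the \<open>t w \<otimes> w\<close>.\<close>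

definition V_words :: "nat \<Rightarrow> nat set \<Rightarrow> nat \<Rightarrow> (nat \<times> nat) option list set" where
  "V_words n D M = {w. length w = M \<and> set w \<subseteq> V_labels n D}"

definition tensor_V ::
  "nat \<Rightarrow> nat set \<Rightarrow> nat \<Rightarrow> (complex, 'g) module
    \<Rightarrow> (complex, (nat \<times> nat) option list \<Rightarrow> 'g) module" where
  "tensor_V n D M G = (let W = V_words n D M in
     \<lparr>carrier = W \<rightarrow>\<^sub>E carrier G,
      mult = undefined, one = undefined,
      zero = (\<lambda>w\<in>W. \<zero>\<^bsub>G\<^esub>),
      add = (\<lambda>s t. \<lambda>w\<in>W. s w \<oplus>\<^bsub>G\<^esub> t w),
      smult = (\<lambda>c t. \<lambda>w\<in>W. c \<odot>\<^bsub>G\<^esub> t w)\<rparr>)"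

text \<open>The action by the Leibniz rule.  The words contributing to the coefficient of \<open>w\<close> through
  the action on the \<open>k\<close>-th factor of \<open>V\<close> are those which agree with \<open>w\<close> except at \<open>k\<close>.\<close>

definition tensor_act ::
  "nat \<Rightarrow> nat set \<Rightarrow> nat \<Rightarrow> (complex, 'g) module \<Rightarrow> (complex mat \<Rightarrow> 'g \<Rightarrow> 'g)
    \<Rightarrow> complex mat \<Rightarrow> ((nat \<times> nat) option list \<Rightarrow> 'g) \<Rightarrow> (nat \<times> nat) option list \<Rightarrow> 'g" where
  "tensor_act n D M G act x t = (\<lambda>w\<in>V_words n D M.
     act x (t w) \<oplus>\<^bsub>G\<^esub>
     (\<Oplus>\<^bsub>G\<^esub>k\<in>{..<M}. \<Oplus>\<^bsub>G\<^esub>b\<in>V_labels n D.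
        V_coord (w ! k) (V_act n D x (V_basis n b)) \<odot>\<^bsub>G\<^esub> t (w[k := b])))"

definition tensor_vec ::
  "nat \<Rightarrow> nat set \<Rightarrow> nat \<Rightarrow> (complex, 'g) module \<Rightarrow> 'g \<Rightarrow> (nat \<times> nat) option list \<Rightarrow> 'g" where
  "tensor_vec n D M G g = (\<lambda>w\<in>V_words n D M. if w = replicate M None then g else \<zero>\<^bsub>G\<^esub>)"


section \<open>The combinatorial set \<open>S\<close> and the monomial relations\<close>

definition P_le :: "nat \<times> nat \<Rightarrow> nat \<times> nat \<Rightarrow> bool" where
  "P_le \<alpha> \<beta> \<longleftrightarrow> fst \<alpha> \<le> fst \<beta> \<and> snd \<alpha> \<le> snd \<beta>"

definition width :: "(nat \<times> nat) set \<Rightarrow> nat" where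
  "width Q = Max (card ` {A. A \<subseteq> Q \<and> (\<forall>\<alpha>\<in>A. \<forall>\<beta>\<in>A. P_le \<alpha> \<beta> \<longrightarrow> \<alpha> = \<beta>)})"

definition S_set :: "nat \<Rightarrow> nat set \<Rightarrow> (nat \<Rightarrow> nat) \<Rightarrow> nat \<Rightarrow> (nat \<times> nat \<Rightarrow> nat) set" where
  "S_set n D m M = {s \<in> PD n D \<rightarrow>\<^sub>E UNIV.
     \<forall>Q \<subseteq> PD n D. (\<Sum>\<alpha>\<in>Q. s \<alpha>) \<le> M + (\<Sum>d\<in>D. m d * width (Q \<inter> Pd n d))}"

definition f_mono :: "nat \<Rightarrow> nat set \<Rightarrow> (nat \<times> nat \<Rightarrow> nat) \<Rightarrow> pol" where
  "f_mono n D s = (\<Prod>\<alpha>\<in>PD n D. fvar \<alpha> ^ s \<alpha>)"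

definition relations :: "nat \<Rightarrow> nat set \<Rightarrow> (nat \<Rightarrow> nat) \<Rightarrow> nat \<Rightarrow> pol set" where
  "relations n D m M =
     {\<Prod>i<r. fvar (root_pos (\<beta> i)) ^ a i | (r :: nat) \<beta> (a :: nat \<Rightarrow> nat).
        1 \<le> r \<and> (\<forall>i<r. \<beta> i \<in> pos_roots n \<and> root_pos (\<beta> i) \<in> PD n D) \<and>
        (\<Sum>i<r. a i) > M + (\<Sum>i<r. weight_pair D m (\<beta> i))}"

end

theory Submission
  imports Defs "HOL-Library.Product_Lexorder" "HOL-Combinatorics.Permutations"
begin

text \<open>
  Call \<open>R = Sym n D\<close> the symmetric algebra of the radical, and order its monomials by their
  exponents: at the smallest pair where two exponents differ, the smaller exponent has the smaller
  entry.  This order sees chains and antichains.  Among the arrays with given row and column sums,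
  an array supported on a chain is the largest (\<open>chain_lex_max\<close>); among the arrays obtained from
  the indicator of an antichain by permuting columns, the indicator itself is the smallest
  (\<open>antichain_lex_min\<close>).

  Spanning.  Let \<open>J\<close> be a stable ideal containing the relations, and let the exponent \<open>e\<close> violate
  the inequality of some set \<open>Q\<close>.  The elements of \<open>Q\<close> with the same nesting depth form a chain.
  Cut these chains into pieces, give every piece a matrix \<open>x y\<^sup>T\<close> with indeterminate entries, and let
  \<open>W\<close> be the sum of these matrices, written in the variables of \<open>R\<close>.  At most \<open>w(Q \<inter> P_d)\<close> pieces
  pass over \<open>d\<close>.  Therefore, after the choice of one matrix unit in every piece, all monomials in
  these units of degree \<open>A = \<Sum>\<alpha>\<in>Q. e \<alpha>\<close> are relations.  The parabolic subalgebra moves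
  the chosen units to the generic matrices, and since \<open>J\<close> is stable all coefficients of \<open>W ^ A\<close> lie
  in \<open>J\<close> (\<open>generic_power_in_ideal\<close>).  The coefficient which records the row and column sums of
  \<open>e\<close> on every piece is, up to a nonzero factor, the monomial of the restriction of \<open>e\<close> to \<open>Q\<close> plus
  smaller monomials, because this restriction is a chain on every piece (\<open>straighten\<close>).  So
  modulo \<open>J\<close> every monomial is a combination of the monomials from \<open>S\<close> (\<open>standard_form\<close>).

  The annihilator.  In a product \<open>p (l \<otimes> v)\<close> at most one factor can act on \<open>v\<close>, so tensoring
  with \<open>V\<close> replaces the annihilator \<open>I\<close> of a cyclic vector by the polynomials which belong to \<open>I\<close>
  together with all their first partial derivatives (\<open>prolong\<close>).  The annihilator of the cyclic
  vector for \<open>M\<close> is thus the \<open>M\<close>-fold prolongation \<open>Ann M\<close> of the one for \<open>0\<close>.  It is a stable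
  ideal, and it contains the relations because a derivative lowers the degree of a monomial by one.

  Independence.  An element \<open>s\<close> of \<open>S\<close> is the sum of an exponent \<open>t\<close> of degree at most \<open>M\<close> and of
  the indicators of \<open>m d\<close> antichains of \<open>P_d\<close>, for all \<open>d\<close> (\<open>decompose\<close>).  Let \<open>p\<close> in \<open>Ann M\<close> be a
  combination of monomials from \<open>S\<close>, with largest exponent \<open>s\<close>.  The partial derivative of order \<open>t\<close>
  of \<open>p\<close> annihilates the highest weight vector of the associated graded module, and contains the
  monomial \<open>s - t\<close>.  The irreducible module can be compared with the submodule generated by the
  highest weight vector of the tensor product of \<open>m d\<close> copies of the \<open>d\<close>-th exterior powers.  There
  the monomial \<open>s - t\<close> gives a nonzero coefficient at some basis vector which is reached neither by
  smaller monomials of the same degree nor by monomials of smaller degree.  Hence the coefficient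
  of \<open>s\<close> in \<open>p\<close> vanishes, and \<open>p = 0\<close> (\<open>Ann_independent\<close>).

  Together: if \<open>J\<close> is a stable ideal containing the relations, so is \<open>J \<inter> Ann M\<close>.  Modulo the latter
  an element of \<open>Ann M\<close> is a combination of monomials from \<open>S\<close>, which lies in \<open>Ann M\<close> and is
  therefore zero; so \<open>Ann M \<subseteq> J\<close> (\<open>Ann_least\<close>).  Spanning and independence modulo \<open>Ann M\<close> also
  show that the monomials from \<open>S\<close> give a basis.
\<close>

abbreviation lookup :: "('a \<Rightarrow>\<^sub>0 'b::zero) \<Rightarrow> 'a \<Rightarrow> 'b" where "lookup \<equiv> Poly_Mapping.lookup"
abbreviation single :: "'a \<Rightarrow> 'b \<Rightarrow> ('a \<Rightarrow>\<^sub>0 'b::zero)" where "single \<equiv> Poly_Mapping.single"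
abbreviation keys :: "('a \<Rightarrow>\<^sub>0 'b::zero) \<Rightarrow> 'a set" where "keys \<equiv> Poly_Mapping.keys"

section \<open>Blocks, the radical and stable ideals\<close>

text \<open>The elements of \<open>D\<close> cut \<open>{1..n}\<close> into consecutive blocks, numbered from \<open>0\<close>.  In this
  numbering the radical is strictly block lower triangular.\<close>

definition blk :: "nat set \<Rightarrow> nat \<Rightarrow> nat" where
  "blk D j = card {d\<in>D. d < j}"

lemma blk_mono: "finite D \<Longrightarrow> i \<le> j \<Longrightarrow> blk D i \<le> blk D j"
  unfolding blk_def by (rule card_mono) auto

lemma PD_iff:
  assumes D: "D \<subseteq> {1..<n}"
  shows "(i, j) \<in> PD n D \<longleftrightarrow> 1 \<le> j \<and> i \<le> n \<and> blk D j < blk D i"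
proof -
  have fin: "finite D" using D finite_subset by blast
  have "blk D j < blk D i \<longleftrightarrow> (\<exists>d\<in>D. j \<le> d \<and> d < i)"
  proof
    assume less: "blk D j < blk D i"
    show "\<exists>d\<in>D. j \<le> d \<and> d < i"
    proof (rule ccontr)
      assume "\<not> (\<exists>d\<in>D. j \<le> d \<and> d < i)"
      then have "{d\<in>D. d < i} \<subseteq> {d\<in>D. d < j}" by auto
      then have "blk D i \<le> blk D j" unfolding blk_def using fin by (intro card_mono) auto
      then show False using less by simp
    qed
  next
    assume "\<exists>d\<in>D. j \<le> d \<and> d < i"
    then obtain d where "d \<in> D" "j \<le> d" "d < i" by blast
    then have "{d\<in>D. d < j} \<subseteq> {d\<in>D. d < i}" "d \<in> {d\<in>D. d < i}" "d \<notin> {d\<in>D. d < j}" by auto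
    then have "{d\<in>D. d < j} \<subset> {d\<in>D. d < i}" by blast
    then show "blk D j < blk D i" unfolding blk_def using fin by (intro psubset_card_mono) auto
  qed
  then show ?thesis by (auto simp: PD_def Pd_def Pos_def)
qed

lemma PD_bounds: "(i, j) \<in> PD n D \<Longrightarrow> 1 \<le> j \<and> j < i \<and> i \<le> n"
  by (auto simp: PD_def Pd_def Pos_def)

lemma ent_mult_Emat:
  assumes "x \<in> carrier_mat n n" "1 \<le> a" "a \<le> n" "1 \<le> b" "b \<le> n" "1 \<le> i" "i \<le> n"
  shows "ent (x * Emat n i j) a b = (if b = j then ent x a i else 0)"
proof -
  have "ent (x * Emat n i j) a b = (\<Sum>c = 0..<n. x $$ (a - 1, c) * (if c + 1 = i \<and> b = j then 1 else 0))"
    using assms by (auto simp: ent_def Emat_def scalar_prod_def intro!: sum.cong)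
  also have "\<dots> = (\<Sum>c = 0..<n. if c = i - 1 then (if b = j then x $$ (a - 1, c) else 0) else 0)"
    using assms by (intro sum.cong) auto
  also have "\<dots> = (if b = j then ent x a i else 0)" using assms by (auto simp: ent_def)
  finally show ?thesis .
qed

lemma ent_Emat_mult:
  assumes "x \<in> carrier_mat n n" "1 \<le> a" "a \<le> n" "1 \<le> b" "b \<le> n" "1 \<le> j" "j \<le> n"
  shows "ent (Emat n i j * x) a b = (if a = i then ent x j b else 0)"
proof -
  have "ent (Emat n i j * x) a b = (\<Sum>c = 0..<n. (if a = i \<and> c + 1 = j then 1 else 0) * x $$ (c, b - 1))"
    using assms by (auto simp: ent_def Emat_def scalar_prod_def intro!: sum.cong)
  also have "\<dots> = (\<Sum>c = 0..<n. if c = j - 1 then (if a = i then x $$ (c, b - 1) else 0) else 0)"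
    using assms by (intro sum.cong) auto
  also have "\<dots> = (if a = i then ent x j b else 0)" using assms by (auto simp: ent_def)
  finally show ?thesis .
qed

lemma Emat_carrier [simp]: "Emat n i j \<in> carrier_mat n n"
  by (simp add: Emat_def)

lemma ent_Emat: "1 \<le> a \<Longrightarrow> a \<le> n \<Longrightarrow> 1 \<le> b \<Longrightarrow> b \<le> n \<Longrightarrow> ent (Emat n i j) a b = (if a = i \<and> b = j then 1 else 0)"
  by (auto simp: ent_def Emat_def)

lemma ent_commutator_Emat:
  assumes "x \<in> carrier_mat n n" "1 \<le> a" "a \<le> n" "1 \<le> b" "b \<le> n" "1 \<le> i" "i \<le> n" "1 \<le> j" "j \<le> n"
  shows "ent (commutator x (Emat n i j)) a b = (if b = j then ent x a i else 0) - (if a = i then ent x j b else 0)"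
proof -
  have "ent (commutator x (Emat n i j)) a b = ent (x * Emat n i j) a b - ent (Emat n i j * x) a b"
  proof -
    have "a - 1 < dim_row (Emat n i j * x)" "b - 1 < dim_col (Emat n i j * x)"
      using assms by (auto simp: carrier_matD[OF Emat_carrier])
    then show ?thesis unfolding commutator_def ent_def by (rule index_minus_mat(1))
  qed
  then show ?thesis using ent_mult_Emat[OF assms(1-7), of j] ent_Emat_mult[OF assms(1-5) assms(8,9), of i] by simp
qed

lemma parabolicD:
  assumes "D \<subseteq> {1..<n}" "x \<in> parabolic n D"
  shows "x \<in> sl n" "x \<in> carrier_mat n n" "(a, b) \<in> PD n D \<Longrightarrow> ent x a b = 0"
  using assms by (auto simp: parabolic_eq sl_def)

lemma rpart_parabolic: "D \<subseteq> {1..<n} \<Longrightarrow> x \<in> parabolic n D \<Longrightarrow> rpart n D x = 0\<^sub>m n n"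
proof (rule eq_matI)
  assume D: "D \<subseteq> {1..<n}" and x: "x \<in> parabolic n D"
  fix i j assume "i < dim_row (0\<^sub>m n n :: complex mat)" "j < dim_col (0\<^sub>m n n :: complex mat)"
  then show "rpart n D x $$ (i, j) = 0\<^sub>m n n $$ (i, j)"
    using parabolicD(3)[OF D x, of "Suc i" "Suc j"] by (simp add: rpart_def ent_def)
qed (simp_all add: rpart_def)

lemma ppart_parabolic: "D \<subseteq> {1..<n} \<Longrightarrow> x \<in> parabolic n D \<Longrightarrow> ppart n D x = x"
  using parabolicD(2)[of D n x] by (intro eq_matI) (auto simp: ppart_def rpart_parabolic)

lemma rpart_Emat: "(i, j) \<in> PD n D \<Longrightarrow> rpart n D (Emat n i j) = Emat n i j"
  by (intro eq_matI) (auto simp: rpart_def Emat_def)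

lemma ppart_Emat: "(i, j) \<in> PD n D \<Longrightarrow> ppart n D (Emat n i j) = 0\<^sub>m n n"
  using minus_r_inv_mat[OF Emat_carrier[of n i j]] by (simp add: ppart_def rpart_Emat)

lemma Emat_sl: "i \<noteq> j \<Longrightarrow> Emat n i j \<in> sl n"
  by (auto simp: sl_def Emat_def intro!: sum.neutral)

lemma Emat_parabolic:
  assumes "D \<subseteq> {1..<n}" "i \<noteq> j" "blk D i \<le> blk D j"
  shows "Emat n i j \<in> parabolic n D"
proof -
  have "ent (Emat n i j) a b = 0" if "(a, b) \<in> PD n D" for a b
  proof -
    have "\<not> (a = i \<and> b = j)" using that assms(3) by (auto simp: PD_iff[OF assms(1)])
    then show ?thesis using PD_bounds[OF that] by (subst ent_Emat) auto
  qed
  then show ?thesis using Emat_sl[OF assms(2)] by (auto simp: parabolic_eq[OF assms(1)])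
qed

lemma deg_bracket_Emat:
  assumes D: "D \<subseteq> {1..<n}" and x: "x \<in> parabolic n D" and ij: "(i, j) \<in> PD n D"
  shows "deg_bracket n D x (Emat n i j) = rpart n D (commutator x (Emat n i j))"
proof -
  have xc: "x \<in> carrier_mat n n" by (rule parabolicD(2)[OF D x])
  have "rpart n D (0\<^sub>m n n) = 0\<^sub>m n n" by (intro eq_matI) (auto simp: rpart_def)
  moreover have "commutator x (0\<^sub>m n n) = 0\<^sub>m n n" "commutator (0\<^sub>m n n) (0\<^sub>m n n) = 0\<^sub>m n n"
    using xc by (auto simp: commutator_def)
  moreover have "rpart n D (commutator x (Emat n i j)) \<in> carrier_mat n n" by (simp add: rpart_def)
  ultimately show ?thesis
    by (simp add: deg_bracket_def rpart_parabolic[OF D x] ppart_parabolic[OF D x] rpart_Emat[OF ij] ppart_Emat[OF ij])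
qed

lemma ent_deg_bracket:
  assumes D: "D \<subseteq> {1..<n}" and x: "x \<in> parabolic n D" and ij: "(i, j) \<in> PD n D" and ab: "(a, b) \<in> PD n D"
  shows "ent (deg_bracket n D x (Emat n i j)) a b = (if b = j then ent x a i else 0) - (if a = i then ent x j b else 0)"
proof -
  have "1 \<le> a" "a \<le> n" "1 \<le> b" "b \<le> n" "1 \<le> i" "i \<le> n" "1 \<le> j" "j \<le> n"
    using PD_bounds[OF ij] PD_bounds[OF ab] by auto
  moreover from this ab have "ent (rpart n D z) a b = ent z a b" for z
    by (auto simp: ent_def rpart_def)
  ultimately show ?thesis
    using ent_commutator_Emat[OF parabolicD(2)[OF D x]] by (simp add: deg_bracket_Emat[OF D x ij])
qed

lemma deriv_fvar_parabolic:
  assumes D: "D \<subseteq> {1..<n}" and x: "x \<in> parabolic n D" and ij: "(i, j) \<in> PD n D"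
  shows "deriv n D x (fvar (i, j)) = (\<Sum>(a, b)\<in>PD n D.
    single 0 ((if b = j then ent x a i else 0) - (if a = i then ent x j b else 0)) * fvar (a, b))"
  unfolding deriv_fvar lin_form_def
  by (rule sum.cong) (use ent_deg_bracket[OF D x ij] in auto)

lemma deriv_fvar_Emat:
  assumes D: "D \<subseteq> {1..<n}" and kl: "k \<noteq> l" "blk D k \<le> blk D l" "1 \<le> k" "k \<le> n" "1 \<le> l" "l \<le> n"
    and ij: "(i, j) \<in> PD n D"
  shows "deriv n D (Emat n k l) (fvar (i, j)) =
    (if i = l \<and> (k, j) \<in> PD n D then fvar (k, j) else 0) - (if j = k \<and> (i, l) \<in> PD n D then fvar (i, l) else 0)"
proof -
  have fin: "finite (PD n D)"
    by (rule finite_subset[of _ "{..n} \<times> {..n}"]) (auto simp: PD_def Pd_def Pos_def)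
  have bd: "1 \<le> i" "i \<le> n" "1 \<le> j" "j \<le> n" using PD_bounds[OF ij] by auto
  let ?s = "single (0 :: (nat \<times> nat) \<Rightarrow>\<^sub>0 nat) :: complex \<Rightarrow> _"
  have "deriv n D (Emat n k l) (fvar (i, j)) = (\<Sum>z\<in>PD n D.
     (if z = (k, j) then (if i = l then fvar z else 0) else 0) - (if z = (i, l) then (if j = k then fvar z else 0) else 0))"
    unfolding deriv_fvar_parabolic[OF D Emat_parabolic[OF D kl(1,2)] ij]
  proof (rule sum.cong[OF refl], clarify)
    fix a b assume "(a, b) \<in> PD n D"
    then have "1 \<le> a" "a \<le> n" "1 \<le> b" "b \<le> n" using PD_bounds by fastforce+
    then show "?s ((if b = j then ent (Emat n k l) a i else 0) - (if a = i then ent (Emat n k l) j b else 0)) * fvar (a, b)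
      = (if (a, b) = (k, j) then (if i = l then fvar (a, b) else 0) else 0)
      - (if (a, b) = (i, l) then (if j = k then fvar (a, b) else 0) else 0)"
      using bd by (auto simp: ent_Emat single_diff algebra_simps)
  qed
  also have "\<dots> = (if i = l \<and> (k, j) \<in> PD n D then fvar (k, j) else 0) - (if j = k \<and> (i, l) \<in> PD n D then fvar (i, l) else 0)"
    using fin by (simp add: sum_subtractf)
  finally show ?thesis .
qed

lemma stable_idealD:
  assumes "stable_ideal n D J"
  shows "J \<subseteq> Sym n D" "0 \<in> J" "p \<in> J \<Longrightarrow> q \<in> J \<Longrightarrow> p + q \<in> J"
    "c \<in> Sym n D \<Longrightarrow> p \<in> J \<Longrightarrow> c * p \<in> J"
    "x \<in> parabolic n D \<Longrightarrow> p \<in> J \<Longrightarrow> deriv n D x p \<in> J"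
proof -
  interpret ideal J "Sym_ring n D" using assms by (simp add: stable_ideal_def)
  show "J \<subseteq> Sym n D" using a_subset by (simp add: Sym_ring_def)
  show "0 \<in> J" using additive_subgroup.zero_closed[OF is_additive_subgroup] by (simp add: Sym_ring_def)
  show "p \<in> J \<Longrightarrow> q \<in> J \<Longrightarrow> p + q \<in> J"
    using additive_subgroup.a_closed[OF is_additive_subgroup, of p q] by (simp add: Sym_ring_def)
  show "c \<in> Sym n D \<Longrightarrow> p \<in> J \<Longrightarrow> c * p \<in> J" using I_l_closed by (simp add: Sym_ring_def)
  show "x \<in> parabolic n D \<Longrightarrow> p \<in> J \<Longrightarrow> deriv n D x p \<in> J" using assms by (auto simp: stable_ideal_def)
qed

lemma Sym_const [simp]: "single 0 c \<in> Sym n D"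
  by (auto simp: Sym_def)

lemma Sym_single: "keys e \<subseteq> PD n D \<Longrightarrow> single e c \<in> Sym n D"
  by (auto simp: Sym_def)

lemma stable_ideal_sum: "stable_ideal n D J \<Longrightarrow> (\<And>i. i \<in> I \<Longrightarrow> f i \<in> J) \<Longrightarrow> (\<Sum>i\<in>I. f i) \<in> J"
  by (induction I rule: infinite_finite_induct) (auto intro: stable_idealD)

lemma stable_ideal_scale: "stable_ideal n D J \<Longrightarrow> p \<in> J \<Longrightarrow> single 0 c * p \<in> J"
  by (rule stable_idealD(4)) auto

lemma stable_ideal_uminus: "stable_ideal n D J \<Longrightarrow> p \<in> J \<Longrightarrow> - p \<in> J"
  using stable_ideal_scale[of n D J p "-1"] by (simp add: single_uminus)

lemma stable_ideal_diff: "stable_ideal n D J \<Longrightarrow> p \<in> J \<Longrightarrow> q \<in> J \<Longrightarrow> p - q \<in> J"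
  using stable_idealD(3)[of n D J p "- q"] stable_ideal_uminus by simp

lemma of_nat_pol: "(of_nat k :: pol) = single 0 (of_nat k)"
  by (simp only: single_of_nat)

lemma stable_ideal_of_nat:
  assumes J: "stable_ideal n D J" and k: "k > 0"
  shows "of_nat k * p \<in> J \<longleftrightarrow> p \<in> J"
proof
  assume "of_nat k * p \<in> J"
  then have "single 0 (1 / of_nat k) * (of_nat k * p) \<in> J" by (rule stable_ideal_scale[OF J])
  also have "single 0 (1 / of_nat k) * (of_nat k * p) = p"
  proof -
    have "single 0 (1 / of_nat k) * (of_nat k * p)
      = single 0 (1 / of_nat k) * single 0 (of_nat k) * p"
      by (simp only: of_nat_pol mult.assoc)
    then show ?thesis using k by (simp only: mult_single) simp
  qed
  finally show "p \<in> J" .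
next
  assume "p \<in> J"
  then show "of_nat k * p \<in> J" unfolding of_nat_pol by (rule stable_ideal_scale[OF J])
qed

section \<open>Widths and decompositions of exponents\<close>

lemma finite_PD: "D \<subseteq> {1..<n} \<Longrightarrow> finite (PD n D)"
  by (rule finite_subset[of _ "{..n} \<times> {..n}"]) (auto simp: PD_def Pd_def Pos_def)

definition antichain :: "(nat \<times> nat) set \<Rightarrow> bool" where
  "antichain A \<longleftrightarrow> (\<forall>\<alpha>\<in>A. \<forall>\<beta>\<in>A. P_le \<alpha> \<beta> \<longrightarrow> \<alpha> = \<beta>)"

definition wwidth :: "(nat \<times> nat \<Rightarrow> nat) \<Rightarrow> (nat \<times> nat) set \<Rightarrow> nat" where
  "wwidth x Q = Max ((\<lambda>A. \<Sum>\<alpha>\<in>A. x \<alpha>) ` {A. A \<subseteq> Q \<and> antichain A})"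

lemma width_eq_wwidth: "width Q = wwidth (\<lambda>_. 1) Q"
  by (simp add: width_def wwidth_def antichain_def)

lemma wwidth_ge:
  assumes "finite Q" "A \<subseteq> Q" "antichain A"
  shows "(\<Sum>\<alpha>\<in>A. x \<alpha>) \<le> wwidth x Q"
  unfolding wwidth_def by (rule Max_ge) (use assms in auto)

lemma wwidth_attained:
  assumes "finite Q"
  obtains A where "A \<subseteq> Q" "antichain A" "wwidth x Q = (\<Sum>\<alpha>\<in>A. x \<alpha>)"
proof -
  have "{} \<in> {A. A \<subseteq> Q \<and> antichain A}" by (simp add: antichain_def)
  then have "wwidth x Q \<in> (\<lambda>A. \<Sum>\<alpha>\<in>A. x \<alpha>) ` {A. A \<subseteq> Q \<and> antichain A}"
    unfolding wwidth_def using assms by (intro Max_in) auto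
  then show thesis using that by auto
qed

lemma wwidth_le:
  assumes "finite Q" "\<And>A. A \<subseteq> Q \<Longrightarrow> antichain A \<Longrightarrow> (\<Sum>\<alpha>\<in>A. x \<alpha>) \<le> b"
  shows "wwidth x Q \<le> b"
  using wwidth_attained[OF assms(1), of x] assms(2) by metis

lemma card_le_width: "finite Q \<Longrightarrow> A \<subseteq> Q \<Longrightarrow> antichain A \<Longrightarrow> card A \<le> width Q"
  using wwidth_ge[of Q A "\<lambda>_. 1"] by (simp add: width_eq_wwidth)

lemma width_le:
  "finite Q \<Longrightarrow> (\<And>A. A \<subseteq> Q \<Longrightarrow> antichain A \<Longrightarrow> card A \<le> b) \<Longrightarrow> width Q \<le> b"
  using wwidth_le[of Q "\<lambda>_. 1"] by (simp add: width_eq_wwidth)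

lemma width_empty [simp]: "width {} = 0"
  using width_le[of "{}" 0] by auto

text \<open>The pairs whose intervals contain the interval of \<open>\<alpha>\<close> with both ends in the interior.  Two
  pairs are incomparable exactly when one of them encloses the other, so that an antichain is a
  nest of intervals.\<close>

definition encl :: "nat \<times> nat \<Rightarrow> (nat \<times> nat) set" where
  "encl \<alpha> = {\<beta>. fst \<alpha> < fst \<beta> \<and> snd \<beta> < snd \<alpha>}"

lemma incomparable_encl:
  "antichain A \<Longrightarrow> \<alpha> \<in> A \<Longrightarrow> \<beta> \<in> A \<Longrightarrow> \<alpha> \<noteq> \<beta> \<Longrightarrow> \<beta> \<in> encl \<alpha> \<or> \<alpha> \<in> encl \<beta>"
  unfolding antichain_def encl_def P_le_def by (auto simp: not_le) (metis leI less_imp_le)+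

text \<open>The weighted number of intervals nested around \<open>\<alpha>\<close>.  The weight of \<open>\<alpha>\<close> is thought of as
  occupying the levels after \<open>depth x P \<alpha>\<close>, see \<open>slice\<close>; elements enclosing one another
  occupy disjoint ranges of levels by \<open>depth_mono\<close>.\<close>

definition depth :: "(nat \<times> nat \<Rightarrow> nat) \<Rightarrow> (nat \<times> nat) set \<Rightarrow> nat \<times> nat \<Rightarrow> nat" where
  "depth x P \<alpha> = wwidth x (P \<inter> encl \<alpha>)"

lemma depth_extend:
  assumes "finite P" "\<alpha> \<in> P"
  obtains A where "A \<subseteq> P" "antichain A" "\<alpha> \<in> A" "A \<subseteq> insert \<alpha> (encl \<alpha>)"
    "(\<Sum>\<gamma>\<in>A. x \<gamma>) = depth x P \<alpha> + x \<alpha>"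
proof -
  obtain A where A: "A \<subseteq> P \<inter> encl \<alpha>" "antichain A" "depth x P \<alpha> = (\<Sum>\<alpha>\<in>A. x \<alpha>)"
    unfolding depth_def using wwidth_attained[of "P \<inter> encl \<alpha>" x] assms by blast
  have "\<alpha> \<notin> A" using A(1) by (auto simp: encl_def)
  have "antichain (insert \<alpha> A)"
    using A(1,2) unfolding antichain_def encl_def P_le_def by fastforce
  moreover have "finite A" using A(1) assms(1) finite_subset by (metis finite_Int)
  ultimately show thesis
    using A assms \<open>\<alpha> \<notin> A\<close> by (intro that[of "insert \<alpha> A"]) auto
qed

lemma depth_mono:
  assumes "finite P" "\<beta> \<in> P" "\<beta> \<in> encl \<alpha>"
  shows "depth x P \<beta> + x \<beta> \<le> depth x P \<alpha>"
proof -
  obtain A where A: "A \<subseteq> P" "antichain A" "A \<subseteq> insert \<beta> (encl \<beta>)"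
    "(\<Sum>\<gamma>\<in>A. x \<gamma>) = depth x P \<beta> + x \<beta>"
    using depth_extend[OF assms(1,2), of x] by metis
  have "A \<subseteq> P \<inter> encl \<alpha>" using A(1,3) assms(3) by (force simp: encl_def)
  then show ?thesis
    using wwidth_ge[of "P \<inter> encl \<alpha>" A x] A assms by (simp add: depth_def)
qed

lemma depth_le_wwidth:
  assumes "finite P" "P \<subseteq> Pos n" "\<alpha> \<in> P" "\<alpha> \<in> Pd n d"
  shows "depth x P \<alpha> + x \<alpha> \<le> wwidth x (P \<inter> Pd n d)"
proof -
  obtain A where A: "A \<subseteq> P" "antichain A" "A \<subseteq> insert \<alpha> (encl \<alpha>)"
    "(\<Sum>\<gamma>\<in>A. x \<gamma>) = depth x P \<alpha> + x \<alpha>"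
    using depth_extend[OF assms(1,3), of x] by metis
  have "A \<subseteq> P \<inter> Pd n d"
    using A(1,3) assms by (force simp: encl_def Pd_def)
  then show ?thesis using wwidth_ge[of "P \<inter> Pd n d" A x] A assms by simp
qed

text \<open>An element occupies \<open>x \<alpha>\<close> consecutive levels; it belongs to the slices of the residues of these
  levels modulo \<open>k\<close>.  If \<open>x \<le> k\<close>, the function \<open>x\<close> is the sum of the indicators of its \<open>k\<close> slices.\<close>

definition slice :: "(nat \<times> nat \<Rightarrow> nat) \<Rightarrow> (nat \<times> nat) set \<Rightarrow> nat \<Rightarrow> nat \<Rightarrow> (nat \<times> nat) set" where
  "slice x P k c = {\<alpha> \<in> P. \<exists>\<tau>\<in>{depth x P \<alpha><..depth x P \<alpha> + x \<alpha>}. \<tau> mod k = c}"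

lemma card_residues:
  assumes "x \<le> k"
  shows "card {c. c < k \<and> (\<exists>\<tau>\<in>{h<..h + x}. \<tau> mod k = c)} = (x::nat)"
proof (cases "k = 0")
  case True then show ?thesis using assms by auto
next
  case False
  have "{c. c < k \<and> (\<exists>\<tau>\<in>{h<..h + x}. \<tau> mod k = c)} = (\<lambda>\<tau>. \<tau> mod k) ` {h<..h + x}"
    using False by auto
  moreover have "inj_on (\<lambda>\<tau>. \<tau> mod k) {h<..h + x}"
  proof (rule inj_onI)
    have *: "a = b" if "a \<in> {h<..h + x}" "b \<in> {h<..h + x}" "a mod k = b mod k" "a \<le> b" for a b
    proof -
      have "k dvd b - a" using that by (metis mod_eq_dvd_iff_nat)
      moreover have "b - a < k" using that assms by auto
      ultimately have "b - a = 0" using nat_dvd_not_less by blast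
      then show ?thesis using that(4) by simp
    qed
    fix a b assume "a \<in> {h<..h + x}" "b \<in> {h<..h + x}" "a mod k = b mod k"
    then show "a = b" using *[of a b] *[of b a] by (metis linear)
  qed
  ultimately show ?thesis by (simp add: card_image)
qed

text \<open>An antichain of one slice has distinct levels of one residue, and all levels over \<open>d\<close> are bounded
  by the weighted width.\<close>

lemma sum_width_slices:
  assumes P: "finite P" "P \<subseteq> Pos n" and k: "k > 0"
  shows "(\<Sum>c<k. width (slice x P k c \<inter> Pd n d)) \<le> wwidth x (P \<inter> Pd n d)"
proof -
  let ?W = "wwidth x (P \<inter> Pd n d)"
  have fin: "finite (slice x P k c)" for c using P(1) by (simp add: slice_def)
  have "width (slice x P k c \<inter> Pd n d) \<le> card {\<tau>\<in>{1..?W}. \<tau> mod k = c}" for c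
  proof (rule width_le)
    fix A assume A: "A \<subseteq> slice x P k c \<inter> Pd n d" "antichain A"
    define lv where "lv \<alpha> = (SOME \<tau>. \<tau> \<in> {depth x P \<alpha><..depth x P \<alpha> + x \<alpha>} \<and> \<tau> mod k = c)" for \<alpha>
    have lv: "depth x P \<alpha> < lv \<alpha>" "lv \<alpha> \<le> depth x P \<alpha> + x \<alpha>" "lv \<alpha> mod k = c" if "\<alpha> \<in> A" for \<alpha>
    proof -
      have "\<exists>\<tau>. \<tau> \<in> {depth x P \<alpha><..depth x P \<alpha> + x \<alpha>} \<and> \<tau> mod k = c"
        using that A(1) unfolding slice_def by blast
      from someI_ex[OF this] show "depth x P \<alpha> < lv \<alpha>" "lv \<alpha> \<le> depth x P \<alpha> + x \<alpha>" "lv \<alpha> mod k = c"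
        by (auto simp: lv_def)
    qed
    have AP: "\<alpha> \<in> P" if "\<alpha> \<in> A" for \<alpha> using that A(1) by (auto simp: slice_def)
    have "inj_on lv A"
    proof (rule inj_onI, rule ccontr)
      fix \<alpha> \<beta> assume ab: "\<alpha> \<in> A" "\<beta> \<in> A" "lv \<alpha> = lv \<beta>" "\<alpha> \<noteq> \<beta>"
      then have "\<beta> \<in> encl \<alpha> \<or> \<alpha> \<in> encl \<beta>" using incomparable_encl A(2) by metis
      then have "lv \<beta> < lv \<alpha> \<or> lv \<alpha> < lv \<beta>"
        using depth_mono[OF P(1) AP[OF ab(2)], of \<alpha> x] depth_mono[OF P(1) AP[OF ab(1)], of \<beta> x]
          lv[OF ab(1)] lv[OF ab(2)] by linarith
      then show False using ab(3) by simp
    qed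
    moreover have "lv ` A \<subseteq> {\<tau>\<in>{1..?W}. \<tau> mod k = c}"
    proof (rule image_subsetI)
      fix \<alpha> assume a: "\<alpha> \<in> A"
      then have "\<alpha> \<in> Pd n d" using A(1) by auto
      then have "depth x P \<alpha> + x \<alpha> \<le> ?W" using depth_le_wwidth P AP[OF a] by blast
      then show "lv \<alpha> \<in> {\<tau>\<in>{1..?W}. \<tau> mod k = c}" using lv[OF a] by auto
    qed
    ultimately show "card A \<le> card {\<tau>\<in>{1..?W}. \<tau> mod k = c}"
      using card_mono[of "{\<tau>\<in>{1..?W}. \<tau> mod k = c}" "lv ` A"] by (simp add: card_image)
  qed (use fin in simp)
  then have "(\<Sum>c<k. width (slice x P k c \<inter> Pd n d)) \<le> (\<Sum>c<k. card {\<tau>\<in>{1..?W}. \<tau> mod k = c})"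
    by (rule sum_mono)
  also have "\<dots> = card (\<Union>c\<in>{..<k}. {\<tau>\<in>{1..?W}. \<tau> mod k = c})"
    by (rule card_UN_disjoint[symmetric]) auto
  also have "\<dots> \<le> card {1..?W}" by (rule card_mono) auto
  finally show ?thesis by simp
qed

definition excess :: "nat \<Rightarrow> nat set \<Rightarrow> (nat \<Rightarrow> nat) \<Rightarrow> (nat \<times> nat \<Rightarrow> nat) \<Rightarrow> (nat \<times> nat) set \<Rightarrow> int" where
  "excess n D m s Q = int (\<Sum>\<alpha>\<in>Q. s \<alpha>) - int (\<Sum>d\<in>D. m d * width (Q \<inter> Pd n d))"

text \<open>Suppose every element is missed by some tight set, and let \<open>k + 1\<close> be the number of tight sets.
  Then every element lies in at most \<open>k\<close> of them, and the sum of the indicators of the tight sets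
  can be redistributed to the \<open>k\<close> slices of the multiplicity function.  The total of \<open>s\<close> is
  preserved and the total width does not increase, so the \<open>k\<close> slices have total excess at least
  \<open>(k + 1) * M\<close>, although each has excess at most \<open>M\<close>.\<close>

lemma tight_sets_meet:
  assumes D: "D \<subseteq> {1..<n}" and M: "M > 0"
    and le: "\<And>Q. Q \<subseteq> PD n D \<Longrightarrow> excess n D m s Q \<le> M"
    and ex: "\<exists>Q\<subseteq>PD n D. excess n D m s Q = M"
  shows "\<exists>\<alpha>. \<forall>Q\<subseteq>PD n D. excess n D m s Q = M \<longrightarrow> \<alpha> \<in> Q"
proof (rule ccontr)
  assume none: "\<nexists>\<alpha>. \<forall>Q\<subseteq>PD n D. excess n D m s Q = M \<longrightarrow> \<alpha> \<in> Q"
  let ?P = "PD n D"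
  have finD: "finite D" using D finite_subset by blast
  have finP: "finite ?P" and PosP: "?P \<subseteq> Pos n"
    using finite_PD[OF D] by (auto simp: PD_def Pd_def)
  define T where "T = {Q. Q \<subseteq> ?P \<and> excess n D m s Q = M}"
  have finT: "finite T" using finP by (simp add: T_def)
  have "T \<noteq> {}" using ex by (auto simp: T_def)
  then have cardT: "card T \<ge> 1" using finT by (simp add: Suc_le_eq card_gt_0_iff)
  define x where "x \<alpha> = card {Q\<in>T. \<alpha> \<in> Q}" for \<alpha>
  define k where "k = card T - 1"
  have xk: "x \<alpha> \<le> k" for \<alpha>
  proof -
    obtain Q where "Q \<in> T" "\<alpha> \<notin> Q" using none unfolding T_def by blast
    then have "{Q\<in>T. \<alpha> \<in> Q} \<subset> T" by auto
    then have "x \<alpha> < card T" unfolding x_def by (rule psubset_card_mono[OF finT])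
    then show ?thesis by (simp add: k_def)
  qed
  (* otherwise the only tight set would be empty, of excess 0 *)
  have "k > 0"
  proof (rule ccontr)
    assume "\<not> k > 0"
    then have x0: "x \<alpha> = 0" for \<alpha> using xk[of \<alpha>] by simp
    obtain Q where Q: "Q \<in> T" using \<open>T \<noteq> {}\<close> by auto
    have "Q = {}"
    proof (rule ccontr)
      assume "Q \<noteq> {}"
      then obtain \<alpha> where "\<alpha> \<in> Q" by auto
      then have "{Q\<in>T. \<alpha> \<in> Q} \<noteq> {}" using Q by auto
      then have "card {Q\<in>T. \<alpha> \<in> Q} \<noteq> 0" using finT by (subst card_0_eq) auto
      then show False using x0[of \<alpha>] by (simp add: x_def)
    qed
    then show False using Q M by (simp add: T_def excess_def)
  qed
  let ?Q = "slice x ?P k"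
  have sub: "?Q c \<subseteq> ?P" for c by (auto simp: slice_def)
  have finsub: "finite Q" if "Q \<subseteq> ?P" for Q using that finP finite_subset by blast
  have dc: "(\<Sum>i\<in>I. \<Sum>\<alpha>\<in>F i. s \<alpha>) = (\<Sum>\<alpha>\<in>?P. card {i\<in>I. \<alpha> \<in> F i} * s \<alpha>)"
    if "finite I" "\<And>i. i \<in> I \<Longrightarrow> F i \<subseteq> ?P" for I :: "'b set" and F
  proof -
    have "(\<Sum>i\<in>I. \<Sum>\<alpha>\<in>F i. s \<alpha>) = (\<Sum>i\<in>I. \<Sum>\<alpha>\<in>?P. if \<alpha> \<in> F i then s \<alpha> else 0)"
      using that finP by (intro sum.cong[OF refl]) (simp add: sum.inter_restrict[symmetric] Int_absorb1)
    also have "\<dots> = (\<Sum>\<alpha>\<in>?P. \<Sum>i\<in>I. if \<alpha> \<in> F i then s \<alpha> else 0)" by (rule sum.swap)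
    also have "\<dots> = (\<Sum>\<alpha>\<in>?P. card {i\<in>I. \<alpha> \<in> F i} * s \<alpha>)"
    proof (rule sum.cong[OF refl])
      fix \<alpha>
      have "(\<Sum>i\<in>I. if \<alpha> \<in> F i then s \<alpha> else 0) = (\<Sum>i\<in>{i\<in>I. \<alpha> \<in> F i}. s \<alpha>)"
        using that(1) by (subst sum.inter_filter) auto
      then show "(\<Sum>i\<in>I. if \<alpha> \<in> F i then s \<alpha> else 0) = card {i\<in>I. \<alpha> \<in> F i} * s \<alpha>" by simp
    qed
    finally show ?thesis .
  qed
  have cnt: "card {c \<in> {..<k}. \<alpha> \<in> ?Q c} = x \<alpha>" if "\<alpha> \<in> ?P" for \<alpha>
    using card_residues[OF xk[of \<alpha>], of "depth x ?P \<alpha>"] that by (simp add: slice_def)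
  have S: "(\<Sum>c<k. \<Sum>\<alpha>\<in>?Q c. s \<alpha>) = (\<Sum>Q\<in>T. \<Sum>\<alpha>\<in>Q. s \<alpha>)"
    using dc[of "{..<k}" ?Q] dc[OF finT, of "\<lambda>Q. Q"] sub cnt by (auto simp: T_def x_def)
  have W: "(\<Sum>c<k. width (?Q c \<inter> Pd n d)) \<le> (\<Sum>Q\<in>T. width (Q \<inter> Pd n d))" for d
  proof -
    have "wwidth x (?P \<inter> Pd n d) \<le> (\<Sum>Q\<in>T. width (Q \<inter> Pd n d))"
    proof (rule wwidth_le)
      fix A assume A: "A \<subseteq> ?P \<inter> Pd n d" "antichain A"
      have finA: "finite A" using A finsub by blast
      have "(\<Sum>\<alpha>\<in>A. x \<alpha>) = (\<Sum>\<alpha>\<in>A. \<Sum>Q\<in>T. if \<alpha> \<in> Q then 1 else 0)"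
        using finT by (intro sum.cong refl) (simp add: x_def sum.inter_filter[symmetric])
      also have "\<dots> = (\<Sum>Q\<in>T. \<Sum>\<alpha>\<in>A. if \<alpha> \<in> Q then 1 else 0)" by (rule sum.swap)
      also have "\<dots> = (\<Sum>Q\<in>T. card (A \<inter> Q))"
        using finA by (intro sum.cong refl) (simp add: sum.inter_restrict[symmetric])
      also have "\<dots> \<le> (\<Sum>Q\<in>T. width (Q \<inter> Pd n d))"
      proof (rule sum_mono)
        fix Q assume "Q \<in> T"
        then have "finite (Q \<inter> Pd n d)" using finsub by (auto simp: T_def)
        moreover have "antichain (A \<inter> Q)" using A(2) by (auto simp: antichain_def)
        ultimately show "card (A \<inter> Q) \<le> width (Q \<inter> Pd n d)"
          using A by (intro card_le_width) auto
      qed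
      finally show "(\<Sum>\<alpha>\<in>A. x \<alpha>) \<le> (\<Sum>Q\<in>T. width (Q \<inter> Pd n d))" .
    qed (use finP in simp)
    then show ?thesis using sum_width_slices[OF finP PosP \<open>k > 0\<close>, of x d] by linarith
  qed
  have "(\<Sum>c<k. \<Sum>d\<in>D. m d * width (?Q c \<inter> Pd n d)) = (\<Sum>d\<in>D. m d * (\<Sum>c<k. width (?Q c \<inter> Pd n d)))"
    by (subst sum.swap) (simp add: sum_distrib_left)
  also have "\<dots> \<le> (\<Sum>d\<in>D. m d * (\<Sum>Q\<in>T. width (Q \<inter> Pd n d)))"
    by (intro sum_mono mult_left_mono W) auto
  also have "\<dots> = (\<Sum>Q\<in>T. \<Sum>d\<in>D. m d * width (Q \<inter> Pd n d))"
    by (subst sum.swap) (simp add: sum_distrib_left)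
  finally have "(\<Sum>Q\<in>T. excess n D m s Q) \<le> (\<Sum>c<k. excess n D m s (?Q c))"
    using S unfolding excess_def sum_subtractf of_nat_sum[symmetric] by linarith
  also have "\<dots> \<le> (\<Sum>c<k. M)" by (rule sum_mono) (use le sub in blast)
  also have "(\<Sum>Q\<in>T. excess n D m s Q) = card T * M" by (simp add: T_def)
  finally have "int (card T) * M \<le> int k * M" by simp
  then have "int (card T) \<le> int k" using M by simp
  then show False using cardT by (simp add: k_def)
qed

text \<open>The \<open>m d\<close> antichains wanted for \<open>d\<close> are indexed by the levels from \<open>level D m d + 1\<close> to
  \<open>level D m d + m d\<close>.  For \<open>j < i\<close> the levels between \<open>level D m j\<close> and
  \<open>level D m i\<close> are those of the \<open>d\<close> with \<open>(i, j) \<in> Pd n d\<close>.\<close>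

definition level :: "nat set \<Rightarrow> (nat \<Rightarrow> nat) \<Rightarrow> nat \<Rightarrow> nat" where
  "level D m x = (\<Sum>d\<in>{d\<in>D. d < x}. m d)"

lemma level_mono: "finite D \<Longrightarrow> x \<le> y \<Longrightarrow> level D m x \<le> level D m y"
  unfolding level_def by (rule sum_mono2) auto

lemma level_step: "finite D \<Longrightarrow> d \<in> D \<Longrightarrow> d < y \<Longrightarrow> level D m d + m d \<le> level D m y"
proof -
  assume a: "finite D" "d \<in> D" "d < y"
  have "level D m d + m d = (\<Sum>d\<in>insert d {e\<in>D. e < d}. m d)" using a(1) by (simp add: level_def)
  also have "\<dots> \<le> level D m y" unfolding level_def by (rule sum_mono2) (use a in auto)
  finally show ?thesis .
qed

lemma level_diff: "finite D \<Longrightarrow> j \<le> i \<Longrightarrow> level D m i = level D m j + (\<Sum>d\<in>{d\<in>D. j \<le> d \<and> d < i}. m d)"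
proof -
  assume a: "finite D" "j \<le> i"
  have "{d\<in>D. d < i} = {d\<in>D. d < j} \<union> {d\<in>D. j \<le> d \<and> d < i}" using a(2) by auto
  then show ?thesis unfolding level_def using a(1) by (simp add: sum.union_disjoint disjoint_iff)
qed

text \<open>Every \<open>\<alpha>\<close> receives \<open>s \<alpha>\<close> consecutive levels, starting after the potential \<open>low \<alpha>\<close>, and a level
  collects the elements that occupy it.  Comparable elements must get disjoint ranges, and the
  levels of \<open>\<alpha>\<close> must belong to those \<open>d\<close> with \<open>\<alpha> \<in> Pd n d\<close>.  The least potential with these
  properties is a longest path: the maximum of \<open>level D m j\<close> plus the weight of a chain below \<open>\<alpha>\<close>
  with columns from \<open>j\<close> on.  The levels of \<open>\<alpha>\<close> do not exceed \<open>level D m (fst \<alpha>)\<close> because the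
  hypothesis, applied to the chain and \<open>\<alpha>\<close>, bounds the total weight by the number of levels
  between \<open>level D m j\<close> and \<open>level D m (fst \<alpha>)\<close>.\<close>

lemma decompose_tight:
  assumes D: "D \<subseteq> {1..<n}"
    and le: "\<And>Q. Q \<subseteq> PD n D \<Longrightarrow> (\<Sum>\<alpha>\<in>Q. s \<alpha>) \<le> (\<Sum>d\<in>D. m d * width (Q \<inter> Pd n d))"
  shows "\<exists>A. (\<forall>d\<in>D. \<forall>\<tau><m d. A d \<tau> \<subseteq> Pd n d \<and> antichain (A d \<tau>)) \<and>
     (\<forall>\<alpha>\<in>PD n D. s \<alpha> = (\<Sum>d\<in>D. \<Sum>\<tau><m d. if \<alpha> \<in> A d \<tau> then 1 else 0))"
proof -
  let ?P = "PD n D" and ?L = "level D m"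
  have finD: "finite D" using D finite_subset by blast
  have finP: "finite ?P" by (rule finite_PD[OF D])
  define Cs where "Cs \<alpha> = {(C, j). C \<subseteq> ?P \<and> (\<forall>\<beta>\<in>C. \<forall>\<gamma>\<in>C. P_le \<beta> \<gamma> \<or> P_le \<gamma> \<beta>) \<and>
      (\<forall>\<beta>\<in>C. P_le \<beta> \<alpha> \<and> \<beta> \<noteq> \<alpha> \<and> j \<le> snd \<beta>) \<and> j \<le> snd \<alpha>}" for \<alpha>
  define low where "low \<alpha> = Max ((\<lambda>(C, j). ?L j + (\<Sum>\<beta>\<in>C. s \<beta>)) ` Cs \<alpha>)" for \<alpha>
  have finC: "finite (Cs \<alpha>)" for \<alpha>
    by (rule finite_subset[of _ "Pow ?P \<times> {..snd \<alpha>}"]) (use finP in \<open>auto simp: Cs_def\<close>)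
  have low_ge: "?L j + (\<Sum>\<beta>\<in>C. s \<beta>) \<le> low \<alpha>" if "(C, j) \<in> Cs \<alpha>" for C j \<alpha>
    unfolding low_def using finC that by (intro Max_ge) (auto intro!: image_eqI[of _ _ "(C, j)"])
  have low_base: "?L (snd \<alpha>) \<le> low \<alpha>" for \<alpha>
    using low_ge[of "{}" "snd \<alpha>" \<alpha>] by (simp add: Cs_def)
  have low_att: "\<exists>C j. (C, j) \<in> Cs \<alpha> \<and> low \<alpha> = ?L j + (\<Sum>\<beta>\<in>C. s \<beta>)" for \<alpha>
  proof -
    have "({}, snd \<alpha>) \<in> Cs \<alpha>" by (simp add: Cs_def)
    then have "low \<alpha> \<in> (\<lambda>(C, j). ?L j + (\<Sum>\<beta>\<in>C. s \<beta>)) ` Cs \<alpha>"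
      unfolding low_def using finC by (intro Max_in) auto
    then show ?thesis by auto
  qed
  have low_step: "low \<beta> + s \<beta> \<le> low \<alpha>" if "\<beta> \<in> ?P" "P_le \<beta> \<alpha>" "\<beta> \<noteq> \<alpha>" for \<alpha> \<beta>
  proof -
    obtain C j where C: "(C, j) \<in> Cs \<beta>" "low \<beta> = ?L j + (\<Sum>\<gamma>\<in>C. s \<gamma>)" using low_att by blast
    have "\<beta> \<notin> C" "finite C" using C(1) finP by (auto simp: Cs_def intro: finite_subset)
    moreover have "(insert \<beta> C, j) \<in> Cs \<alpha>"
      using C(1) that unfolding Cs_def P_le_def by (auto intro: prod_eqI)
    ultimately show ?thesis using low_ge[of "insert \<beta> C" j \<alpha>] C(2) by simp
  qed
  (* a chain has width at most one, and width zero in the Pd n d which it does not meet *)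
  have low_top: "low \<alpha> + s \<alpha> \<le> ?L (fst \<alpha>)" if a: "\<alpha> \<in> ?P" for \<alpha>
  proof -
    obtain C j where C: "(C, j) \<in> Cs \<alpha>" "low \<alpha> = ?L j + (\<Sum>\<gamma>\<in>C. s \<gamma>)" using low_att by blast
    have nC: "\<alpha> \<notin> C" "finite C" using C(1) finP by (auto simp: Cs_def intro: finite_subset)
    let ?C = "insert \<alpha> C"
    have w: "width (?C \<inter> Pd n d) \<le> (if j \<le> d \<and> d < fst \<alpha> then 1 else 0)" for d
    proof (rule width_le)
      fix A assume A: "A \<subseteq> ?C \<inter> Pd n d" "antichain A"
      have "\<beta> = \<gamma>" if "\<beta> \<in> A" "\<gamma> \<in> A" for \<beta> \<gamma>
      proof -
        have "\<forall>\<beta>\<in>C. \<forall>\<gamma>\<in>C. P_le \<beta> \<gamma> \<or> P_le \<gamma> \<beta>" "\<forall>\<beta>\<in>C. P_le \<beta> \<alpha>" "P_le \<alpha> \<alpha>"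
          using C(1) by (auto simp: Cs_def P_le_def)
        moreover have "\<beta> \<in> ?C" "\<gamma> \<in> ?C" using that A(1) by auto
        ultimately have "P_le \<beta> \<gamma> \<or> P_le \<gamma> \<beta>" by blast
        then show ?thesis using A(2) that by (auto simp: antichain_def)
      qed
      then have "card A \<le> 1" using nC(2) A(1)
        by (subst One_nat_def, subst card_le_Suc0_iff_eq) (auto intro: finite_subset[of A ?C])
      moreover have "A = {}" if "\<not> (j \<le> d \<and> d < fst \<alpha>)"
      proof (rule ccontr)
        assume "A \<noteq> {}"
        then obtain \<beta> where b: "\<beta> \<in> ?C" "\<beta> \<in> Pd n d" using A(1) by auto
        then have "j \<le> snd \<beta>" "fst \<beta> \<le> fst \<alpha>" using C(1) by (auto simp: Cs_def P_le_def)
        then show False using b(2) that by (auto simp: Pd_def)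
      qed
      ultimately show "card A \<le> (if j \<le> d \<and> d < fst \<alpha> then 1 else 0)" by auto
    qed (use nC in simp)
    have "low \<alpha> + s \<alpha> = ?L j + (\<Sum>\<gamma>\<in>?C. s \<gamma>)" using C(2) nC by simp
    also have "\<dots> \<le> ?L j + (\<Sum>d\<in>D. m d * width (?C \<inter> Pd n d))"
      using le[of ?C] a C(1) by (auto simp: Cs_def)
    also have "\<dots> \<le> ?L j + (\<Sum>d\<in>D. m d * (if j \<le> d \<and> d < fst \<alpha> then 1 else 0))"
      by (intro add_left_mono sum_mono mult_left_mono w) auto
    also have "(\<Sum>d\<in>D. m d * (if j \<le> d \<and> d < fst \<alpha> then 1 else 0)) = (\<Sum>d\<in>{d\<in>D. j \<le> d \<and> d < fst \<alpha>}. m d)"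
      using finD by (subst sum.inter_filter) (auto intro!: sum.cong)
    also have "?L j + \<dots> = ?L (fst \<alpha>)"
    proof -
      have "j \<le> snd \<alpha>" using C(1) by (auto simp: Cs_def)
      moreover have "snd \<alpha> < fst \<alpha>" using a by (auto simp: PD_def Pd_def Pos_def)
      ultimately show ?thesis using level_diff[OF finD, of j "fst \<alpha>" m] by simp
    qed
    finally show ?thesis .
  qed
  define A where "A d \<tau> = {\<alpha>\<in>?P. low \<alpha> < ?L d + \<tau> + 1 \<and> ?L d + \<tau> + 1 \<le> low \<alpha> + s \<alpha>}" for d \<tau>
  have sub: "A d \<tau> \<subseteq> Pd n d" if d: "d \<in> D" "\<tau> < m d" for d \<tau>
  proof
    fix \<alpha> assume a: "\<alpha> \<in> A d \<tau>"
    then have aP: "\<alpha> \<in> ?P" by (simp add: A_def)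
    have "snd \<alpha> \<le> d"
    proof (rule ccontr)
      assume "\<not> snd \<alpha> \<le> d"
      then have "?L d + m d \<le> ?L (snd \<alpha>)" using level_step[OF finD d(1)] by simp
      then show False using low_base[of \<alpha>] a d(2) by (simp add: A_def)
    qed
    moreover have "d < fst \<alpha>"
    proof (rule ccontr)
      assume "\<not> d < fst \<alpha>"
      then have "?L (fst \<alpha>) \<le> ?L d" using level_mono[OF finD] by simp
      then show False using low_top[OF aP] a by (simp add: A_def)
    qed
    ultimately show "\<alpha> \<in> Pd n d" using aP by (auto simp: PD_def Pd_def)
  qed
  have anti: "antichain (A d \<tau>)" for d \<tau>
    unfolding antichain_def
  proof (intro ballI impI, rule ccontr)
    fix \<beta> \<alpha> assume "\<beta> \<in> A d \<tau>" "\<alpha> \<in> A d \<tau>" "P_le \<beta> \<alpha>" "\<beta> \<noteq> \<alpha>"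
    then show False using low_step[of \<beta> \<alpha>] by (simp add: A_def)
  qed
  have cnt: "s \<alpha> = (\<Sum>d\<in>D. \<Sum>\<tau><m d. if \<alpha> \<in> A d \<tau> then 1 else 0)" if a: "\<alpha> \<in> ?P" for \<alpha>
  proof -
    let ?S = "SIGMA d:D. {..<m d}" and ?v = "\<lambda>(d, \<tau>). ?L d + \<tau> + 1"
    have finS: "finite ?S" using finD by simp
    have inj: "inj_on ?v ?S"
    proof (rule inj_onI)
      have *: "(d, \<tau>) = (d', \<tau>')" if "d \<in> D" "\<tau> < m d" "d' \<in> D" "?L d + \<tau> = ?L d' + \<tau>'" "d \<le> d'" for d \<tau> d' \<tau>'
      proof (cases "d = d'")
        case False
        then have "?L d + m d \<le> ?L d'" using level_step[OF finD] that by simp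
        then show ?thesis using that by simp
      qed (use that in simp)
      fix a b assume "a \<in> ?S" "b \<in> ?S" "?v a = ?v b"
      then show "a = b"
        using *[of "fst a" "snd a" "fst b" "snd b"] *[of "fst b" "snd b" "fst a" "snd a"]
        by (cases "fst a \<le> fst b") (auto split: prod.splits)
    qed
    have img: "?v ` ?S = {1..?L n}"
    proof (rule card_subset_eq)
      show "?v ` ?S \<subseteq> {1..?L n}"
      proof (rule image_subsetI)
        fix z assume "z \<in> ?S"
        then obtain d \<tau> where z: "z = (d, \<tau>)" "d \<in> D" "\<tau> < m d" by auto
        then show "?v z \<in> {1..?L n}" using level_step[OF finD, of d n m] D by auto
      qed
      have "{d\<in>D. d < n} = D" using D by auto
      then have "?L n = card ?S" using finD by (simp add: level_def)
      then show "card (?v ` ?S) = card {1..?L n}" using inj by (simp add: card_image)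
    qed simp
    have "(\<Sum>d\<in>D. \<Sum>\<tau><m d. if \<alpha> \<in> A d \<tau> then 1 else 0) = (\<Sum>z\<in>?S. if \<alpha> \<in> A (fst z) (snd z) then 1 else (0::nat))"
      using finD by (subst sum.Sigma) (auto simp: case_prod_beta)
    also have "\<dots> = (\<Sum>z\<in>?S. if ?v z \<in> {low \<alpha><..low \<alpha> + s \<alpha>} then 1 else 0)"
      by (rule sum.cong) (use a in \<open>auto simp: A_def\<close>)
    also have "\<dots> = (\<Sum>y\<in>{1..?L n}. if y \<in> {low \<alpha><..low \<alpha> + s \<alpha>} then 1 else 0)"
      unfolding img[symmetric] by (subst sum.reindex[OF inj]) (simp add: comp_def)
    also have "\<dots> = card ({1..?L n} \<inter> {low \<alpha><..low \<alpha> + s \<alpha>})"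
      by (simp only: sum.inter_restrict[symmetric] finite_atLeastAtMost) simp
    also have "{1..?L n} \<inter> {low \<alpha><..low \<alpha> + s \<alpha>} = {low \<alpha><..low \<alpha> + s \<alpha>}"
    proof -
      have "fst \<alpha> \<le> n" using a by (auto simp: PD_def Pd_def Pos_def)
      then have "low \<alpha> + s \<alpha> \<le> ?L n" using low_top[OF a] level_mono[OF finD, of "fst \<alpha>" n m] by simp
      then show ?thesis by auto
    qed
    finally show ?thesis by simp
  qed
  show ?thesis using sub anti cnt by blast
qed

text \<open>Lower one entry at a time.  If the bound is attained by some set, the entry at a common element
  of all sets attaining it can be lowered; in any case the bound then decreases by one.\<close>

lemma decompose:
  assumes D: "D \<subseteq> {1..<n}"
    and le: "\<And>Q. Q \<subseteq> PD n D \<Longrightarrow> (\<Sum>\<alpha>\<in>Q. s \<alpha>) \<le> M + (\<Sum>d\<in>D. m d * width (Q \<inter> Pd n d))"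
  shows "\<exists>t A. (\<Sum>\<alpha>\<in>PD n D. t \<alpha>) \<le> M \<and>
     (\<forall>d\<in>D. \<forall>\<tau><m d. A d \<tau> \<subseteq> Pd n d \<and> antichain (A d \<tau>)) \<and>
     (\<forall>\<alpha>\<in>PD n D. s \<alpha> = t \<alpha> + (\<Sum>d\<in>D. \<Sum>\<tau><m d. if \<alpha> \<in> A d \<tau> then 1 else 0))"
  using le
proof (induction M arbitrary: s)
  case 0
  then have "\<And>Q. Q \<subseteq> PD n D \<Longrightarrow> (\<Sum>\<alpha>\<in>Q. s \<alpha>) \<le> (\<Sum>d\<in>D. m d * width (Q \<inter> Pd n d))" by simp
  from decompose_tight[OF D this] obtain A where
    "\<forall>d\<in>D. \<forall>\<tau><m d. A d \<tau> \<subseteq> Pd n d \<and> antichain (A d \<tau>)"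
    "\<forall>\<alpha>\<in>PD n D. s \<alpha> = (\<Sum>d\<in>D. \<Sum>\<tau><m d. if \<alpha> \<in> A d \<tau> then 1 else 0)" by blast
  then show ?case by (intro exI[of _ "\<lambda>_. 0"] exI[of _ A]) auto
next
  case (Suc M)
  let ?P = "PD n D"
  have finP: "finite ?P" by (rule finite_PD[OF D])
  have ex_le: "excess n D m s Q \<le> int (Suc M)" if "Q \<subseteq> ?P" for Q
    using Suc.prems[OF that] unfolding excess_def by linarith
  show ?case
  proof (cases "\<exists>Q\<subseteq>?P. excess n D m s Q = int (Suc M)")
    case False
    have "(\<Sum>\<alpha>\<in>Q. s \<alpha>) \<le> M + (\<Sum>d\<in>D. m d * width (Q \<inter> Pd n d))" if "Q \<subseteq> ?P" for Q
    proof -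
      have "excess n D m s Q \<noteq> int (Suc M)" using False that by blast
      then show ?thesis using ex_le[OF that] unfolding excess_def by linarith
    qed
    from Suc.IH[OF this] obtain t A where tA: "(\<Sum>\<alpha>\<in>?P. t \<alpha>) \<le> M"
      "\<forall>d\<in>D. \<forall>\<tau><m d. A d \<tau> \<subseteq> Pd n d \<and> antichain (A d \<tau>)"
      "\<forall>\<alpha>\<in>?P. s \<alpha> = t \<alpha> + (\<Sum>d\<in>D. \<Sum>\<tau><m d. if \<alpha> \<in> A d \<tau> then 1 else 0)" by blast
    show ?thesis by (intro exI[of _ t] exI[of _ A] conjI tA(2,3)) (use tA(1) in simp)
  next
    case True
    obtain \<alpha> where \<alpha>: "\<forall>Q\<subseteq>?P. excess n D m s Q = int (Suc M) \<longrightarrow> \<alpha> \<in> Q"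
      using tight_sets_meet[OF D _ ex_le True] by auto
    obtain Q0 where Q0: "Q0 \<subseteq> ?P" "excess n D m s Q0 = int (Suc M)" using True by blast
    have aQ0: "\<alpha> \<in> Q0" using \<alpha> Q0 by blast
    then have aP: "\<alpha> \<in> ?P" using Q0 by blast
    have pos: "s \<alpha> > 0"
    proof (rule ccontr)
      assume "\<not> s \<alpha> > 0"
      then have s0: "(\<Sum>\<beta>\<in>Q0 - {\<alpha>}. s \<beta>) = (\<Sum>\<beta>\<in>Q0. s \<beta>)"
        using aQ0 by (subst sum_diff1_nat) simp
      have "width ((Q0 - {\<alpha>}) \<inter> Pd n d) \<le> width (Q0 \<inter> Pd n d)" for d
      proof (rule width_le)
        show "finite ((Q0 - {\<alpha>}) \<inter> Pd n d)" using Q0(1) finP by (simp add: finite_subset)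
        fix A assume "A \<subseteq> (Q0 - {\<alpha>}) \<inter> Pd n d" "antichain A"
        then show "card A \<le> width (Q0 \<inter> Pd n d)"
          using Q0(1) finP by (intro card_le_width) (auto simp: finite_subset)
      qed
      then have "(\<Sum>d\<in>D. m d * width ((Q0 - {\<alpha>}) \<inter> Pd n d)) \<le> (\<Sum>d\<in>D. m d * width (Q0 \<inter> Pd n d))"
        by (intro sum_mono mult_left_mono) auto
      then have "excess n D m s (Q0 - {\<alpha>}) \<ge> int (Suc M)"
        using Q0(2) s0 unfolding excess_def by linarith
      then have "excess n D m s (Q0 - {\<alpha>}) = int (Suc M)"
        using ex_le[of "Q0 - {\<alpha>}"] Q0(1) by (meson Diff_subset order.antisym order.trans)
      then show False using \<alpha> Q0(1) by blast
    qed
    define s' where "s' = s(\<alpha> := s \<alpha> - 1)"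
    have sum_s': "(\<Sum>\<beta>\<in>Q. s \<beta>) = (\<Sum>\<beta>\<in>Q. s' \<beta>) + (if \<alpha> \<in> Q then 1 else 0)" if "Q \<subseteq> ?P" for Q
    proof -
      have "finite Q" using that finP finite_subset by blast
      have "(\<Sum>\<beta>\<in>Q. s \<beta>) = (\<Sum>\<beta>\<in>Q. s' \<beta> + (if \<beta> = \<alpha> then 1 else 0))"
        by (rule sum.cong) (use pos in \<open>auto simp: s'_def\<close>)
      then show ?thesis using \<open>finite Q\<close> by (simp add: sum.distrib)
    qed
    have "(\<Sum>\<beta>\<in>Q. s' \<beta>) \<le> M + (\<Sum>d\<in>D. m d * width (Q \<inter> Pd n d))" if Q: "Q \<subseteq> ?P" for Q
    proof (cases "excess n D m s Q = int (Suc M)")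
      case True
      then have "\<alpha> \<in> Q" using \<alpha> Q by blast
      then show ?thesis using sum_s'[OF Q] Suc.prems[OF Q] by simp
    next
      case False
      then have "excess n D m s Q \<le> int M" using ex_le[OF Q] by linarith
      moreover have "(\<Sum>\<beta>\<in>Q. s' \<beta>) \<le> (\<Sum>\<beta>\<in>Q. s \<beta>)" using sum_s'[OF Q] by linarith
      ultimately show ?thesis unfolding excess_def by linarith
    qed
    from Suc.IH[OF this] obtain t A where tA: "(\<Sum>\<alpha>\<in>?P. t \<alpha>) \<le> M"
      "\<forall>d\<in>D. \<forall>\<tau><m d. A d \<tau> \<subseteq> Pd n d \<and> antichain (A d \<tau>)"
      "\<forall>\<alpha>\<in>?P. s' \<alpha> = t \<alpha> + (\<Sum>d\<in>D. \<Sum>\<tau><m d. if \<alpha> \<in> A d \<tau> then 1 else 0)" by blast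
    have "(\<Sum>\<beta>\<in>?P. t \<beta> + (if \<beta> = \<alpha> then 1 else 0)) \<le> Suc M"
      using tA(1) finP aP by (simp add: sum.distrib)
    moreover have "s \<beta> = t \<beta> + (if \<beta> = \<alpha> then 1 else 0) + (\<Sum>d\<in>D. \<Sum>\<tau><m d. if \<beta> \<in> A d \<tau> then 1 else 0)"
      if "\<beta> \<in> ?P" for \<beta>
    proof (cases "\<beta> = \<alpha>")
      case True
      then have "s \<beta> = s' \<beta> + 1" using pos by (simp add: s'_def)
      then show ?thesis using tA(3) that True by simp
    next
      case False
      then have "s \<beta> = s' \<beta>" by (simp add: s'_def)
      then show ?thesis using tA(3) that False by simp
    qed
    ultimately show ?thesis
      by (intro exI[of _ "\<lambda>\<beta>. t \<beta> + (if \<beta> = \<alpha> then 1 else 0)"] exI[of _ A] conjI tA(2) ballI)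
  qed
qed

section \<open>Derivations of polynomial rings\<close>

type_synonym ('z, 'r) poly_over = "('z \<Rightarrow>\<^sub>0 nat) \<Rightarrow>\<^sub>0 'r"

definition derivation :: "('r::comm_ring_1 \<Rightarrow> 'r) \<Rightarrow> bool" where
  "derivation f \<longleftrightarrow> (\<forall>x y. f (x + y) = f x + f y) \<and> (\<forall>x y. f (x * y) = f x * y + x * f y)"

lemma derivation_zero: "derivation f \<Longrightarrow> f 0 = 0"
  by (metis derivation_def add_cancel_right_right)

lemma derivation_diff: "derivation f \<Longrightarrow> derivation g \<Longrightarrow> derivation (\<lambda>x. f x - g x)"
  by (auto simp: derivation_def algebra_simps)

lemma derivation_sum: "(\<And>i. i \<in> I \<Longrightarrow> derivation (f i)) \<Longrightarrow> derivation (\<lambda>x. \<Sum>i\<in>I. f i x)"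
  by (auto simp: derivation_def sum.distrib sum_distrib_left sum_distrib_right)

lemma derivation_power: "derivation f \<Longrightarrow> f (x ^ Suc k) = of_nat (Suc k) * x ^ k * f x"
  by (induction k) (auto simp: derivation_def algebra_simps)

text \<open>This is how statements about the generic element pass to its powers: two derivations are compared
  on the element itself.\<close>

lemma derivation_power_eq: "derivation f \<Longrightarrow> derivation g \<Longrightarrow> f x = g x \<Longrightarrow> f (x ^ k) = g (x ^ k)"
proof (cases k)
  case 0
  assume "derivation f" "derivation g"
  then have "f (1 * 1) = f 1 + f 1" "g (1 * 1) = g 1 + g 1"
    unfolding derivation_def by (metis mult_1 mult.right_neutral)+
  then show ?thesis using 0 by simp
next
  case (Suc j)
  assume "derivation f" "derivation g" "f x = g x"
  then show ?thesis using Suc derivation_power by metis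
qed

lemma poly_mapping_expand:
  "p = (\<Sum>e\<in>keys p. single e (lookup p e))"
  by (rule poly_mapping_eqI) (auto simp: lookup_sum lookup_single when_def in_keys_iff)

lemma derivation_on_singles:
  fixes f :: "('a::comm_monoid_add \<Rightarrow>\<^sub>0 'r::comm_ring_1) \<Rightarrow> ('a \<Rightarrow>\<^sub>0 'r)"
  assumes add: "\<And>x y. f (x + y) = f x + f y"
    and mult: "\<And>e e' c c'. f (single e c * single e' c') =
      f (single e c) * single e' c' + single e c * f (single e' c')"
  shows "derivation f"
proof -
  have f0: "f 0 = 0" by (metis add add_cancel_right_right)
  have fsum: "f (sum g A) = (\<Sum>a\<in>A. f (g a))" for g and A :: "'b set"
    by (induction A rule: infinite_finite_induct) (auto simp: add f0)
  have "f (x * y) = f x * y + x * f y" for x y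
  proof -
    let ?x = "\<lambda>e. single e (lookup x e)"
    let ?y = "\<lambda>e. single e (lookup y e)"
    have "f ((\<Sum>e\<in>keys x. ?x e) * (\<Sum>e\<in>keys y. ?y e)) =
      f (\<Sum>e\<in>keys x. ?x e) * (\<Sum>e\<in>keys y. ?y e)
      + (\<Sum>e\<in>keys x. ?x e) * f (\<Sum>e\<in>keys y. ?y e)"
      by (simp add: sum_product fsum mult sum.distrib)
    then show ?thesis by (simp only: poly_mapping_expand[symmetric])
  qed
  then show ?thesis using add by (simp add: derivation_def)
qed

text \<open>Additive extension of a map which is given on the terms of a polynomial.\<close>

definition extend :: "('a \<Rightarrow> 'r \<Rightarrow> ('b \<Rightarrow>\<^sub>0 's::comm_monoid_add)) \<Rightarrow> ('a \<Rightarrow>\<^sub>0 'r::zero) \<Rightarrow> ('b \<Rightarrow>\<^sub>0 's)" where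
  "extend h p = (\<Sum>e\<in>keys p. h e (lookup p e))"

lemma extend_superset:
  assumes "finite K" "keys p \<subseteq> K" "\<And>e. h e 0 = 0"
  shows "extend h p = (\<Sum>e\<in>K. h e (lookup p e))"
  unfolding extend_def
  by (rule sum.mono_neutral_left) (use assms in \<open>auto simp: in_keys_iff\<close>)

lemma extend_add:
  fixes h :: "'a \<Rightarrow> 'r::comm_monoid_add \<Rightarrow> ('b \<Rightarrow>\<^sub>0 's::comm_monoid_add)"
  assumes "\<And>e. h e 0 = 0" "\<And>e x y. h e (x + y) = h e x + h e y"
  shows "extend h (p + q) = extend h p + extend h q"
proof -
  let ?K = "keys p \<union> keys q"
  have *: "extend h r = (\<Sum>e\<in>?K. h e (lookup r e))" if "keys r \<subseteq> ?K" for r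
    by (rule extend_superset) (use that assms in auto)
  from *[of p] *[of q] *[of "p + q", OF Poly_Mapping.keys_add] show ?thesis
    using assms by (simp add: lookup_add sum.distrib)
qed

lemma extend_single: "(\<And>e. h e 0 = 0) \<Longrightarrow> extend h (single e c) = h e c"
  by (subst extend_superset[of "{e}"]) auto

text \<open>This is the first order differential operator \<open>z_a \<partial>/\<partial>z_b\<close>.\<close>

definition move :: "'z \<Rightarrow> 'z \<Rightarrow> ('z, 'r::comm_ring_1) poly_over \<Rightarrow> ('z, 'r) poly_over" where
  "move a b = extend (\<lambda>e c. single (e - single b 1 + single a 1)
     (of_nat (lookup e b) * c))"

lemma move_single: "move a b (single e c) =
    single (e - single b 1 + single a 1) (of_nat (lookup e b) * c)"
  unfolding move_def by (rule extend_single) simp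

lemma move_add: "move a b (p + q) = move a b p + move a b q"
  unfolding move_def by (rule extend_add) (simp_all add: distrib_left single_add)

lemma minus_single_add:
  assumes "lookup e b > (0::nat)"
  shows "e + e' - single b 1 = (e - single b 1) + e'"
  by (rule poly_mapping_eqI) (use assms in \<open>auto simp: lookup_add lookup_minus lookup_single when_def\<close>)

lemma derivation_move:
  fixes a b :: 'z
  shows "derivation (move a b :: ('z, 'r::comm_ring_1) poly_over \<Rightarrow> _)"
proof (rule derivation_on_singles)
  fix e e' :: "'z \<Rightarrow>\<^sub>0 nat" and c c' :: 'r
  let ?b = "single b (1::nat)" and ?a = "single a (1::nat)"
  have *: "single (e + e' - ?b + ?a) (of_nat (lookup e b) * x :: 'r)
     = single (e - ?b + ?a + e') (of_nat (lookup e b) * x)"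
    for e e' :: "'z \<Rightarrow>\<^sub>0 nat" and x :: 'r
  proof (cases "lookup e b = 0")
    case False
    then have "e + e' - ?b + ?a = e - ?b + ?a + e'"
      using minus_single_add[of e b e'] by (simp only: neq0_conv[symmetric] False not_False_eq_True simp_thms add.assoc add.commute[of ?a e'])
    then show ?thesis by simp
  qed simp
  show "move a b (single e c * single e' c') =
      move a b (single e c) * single e' c' + single e c * move a b (single e' c')"
  proof -
    have "move a b (single e c * single e' c') =
        single (e + e' - ?b + ?a) (of_nat (lookup e b) * (c * c'))
        + single (e' + e - ?b + ?a) (of_nat (lookup e' b) * (c * c'))"
      by (simp add: mult_single move_single lookup_add distrib_right single_add add.commute[of e' e])
    also have "\<dots> = single (e - ?b + ?a + e') (of_nat (lookup e b) * (c * c'))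
        + single (e' - ?b + ?a + e) (of_nat (lookup e' b) * (c * c'))"
      by (simp only: *[of e e' "c * c'"] *[of e' e "c * c'"])
    also have "\<dots> = move a b (single e c) * single e' c' + single e c * move a b (single e' c')"
      by (simp only: mult_single move_single add.commute add.left_commute add.assoc mult.commute mult.left_commute mult.assoc)
    finally show ?thesis .
  qed
qed (rule move_add)

lemma lookup_move:
  fixes p :: "('z, 'r::comm_ring_1) poly_over"
  shows "lookup (move a b p) (\<mu> + single a 1) =
     of_nat (lookup \<mu> b + 1) * lookup p (\<mu> + single b 1)"
proof -
  let ?b = "single b (1::nat)" and ?a = "single a (1::nat)"
  have eq: "lookup (single (e - ?b + ?a) (of_nat (lookup e b) * c)) (\<mu> + ?a)
     = (if e = \<mu> + ?b then of_nat (lookup \<mu> b + 1) * c else 0)" for e and c :: 'r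
  proof (cases "lookup e b = 0")
    case True
    then have "e \<noteq> \<mu> + ?b" by (auto simp: lookup_add)
    then show ?thesis using True by simp
  next
    case False
    then have "e - ?b + ?b = e"
      by (intro poly_mapping_eqI) (auto simp: lookup_add lookup_minus lookup_single when_def)
    then have "e - ?b + ?a = \<mu> + ?a \<longleftrightarrow> e = \<mu> + ?b" by (metis add_right_cancel add_diff_cancel_right')
    then show ?thesis by (auto simp: lookup_single when_def lookup_add)
  qed
  show ?thesis
    unfolding move_def extend_def
    by (simp only: lookup_sum eq) (simp add: sum.delta' in_keys_iff)
qed

lemma lookup_move_0:
  assumes "lookup \<mu> a = 0"
  shows "lookup (move a b p) \<mu> = 0"
proof -
  have "e - single b 1 + single a 1 \<noteq> \<mu>" for e
    using assms by (auto simp: lookup_add)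
  then show ?thesis unfolding move_def extend_def by (simp add: lookup_sum lookup_single)
qed

definition coeffwise :: "('r \<Rightarrow> 'r) \<Rightarrow> ('z, 'r::comm_ring_1) poly_over \<Rightarrow> ('z, 'r) poly_over" where
  "coeffwise \<delta> = extend (\<lambda>e c. single e (\<delta> c))"

lemma lookup_coeffwise: "derivation \<delta> \<Longrightarrow> lookup (coeffwise \<delta> p) \<mu> = \<delta> (lookup p \<mu>)"
  unfolding coeffwise_def extend_def
  by (simp add: lookup_sum lookup_single when_def in_keys_iff derivation_zero)

lemma coeffwise_single: "derivation \<delta> \<Longrightarrow> coeffwise \<delta> (single e c) = single e (\<delta> c)"
  unfolding coeffwise_def by (rule extend_single) (simp add: derivation_zero)

lemma coeffwise_add: "derivation \<delta> \<Longrightarrow> coeffwise \<delta> (p + q) = coeffwise \<delta> p + coeffwise \<delta> q"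
  by (rule poly_mapping_eqI) (auto simp: lookup_coeffwise lookup_add derivation_def)

lemma derivation_coeffwise: "derivation \<delta> \<Longrightarrow> derivation (coeffwise \<delta>)"
  by (rule derivation_on_singles)
    (auto simp: coeffwise_add mult_single coeffwise_single derivation_def single_add)

lemma derivation_deriv: "derivation (deriv n D x)"
  by (auto simp: derivation_def deriv_add deriv_mult)

section \<open>Powers of sums\<close>

definition words_over :: "'z set \<Rightarrow> nat \<Rightarrow> 'z list set" where
  "words_over Z A = {ws. set ws \<subseteq> Z \<and> length ws = A}"

lemma finite_words_over: "finite Z \<Longrightarrow> finite (words_over Z A)"
  unfolding words_over_def by (rule finite_lists_length_eq)

lemma words_over_Suc: "words_over Z (Suc A) = (\<lambda>(z, ws). z # ws) ` (Z \<times> words_over Z A)"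
  by (auto simp: words_over_def length_Suc_conv image_iff)

lemma power_sum_words:
  fixes f :: "'z \<Rightarrow> 'r::comm_semiring_1"
  assumes "finite Z"
  shows "(\<Sum>z\<in>Z. f z) ^ A = (\<Sum>ws\<in>words_over Z A. prod_list (map f ws))"
proof (induction A)
  case 0
  have "words_over Z 0 = {[]}" by (auto simp: words_over_def)
  then show ?case by simp
next
  case (Suc A)
  have "inj_on (\<lambda>(z, ws). z # ws) (Z \<times> words_over Z A)" by (auto simp: inj_on_def)
  then have "(\<Sum>ws\<in>words_over Z (Suc A). prod_list (map f ws)) =
      (\<Sum>(z, ws)\<in>Z \<times> words_over Z A. f z * prod_list (map f ws))"
    unfolding words_over_Suc by (subst sum.reindex) (auto simp: case_prod_beta)
  also have "\<dots> = (\<Sum>z\<in>Z. f z) * (\<Sum>ws\<in>words_over Z A. prod_list (map f ws))"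
    by (simp add: sum_product sum.cartesian_product)
  finally show ?case by (simp add: Suc.IH)
qed

lemma prod_list_single:
  "prod_list (map (\<lambda>z. single (m z) (g z)) ws) = single (sum_list (map m ws)) (prod_list (map g ws))"
  by (induction ws) (auto simp: mult_single)

lemma lookup_power_words:
  fixes g :: "'z \<Rightarrow> 'r::comm_semiring_1" and m :: "'z \<Rightarrow> 'a::comm_monoid_add"
  assumes "finite Z"
  shows "lookup ((\<Sum>z\<in>Z. single (m z) (g z)) ^ A) \<mu> =
     (\<Sum>ws\<in>{ws\<in>words_over Z A. sum_list (map m ws) = \<mu>}. prod_list (map g ws))"
  using finite_words_over[OF assms, of A]
  by (simp add: power_sum_words[OF assms] prod_list_single lookup_sum lookup_single when_def sum.inter_filter)

lemma prod_list_eq_prod_count: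
  fixes g :: "'z \<Rightarrow> 'r::comm_monoid_mult"
  assumes "finite Z" "set ws \<subseteq> Z"
  shows "prod_list (map g ws) = (\<Prod>z\<in>Z. g z ^ count_list ws z)"
  using assms(2)
proof (induction ws)
  case (Cons w ws)
  have "(\<Prod>z\<in>Z. g z ^ count_list (w # ws) z) = (\<Prod>z\<in>Z. g z ^ count_list ws z * (if z = w then g z else 1))"
    by (rule prod.cong) (auto simp: mult.commute)
  also have "\<dots> = (\<Prod>z\<in>Z. g z ^ count_list ws z) * g w"
    using assms(1) Cons.prems by (simp add: prod.distrib)
  finally show ?case using Cons by (simp add: mult.commute)
qed simp

section \<open>Linked pieces\<close>

lemma rank_bij:
  fixes key :: "'a \<Rightarrow> nat"
  assumes fin: "finite X" and inj: "inj_on key X"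
  shows "bij_betw (\<lambda>x. card {y\<in>X. key y < key x}) X {..<card X}"
proof -
  let ?r = "\<lambda>x. card {y\<in>X. key y < key x}"
  have less: "?r x < ?r x'" if "x \<in> X" "key x < key x'" for x x'
  proof (rule psubset_card_mono)
    have "x \<in> {y\<in>X. key y < key x'}" "x \<notin> {y\<in>X. key y < key x}" using that by auto
    moreover have "{y\<in>X. key y < key x} \<subseteq> {y\<in>X. key y < key x'}" using that by auto
    ultimately show "{y\<in>X. key y < key x} \<subset> {y\<in>X. key y < key x'}" by blast
  qed (use fin in simp)
  have "inj_on ?r X"
  proof (rule inj_onI, rule ccontr)
    fix x x' assume x: "x \<in> X" "x' \<in> X" "?r x = ?r x'" "x \<noteq> x'"
    then have "key x \<noteq> key x'" using inj by (auto simp: inj_on_def)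
    then have "key x < key x' \<or> key x' < key x" by linarith
    then show False using less[of x x'] less[of x' x] x by auto
  qed
  moreover have "?r ` X = {..<card X}"
  proof (rule card_subset_eq)
    show "?r ` X \<subseteq> {..<card X}"
    proof (rule image_subsetI)
      fix x assume "x \<in> X"
      then have "{y\<in>X. key y < key x} \<subset> X" by auto
      then show "?r x \<in> {..<card X}" using fin psubset_card_mono by blast
    qed
    show "card (?r ` X) = card {..<card X}" using \<open>inj_on ?r X\<close> by (simp add: card_image)
  qed simp
  ultimately show ?thesis by (simp add: bij_betw_def)
qed

text \<open>A piece \<open>i\<close> extends from block \<open>p i\<close> to block \<open>q i\<close> and has the nesting level \<open>key i\<close>.  Pieces which
  overlap in more than an end are nested, the one of smaller level being the outer one.  \<open>en B\<close>
  enumerates \<open>cap B\<close> members of the block \<open>B\<close>, enough for all pieces that end there on one side.\<close>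

locale pieces =
  fixes n :: nat and D :: "nat set" and I :: "'i set" and p q key :: "'i \<Rightarrow> nat"
    and cap :: "nat \<Rightarrow> nat" and en :: "nat \<Rightarrow> nat \<Rightarrow> nat"
  assumes D: "D \<subseteq> {1..<n}" and finI: "finite I" and pq: "i \<in> I \<Longrightarrow> p i < q i"
    and laminar: "i \<in> I \<Longrightarrow> j \<in> I \<Longrightarrow> i \<noteq> j \<Longrightarrow> p i < q j \<Longrightarrow> p j < q i \<Longrightarrow> key i \<le> key j
      \<Longrightarrow> key i < key j \<and> p i \<le> p j \<and> q j \<le> q i"
    and en_inj: "r < cap B \<Longrightarrow> r' < cap B \<Longrightarrow> en B r = en B r' \<Longrightarrow> r = r'"
    and en_blk: "r < cap B \<Longrightarrow> 1 \<le> en B r \<and> en B r \<le> n \<and> blk D (en B r) = B"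
    and capL: "card {i\<in>I. q i = B} \<le> cap B" and capR: "card {i\<in>I. p i = B} \<le> cap B"
begin

text \<open>Piece \<open>i\<close> will be represented by the matrix unit in the row \<open>bb i\<close> and the column \<open>cc i\<close>.  The row is
  chosen in the upper block \<open>q i\<close>, the pieces with the same upper block taking different rows in the
  order of their levels; similarly for columns.  \<open>Kx i\<close> and \<open>Ly i\<close> are all rows and columns that a
  matrix unit of piece \<open>i\<close> may have.\<close>

definition rL :: "'i \<Rightarrow> nat" where "rL i = card {i'\<in>{i'\<in>I. q i' = q i}. key i' < key i}"
definition rR :: "'i \<Rightarrow> nat" where "rR i = card {i'\<in>{i'\<in>I. p i' = p i}. key i' < key i}"
definition bb :: "'i \<Rightarrow> nat" where "bb i = en (q i) (rL i)"
definition cc :: "'i \<Rightarrow> nat" where "cc i = en (p i) (rR i)"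
definition Kx :: "'i \<Rightarrow> nat set" where "Kx i = {k. 1 \<le> k \<and> k \<le> n \<and> p i < blk D k \<and> blk D k \<le> q i}"
definition Ly :: "'i \<Rightarrow> nat set" where "Ly i = {l. 1 \<le> l \<and> l \<le> n \<and> p i \<le> blk D l \<and> blk D l < q i}"

lemma finD: "finite D"
  using D finite_subset by blast

lemma laminar_disj:
  assumes "i \<in> I" "j \<in> I" "i \<noteq> j" "p i < q j" "p j < q i"
  shows "key i < key j \<and> p i \<le> p j \<and> q j \<le> q i \<or> key j < key i \<and> p j \<le> p i \<and> q i \<le> q j"
  using laminar[OF assms] laminar[OF assms(2,1) assms(3)[symmetric] assms(5,4)] by linarith

lemma key_inj_q: "inj_on key {i'\<in>I. q i' = B}"
proof (rule inj_onI, rule ccontr)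
  fix i j assume ij: "i \<in> {i'\<in>I. q i' = B}" "j \<in> {i'\<in>I. q i' = B}" "key i = key j" "i \<noteq> j"
  then show False using laminar[of i j] pq[of i] pq[of j] by auto
qed

lemma key_inj_p: "inj_on key {i'\<in>I. p i' = B}"
proof (rule inj_onI, rule ccontr)
  fix i j assume ij: "i \<in> {i'\<in>I. p i' = B}" "j \<in> {i'\<in>I. p i' = B}" "key i = key j" "i \<noteq> j"
  then show False using laminar[of i j] pq[of i] pq[of j] by auto
qed

lemma rL_bij: "bij_betw rL {i\<in>I. q i = B} {..<card {i\<in>I. q i = B}}"
proof -
  have "bij_betw (\<lambda>x. card {y\<in>{i\<in>I. q i = B}. key y < key x}) {i\<in>I. q i = B} {..<card {i\<in>I. q i = B}}"
    by (rule rank_bij) (use finI key_inj_q in auto)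
  then show ?thesis by (rule bij_betw_cong[THEN iffD1, rotated]) (simp add: rL_def)
qed

lemma rR_bij: "bij_betw rR {i\<in>I. p i = B} {..<card {i\<in>I. p i = B}}"
proof -
  have "bij_betw (\<lambda>x. card {y\<in>{i\<in>I. p i = B}. key y < key x}) {i\<in>I. p i = B} {..<card {i\<in>I. p i = B}}"
    by (rule rank_bij) (use finI key_inj_p in auto)
  then show ?thesis by (rule bij_betw_cong[THEN iffD1, rotated]) (simp add: rR_def)
qed

lemma rL_card: "i \<in> I \<Longrightarrow> rL i < card {i'\<in>I. q i' = q i}"
  using bij_betwE[OF rL_bij[of "q i"]] by auto

lemma rR_card: "i \<in> I \<Longrightarrow> rR i < card {i'\<in>I. p i' = p i}"
  using bij_betwE[OF rR_bij[of "p i"]] by auto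

lemma rL_cap: "i \<in> I \<Longrightarrow> rL i < cap (q i)"
  using rL_card capL order_less_le_trans by blast

lemma rR_cap: "i \<in> I \<Longrightarrow> rR i < cap (p i)"
  using rR_card capR order_less_le_trans by blast

lemma rL_ex: "i \<in> I \<Longrightarrow> r < rL i \<Longrightarrow> \<exists>i'\<in>I. q i' = q i \<and> rL i' = r"
proof -
  assume "i \<in> I" "r < rL i"
  then have "r \<in> {..<card {i'\<in>I. q i' = q i}}" using rL_card[of i] by simp
  then have "r \<in> rL ` {i'\<in>I. q i' = q i}" using rL_bij[of "q i"] by (simp add: bij_betw_def)
  then show ?thesis by auto
qed

lemma rR_ex: "i \<in> I \<Longrightarrow> r < rR i \<Longrightarrow> \<exists>i'\<in>I. p i' = p i \<and> rR i' = r"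
proof -
  assume "i \<in> I" "r < rR i"
  then have "r \<in> {..<card {i'\<in>I. p i' = p i}}" using rR_card[of i] by simp
  then have "r \<in> rR ` {i'\<in>I. p i' = p i}" using rR_bij[of "p i"] by (simp add: bij_betw_def)
  then show ?thesis by auto
qed

lemma rL_mono: "q i = q j \<Longrightarrow> key i \<le> key j \<Longrightarrow> rL i \<le> rL j"
  unfolding rL_def by (rule card_mono) (use finI in auto)

lemma rR_mono: "p i = p j \<Longrightarrow> key i \<le> key j \<Longrightarrow> rR i \<le> rR j"
  unfolding rR_def by (rule card_mono) (use finI in auto)

lemma rL_inj: "i \<in> I \<Longrightarrow> j \<in> I \<Longrightarrow> q i = q j \<Longrightarrow> rL i = rL j \<Longrightarrow> i = j"
  using rL_bij[of "q i"] by (auto simp: bij_betw_def inj_on_def)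

lemma rR_inj: "i \<in> I \<Longrightarrow> j \<in> I \<Longrightarrow> p i = p j \<Longrightarrow> rR i = rR j \<Longrightarrow> i = j"
  using rR_bij[of "p i"] by (auto simp: bij_betw_def inj_on_def)

lemma rL_less: "i \<in> I \<Longrightarrow> j \<in> I \<Longrightarrow> q i = q j \<Longrightarrow> key i < key j \<Longrightarrow> rL i < rL j"
  using rL_mono[of i j] rL_inj[of i j] by (metis le_neq_implies_less less_imp_le less_irrefl)

lemma rR_less: "i \<in> I \<Longrightarrow> j \<in> I \<Longrightarrow> p i = p j \<Longrightarrow> key i < key j \<Longrightarrow> rR i < rR j"
  using rR_mono[of i j] rR_inj[of i j] by (metis le_neq_implies_less less_imp_le less_irrefl)

lemma bb: "i \<in> I \<Longrightarrow> 1 \<le> bb i \<and> bb i \<le> n \<and> blk D (bb i) = q i"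
  unfolding bb_def using en_blk rL_cap by blast

lemma cc: "i \<in> I \<Longrightarrow> 1 \<le> cc i \<and> cc i \<le> n \<and> blk D (cc i) = p i"
  unfolding cc_def using en_blk rR_cap by blast

lemma bb_inj: "i \<in> I \<Longrightarrow> j \<in> I \<Longrightarrow> bb i = bb j \<longleftrightarrow> i = j"
  using bb[of i] bb[of j] en_inj[OF rL_cap[of i], of "rL j"] rL_cap[of j] rL_inj[of i j]
  by (metis bb_def)

lemma cc_inj: "i \<in> I \<Longrightarrow> j \<in> I \<Longrightarrow> cc i = cc j \<longleftrightarrow> i = j"
  using cc[of i] cc[of j] en_inj[OF rR_cap[of i], of "rR j"] rR_cap[of j] rR_inj[of i j]
  by (metis cc_def)

lemma bb_cc: "i \<in> I \<Longrightarrow> j \<in> I \<Longrightarrow> bb i = cc j \<longleftrightarrow> q i = p j \<and> rL i = rR j"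
  using bb[of i] cc[of j] en_inj[OF rL_cap[of i], of "rR j"] rR_cap[of j]
  by (metis bb_def cc_def)

lemma bb_Kx: "i \<in> I \<Longrightarrow> bb i \<in> Kx i"
  using bb pq by (auto simp: Kx_def)

lemma cc_Ly: "i \<in> I \<Longrightarrow> cc i \<in> Ly i"
  using cc pq by (auto simp: Ly_def)

text \<open>
  \<open>GX i k\<close> and \<open>GY j l\<close> say that the row parameter \<open>x_ik\<close>, respectively the column parameter
  \<open>y_jl\<close>, can be dealt with.  The first two rules come from the action of the parabolic
  subalgebra; they fail to conclude only when one base column is equal to another base row, that is,
  for pieces with \<open>q i = p j\<close>.  In this case the other two rules, which come from
  reparametrizations of the generic element, lead to a pair of pieces linked at another block.
  Laminarity forces this block to lie further down (\<open>link_left\<close>) or further up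
  (\<open>link_right\<close>), so that the recursion ends.\<close>

context
  fixes GX GY :: "'i \<Rightarrow> nat \<Rightarrow> bool"
  assumes r1: "\<And>i k. i \<in> I \<Longrightarrow> k \<in> Kx i \<Longrightarrow> k \<noteq> bb i \<Longrightarrow>
        (\<And>j. j \<in> I \<Longrightarrow> cc j = k \<Longrightarrow> bb i \<in> Ly j \<Longrightarrow> GY j (bb i)) \<Longrightarrow> GX i k"
    and r2: "\<And>j l. j \<in> I \<Longrightarrow> l \<in> Ly j \<Longrightarrow> l \<noteq> cc j \<Longrightarrow>
        (\<And>i. i \<in> I \<Longrightarrow> bb i = l \<Longrightarrow> cc j \<in> Kx i \<Longrightarrow> GX i (cc j)) \<Longrightarrow> GY j l"
    and r3: "\<And>i j. i \<in> I \<Longrightarrow> j \<in> I \<Longrightarrow> i \<noteq> j \<Longrightarrow> p j \<le> p i \<Longrightarrow> q j \<le> q i \<Longrightarrow> bb j \<in> Kx i \<Longrightarrow>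
        (cc i \<in> Ly j \<Longrightarrow> GY j (cc i)) \<Longrightarrow> GX i (bb j)"
    and r4: "\<And>i j. i \<in> I \<Longrightarrow> j \<in> I \<Longrightarrow> i \<noteq> j \<Longrightarrow> p j \<le> p i \<Longrightarrow> q j \<le> q i \<Longrightarrow> cc i \<in> Ly j \<Longrightarrow>
        (bb j \<in> Kx i \<Longrightarrow> GX i (bb j)) \<Longrightarrow> GY j (cc i)"
begin

text \<open>The index \<open>cc j\<close> is the base row of a piece \<open>i'\<close> outside \<open>i\<close> with the same upper block.  Mixing \<open>i\<close>
  with \<open>i'\<close> trades \<open>x\<close> at this row for \<open>y\<close> at the column \<open>cc i\<close>, and an obstruction there is a
  piece that is linked to \<open>i'\<close> at the block \<open>p i\<close>, which lies below \<open>q i\<close>.\<close>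

lemma link_left:
  "i \<in> I \<Longrightarrow> j \<in> I \<Longrightarrow> q i = B \<Longrightarrow> p j = B \<Longrightarrow> rR j < rL i \<Longrightarrow> GX i (cc j)"
proof (induction B arbitrary: i j rule: less_induct)
  case (less B)
  obtain i' where i': "i' \<in> I" "q i' = q i" "rL i' = rR j" using rL_ex less.prems by blast
  have eq: "bb i' = cc j" using bb_cc[OF i'(1) less.prems(2)] i' less.prems by simp
  have ne: "i \<noteq> i'" using i' less.prems by auto
  have "key i' < key i"
  proof (rule ccontr)
    assume "\<not> key i' < key i"
    then have "rL i \<le> rL i'" using rL_mono[of i i'] i'(2) by simp
    then show False using i'(3) less.prems(5) by simp
  qed
  have p': "p i' \<le> p i"
    using laminar[OF i'(1) less.prems(1) ne[symmetric]] i'(2) pq[OF less.prems(1)] pq[OF i'(1)]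
      \<open>key i' < key i\<close> by simp
  have inK: "bb i' \<in> Kx i" using bb[OF i'(1)] i' pq[OF less.prems(1)] by (auto simp: Kx_def)
  have "GX i (bb i')"
  proof (rule r3[OF less.prems(1) i'(1) ne p' _ inK])
    assume "cc i \<in> Ly i'"
    show "GY i' (cc i)"
    proof (rule r2[OF i'(1) \<open>cc i \<in> Ly i'\<close>])
      show "cc i \<noteq> cc i'" using cc_inj less.prems(1) i'(1) ne by blast
      fix k assume k: "k \<in> I" "bb k = cc i" "cc i' \<in> Kx k"
      have qk: "q k = p i" "rL k = rR i" using bb_cc[OF k(1) less.prems(1)] k(2) by auto
      have pk: "p k < p i'" using k(3) cc[OF i'(1)] by (auto simp: Kx_def)
      have "p i' = p i"
      proof (rule ccontr)
        assume "p i' \<noteq> p i"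
        then have "p i' < p i" using p' by simp
        then show False using laminar_disj[of k i'] k(1) i' pk qk pq[OF less.prems(1)] by auto
      qed
      moreover have "rR i' < rR i" using rR_less[OF i'(1) less.prems(1)] \<open>p i' = p i\<close> \<open>key i' < key i\<close> by blast
      ultimately show "GX k (cc i')"
        using less.IH[of "p i" k i'] k(1) i'(1) qk pq[OF less.prems(1)] less.prems(3) by simp
    qed
  qed (use i' in simp)
  then show ?case by (simp add: eq)
qed

text \<open>The mirror image of \<open>link_left\<close>, with the recursion going to the block \<open>q j\<close> above \<open>p j\<close>.\<close>

lemma link_right:
  assumes "i \<in> I" "j \<in> I" "q i = p j" "rL i < rR j"
  shows "GY j (bb i)"
proof -
  (* any bound on the blocks would do; it makes the upward recursion well-founded *)
  define Q where "Q = (\<Sum>i\<in>I. q i)"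
  have qQ: "q i \<le> Q" if "i \<in> I" for i unfolding Q_def using finI that by (simp add: member_le_sum)
  have "GY j (bb i)" if "i \<in> I" "j \<in> I" "q i = p j" "rL i < rR j" "Q - q i = N" for i j N
    using that
  proof (induction N arbitrary: i j rule: less_induct)
    case (less N)
    obtain j' where j': "j' \<in> I" "p j' = p j" "rR j' = rL i" using rR_ex less.prems by metis
    have eq: "cc j' = bb i" using bb_cc[OF less.prems(1) j'(1)] j' less.prems by simp
    have ne: "j' \<noteq> j" using j' less.prems by auto
    have "key j' < key j"
    proof (rule ccontr)
      assume "\<not> key j' < key j"
      then have "rR j \<le> rR j'" using rR_mono[of j j'] j'(2) by simp
      then show False using j'(3) less.prems(4) by simp
    qed
    have q': "q j \<le> q j'"
      using laminar[OF j'(1) less.prems(2) ne] j'(2) pq[OF less.prems(2)] pq[OF j'(1)]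
        \<open>key j' < key j\<close> by simp
    have inL: "cc j' \<in> Ly j" using cc[OF j'(1)] j' pq[OF less.prems(2)] by (auto simp: Ly_def)
    have "GY j (cc j')"
    proof (rule r4[OF j'(1) less.prems(2) ne _ q' inL])
      assume "bb j \<in> Kx j'"
      show "GX j' (bb j)"
      proof (rule r1[OF j'(1) \<open>bb j \<in> Kx j'\<close>])
        show "bb j \<noteq> bb j'" using bb_inj less.prems(2) j'(1) ne by blast
        fix k assume k: "k \<in> I" "cc k = bb j" "bb j' \<in> Ly k"
        have qk: "q j = p k" "rL j = rR k" using bb_cc[OF less.prems(2) k(1)] k(2) by auto
        have pk: "q j' < q k" using k(3) bb[OF j'(1)] by (auto simp: Ly_def)
        have "q j' = q j"
        proof (rule ccontr)
          assume "q j' \<noteq> q j"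
          then have "q j < q j'" using q' by simp
          then show False using laminar_disj[of k j'] k(1) j' pk qk pq[OF less.prems(2)] by auto
        qed
        moreover have "rL j' < rL j" using rL_less[OF j'(1) less.prems(2)] \<open>q j' = q j\<close> \<open>key j' < key j\<close> by blast
        moreover have "Q - q j' < N"
          using less.prems pq[of j'] qQ[of j'] j' by linarith
        ultimately show "GY k (bb j')"
          using less.IH[of "Q - q j'" j' k] k(1) j'(1) qk by simp
      qed
    qed (use j' in simp)
    then show ?case by (simp add: eq)
  qed
  then show ?thesis using assms by blast
qed

lemma linked_GX:
  assumes "i \<in> I" "k \<in> Kx i" "k \<noteq> bb i"
  shows "GX i k"
proof (cases "\<exists>j\<in>I. cc j = k \<and> bb i \<in> Ly j")
  case True
  then obtain j where j: "j \<in> I" "cc j = k" "bb i \<in> Ly j" by blast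
  have bl: "p i < p j" "p j \<le> q i" "q i < q j"
    using j assms(2) cc[OF j(1)] bb[OF assms(1)] by (auto simp: Kx_def Ly_def)
  have eq: "p j = q i"
    using laminar_disj[of i j] assms(1) j(1) bl by (cases "i = j"; cases "p j < q i") auto
  have "rL i \<noteq> rR j" using bb_cc[OF assms(1) j(1)] eq j(2) assms(3) by auto
  then consider "rR j < rL i" | "rL i < rR j" by linarith
  then show ?thesis
  proof cases
    case 1
    then show ?thesis using link_left[OF assms(1) j(1)] eq j(2) by blast
  next
    case 2
    show ?thesis
    proof (rule r1[OF assms])
      fix j' assume "j' \<in> I" "cc j' = k"
      then have "j' = j" using cc_inj j by blast
      then show "GY j' (bb i)" using link_right[OF assms(1) j(1)] eq 2 by simp
    qed
  qed
next
  case False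
  then show ?thesis using r1[OF assms] by blast
qed

lemma linked_GY:
  assumes "j \<in> I" "l \<in> Ly j" "l \<noteq> cc j"
  shows "GY j l"
proof (cases "\<exists>i\<in>I. bb i = l \<and> cc j \<in> Kx i")
  case True
  then obtain i where i: "i \<in> I" "bb i = l" "cc j \<in> Kx i" by blast
  have bl: "p i < p j" "p j \<le> q i" "q i < q j"
    using i assms(2) cc[OF assms(1)] bb[OF i(1)] by (auto simp: Kx_def Ly_def)
  have eq: "p j = q i"
    using laminar_disj[of i j] assms(1) i(1) bl by (cases "i = j"; cases "p j < q i") auto
  have "rL i \<noteq> rR j" using bb_cc[OF i(1) assms(1)] eq i(2) assms(3) by auto
  then consider "rR j < rL i" | "rL i < rR j" by linarith
  then show ?thesis
  proof cases
    case 2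
    then show ?thesis using link_right[OF i(1) assms(1)] eq i(2) by simp
  next
    case 1
    show ?thesis
    proof (rule r2[OF assms])
      fix i' assume "i' \<in> I" "bb i' = l"
      then have "i' = i" using bb_inj i by blast
      then show "GX i' (cc j)" using link_left[OF i(1) assms(1)] eq 1 by simp
    qed
  qed
next
  case False
  then show ?thesis using r2[OF assms] by blast
qed

end

end

section \<open>The generic element of a family of pieces\<close>

lemma derivation_sum_arg: "derivation f \<Longrightarrow> f (sum g A) = (\<Sum>a\<in>A. f (g a))"
  by (induction A rule: infinite_finite_induct) (auto simp: derivation_def derivation_zero)

context pieces
begin

text \<open>The parameters are \<open>x_ik\<close>, encoded as \<open>(True, i, k)\<close>, and \<open>y_jl\<close>, encoded as \<open>(False, j, l)\<close>.\<close>

definition base :: "bool \<times> 'i \<times> nat \<Rightarrow> bool" where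
  "base = (\<lambda>(b, i, k). k = (if b then bb i else cc i))"

definition nonbase_degree :: "(bool \<times> 'i \<times> nat \<Rightarrow>\<^sub>0 nat) \<Rightarrow> nat" where
  "nonbase_degree \<mu> = (\<Sum>z\<in>keys \<mu>. if base z then 0 else lookup \<mu> z)"

lemma nonbase_degree_add: "nonbase_degree (\<mu> + \<nu>) = nonbase_degree \<mu> + nonbase_degree \<nu>"
proof -
  let ?K = "keys \<mu> \<union> keys \<nu>"
  have *: "nonbase_degree r = (\<Sum>z\<in>?K. if base z then 0 else lookup r z)"
    if "keys r \<subseteq> ?K" for r
    unfolding nonbase_degree_def
    by (rule sum.mono_neutral_left) (use that in \<open>auto simp: in_keys_iff\<close>)
  have "nonbase_degree (\<mu> + \<nu>) = (\<Sum>z\<in>?K. (if base z then 0 else lookup \<mu> z)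
      + (if base z then 0 else lookup \<nu> z))"
    unfolding *[OF Poly_Mapping.keys_add] by (rule sum.cong) (auto simp: lookup_add)
  then show ?thesis using *[of \<mu>] *[of \<nu>] by (simp add: sum.distrib)
qed

lemma nonbase_degree_single: "nonbase_degree (single z 1) = (if base z then 0 else 1)"
  by (simp add: nonbase_degree_def)

definition triples :: "('i \<times> nat \<times> nat) set" where
  "triples = {(i, k, l). i \<in> I \<and> k \<in> Kx i \<and> l \<in> Ly i \<and> (k, l) \<in> PD n D}"

text \<open>The monomial \<open>x_ik y_jl\<close>.\<close>

definition pairmon :: "'i \<Rightarrow> nat \<Rightarrow> 'i \<Rightarrow> nat \<Rightarrow> (bool \<times> 'i \<times> nat) \<Rightarrow>\<^sub>0 nat" where
  "pairmon i k j l = single (True, i, k) 1 + single (False, j, l) 1"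

text \<open>This is \<open>W = \<Sum> x_ik y_il f_kl\<close>, a sum of one generic matrix of rank one for every piece, truncated
  to the radical.\<close>

definition generic :: "(bool \<times> 'i \<times> nat, pol) poly_over" where
  "generic = (\<Sum>(i, k, l)\<in>triples. single (pairmon i k i l) (fvar (k, l)))"

lemma finite_triples: "finite triples"
  by (rule finite_subset[of _ "I \<times> {..n} \<times> {..n}"])
    (use finI in \<open>auto simp: triples_def Kx_def Ly_def\<close>)

lemma move_pairmon_row: "move (True, j, l) (True, i, k) (single (pairmon i' k' i' l') c) =
    (if i' = i \<and> k' = k then single (pairmon j l i' l') c else 0)"
proof (cases "i' = i \<and> k' = k")
  case True
  then have "pairmon i' k' i' l' - single (True, i, k) 1 = single (False, i', l') 1"
    by (simp add: pairmon_def)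
  then show ?thesis using True
    by (simp add: move_single pairmon_def lookup_add lookup_single add.commute)
next
  case False
  then have "lookup (pairmon i' k' i' l') (True, i, k) = 0"
    by (auto simp: pairmon_def lookup_add lookup_single when_def)
  then show ?thesis unfolding move_single using False by auto
qed

lemma move_pairmon_col: "move (False, i, k) (False, j, l) (single (pairmon i' k' i' l') c) =
    (if i' = j \<and> l' = l then single (pairmon i' k' i k) c else 0)"
proof (cases "i' = j \<and> l' = l")
  case True
  then have "pairmon i' k' i' l' - single (False, j, l) 1 = single (True, i', k') 1"
    by (simp add: pairmon_def)
  then show ?thesis using True
    by (simp add: move_single pairmon_def lookup_add lookup_single add.commute)
next
  case False
  then have "lookup (pairmon i' k' i' l') (False, j, l) = 0"
    by (auto simp: pairmon_def lookup_add lookup_single when_def)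
  then show ?thesis unfolding move_single using False by auto
qed

text \<open>The matrix unit \<open>E_{k,l}\<close> of the parabolic subalgebra changes the vectors \<open>x_i\<close> and \<open>y_j\<close>; its effect
  on \<open>generic\<close> is therefore the effect of a vector field on the space of parameters
  (\<open>field_generic\<close>).\<close>

definition field :: "nat \<Rightarrow> nat \<Rightarrow> (bool \<times> 'i \<times> nat, pol) poly_over \<Rightarrow> (bool \<times> 'i \<times> nat, pol) poly_over" where
  "field k l P = (\<Sum>i\<in>{i\<in>I. k \<in> Kx i \<and> l \<in> Kx i}. move (True, i, l) (True, i, k) P)
     - (\<Sum>j\<in>{j\<in>I. k \<in> Ly j \<and> l \<in> Ly j}. move (False, j, k) (False, j, l) P)"

text \<open>The vector field of the substitution \<open>x_i \<mapsto> x_i + t x_j\<close>, \<open>y_j \<mapsto> y_j - t y_i\<close>, which does not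
  change \<open>x_i y_i\<^sup>T + x_j y_j\<^sup>T\<close>.\<close>

definition mixing :: "'i \<Rightarrow> 'i \<Rightarrow> (bool \<times> 'i \<times> nat, pol) poly_over \<Rightarrow> (bool \<times> 'i \<times> nat, pol) poly_over" where
  "mixing i j P = (\<Sum>k\<in>Kx i \<inter> Kx j. move (True, j, k) (True, i, k) P)
     - (\<Sum>l\<in>Ly i \<inter> Ly j. move (False, i, l) (False, j, l) P)"

lemma derivation_field: "derivation (field k l)"
  unfolding field_def[abs_def] by (intro derivation_diff derivation_sum derivation_move)

lemma derivation_mixing: "derivation (mixing i j)"
  unfolding mixing_def[abs_def] by (intro derivation_diff derivation_sum derivation_move)

lemma finite_Kx: "finite (Kx i)" and finite_Ly: "finite (Ly i)"
  by (rule finite_subset[of _ "{..n}"]; auto simp: Kx_def Ly_def)+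

lemma move_generic_row: "move (True, j, l) (True, i, k) generic =
    (\<Sum>z\<in>{z\<in>triples. fst z = i \<and> fst (snd z) = k}. single (pairmon j l i (snd (snd z))) (fvar (snd z)))"
  unfolding generic_def derivation_sum_arg[OF derivation_move]
  using finite_triples by (subst sum.inter_filter) (auto simp: move_pairmon_row intro!: sum.cong)

lemma move_generic_col: "move (False, i, k) (False, j, l) generic =
    (\<Sum>z\<in>{z\<in>triples. fst z = j \<and> snd (snd z) = l}. single (pairmon j (fst (snd z)) i k) (fvar (snd z)))"
  unfolding generic_def derivation_sum_arg[OF derivation_move]
  using finite_triples by (subst sum.inter_filter) (auto simp: move_pairmon_col intro!: sum.cong)

lemma in_PD: "(k, l) \<in> PD n D \<longleftrightarrow> 1 \<le> l \<and> k \<le> n \<and> blk D l < blk D k"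
  by (rule PD_iff[OF D])

lemma sum_group_row:
  assumes "finite K"
  shows "(\<Sum>i\<in>K. \<Sum>z\<in>{z\<in>triples. f z = i \<and> P i z}. h z) = (\<Sum>z\<in>{z\<in>triples. f z \<in> K \<and> P (f z) z}. h z)"
proof -
  have "(\<Sum>z\<in>{z\<in>triples. f z \<in> K \<and> P (f z) z}. h z) = (\<Sum>z\<in>(\<Union>i\<in>K. {z\<in>triples. f z = i \<and> P i z}). h z)"
    by (rule sum.cong) auto
  also have "\<dots> = (\<Sum>i\<in>K. \<Sum>z\<in>{z\<in>triples. f z = i \<and> P i z}. h z)"
    using assms finite_triples by (subst sum.UNION_disjoint) auto
  finally show ?thesis by simp
qed

lemma field_generic:
  assumes kl: "k \<noteq> l" "blk D k \<le> blk D l" "1 \<le> k" "k \<le> n" "1 \<le> l" "l \<le> n"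
  shows "coeffwise (deriv n D (Emat n k l)) generic = field k l generic"
proof -
  let ?R = "\<lambda>z. single (pairmon (fst z) l (fst z) (snd (snd z))) (fvar (k, snd (snd z)))"
  let ?C = "\<lambda>z. single (pairmon (fst z) (fst (snd z)) (fst z) k) (fvar (fst (snd z), l))"
  have "coeffwise (deriv n D (Emat n k l)) generic = (\<Sum>z\<in>triples.
     (if fst (snd z) = l \<and> (k, snd (snd z)) \<in> PD n D then ?R z else 0)
     - (if snd (snd z) = k \<and> (fst (snd z), l) \<in> PD n D then ?C z else 0))"
    unfolding generic_def derivation_sum_arg[OF derivation_coeffwise[OF derivation_deriv]]
  proof (rule sum.cong[OF refl], clarify)
    fix i k' l' assume "(i, k', l') \<in> triples"
    then have "(k', l') \<in> PD n D" by (simp add: triples_def)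
    from deriv_fvar_Emat[OF D kl this]
    show "coeffwise (deriv n D (Emat n k l)) (single (pairmon i k' i l') (fvar (k', l'))) =
       (if fst (snd (i, k', l')) = l \<and> (k, snd (snd (i, k', l'))) \<in> PD n D then ?R (i, k', l') else 0)
     - (if snd (snd (i, k', l')) = k \<and> (fst (snd (i, k', l')), l) \<in> PD n D then ?C (i, k', l') else 0)"
      by (simp add: coeffwise_single[OF derivation_deriv] single_diff)
  qed
  also have "\<dots> = (\<Sum>z\<in>{z\<in>triples. fst (snd z) = l \<and> (k, snd (snd z)) \<in> PD n D}. ?R z)
     - (\<Sum>z\<in>{z\<in>triples. snd (snd z) = k \<and> (fst (snd z), l) \<in> PD n D}. ?C z)"
    using finite_triples by (simp add: sum_subtractf sum.inter_filter)
  also have "(\<Sum>z\<in>{z\<in>triples. fst (snd z) = l \<and> (k, snd (snd z)) \<in> PD n D}. ?R z)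
     = (\<Sum>z\<in>{z\<in>triples. fst z \<in> {i\<in>I. k \<in> Kx i \<and> l \<in> Kx i} \<and> fst (snd z) = k}.
          single (pairmon (fst z) l (fst z) (snd (snd z))) (fvar (snd z)))"
    by (rule sum.reindex_bij_witness[where i = "\<lambda>z. (fst z, l, snd (snd z))" and j = "\<lambda>z. (fst z, k, snd (snd z))"])
      (use kl in \<open>auto simp: triples_def in_PD Kx_def Ly_def\<close>)
  also have "\<dots> = (\<Sum>i\<in>{i\<in>I. k \<in> Kx i \<and> l \<in> Kx i}. move (True, i, l) (True, i, k) generic)"
    unfolding move_generic_row
    by (subst sum_group_row[where f = fst and P = "\<lambda>i z. fst (snd z) = k", symmetric])
      (use finI in \<open>auto intro!: sum.cong\<close>)
  also have "(\<Sum>z\<in>{z\<in>triples. snd (snd z) = k \<and> (fst (snd z), l) \<in> PD n D}. ?C z)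
     = (\<Sum>z\<in>{z\<in>triples. fst z \<in> {i\<in>I. k \<in> Ly i \<and> l \<in> Ly i} \<and> snd (snd z) = l}.
          single (pairmon (fst z) (fst (snd z)) (fst z) k) (fvar (snd z)))"
    by (rule sum.reindex_bij_witness[where i = "\<lambda>z. (fst z, fst (snd z), k)" and j = "\<lambda>z. (fst z, fst (snd z), l)"])
      (use kl in \<open>auto simp: triples_def in_PD Kx_def Ly_def\<close>)
  also have "\<dots> = (\<Sum>i\<in>{i\<in>I. k \<in> Ly i \<and> l \<in> Ly i}. move (False, i, k) (False, i, l) generic)"
    unfolding move_generic_col
    by (subst sum_group_row[where f = fst and P = "\<lambda>i z. snd (snd z) = l", symmetric])
      (use finI in \<open>auto intro!: sum.cong\<close>)
  finally show ?thesis by (simp add: field_def)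
qed

text \<open>The inequalities on the ends guarantee that the truncations of the two pieces are
  compatible with the substitution.\<close>

lemma mixing_generic:
  assumes ij: "i \<in> I" "j \<in> I" "p j \<le> p i" "q j \<le> q i"
  shows "mixing i j generic = 0"
proof -
  have "(\<Sum>k\<in>Kx i \<inter> Kx j. move (True, j, k) (True, i, k) generic)
     = (\<Sum>z\<in>{z\<in>triples. fst (snd z) \<in> Kx i \<inter> Kx j \<and> fst z = i}.
          single (pairmon j (fst (snd z)) i (snd (snd z))) (fvar (snd z)))"
    unfolding move_generic_row
    by (subst sum_group_row[where f = "\<lambda>z. fst (snd z)" and P = "\<lambda>k z. fst z = i", symmetric])
      (use finite_Kx in \<open>auto intro!: sum.cong\<close>)
  also have "\<dots> = (\<Sum>z\<in>{z\<in>triples. snd (snd z) \<in> Ly i \<inter> Ly j \<and> fst z = j}.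
          single (pairmon j (fst (snd z)) i (snd (snd z))) (fvar (snd z)))"
    by (rule sum.reindex_bij_witness[where i = "\<lambda>z. (i, snd z)" and j = "\<lambda>z. (j, snd z)"])
      (use ij in \<open>auto simp: triples_def in_PD Kx_def Ly_def\<close>)
  also have "\<dots> = (\<Sum>l\<in>Ly i \<inter> Ly j. move (False, i, l) (False, j, l) generic)"
    unfolding move_generic_col
    by (subst sum_group_row[where f = "\<lambda>z. snd (snd z)" and P = "\<lambda>k z. fst z = j", symmetric])
      (use finite_Ly in \<open>auto intro!: sum.cong\<close>)
  finally show ?thesis by (simp add: mixing_def)
qed

lemma field_power:
  assumes "k \<noteq> l" "blk D k \<le> blk D l" "1 \<le> k" "k \<le> n" "1 \<le> l" "l \<le> n"
  shows "coeffwise (deriv n D (Emat n k l)) (generic ^ A) = field k l (generic ^ A)"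
  by (rule derivation_power_eq[OF derivation_coeffwise[OF derivation_deriv] derivation_field field_generic[OF assms]])

lemma mixing_power:
  assumes "i \<in> I" "j \<in> I" "p j \<le> p i" "q j \<le> q i"
  shows "mixing i j (generic ^ A) = 0"
proof -
  have "derivation (\<lambda>_. 0 :: (bool \<times> 'i \<times> nat, pol) poly_over)" by (simp add: derivation_def)
  from derivation_power_eq[OF derivation_mixing this] show ?thesis using mixing_generic[OF assms] by simp
qed

lemma lookup_generic_power:
  "lookup (generic ^ A) \<mu> =
     (\<Sum>ws\<in>{ws\<in>words_over triples A. sum_list (map (\<lambda>(i, k, l). pairmon i k i l) ws) = \<mu>}.
        prod_list (map (\<lambda>(i, k, l). fvar (k, l)) ws))"
proof -
  have "generic = (\<Sum>z\<in>triples. single (case z of (i, k, l) \<Rightarrow> pairmon i k i l) (case z of (i, k, l) \<Rightarrow> fvar (k, l)))"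
    unfolding generic_def by (rule sum.cong) auto
  then show ?thesis by (simp only: lookup_power_words[OF finite_triples])
qed

lemma lookup_sum_list_pos:
  "lookup (sum_list (xs :: ('z \<Rightarrow>\<^sub>0 nat) list)) z > 0 \<longleftrightarrow> (\<exists>x\<in>set xs. lookup x z > 0)"
  by (induction xs) (auto simp: lookup_add)

lemma lookup_pairmon: "lookup (pairmon i k j l) (b, i', k') =
   (if b then (if i' = i \<and> k' = k then 1 else 0) else (if i' = j \<and> k' = l then 1 else 0))"
  by (auto simp: pairmon_def lookup_add lookup_single when_def)

end

context pieces
begin

text \<open>
  One step of the induction on the degree in the parameters off the base.  A parameter is good if
  all coefficients of degree \<open>N + 1\<close> in which it occurs lie in \<open>J\<close>.  A relation between
  coefficients of degree \<open>N\<close> involves, through operators \<open>z_a \<partial>/\<partial>z_b\<close>, coefficients of degree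
  \<open>N + 1\<close> only for \<open>a\<close> on and \<open>b\<close> off the base.  If all these terms but one are known to lie in \<open>J\<close>,
  so does the remaining one, and its parameter \<open>b\<close> is good.\<close>

context
  fixes J :: "pol set" and A N :: nat
  assumes J: "stable_ideal n D J"
    and IH: "\<And>\<mu>. nonbase_degree \<mu> \<le> N \<Longrightarrow> lookup (generic ^ A) \<mu> \<in> J"
begin

definition Good :: "bool \<times> 'i \<times> nat \<Rightarrow> bool" where
  "Good z \<longleftrightarrow> (\<forall>\<mu>. nonbase_degree \<mu> = Suc N \<longrightarrow> lookup \<mu> z > 0 \<longrightarrow> lookup (generic ^ A) \<mu> \<in> J)"

lemma minus_plus_single: "lookup \<mu> a > 0 \<Longrightarrow> \<mu> - single a 1 + single a 1 = (\<mu> :: 'z \<Rightarrow>\<^sub>0 nat)"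
  by (rule poly_mapping_eqI) (auto simp: lookup_add lookup_minus lookup_single when_def)

lemma move_in_J:
  assumes \<mu>: "nonbase_degree \<mu> = N" and ab: "base a \<Longrightarrow> \<not> base b \<Longrightarrow> Good b"
  shows "lookup (move a b (generic ^ A)) \<mu> \<in> J"
proof (cases "lookup \<mu> a = 0")
  case True
  then show ?thesis by (simp add: lookup_move_0 stable_idealD(2)[OF J])
next
  case False
  define \<mu>0 where "\<mu>0 = \<mu> - single a 1"
  have \<mu>0: "\<mu> = \<mu>0 + single a 1" using False by (simp only: \<mu>0_def minus_plus_single neq0_conv)
  let ?\<nu> = "\<mu>0 + single b 1"
  have nb: "nonbase_degree \<mu>0 + (if base a then 0 else 1) = N"
    using \<mu> unfolding \<mu>0 nonbase_degree_add nonbase_degree_single .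
  have nb': "nonbase_degree ?\<nu> = nonbase_degree \<mu>0 + (if base b then 0 else 1)"
    unfolding nonbase_degree_add nonbase_degree_single ..
  have "lookup (generic ^ A) ?\<nu> \<in> J"
  proof (cases "nonbase_degree ?\<nu> \<le> N")
    case True
    then show ?thesis by (rule IH)
  next
    case False
    then have "base a" "\<not> base b" "nonbase_degree ?\<nu> = Suc N" using nb nb' by (auto split: if_splits)
    moreover have "lookup ?\<nu> b > 0" by (simp add: lookup_add)
    ultimately show ?thesis using ab unfolding Good_def by blast
  qed
  then have "of_nat (lookup \<mu>0 b + 1) * lookup (generic ^ A) ?\<nu> \<in> J"
    by (subst stable_ideal_of_nat[OF J]) simp
  then show ?thesis by (subst \<mu>0, subst lookup_move)
qed

lemma Good_from_move:
  assumes ab: "base a" "\<not> base b" and in_J: "\<And>\<mu>. nonbase_degree \<mu> = N \<Longrightarrow> lookup (move a b (generic ^ A)) \<mu> \<in> J"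
  shows "Good b"
  unfolding Good_def
proof (intro allI impI)
  fix \<mu> assume \<mu>: "nonbase_degree \<mu> = Suc N" "lookup \<mu> b > 0"
  define \<mu>0 where "\<mu>0 = \<mu> - single b 1"
  have \<mu>0: "\<mu> = \<mu>0 + single b 1" using \<mu>(2) by (simp only: \<mu>0_def minus_plus_single)
  have "nonbase_degree \<mu>0 + (if base b then 0 else 1) = Suc N"
    using \<mu>(1) unfolding \<mu>0 nonbase_degree_add nonbase_degree_single .
  then have "nonbase_degree (\<mu>0 + single a 1) = N"
    using ab unfolding nonbase_degree_add nonbase_degree_single by simp
  from in_J[OF this] have "of_nat (lookup \<mu>0 b + 1) * lookup (generic ^ A) \<mu> \<in> J"
    unfolding lookup_move \<mu>0[symmetric] .
  then show "lookup (generic ^ A) \<mu> \<in> J"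
    by (subst (asm) stable_ideal_of_nat[OF J]) simp
qed

lemma sum_isolate:
  assumes "finite K" "i \<in> K" "(\<Sum>k\<in>K. f k) \<in> J" "\<And>k. k \<in> K \<Longrightarrow> k \<noteq> i \<Longrightarrow> f k \<in> J"
  shows "f i \<in> J"
proof -
  have "f i = (\<Sum>k\<in>K. f k) - (\<Sum>k\<in>K - {i}. f k)" using assms(1,2) by (simp add: sum.remove)
  then show ?thesis using stable_ideal_diff[OF J assms(3)] stable_ideal_sum[OF J, of "K - {i}" f] assms(4) by auto
qed

lemma field_in_J:
  assumes "k \<noteq> l" "blk D k \<le> blk D l" "1 \<le> k" "k \<le> n" "1 \<le> l" "l \<le> n" "nonbase_degree \<mu> = N"
  shows "(\<Sum>i\<in>{i\<in>I. k \<in> Kx i \<and> l \<in> Kx i}. lookup (move (True, i, l) (True, i, k) (generic ^ A)) \<mu>)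
     - (\<Sum>j\<in>{j\<in>I. k \<in> Ly j \<and> l \<in> Ly j}. lookup (move (False, j, k) (False, j, l) (generic ^ A)) \<mu>) \<in> J"
proof -
  have "deriv n D (Emat n k l) (lookup (generic ^ A) \<mu>) \<in> J"
    using IH[of \<mu>] assms Emat_parabolic[OF D] stable_idealD(5)[OF J] by simp
  also have "deriv n D (Emat n k l) (lookup (generic ^ A) \<mu>) = lookup (field k l (generic ^ A)) \<mu>"
    using field_power[OF assms(1-6), of A] lookup_coeffwise[OF derivation_deriv] by metis
  finally show ?thesis by (simp add: field_def lookup_sum lookup_minus)
qed

lemma base_simps: "base (True, i, k) \<longleftrightarrow> k = bb i" "base (False, i, k) \<longleftrightarrow> k = cc i"
  by (auto simp: base_def)

text \<open>The matrix unit \<open>E_{k,bb i}\<close> has the effect \<open>\<Sum> x_{i',bb i} \<partial>/\<partial>x_{i',k} - \<Sum> y_{j,k} \<partial>/\<partial>y_{j,bb i}\<close>.  Since \<open>bb i\<close>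
  is the base row of no other piece, only one term of the first sum leads to coefficients of degree
  \<open>N + 1\<close>; a term of the second sum does so only if \<open>k\<close> is the base column of \<open>j\<close>.\<close>

lemma Good_X:
  assumes i: "i \<in> I" "k \<in> Kx i" "k \<noteq> bb i"
    and Y: "\<And>j. j \<in> I \<Longrightarrow> cc j = k \<Longrightarrow> bb i \<in> Ly j \<Longrightarrow> Good (False, j, bb i)"
  shows "Good (True, i, k)"
proof (rule Good_from_move[of "(True, i, bb i)"])
  fix \<mu> assume \<mu>: "nonbase_degree \<mu> = N"
  have kl: "k \<noteq> bb i" "blk D k \<le> blk D (bb i)" "1 \<le> k" "k \<le> n" "1 \<le> bb i" "bb i \<le> n"
    using i bb[OF i(1)] by (auto simp: Kx_def)
  let ?f = "\<lambda>i'. lookup (move (True, i', bb i) (True, i', k) (generic ^ A)) \<mu>"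
  let ?g = "\<lambda>j. lookup (move (False, j, k) (False, j, bb i) (generic ^ A)) \<mu>"
  let ?K = "{i'\<in>I. k \<in> Kx i' \<and> bb i \<in> Kx i'}" and ?L = "{j\<in>I. k \<in> Ly j \<and> bb i \<in> Ly j}"
  have "(\<Sum>j\<in>?L. ?g j) \<in> J"
    by (rule stable_ideal_sum[OF J], rule move_in_J[OF \<mu>]) (use Y in \<open>auto simp: base_simps\<close>)
  from stable_idealD(3)[OF J field_in_J[OF kl \<mu>] this] have S: "(\<Sum>i'\<in>?K. ?f i') \<in> J" by simp
  show "?f i \<in> J"
  proof (rule sum_isolate[OF _ _ S])
    show "finite ?K" using finI by simp
    show "i \<in> ?K" using i bb_Kx by simp
    fix i' assume "i' \<in> ?K" "i' \<noteq> i"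
    then show "?f i' \<in> J" by (intro move_in_J[OF \<mu>]) (use i(1) bb_inj in \<open>auto simp: base_simps\<close>)
  qed
qed (use i in \<open>auto simp: base_simps\<close>)

lemma Good_Y:
  assumes j: "j \<in> I" "l \<in> Ly j" "l \<noteq> cc j"
    and X: "\<And>i. i \<in> I \<Longrightarrow> bb i = l \<Longrightarrow> cc j \<in> Kx i \<Longrightarrow> Good (True, i, cc j)"
  shows "Good (False, j, l)"
proof (rule Good_from_move[of "(False, j, cc j)"])
  fix \<mu> assume \<mu>: "nonbase_degree \<mu> = N"
  have kl: "cc j \<noteq> l" "blk D (cc j) \<le> blk D l" "1 \<le> cc j" "cc j \<le> n" "1 \<le> l" "l \<le> n"
    using j cc[OF j(1)] by (auto simp: Ly_def)
  let ?f = "\<lambda>i. lookup (move (True, i, l) (True, i, cc j) (generic ^ A)) \<mu>"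
  let ?g = "\<lambda>j'. lookup (move (False, j', cc j) (False, j', l) (generic ^ A)) \<mu>"
  let ?K = "{i\<in>I. cc j \<in> Kx i \<and> l \<in> Kx i}" and ?L = "{j'\<in>I. cc j \<in> Ly j' \<and> l \<in> Ly j'}"
  have "(\<Sum>i\<in>?K. ?f i) \<in> J"
    by (rule stable_ideal_sum[OF J], rule move_in_J[OF \<mu>]) (use X in \<open>auto simp: base_simps\<close>)
  from stable_ideal_diff[OF J this field_in_J[OF kl \<mu>]] have S: "(\<Sum>j'\<in>?L. ?g j') \<in> J" by simp
  show "?g j \<in> J"
  proof (rule sum_isolate[OF _ _ S])
    show "finite ?L" using finI by simp
    show "j \<in> ?L" using j cc_Ly by simp
    fix j' assume "j' \<in> ?L" "j' \<noteq> j"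
    then show "?g j' \<in> J" by (intro move_in_J[OF \<mu>]) (use j(1) cc_inj in \<open>auto simp: base_simps\<close>)
  qed
qed (use j in \<open>auto simp: base_simps\<close>)

lemma mixing_0:
  assumes "i \<in> I" "j \<in> I" "p j \<le> p i" "q j \<le> q i"
  shows "(\<Sum>k\<in>Kx i \<inter> Kx j. lookup (move (True, j, k) (True, i, k) (generic ^ A)) \<mu>)
     = (\<Sum>l\<in>Ly i \<inter> Ly j. lookup (move (False, i, l) (False, j, l) (generic ^ A)) \<mu>)"
proof -
  have "lookup (mixing i j (generic ^ A)) \<mu> = 0" using mixing_power[OF assms] by simp
  then show ?thesis by (simp add: mixing_def lookup_sum lookup_minus)
qed

lemma Good_mix_X:
  assumes ij: "i \<in> I" "j \<in> I" "i \<noteq> j" "p j \<le> p i" "q j \<le> q i" "bb j \<in> Kx i"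
    and Y: "cc i \<in> Ly j \<Longrightarrow> Good (False, j, cc i)"
  shows "Good (True, i, bb j)"
proof (rule Good_from_move[of "(True, j, bb j)"])
  fix \<mu> assume \<mu>: "nonbase_degree \<mu> = N"
  have "(\<Sum>l\<in>Ly i \<inter> Ly j. lookup (move (False, i, l) (False, j, l) (generic ^ A)) \<mu>) \<in> J"
    by (rule stable_ideal_sum[OF J], rule move_in_J[OF \<mu>]) (use Y in \<open>auto simp: base_simps\<close>)
  then have S: "(\<Sum>k\<in>Kx i \<inter> Kx j. lookup (move (True, j, k) (True, i, k) (generic ^ A)) \<mu>) \<in> J"
    by (simp add: mixing_0[OF ij(1,2,4,5)])
  show "lookup (move (True, j, bb j) (True, i, bb j) (generic ^ A)) \<mu> \<in> J"
  proof (rule sum_isolate[OF _ _ S])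
    show "bb j \<in> Kx i \<inter> Kx j" using ij bb_Kx by simp
    fix k assume "k \<in> Kx i \<inter> Kx j" "k \<noteq> bb j"
    then show "lookup (move (True, j, k) (True, i, k) (generic ^ A)) \<mu> \<in> J"
      by (intro move_in_J[OF \<mu>]) (auto simp: base_simps)
  qed (use finite_Kx in simp)
qed (use ij bb_inj in \<open>auto simp: base_simps\<close>)

lemma Good_mix_Y:
  assumes ij: "i \<in> I" "j \<in> I" "i \<noteq> j" "p j \<le> p i" "q j \<le> q i" "cc i \<in> Ly j"
    and X: "bb j \<in> Kx i \<Longrightarrow> Good (True, i, bb j)"
  shows "Good (False, j, cc i)"
proof (rule Good_from_move[of "(False, i, cc i)"])
  fix \<mu> assume \<mu>: "nonbase_degree \<mu> = N"
  have "(\<Sum>k\<in>Kx i \<inter> Kx j. lookup (move (True, j, k) (True, i, k) (generic ^ A)) \<mu>) \<in> J"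
    by (rule stable_ideal_sum[OF J], rule move_in_J[OF \<mu>]) (use X in \<open>auto simp: base_simps\<close>)
  then have S: "(\<Sum>l\<in>Ly i \<inter> Ly j. lookup (move (False, i, l) (False, j, l) (generic ^ A)) \<mu>) \<in> J"
    by (simp add: mixing_0[OF ij(1,2,4,5)])
  show "lookup (move (False, i, cc i) (False, j, cc i) (generic ^ A)) \<mu> \<in> J"
  proof (rule sum_isolate[OF _ _ S])
    show "cc i \<in> Ly i \<inter> Ly j" using ij cc_Ly by simp
    fix l assume "l \<in> Ly i \<inter> Ly j" "l \<noteq> cc i"
    then show "lookup (move (False, i, l) (False, j, l) (generic ^ A)) \<mu> \<in> J"
      by (intro move_in_J[OF \<mu>]) (auto simp: base_simps)
  qed (use finite_Ly in simp)
qed (use ij cc_inj in \<open>auto simp: base_simps\<close>)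

lemma nonbase_degree_Suc:
  assumes \<mu>: "nonbase_degree \<mu> = Suc N"
  shows "lookup (generic ^ A) \<mu> \<in> J"
proof -
  have GX: "Good (True, i, k)" if "i \<in> I" "k \<in> Kx i" "k \<noteq> bb i" for i k
    by (rule linked_GX[of "\<lambda>j l. Good (False, j, l)" "\<lambda>i k. Good (True, i, k)", OF Good_X Good_Y Good_mix_X Good_mix_Y]) (use that in blast)+
  have GY: "Good (False, j, l)" if "j \<in> I" "l \<in> Ly j" "l \<noteq> cc j" for j l
    by (rule linked_GY[of "\<lambda>j l. Good (False, j, l)" "\<lambda>i k. Good (True, i, k)", OF Good_X Good_Y Good_mix_X Good_mix_Y]) (use that in blast)+
  let ?ws = "{ws\<in>words_over triples A. sum_list (map (\<lambda>(i, k, l). pairmon i k i l) ws) = \<mu>}"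
  obtain z where z: "z \<in> keys \<mu>" "\<not> base z"
  proof -
    have "\<not> (\<forall>z\<in>keys \<mu>. base z)"
    proof
      assume "\<forall>z\<in>keys \<mu>. base z"
      then have "nonbase_degree \<mu> = 0" by (simp add: nonbase_degree_def)
      then show False using \<mu> by simp
    qed
    then show thesis using that by blast
  qed
  show ?thesis
  proof (cases "?ws = {}")
    case True
    then show ?thesis unfolding lookup_generic_power True by (simp add: stable_idealD(2)[OF J])
  next
    case False
    then obtain ws where ws: "ws \<in> words_over triples A" "sum_list (map (\<lambda>(i, k, l). pairmon i k i l) ws) = \<mu>" by blast
    have zpos: "lookup \<mu> z > 0" using z(1) by (simp add: in_keys_iff)
    then obtain x where x: "x \<in> set ws" "lookup (case x of (i, k, l) \<Rightarrow> pairmon i k i l) z > 0"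
      unfolding ws(2)[symmetric] lookup_sum_list_pos by auto
    obtain i k l where xi: "x = (i, k, l)" by (cases x)
    then have "(i, k, l) \<in> triples" using x ws by (auto simp: words_over_def)
    then have t: "i \<in> I" "k \<in> Kx i" "l \<in> Ly i" by (auto simp: triples_def)
    obtain b i' k' where zb: "z = (b, i', k')" by (cases z)
    have "b \<and> z = (True, i, k) \<or> \<not> b \<and> z = (False, i, l)"
      using x(2) unfolding xi zb by (auto simp: lookup_pairmon split: if_splits)
    then have "Good z" using GX[OF t(1,2)] GY[OF t(1,3)] z(2) by (auto simp: base_simps)
    then show ?thesis using \<mu> zpos unfolding Good_def by blast
  qed
qed

end

text \<open>The generic element lies in the closure of the orbit of the combinations of the base units
  under the parabolic group, which is why the relations between the base units carry over.  The
  proof is infinitesimal: induction on the degree of the coefficient in the parameters off the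
  base, degree zero being the hypothesis on the base units.\<close>

theorem generic_power_in_ideal:
  assumes J: "stable_ideal n D J"
    and rel: "\<And>a. (\<Sum>i\<in>I. a i) = A \<Longrightarrow> (\<Prod>i\<in>I. fvar (bb i, cc i) ^ a i) \<in> J"
  shows "lookup (generic ^ A) \<mu> \<in> J"
proof -
  have "\<forall>\<mu>. nonbase_degree \<mu> \<le> N \<longrightarrow> lookup (generic ^ A) \<mu> \<in> J" for N
  proof (induction N)
    case 0
    show ?case
    proof (intro allI impI)
      fix \<mu> assume \<mu>: "nonbase_degree \<mu> \<le> 0"
      have bs: "base z" if "lookup \<mu> z > 0" for z
      proof (rule ccontr)
        assume nz: "\<not> base z"
        have "z \<in> keys \<mu>" using that by (simp add: in_keys_iff)
        then have "(if base z then 0 else lookup \<mu> z) \<le> nonbase_degree \<mu>"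
          unfolding nonbase_degree_def by (intro member_le_sum) auto
        then show False using \<mu> that nz by simp
      qed
      show "lookup (generic ^ A) \<mu> \<in> J"
        unfolding lookup_generic_power
      proof (rule stable_ideal_sum[OF J])
        fix ws assume "ws \<in> {ws\<in>words_over triples A. sum_list (map (\<lambda>(i, k, l). pairmon i k i l) ws) = \<mu>}"
        then have ws: "set ws \<subseteq> triples" "length ws = A" "sum_list (map (\<lambda>(i, k, l). pairmon i k i l) ws) = \<mu>"
          by (auto simp: words_over_def)
        have eq: "k = bb i \<and> l = cc i" if "(i, k, l) \<in> set ws" for i k l
        proof -
          have "lookup \<mu> (True, i, k) > 0" "lookup \<mu> (False, i, l) > 0"
            unfolding ws(3)[symmetric] lookup_sum_list_pos using that by (force simp: lookup_pairmon)+
          from bs[OF this(1)] bs[OF this(2)] show ?thesis by (simp add: base_def)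
        qed
        have "map (\<lambda>(i, k, l). fvar (k, l)) ws = map (\<lambda>i. fvar (bb i, cc i)) (map fst ws)"
          using eq by auto
        moreover have "set (map fst ws) \<subseteq> I" using ws(1) by (auto simp: triples_def)
        ultimately have "prod_list (map (\<lambda>(i, k, l). fvar (k, l)) ws) = (\<Prod>i\<in>I. fvar (bb i, cc i) ^ count_list (map fst ws) i)"
          using prod_list_eq_prod_count[OF finI, of "map fst ws" "\<lambda>i. fvar (bb i, cc i)"] by (simp only:)
        moreover have "(\<Sum>i\<in>I. count_list (map fst ws) i) = A"
          using sum_count_set[of "map fst ws" I] \<open>set (map fst ws) \<subseteq> I\<close> ws(2) finI by simp
        ultimately show "prod_list (map (\<lambda>(i, k, l). fvar (k, l)) ws) \<in> J" using rel by simp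
      qed
    qed
  next
    case (Suc N)
    then show ?case using nonbase_degree_Suc[OF J, of N A] by (auto simp: le_Suc_eq)
  qed
  then show ?thesis by blast
qed

end

section \<open>Chains are lexicographically maximal\<close>

text \<open>At the first position \<open>(i, j)\<close> where \<open>c\<close> exceeds \<open>s\<close>, equality of the sums forces \<open>s\<close> to exceed \<open>c\<close>
  further right in row \<open>i\<close> and further down in column \<open>j\<close>.  These two positions are incomparable
  elements of the support of \<open>s\<close>.\<close>

lemma chain_lex_max:
  fixes c s :: "nat \<times> nat \<Rightarrow>\<^sub>0 nat"
  assumes rows: "\<And>i. (\<Sum>l<N. lookup c (i, l)) = (\<Sum>l<N. lookup s (i, l))"
    and cols: "\<And>j. (\<Sum>k<N. lookup c (k, j)) = (\<Sum>k<N. lookup s (k, j))"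
    and keys: "keys c \<subseteq> {..<N} \<times> {..<N}"
    and chain: "\<And>\<alpha> \<beta>. \<alpha> \<in> keys s \<Longrightarrow> \<beta> \<in> keys s \<Longrightarrow> P_le \<alpha> \<beta> \<or> P_le \<beta> \<alpha>"
  shows "c \<le> s"
proof (rule ccontr)
  assume "\<not> c \<le> s"
  then have "s < c" by simp
  then obtain z where z: "lookup s z < lookup c z"
    "\<And>z'. z' < z \<Longrightarrow> lookup s z' = lookup c z'"
    unfolding less_poly_mapping.rep_eq less_fun_def by blast
  obtain i j where ij: "z = (i, j)" by (cases z)
  have "z \<in> keys c" using z(1) by (auto simp: in_keys_iff)
  then have lt: "i < N" "j < N" using keys ij by auto
  have ex: "\<exists>x<N. g x < f x" if "(\<Sum>x<N. f x) = (\<Sum>x<N. g x)" "y < N" "f y < g y" for f g :: "nat \<Rightarrow> nat" and y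
  proof (rule ccontr)
    assume "\<not> (\<exists>x<N. g x < f x)"
    then have "\<forall>x\<in>{..<N}. f x \<le> g x" by (meson lessThan_iff not_le)
    moreover have "\<exists>x\<in>{..<N}. f x < g x" using that(2,3) by blast
    ultimately have "(\<Sum>x<N. f x) < (\<Sum>x<N. g x)" by (intro sum_strict_mono_ex1) auto
    then show False using that(1) by simp
  qed
  obtain l where l: "lookup c (i, l) < lookup s (i, l)"
    using ex[OF rows[symmetric] lt(2)] z(1) ij by blast
  obtain k where k: "lookup c (k, j) < lookup s (k, j)"
    using ex[OF cols[symmetric] lt(1)] z(1) ij by blast
  have "\<not> (i, l) < (i, j)" "l \<noteq> j" "\<not> (k, j) < (i, j)" "k \<noteq> i"
    using l k z ij by force+
  then have "j < l" "i < k" by auto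
  moreover have "(i, l) \<in> keys s" "(k, j) \<in> keys s"
    using l k by (auto simp: in_keys_iff)
  then have "P_le (i, l) (k, j) \<or> P_le (k, j) (i, l)" using chain by blast
  ultimately show False by (auto simp: P_le_def)
qed

section \<open>Layers and their pieces\<close>

text \<open>Membership in \<open>Pd n d\<close> can be read off from the blocks, \<open>blk D d\<close> being the block of \<open>d\<close>.\<close>

lemma Pd_blk:
  assumes D: "D \<subseteq> {1..<n}" and d: "d \<in> D" and \<alpha>: "\<alpha> \<in> Pos n"
  shows "\<alpha> \<in> Pd n d \<longleftrightarrow> blk D (snd \<alpha>) \<le> blk D d \<and> blk D d < blk D (fst \<alpha>)"
proof -
  have fin: "finite D" using D finite_subset by blast
  have step: "blk D d < blk D x" if "d < x" for x
  proof -
    have "{e\<in>D. e < d} \<subseteq> {e\<in>D. e < x}" "d \<in> {e\<in>D. e < x}" "d \<notin> {e\<in>D. e < d}" using that d by auto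
    then have "{e\<in>D. e < d} \<subset> {e\<in>D. e < x}" by blast
    then show ?thesis unfolding blk_def using fin by (intro psubset_card_mono) auto
  qed
  have "snd \<alpha> \<le> d \<longleftrightarrow> blk D (snd \<alpha>) \<le> blk D d"
    using blk_mono[OF fin] step by (metis not_le)
  moreover have "d < fst \<alpha> \<longleftrightarrow> blk D d < blk D (fst \<alpha>)"
    using blk_mono[OF fin] step by (metis not_le)
  ultimately show ?thesis using \<alpha> by (auto simp: Pd_def)
qed

locale layered =
  fixes n :: nat and D :: "nat set" and Q :: "(nat \<times> nat) set"
  assumes D: "D \<subseteq> {1..<n}" and Q: "Q \<subseteq> PD n D"
begin

lemma finD: "finite D" using D finite_subset by blast
lemma finQ: "finite Q" using Q finite_PD[OF D] finite_subset by blast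
lemma QPos: "Q \<subseteq> Pos n" using Q by (auto simp: PD_def Pd_def)

text \<open>The layers of \<open>Q\<close> are the sets where \<open>h\<close> is constant.  An element of a layer is enclosed by an
  element of every earlier layer (\<open>h_outer\<close>), and by none of its own, so a layer is a chain.\<close>

definition h :: "nat \<times> nat \<Rightarrow> nat" where "h \<alpha> = depth (\<lambda>_. 1) Q \<alpha>"

lemma h_encl: "\<beta> \<in> Q \<Longrightarrow> \<beta> \<in> encl \<alpha> \<Longrightarrow> h \<beta> < h \<alpha>"
  using depth_mono[OF finQ, of \<beta> \<alpha> "\<lambda>_. 1"] by (simp add: h_def)

lemma h_comparable: "\<alpha> \<in> Q \<Longrightarrow> \<beta> \<in> Q \<Longrightarrow> h \<alpha> = h \<beta> \<Longrightarrow> P_le \<alpha> \<beta> \<or> P_le \<beta> \<alpha>"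
proof -
  assume "\<alpha> \<in> Q" "\<beta> \<in> Q" "h \<alpha> = h \<beta>"
  then have "\<alpha> \<notin> encl \<beta>" "\<beta> \<notin> encl \<alpha>" using h_encl[of \<alpha> \<beta>] h_encl[of \<beta> \<alpha>] by auto
  then show ?thesis unfolding encl_def P_le_def by (simp add: not_less) linarith
qed

lemma h_less_width: "\<alpha> \<in> Q \<Longrightarrow> \<alpha> \<in> Pd n d \<Longrightarrow> h \<alpha> < width (Q \<inter> Pd n d)"
  using depth_le_wwidth[OF finQ QPos, of \<alpha> d "\<lambda>_. 1"] by (simp add: h_def width_eq_wwidth)

lemma h_pred:
  assumes "h \<alpha> = Suc k"
  shows "\<exists>\<beta>\<in>Q \<inter> encl \<alpha>. h \<beta> = k"
proof -
  obtain A where A: "A \<subseteq> Q \<inter> encl \<alpha>" "antichain A" "h \<alpha> = card A"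
    using wwidth_attained[of "Q \<inter> encl \<alpha>" "\<lambda>_. 1"] finQ by (auto simp: h_def depth_def)
  have finA: "finite A" and "A \<noteq> {}" using A finQ assms finite_subset by auto
  define r where "r = Min (fst ` A)"
  have "r \<in> fst ` A" unfolding r_def using finA \<open>A \<noteq> {}\<close> by (intro Min_in) auto
  then obtain \<beta> where \<beta>: "\<beta> \<in> A" "fst \<beta> = r" by auto
  have "\<gamma> \<in> encl \<beta>" if "\<gamma> \<in> A" "\<gamma> \<noteq> \<beta>" for \<gamma>
  proof -
    have "r \<le> fst \<gamma>" unfolding r_def using finA that by (intro Min_le) auto
    then have "\<beta> \<notin> encl \<gamma>" using \<beta> by (auto simp: encl_def)
    then show ?thesis using incomparable_encl[OF A(2) that(1) \<beta>(1) that(2)] by blast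
  qed
  then have "A - {\<beta>} \<subseteq> Q \<inter> encl \<beta>" using A(1) by auto
  moreover have "antichain (A - {\<beta>})" using A(2) by (auto simp: antichain_def)
  ultimately have "card (A - {\<beta>}) \<le> h \<beta>"
    using wwidth_ge[of "Q \<inter> encl \<beta>" "A - {\<beta>}" "\<lambda>_. 1"] finQ by (simp add: h_def depth_def)
  then have "k \<le> h \<beta>" using \<beta>(1) finA A(3) assms by simp
  moreover have "h \<beta> < Suc k" using h_encl[of \<beta> \<alpha>] \<beta>(1) A(1) assms by auto
  ultimately show ?thesis using \<beta>(1) A(1) by (intro bexI[of _ \<beta>]) auto
qed

lemma h_outer: "\<alpha> \<in> Q \<Longrightarrow> k < h \<alpha> \<Longrightarrow> \<exists>\<beta>\<in>Q \<inter> encl \<alpha>. h \<beta> = k"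
proof (induction "h \<alpha>" arbitrary: \<alpha>)
  case 0
  then show ?case by simp
next
  case (Suc x)
  obtain \<beta> where \<beta>: "\<beta> \<in> Q \<inter> encl \<alpha>" "h \<beta> = x" using h_pred Suc(2) by metis
  show ?case
  proof (cases "k = x")
    case True then show ?thesis using \<beta> by blast
  next
    case False
    then have "k < h \<beta>" using Suc.prems Suc(2) \<beta> by simp
    then obtain \<gamma> where "\<gamma> \<in> Q \<inter> encl \<beta>" "h \<gamma> = k" using Suc(1)[of \<beta>] \<beta> by blast
    then show ?thesis using \<beta> by (intro bexI[of _ \<gamma>]) (auto simp: encl_def)
  qed
qed

abbreviation "lo \<alpha> \<equiv> blk D (snd \<alpha>)"
abbreviation "hi \<alpha> \<equiv> blk D (fst \<alpha>)"

lemma lo_hi: "\<alpha> \<in> Q \<Longrightarrow> lo \<alpha> < hi \<alpha>"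
  using Q PD_iff[OF D, of "fst \<alpha>" "snd \<alpha>"] by auto

lemma encl_blk: "\<beta> \<in> encl \<alpha> \<Longrightarrow> lo \<beta> \<le> lo \<alpha> \<and> hi \<alpha> \<le> hi \<beta>"
  using blk_mono[OF finD] by (auto simp: encl_def)

text \<open>\<open>cov k a\<close>: an element of layer \<open>k\<close> passes from block \<open>a - 1\<close> to block \<open>a\<close>.
  \<open>link k a\<close>: an element of layer \<open>k\<close> passes over the block \<open>a\<close>.\<close>

definition cov :: "nat \<Rightarrow> nat \<Rightarrow> bool" where "cov k a \<longleftrightarrow> (\<exists>\<alpha>\<in>Q. h \<alpha> = k \<and> lo \<alpha> < a \<and> a \<le> hi \<alpha>)"
definition link :: "nat \<Rightarrow> nat \<Rightarrow> bool" where "link k a \<longleftrightarrow> (\<exists>\<alpha>\<in>Q. h \<alpha> = k \<and> lo \<alpha> < a \<and> a < hi \<alpha>)"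

lemma link_cov: "link k a \<Longrightarrow> cov k a" "link k a \<Longrightarrow> cov k (Suc a)"
  by (auto simp: link_def cov_def Suc_le_eq less_SucI intro: less_imp_le)

lemma link_mono: "k \<le> k' \<Longrightarrow> link k' a \<Longrightarrow> link k a"
proof -
  assume kk: "k \<le> k'" and "link k' a"
  then obtain \<alpha> where \<alpha>: "\<alpha> \<in> Q" "h \<alpha> = k'" "lo \<alpha> < a" "a < hi \<alpha>" by (auto simp: link_def)
  show "link k a"
  proof (cases "k = k'")
    case False
    then obtain \<beta> where \<beta>: "\<beta> \<in> Q" "\<beta> \<in> encl \<alpha>" "h \<beta> = k" using h_outer[OF \<alpha>(1), of k] \<alpha>(2) kk by auto
    then show ?thesis using encl_blk[OF \<beta>(2)] \<alpha> unfolding link_def by (intro bexI[of _ \<beta>]) auto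
  qed (use \<open>link k' a\<close> in simp)
qed

text \<open>A layer is cut at the blocks over which none of its elements passes.  Such a block is not passed
  over by any deeper layer either (\<open>link_mono\<close>), and this makes the pieces laminar.\<close>

definition runs :: "(nat \<times> nat \<times> nat) set" where
  "runs = {(k, p, q). p < q \<and> (\<forall>a. p < a \<and> a \<le> q \<longrightarrow> cov k a) \<and> (\<forall>a. p < a \<and> a < q \<longrightarrow> link k a)
     \<and> \<not> link k p \<and> \<not> link k q}"

lemma finite_runs: "finite runs"
proof (rule finite_subset)
  show "runs \<subseteq> h ` Q \<times> {..card D} \<times> {..card D}"
  proof (rule subsetI)
    fix x assume "x \<in> runs"
    moreover obtain k p q where x: "x = (k, p, q)" by (cases x)
    ultimately have r: "(k, p, q) \<in> runs" by simp
    then have "cov k q" by (auto simp: runs_def)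
    then obtain \<alpha> where \<alpha>: "\<alpha> \<in> Q" "h \<alpha> = k" "q \<le> hi \<alpha>" by (auto simp: cov_def)
    have "hi \<alpha> \<le> card D" unfolding blk_def using finD by (intro card_mono) auto
    then show "x \<in> h ` Q \<times> {..card D} \<times> {..card D}" using \<alpha> r by (auto simp: runs_def x)
  qed
qed (use finQ in simp)

lemma runs_laminar:
  assumes r: "(k, p, q) \<in> runs" "(k', p', q') \<in> runs" "(k, p, q) \<noteq> (k', p', q')"
    and s: "p < q'" "p' < q" and kk: "k \<le> k'"
  shows "k < k' \<and> p \<le> p' \<and> q' \<le> q"
proof -
  have *: "p \<le> p' \<and> q' \<le> q" if "(k, p, q) \<in> runs" "(k', p', q') \<in> runs" "p < q'" "p' < q" "k \<le> k'"
    for k p q k' p' q'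
  proof -
    have "p \<le> p'"
    proof (rule ccontr)
      assume "\<not> p \<le> p'"
      then have "link k' p" using that by (auto simp: runs_def)
      then show False using link_mono[OF that(5)] that(1) by (auto simp: runs_def)
    qed
    moreover have "q' \<le> q"
    proof (rule ccontr)
      assume "\<not> q' \<le> q"
      then have "link k' q" using that by (auto simp: runs_def)
      then show False using link_mono[OF that(5)] that(1) by (auto simp: runs_def)
    qed
    ultimately show ?thesis ..
  qed
  show ?thesis
  proof (cases "k = k'")
    case True
    then show ?thesis using *[OF r(1,2) s kk] *[OF r(2,1) s(2,1)] r(3) by auto
  qed (use *[OF r(1,2) s kk] kk in auto)
qed

lemma run_exists:
  assumes \<alpha>: "\<alpha> \<in> Q"
  shows "\<exists>p q. (h \<alpha>, p, q) \<in> runs \<and> p \<le> lo \<alpha> \<and> hi \<alpha> \<le> q"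
proof -
  let ?k = "h \<alpha>"
  define p where "p = Max {a. a \<le> lo \<alpha> \<and> \<not> link ?k a}"
  define q where "q = (LEAST a. hi \<alpha> \<le> a \<and> \<not> link ?k a)"
  have "\<not> link ?k 0" by (simp add: link_def)
  then have "p \<in> {a. a \<le> lo \<alpha> \<and> \<not> link ?k a}" unfolding p_def
    by (intro Max_in) (auto intro: finite_subset[of _ "{..lo \<alpha>}"])
  then have p: "p \<le> lo \<alpha>" "\<not> link ?k p" by auto
  have p': "link ?k a" if "p < a" "a \<le> lo \<alpha>" for a
  proof (rule ccontr)
    assume "\<not> link ?k a"
    then have "a \<le> p" unfolding p_def using that by (intro Max_ge) (auto intro: finite_subset[of _ "{..lo \<alpha>}"])
    then show False using that by simp
  qed
  have hiD: "hi \<beta> \<le> card D" for \<beta> unfolding blk_def using finD by (intro card_mono) auto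
  then have "hi \<alpha> \<le> card D \<and> \<not> link ?k (card D)" unfolding link_def using hiD by (metis not_le)
  then have q: "hi \<alpha> \<le> q" "\<not> link ?k q"
    using LeastI[of "\<lambda>a. hi \<alpha> \<le> a \<and> \<not> link ?k a" "card D"] unfolding q_def by blast+
  have q': "link ?k a" if "hi \<alpha> \<le> a" "a < q" for a
    using that not_less_Least[of a "\<lambda>a. hi \<alpha> \<le> a \<and> \<not> link ?k a"] unfolding q_def by blast
  have lh: "lo \<alpha> < hi \<alpha>" by (rule lo_hi[OF \<alpha>])
  have lk: "link ?k a" if "p < a" "a < q" for a
  proof -
    consider "a \<le> lo \<alpha>" | "lo \<alpha> < a" "a < hi \<alpha>" | "hi \<alpha> \<le> a" by linarith
    then show ?thesis
    proof cases
      case 2 then show ?thesis using \<alpha> by (auto simp: link_def)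
    qed (use p' q' that in auto)
  qed
  have "cov ?k a" if a: "p < a" "a \<le> q" for a
  proof (cases "a < q")
    case True then show ?thesis using lk a link_cov by blast
  next
    case False
    then have aq: "a = q" using a by simp
    show ?thesis
    proof (cases "q = hi \<alpha>")
      case True then show ?thesis using aq lh \<alpha> by (auto simp: cov_def)
    next
      case False
      then have "hi \<alpha> \<le> q - 1" "q - 1 < q" "Suc (q - 1) = q" using q(1) by auto
      then show ?thesis using q'[of "q - 1"] link_cov(2)[of ?k "q - 1"] aq by simp
    qed
  qed
  then have "(?k, p, q) \<in> runs" using lk p q lh by (auto simp: runs_def)
  then show ?thesis using p q by blast
qed

text \<open>At most one piece of every layer passes over \<open>d\<close>, and it contains an element of \<open>Pd n d\<close> around
  which as many elements of \<open>Q \<inter> Pd n d\<close> are nested as there are earlier layers.\<close>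

lemma card_runs_through:
  assumes d: "d \<in> D"
  shows "card {r\<in>runs. fst (snd r) \<le> blk D d \<and> blk D d < snd (snd r)} \<le> width (Q \<inter> Pd n d)"
proof -
  let ?R = "{r\<in>runs. fst (snd r) \<le> blk D d \<and> blk D d < snd (snd r)}"
  have "inj_on fst ?R"
  proof (rule inj_onI, rule ccontr)
    fix r r' assume "r \<in> ?R" "r' \<in> ?R" "fst r = fst r'" "r \<noteq> r'"
    then show False
      using runs_laminar[of "fst r" "fst (snd r)" "snd (snd r)" "fst r'" "fst (snd r')" "snd (snd r')"]
      by (cases r; cases r') auto
  qed
  moreover have "fst ` ?R \<subseteq> {..<width (Q \<inter> Pd n d)}"
  proof (rule image_subsetI)
    fix r assume r: "r \<in> ?R"
    obtain k p q where kpq: "r = (k, p, q)" by (cases r)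
    have "cov k (Suc (blk D d))" using r kpq by (auto simp: runs_def)
    then obtain \<alpha> where \<alpha>: "\<alpha> \<in> Q" "h \<alpha> = k" "lo \<alpha> \<le> blk D d" "blk D d < hi \<alpha>" by (auto simp: cov_def)
    then have "\<alpha> \<in> Pd n d" using Pd_blk[OF D d] QPos by blast
    then show "fst r \<in> {..<width (Q \<inter> Pd n d)}" using h_less_width[OF \<alpha>(1)] \<alpha>(2) kpq by simp
  qed
  ultimately have "card ?R \<le> card {..<width (Q \<inter> Pd n d)}" by (rule card_inj_on_le) simp
  then show ?thesis by simp
qed

definition block :: "nat \<Rightarrow> nat set" where "block B = {x. 1 \<le> x \<and> x \<le> n \<and> blk D x = B}"

lemma finite_block: "finite (block B)"
  by (rule finite_subset[of _ "{..n}"]) (auto simp: block_def)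

text \<open>The pieces with upper block \<open>B\<close> are nested.  The largest row of an element of such a piece
  in this block increases from each piece to the outer ones, which yields different members of
  the block.\<close>

lemma cap_rows: "card {r\<in>runs. snd (snd r) = B} \<le> card (block B)"
proof -
  let ?R = "{r\<in>runs. snd (snd r) = B}"
  let ?X = "\<lambda>r. fst ` {\<alpha>\<in>Q. h \<alpha> = fst r \<and> lo \<alpha> < B \<and> B \<le> hi \<alpha>}"
  have X: "finite (?X r)" "?X r \<noteq> {}" "?X r \<subseteq> block B" if "r \<in> ?R" for r
  proof -
    show "finite (?X r)" using finQ by simp
    have "cov (fst r) B" "\<not> link (fst r) B" using that by (auto simp: runs_def)
    then show "?X r \<noteq> {}" "?X r \<subseteq> block B" using QPos by (force simp: cov_def link_def block_def Pos_def)+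
  qed
  have less: "Max (?X r') < Max (?X r)" if r: "r \<in> ?R" "r' \<in> ?R" "fst r < fst r'" for r r'
  proof -
    have "Max (?X r') \<in> ?X r'" using X[OF r(2)] by (intro Max_in) auto
    then obtain \<alpha> where \<alpha>: "\<alpha> \<in> Q" "h \<alpha> = fst r'" "lo \<alpha> < B" "B \<le> hi \<alpha>" "fst \<alpha> = Max (?X r')" by auto
    obtain \<beta> where \<beta>: "\<beta> \<in> Q" "\<beta> \<in> encl \<alpha>" "h \<beta> = fst r" using h_outer[OF \<alpha>(1), of "fst r"] \<alpha>(2) r(3) by auto
    have "fst \<beta> \<in> ?X r" using \<beta> \<alpha> encl_blk[OF \<beta>(2)] by auto
    then have "fst \<beta> \<le> Max (?X r)" using X[OF r(1)] by (intro Max_ge) auto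
    then show ?thesis using \<beta>(2) \<alpha>(5) by (auto simp: encl_def)
  qed
  have "inj_on (\<lambda>r. Max (?X r)) ?R"
  proof (rule inj_onI, rule ccontr)
    fix r r' assume r: "r \<in> ?R" "r' \<in> ?R" "Max (?X r) = Max (?X r')" "r \<noteq> r'"
    have "fst r \<noteq> fst r'"
      using runs_laminar[of "fst r" "fst (snd r)" "snd (snd r)" "fst r'" "fst (snd r')" "snd (snd r')"] r by (auto simp: runs_def)
    then show False using less[OF r(1,2)] less[OF r(2,1)] r(3) by linarith
  qed
  moreover have "(\<lambda>r. Max (?X r)) ` ?R \<subseteq> block B"
  proof (rule image_subsetI)
    fix r assume "r \<in> ?R"
    then show "Max (?X r) \<in> block B" using X[of r] Max_in[of "?X r"] by blast
  qed
  ultimately show ?thesis by (rule card_inj_on_le[OF _ _ finite_block])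
qed

lemma cap_cols: "card {r\<in>runs. fst (snd r) = B} \<le> card (block B)"
proof -
  let ?R = "{r\<in>runs. fst (snd r) = B}"
  let ?X = "\<lambda>r. snd ` {\<alpha>\<in>Q. h \<alpha> = fst r \<and> lo \<alpha> \<le> B \<and> B < hi \<alpha>}"
  have X: "finite (?X r)" "?X r \<noteq> {}" "?X r \<subseteq> block B" if "r \<in> ?R" for r
  proof -
    show "finite (?X r)" using finQ by simp
    have "cov (fst r) (Suc B)" "\<not> link (fst r) B" using that by (auto simp: runs_def)
    then show "?X r \<noteq> {}" "?X r \<subseteq> block B" using QPos by (force simp: cov_def link_def block_def Pos_def)+
  qed
  have less: "Min (?X r) < Min (?X r')" if r: "r \<in> ?R" "r' \<in> ?R" "fst r < fst r'" for r r'
  proof -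
    have "Min (?X r') \<in> ?X r'" using X[OF r(2)] by (intro Min_in) auto
    then obtain \<alpha> where \<alpha>: "\<alpha> \<in> Q" "h \<alpha> = fst r'" "lo \<alpha> \<le> B" "B < hi \<alpha>" "snd \<alpha> = Min (?X r')" by auto
    obtain \<beta> where \<beta>: "\<beta> \<in> Q" "\<beta> \<in> encl \<alpha>" "h \<beta> = fst r" using h_outer[OF \<alpha>(1), of "fst r"] \<alpha>(2) r(3) by auto
    have "snd \<beta> \<in> ?X r" using \<beta> \<alpha> encl_blk[OF \<beta>(2)] by auto
    then have "Min (?X r) \<le> snd \<beta>" using X[OF r(1)] by (intro Min_le) auto
    then show ?thesis using \<beta>(2) \<alpha>(5) by (auto simp: encl_def)
  qed
  have "inj_on (\<lambda>r. Min (?X r)) ?R"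
  proof (rule inj_onI, rule ccontr)
    fix r r' assume r: "r \<in> ?R" "r' \<in> ?R" "Min (?X r) = Min (?X r')" "r \<noteq> r'"
    have "fst r \<noteq> fst r'"
      using runs_laminar[of "fst r" "fst (snd r)" "snd (snd r)" "fst r'" "fst (snd r')" "snd (snd r')"] r by (auto simp: runs_def)
    then show False using less[OF r(1,2)] less[OF r(2,1)] r(3) by linarith
  qed
  moreover have "(\<lambda>r. Min (?X r)) ` ?R \<subseteq> block B"
  proof (rule image_subsetI)
    fix r assume "r \<in> ?R"
    then show "Min (?X r) \<in> block B" using X[of r] Min_in[of "?X r"] by blast
  qed
  ultimately show ?thesis by (rule card_inj_on_le[OF _ _ finite_block])
qed

definition en :: "nat \<Rightarrow> nat \<Rightarrow> nat" where "en B r = sorted_list_of_set (block B) ! r"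

sublocale pieces n D runs "\<lambda>r. fst (snd r)" "\<lambda>r. snd (snd r)" fst "\<lambda>B. card (block B)" en
proof
  show "D \<subseteq> {1..<n}" by (rule D)
  show "finite runs" by (rule finite_runs)
  show "fst (snd i) < snd (snd i)" if "i \<in> runs" for i using that by (auto simp: runs_def)
  show "fst i < fst j \<and> fst (snd i) \<le> fst (snd j) \<and> snd (snd j) \<le> snd (snd i)"
    if "i \<in> runs" "j \<in> runs" "i \<noteq> j" "fst (snd i) < snd (snd j)" "fst (snd j) < snd (snd i)" "fst i \<le> fst j" for i j
    using runs_laminar[of "fst i" "fst (snd i)" "snd (snd i)" "fst j" "fst (snd j)" "snd (snd j)"] that by auto
  show "r = r'" if "r < card (block B)" "r' < card (block B)" "en B r = en B r'" for r r' B
    using that finite_block by (simp add: en_def nth_eq_iff_index_eq)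
  show "1 \<le> en B r \<and> en B r \<le> n \<and> blk D (en B r) = B" if "r < card (block B)" for r B
  proof -
    have "en B r \<in> set (sorted_list_of_set (block B))" unfolding en_def using that by (intro nth_mem) simp
    then show ?thesis using finite_block by (simp add: block_def)
  qed
qed (use cap_rows cap_cols in auto)

end

section \<open>Straightening\<close>

lemma fvar_power: "fvar \<alpha> ^ k = single (single \<alpha> k) 1"
  by (induction k) (auto simp: fvar_def mult_single single_add[symmetric])

text \<open>The exponent of the product of the variables of the triples in the list, the pieces being
  forgotten.\<close>

definition content :: "('i \<times> nat \<times> nat) list \<Rightarrow> (nat \<times> nat \<Rightarrow>\<^sub>0 nat)" where
  "content ws = sum_list (map (\<lambda>z. single (snd z) 1) ws)"

lemma content_Nil [simp]: "content [] = 0" and content_Cons: "content (z # ws) = single (snd z) 1 + content ws"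
  by (auto simp: content_def)

lemma content_append: "content (us @ ws) = content us + content ws"
  by (simp add: content_def)

lemma prod_list_fvar: "prod_list (map (\<lambda>(i, k, l). fvar (k, l)) ws) = single (content ws) 1"
  by (induction ws) (auto simp: content_Cons fvar_def mult_single)

lemma keys_content: "keys (content ws) = snd ` set ws"
proof (induction ws)
  case (Cons z ws)
  have "keys (single (snd z) (1::nat) + content ws)
     = keys (single (snd z) (1::nat)) \<union> keys (content ws)"
    by (auto simp: in_keys_iff lookup_add lookup_single when_def split: if_splits)
  then show ?case using Cons by (simp add: content_Cons)
qed simp

lemma content_partition:
  assumes "finite I" "fst ` set ws \<subseteq> I"
  shows "content ws = (\<Sum>i\<in>I. content (filter (\<lambda>z. fst z = i) ws))"
  using assms(2)
proof (induction ws)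
  case (Cons z ws)
  have "(\<Sum>i\<in>I. content (filter (\<lambda>z. fst z = i) (z # ws))) =
      (\<Sum>i\<in>I. (if i = fst z then single (snd z) 1 else 0) + content (filter (\<lambda>z. fst z = i) ws))"
    by (rule sum.cong) (auto simp: content_Cons)
  then show ?case using Cons assms(1) by (simp add: content_Cons sum.distrib)
qed simp

lemma sum_single_const:
  "finite X \<Longrightarrow> (\<Sum>x\<in>X. single e (1::complex)) = single e (of_nat (card X))"
  by (induction X rule: finite_induct) (simp_all del: sum_constant add: single_add)

definition degree :: "(nat \<times> nat \<Rightarrow>\<^sub>0 nat) \<Rightarrow> nat" where
  "degree e = (\<Sum>\<alpha>\<in>keys e. lookup e \<alpha>)"

lemma degree_superset: "finite K \<Longrightarrow> keys e \<subseteq> K \<Longrightarrow> degree e = (\<Sum>\<alpha>\<in>K. lookup e \<alpha>)"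
  unfolding degree_def by (rule sum.mono_neutral_left) (auto simp: in_keys_iff)

lemma degree_add: "degree (e + e') = degree e + degree e'"
proof -
  let ?K = "keys e \<union> keys e'"
  have "degree (e + e') = (\<Sum>\<alpha>\<in>?K. lookup (e + e') \<alpha>)"
    by (rule degree_superset) (use Poly_Mapping.keys_add[of e e'] in auto)
  then show ?thesis
    using degree_superset[of ?K e] degree_superset[of ?K e'] by (simp add: lookup_add sum.distrib)
qed

lemma degree_single [simp]: "degree (single \<alpha> k) = k"
  by (simp add: degree_def)

lemma degree_content: "degree (content ws) = length ws"
proof (induction ws)
  case Nil
  then show ?case by (simp add: degree_def)
qed (simp add: content_Cons degree_add)

context pieces
begin

text \<open>Equality of the parameter monomials means that the two lists have the same row and column sums on
  every piece.\<close>

lemma content_le: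
  assumes ws: "set ws \<subseteq> triples" and us: "set us \<subseteq> triples"
    and eq: "sum_list (map (\<lambda>(i, k, l). pairmon i k i l) ws) = sum_list (map (\<lambda>(i, k, l). pairmon i k i l) us)"
    and chain: "\<And>i \<alpha> \<beta>. (i, \<alpha>) \<in> set us \<Longrightarrow> (i, \<beta>) \<in> set us \<Longrightarrow> P_le \<alpha> \<beta> \<or> P_le \<beta> \<alpha>"
  shows "content ws \<le> content us"
proof -
  let ?N = "Suc n"
  let ?f = "\<lambda>i. filter (\<lambda>z. fst z = i)"
  have tri: "fst z \<in> I" "fst (snd z) < ?N" "snd (snd z) < ?N" if "z \<in> triples" for z
    using that by (auto simp: triples_def Kx_def Ly_def)
  have row: "(\<Sum>l<?N. lookup (content (?f i xs)) (k, l))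
      = lookup (sum_list (map (\<lambda>(i, k, l). pairmon i k i l) xs)) (True, i, k)" if "set xs \<subseteq> triples" for i k xs
    using that
  proof (induction xs)
    case (Cons z xs)
    obtain i' k' l' where z: "z = (i', k', l')" by (cases z)
    have l': "l' < ?N" using Cons.prems tri[of z] z by simp
    have "(\<Sum>l<?N. lookup (single (k', l') (1::nat)) (k, l)) = (if k' = k then 1 else 0)"
      using l' by (simp add: lookup_single when_def)
    then show ?case using Cons z
      by (auto simp: content_Cons lookup_add sum.distrib lookup_pairmon)
  qed simp
  have col: "(\<Sum>k<?N. lookup (content (?f i xs)) (k, l))
      = lookup (sum_list (map (\<lambda>(i, k, l). pairmon i k i l) xs)) (False, i, l)" if "set xs \<subseteq> triples" for i l xs
    using that
  proof (induction xs)
    case (Cons z xs)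
    obtain i' k' l' where z: "z = (i', k', l')" by (cases z)
    have k': "k' < ?N" using Cons.prems tri[of z] z by simp
    have "(\<Sum>k<?N. lookup (single (k', l') (1::nat)) (k, l)) = (if l' = l then 1 else 0)"
      using k' by (simp add: lookup_single when_def)
    then show ?case using Cons z
      by (auto simp: content_Cons lookup_add sum.distrib lookup_pairmon)
  qed simp
  have "content (?f i ws) \<le> content (?f i us)" for i
  proof (rule chain_lex_max[where N = ?N])
    show "keys (content (?f i ws)) \<subseteq> {..<?N} \<times> {..<?N}"
    proof
      fix \<alpha> assume "\<alpha> \<in> keys (content (?f i ws))"
      then obtain z where "z \<in> set ws" "\<alpha> = snd z" by (auto simp: keys_content)
      then show "\<alpha> \<in> {..<?N} \<times> {..<?N}" using tri[of z] ws by (auto simp: mem_Times_iff)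
    qed
    fix \<alpha> \<beta> assume "\<alpha> \<in> keys (content (?f i us))" "\<beta> \<in> keys (content (?f i us))"
    then have "(i, \<alpha>) \<in> set us" "(i, \<beta>) \<in> set us" by (auto simp: keys_content)
    then show "P_le \<alpha> \<beta> \<or> P_le \<beta> \<alpha>" by (rule chain)
  qed (simp_all only: row[OF ws] row[OF us] col[OF ws] col[OF us] eq)
  then have "(\<Sum>i\<in>I. content (?f i ws)) \<le> (\<Sum>i\<in>I. content (?f i us))" by (intro sum_mono)
  moreover have "fst ` set ws \<subseteq> I" "fst ` set us \<subseteq> I" using ws us tri by auto
  ultimately show ?thesis using content_partition[OF finI] by metis
qed

end

text \<open>The bound of the relations with \<open>weight_pair\<close> written out: \<open>d\<close> contributes \<open>m d\<close> for every factor
  in \<open>Pd n d\<close>.\<close>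

lemma prod_in_relations:
  assumes D: "D \<subseteq> {1..<n}" and fin: "finite I"
    and bc: "\<And>i. i \<in> I \<Longrightarrow> (b i, c i) \<in> PD n D"
    and big: "(\<Sum>i\<in>I. a i) > M + (\<Sum>i\<in>I. \<Sum>d\<in>D. m d * (if c i \<le> d \<and> d < b i then 1 else 0))"
  shows "(\<Prod>i\<in>I. fvar (b i, c i) ^ a i) \<in> relations n D m M"
proof -
  obtain f where f: "bij_betw f {..<card I} I" using fin ex_bij_betw_nat_finite lessThan_atLeast0 by metis
  define \<beta> where "\<beta> t = (c (f t), b (f t) - 1)" for t
  have fI: "f t \<in> I" if "t < card I" for t using f that by (auto simp: bij_betw_def)
  have rp: "root_pos (\<beta> t) = (b (f t), c (f t))" if "t < card I" for t
    using PD_bounds[OF bc[OF fI[OF that]]] by (simp add: root_pos_def \<beta>_def)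
  have wp: "weight_pair D m (\<beta> t) = (\<Sum>d\<in>D. m d * (if c (f t) \<le> d \<and> d < b (f t) then 1 else 0))" if "t < card I" for t
  proof -
    have "(\<Sum>k = c (f t)..b (f t) - 1. if k = d then 1 else (0::nat)) = (if c (f t) \<le> d \<and> d < b (f t) then 1 else 0)" for d
      using PD_bounds[OF bc[OF fI[OF that]]] by auto
    then show ?thesis by (simp only: weight_pair_def \<beta>_def prod.case)
  qed
  have reidx: "(\<Sum>i\<in>I. g i) = (\<Sum>t<card I. g (f t))" for g :: "_ \<Rightarrow> nat"
    using sum.reindex_bij_betw[OF f, of g] by simp
  have "(\<Prod>i\<in>I. fvar (b i, c i) ^ a i) = (\<Prod>t<card I. fvar (b (f t), c (f t)) ^ a (f t))"
    using prod.reindex_bij_betw[OF f, of "\<lambda>i. fvar (b i, c i) ^ a i"] by simp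
  also have "\<dots> = (\<Prod>t<card I. fvar (root_pos (\<beta> t)) ^ (a \<circ> f) t)"
    by (rule prod.cong) (auto simp: rp)
  finally have 1: "(\<Prod>i\<in>I. fvar (b i, c i) ^ a i) = (\<Prod>t<card I. fvar (root_pos (\<beta> t)) ^ (a \<circ> f) t)" .
  have "I \<noteq> {}" using big by auto
  then have 2: "1 \<le> card I" using fin by (simp add: Suc_le_eq card_gt_0_iff)
  have 3: "\<beta> t \<in> pos_roots n \<and> root_pos (\<beta> t) \<in> PD n D" if "t < card I" for t
    using PD_bounds[OF bc[OF fI[OF that]]] bc[OF fI[OF that]] rp[OF that] by (auto simp: pos_roots_def \<beta>_def)
  have 4: "(\<Sum>t<card I. (a \<circ> f) t) > M + (\<Sum>t<card I. weight_pair D m (\<beta> t))"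
  proof -
    have "(\<Sum>t<card I. weight_pair D m (\<beta> t)) = (\<Sum>t<card I. \<Sum>d\<in>D. m d * (if c (f t) \<le> d \<and> d < b (f t) then 1 else 0))"
      by (rule sum.cong) (auto simp: wp)
    then show ?thesis using big reidx[of a] reidx[of "\<lambda>i. \<Sum>d\<in>D. m d * (if c i \<le> d \<and> d < b i then 1 else 0)"]
      by (simp add: comp_def)
  qed
  show ?thesis
    unfolding relations_def 1 mem_Collect_eq
    by (rule exI[of _ "card I"], rule exI[of _ \<beta>], rule exI[of _ "a \<circ> f"]) (use 2 3 4 in blast)
qed

context layered
begin

text \<open>The restriction of \<open>e\<close> to \<open>Q\<close> is the content of a list \<open>us\<close> in which every element is labelled by
  its piece.  The coefficient of the generic power at the parameter monomial of \<open>us\<close> is the sum of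
  the monomials of all lists with the same margins.  The contents of these lists are at most that
  of \<open>us\<close>, and \<open>us\<close> itself occurs.  The rest of \<open>e\<close> is carried along as a factor.\<close>

lemma straighten:
  assumes J: "stable_ideal n D J" and rel: "relations n D m M \<subseteq> J"
    and e: "keys e \<subseteq> PD n D"
    and big: "(\<Sum>\<alpha>\<in>Q. lookup e \<alpha>) > M + (\<Sum>d\<in>D. m d * width (Q \<inter> Pd n d))"
  shows "\<exists>p c. c \<noteq> 0 \<and> single e c + p \<in> J \<and>
    (\<forall>e'\<in>keys p. e' < e \<and> degree e' = degree e \<and> keys e' \<subseteq> PD n D)"
proof -
  define A where "A = (\<Sum>\<alpha>\<in>Q. lookup e \<alpha>)"
  define piece where "piece \<alpha> = (SOME r. r \<in> runs \<and> fst r = h \<alpha> \<and> fst (snd r) \<le> lo \<alpha> \<and> hi \<alpha> \<le> snd (snd r))" for \<alpha>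
  have piece: "piece \<alpha> \<in> runs" "fst (piece \<alpha>) = h \<alpha>" "fst (snd (piece \<alpha>)) \<le> lo \<alpha>" "hi \<alpha> \<le> snd (snd (piece \<alpha>))" if "\<alpha> \<in> Q" for \<alpha>
  proof -
    obtain p q where "(h \<alpha>, p, q) \<in> runs \<and> p \<le> lo \<alpha> \<and> hi \<alpha> \<le> q" using run_exists[OF \<open>\<alpha> \<in> Q\<close>] by blast
    then have "\<exists>r. r \<in> runs \<and> fst r = h \<alpha> \<and> fst (snd r) \<le> lo \<alpha> \<and> hi \<alpha> \<le> snd (snd r)"
      by (intro exI[of _ "(h \<alpha>, p, q)"]) simp
    from someI_ex[OF this] show "piece \<alpha> \<in> runs" "fst (piece \<alpha>) = h \<alpha>" "fst (snd (piece \<alpha>)) \<le> lo \<alpha>" "hi \<alpha> \<le> snd (snd (piece \<alpha>))"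
      by (auto simp: piece_def)
  qed
  have genJ: "lookup (generic ^ A) \<mu> \<in> J" for \<mu>
  proof (rule generic_power_in_ideal[OF J])
    fix a assume a: "(\<Sum>i\<in>runs. a i) = A"
    have bc: "(bb i, cc i) \<in> PD n D" if "i \<in> runs" for i
      using bb[OF that] cc[OF that] pq[OF that] by (simp add: in_PD)
    have "(\<Sum>i\<in>runs. \<Sum>d\<in>D. m d * (if cc i \<le> d \<and> d < bb i then 1 else 0))
       = (\<Sum>d\<in>D. m d * card {i\<in>runs. cc i \<le> d \<and> d < bb i})"
      using finite_runs by (subst sum.swap) (simp add: sum_distrib_left[symmetric] sum.inter_filter[symmetric])
    also have "\<dots> \<le> (\<Sum>d\<in>D. m d * width (Q \<inter> Pd n d))"
    proof (intro sum_mono mult_left_mono)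
      fix d assume d: "d \<in> D"
      have "cc i \<le> d \<and> d < bb i \<longleftrightarrow> fst (snd i) \<le> blk D d \<and> blk D d < snd (snd i)" if "i \<in> runs" for i
      proof -
        have "(bb i, cc i) \<in> Pos n" using bc[OF that] by (auto simp: PD_def Pd_def)
        then have "(bb i, cc i) \<in> Pd n d \<longleftrightarrow> blk D (cc i) \<le> blk D d \<and> blk D d < blk D (bb i)"
          using Pd_blk[OF D d] by auto
        then show ?thesis using \<open>(bb i, cc i) \<in> Pos n\<close> bb[OF that] cc[OF that] by (auto simp: Pd_def)
      qed
      then have "{i\<in>runs. cc i \<le> d \<and> d < bb i} = {r\<in>runs. fst (snd r) \<le> blk D d \<and> blk D d < snd (snd r)}" by auto
      then show "card {i\<in>runs. cc i \<le> d \<and> d < bb i} \<le> width (Q \<inter> Pd n d)" using card_runs_through[OF d] by simp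
    qed simp
    finally have "(\<Sum>i\<in>runs. a i) > M + (\<Sum>i\<in>runs. \<Sum>d\<in>D. m d * (if cc i \<le> d \<and> d < bb i then 1 else 0))"
      using big a by (simp add: A_def)
    from prod_in_relations[OF D finite_runs bc this] show "(\<Prod>i\<in>runs. fvar (bb i, cc i) ^ a i) \<in> J" using rel by blast
  qed
  obtain qs where qs: "set qs = Q" "distinct qs" using finite_distinct_list[OF finQ] by blast
  define us where "us = concat (map (\<lambda>\<alpha>. replicate (lookup e \<alpha>) (piece \<alpha>, \<alpha>)) qs)"
  have in_us: "i = piece \<alpha> \<and> \<alpha> \<in> Q" if "(i, \<alpha>) \<in> set us" for i \<alpha>
    using that qs by (auto simp: us_def)
  have len: "length us = A"
    using sum_list_distinct_conv_sum_set[OF qs(2), of "lookup e"] qs(1)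
    by (simp add: us_def length_concat comp_def A_def)
  have us_tri: "set us \<subseteq> triples"
  proof
    fix z assume "z \<in> set us"
    moreover obtain i \<alpha> where i: "z = (i, \<alpha>)" by (cases z)
    ultimately have "i = piece \<alpha>" "\<alpha> \<in> Q" using in_us[of i \<alpha>] by simp_all
    then have z: "z = (piece \<alpha>, \<alpha>)" "\<alpha> \<in> Q" using i by simp_all
    have "(fst \<alpha>, snd \<alpha>) \<in> PD n D" using Q z(2) by auto
    then show "z \<in> triples"
      using z piece[OF z(2)] lo_hi[OF z(2)] PD_bounds[OF \<open>(fst \<alpha>, snd \<alpha>) \<in> PD n D\<close>]
      by (cases \<alpha>) (auto simp: triples_def Kx_def Ly_def)
  qed
  have us_content: "lookup (content us) \<alpha> = (if \<alpha> \<in> Q then lookup e \<alpha> else 0)" for \<alpha>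
  proof -
    have rep: "content (replicate k (i, \<beta>)) = single \<beta> k" for k \<beta> and i :: "nat \<times> nat \<times> nat"
      by (induction k) (auto simp: content_Cons single_add[symmetric])
    have "content us = sum_list (map (\<lambda>\<beta>. single \<beta> (lookup e \<beta>)) qs)"
      unfolding us_def by (induction qs) (auto simp: content_append rep)
    also have "\<dots> = (\<Sum>\<beta>\<in>Q. single \<beta> (lookup e \<beta>))"
      using sum_list_distinct_conv_sum_set[OF qs(2)] qs(1) by simp
    finally show ?thesis using finQ by (simp add: lookup_sum lookup_single when_def)
  qed
  define e1 where "e1 = e - content us"
  have e_split: "e = e1 + content us"
    by (rule poly_mapping_eqI) (auto simp: e1_def lookup_add lookup_minus us_content)
  define \<mu> where "\<mu> = sum_list (map (\<lambda>(i, k, l). pairmon i k i l) us)"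
  define W where "W = {ws\<in>words_over triples A. sum_list (map (\<lambda>(i, k, l). pairmon i k i l) ws) = \<mu>}"
  have finW: "finite W" unfolding W_def using finite_words_over[OF finite_triples] by simp
  have usW: "us \<in> W" using us_tri len by (auto simp: W_def words_over_def \<mu>_def)
  have le: "content ws \<le> content us" if "ws \<in> W" for ws
  proof (rule content_le)
    show "set ws \<subseteq> triples" using that by (auto simp: W_def words_over_def)
    show "sum_list (map (\<lambda>(i, k, l). pairmon i k i l) ws) = sum_list (map (\<lambda>(i, k, l). pairmon i k i l) us)"
      using that by (simp add: W_def \<mu>_def)
    show "set us \<subseteq> triples" by (rule us_tri)
    fix i \<alpha> \<beta> assume "(i, \<alpha>) \<in> set us" "(i, \<beta>) \<in> set us"
    from in_us[OF this(1)] in_us[OF this(2)] have "\<alpha> \<in> Q" "\<beta> \<in> Q" "piece \<alpha> = piece \<beta>" by simp_all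
    then show "P_le \<alpha> \<beta> \<or> P_le \<beta> \<alpha>" using h_comparable[of \<alpha> \<beta>] piece(2)[of \<alpha>] piece(2)[of \<beta>] by simp
  qed
  let ?s = "\<lambda>ws. single (e1 + content ws) (1::complex)"
  define p where "p = (\<Sum>ws\<in>{ws\<in>W. content ws \<noteq> content us}. ?s ws)"
  define c where "c = (of_nat (card {ws\<in>W. content ws = content us}) :: complex)"
  have e1: "keys e1 \<subseteq> PD n D" using e by (auto simp: e1_def in_keys_iff lookup_minus)
  have "single e1 1 * lookup (generic ^ A) \<mu> \<in> J"
    by (rule stable_idealD(4)[OF J Sym_single[OF e1] genJ])
  also have "single e1 1 * lookup (generic ^ A) \<mu> = (\<Sum>ws\<in>W. ?s ws)"
    unfolding lookup_generic_power W_def[symmetric] prod_list_fvar sum_distrib_left by (simp add: mult_single)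
  also have "\<dots> = (\<Sum>ws\<in>{ws\<in>W. content ws = content us}. ?s ws) + p"
  proof -
    have "W = {ws\<in>W. content ws = content us} \<union> {ws\<in>W. content ws \<noteq> content us}" by auto
    then show ?thesis unfolding p_def using finW by (subst sum.union_disjoint[symmetric]) auto
  qed
  also have "(\<Sum>ws\<in>{ws\<in>W. content ws = content us}. ?s ws) = single e c"
  proof -
    have "(\<Sum>ws\<in>{ws\<in>W. content ws = content us}. ?s ws) = (\<Sum>ws\<in>{ws\<in>W. content ws = content us}. single e 1)"
      by (rule sum.cong) (auto simp: e_split[symmetric])
    also have "\<dots> = single e c"
      unfolding c_def using finW by (intro sum_single_const) simp
    finally show ?thesis .
  qed
  finally have inJ: "single e c + p \<in> J" .
  have "c \<noteq> 0"
  proof -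
    have "us \<in> {ws\<in>W. content ws = content us}" using usW by simp
    then have "card {ws\<in>W. content ws = content us} \<noteq> 0" using finW by (subst card_0_eq) auto
    then show ?thesis unfolding c_def by (simp del: card_0_eq)
  qed
  moreover have "e' < e \<and> degree e' = degree e \<and> keys e' \<subseteq> PD n D" if "e' \<in> keys p" for e'
  proof -
    have "keys p \<subseteq> (\<Union>ws\<in>{ws\<in>W. content ws \<noteq> content us}. keys (?s ws))"
      unfolding p_def using keys_sum[of ?s "{ws\<in>W. content ws \<noteq> content us}"] by simp
    then have "e' \<in> (\<Union>ws\<in>{ws\<in>W. content ws \<noteq> content us}. keys (?s ws))"
      using \<open>e' \<in> keys p\<close> by blast
    then obtain ws where ws: "ws \<in> W" "content ws \<noteq> content us" "e' = e1 + content ws"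
      by (auto split: if_splits)
    have "content ws < content us" using le[OF ws(1)] ws(2) by simp
    then have "e' < e" unfolding ws(3) by (subst e_split) (rule add_strict_left_mono)
    moreover have "degree e' = degree e"
      unfolding ws(3) using ws(1) len by (subst e_split) (auto simp: degree_add degree_content W_def words_over_def)
    moreover have "keys (content ws) \<subseteq> PD n D"
      using ws(1) by (force simp: keys_content W_def words_over_def triples_def)
    ultimately show ?thesis unfolding ws(3) using e1 Poly_Mapping.keys_add[of e1 "content ws"] by blast
  qed
  ultimately show ?thesis using inJ by blast
qed

end

text \<open>The set \<open>S_set\<close> as a set of exponents.\<close>

definition S_exp :: "nat \<Rightarrow> nat set \<Rightarrow> (nat \<Rightarrow> nat) \<Rightarrow> nat \<Rightarrow> (nat \<times> nat \<Rightarrow>\<^sub>0 nat) set" where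
  "S_exp n D m M = {e. keys e \<subseteq> PD n D \<and> (\<forall>Q \<subseteq> PD n D.
     (\<Sum>\<alpha>\<in>Q. lookup e \<alpha>) \<le> M + (\<Sum>d\<in>D. m d * width (Q \<inter> Pd n d)))}"

lemma finite_degree:
  assumes "finite P"
  shows "finite {e. keys e \<subseteq> P \<and> degree e = N}"
proof -
  have "inj_on (\<lambda>e. restrict (lookup e) P) {e. keys e \<subseteq> P \<and> degree e = N}"
  proof (rule inj_onI)
    fix e e' assume e: "e \<in> {e. keys e \<subseteq> P \<and> degree e = N}" "e' \<in> {e. keys e \<subseteq> P \<and> degree e = N}"
      "restrict (lookup e) P = restrict (lookup e') P"
    show "e = e'"
    proof (rule poly_mapping_eqI)
      fix z
      show "lookup e z = lookup e' z"
      proof (cases "z \<in> P")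
        case True
        then show ?thesis using fun_cong[OF e(3), of z] by simp
      next
        case False
        then have "z \<notin> keys e" "z \<notin> keys e'" using e(1,2) by auto
        then show ?thesis by (simp add: in_keys_iff)
      qed
    qed
  qed
  have sub: "(\<lambda>e. restrict (lookup e) P) ` {e. keys e \<subseteq> P \<and> degree e = N} \<subseteq> P \<rightarrow>\<^sub>E {..N}"
  proof (rule image_subsetI)
    fix e assume "e \<in> {e. keys e \<subseteq> P \<and> degree e = N}"
    then have "(\<Sum>\<alpha>\<in>P. lookup e \<alpha>) = N" using degree_superset[OF assms] by auto
    then show "restrict (lookup e) P \<in> P \<rightarrow>\<^sub>E {..N}"
      using member_le_sum[OF _ _ assms, of _ "lookup e"] by auto
  qed
  have "finite (P \<rightarrow>\<^sub>E {..N})" using assms by (intro finite_PiE) auto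
  from finite_subset[OF sub this] \<open>inj_on _ _\<close> show ?thesis by (rule finite_imageD)
qed

text \<open>Straightening does not change the degree, and there are only finitely many exponents of given
  degree, so it terminates.\<close>

lemma monomial_standard_form:
  assumes D: "D \<subseteq> {1..<n}" and J: "stable_ideal n D J" and rel: "relations n D m M \<subseteq> J"
    and e: "keys e \<subseteq> PD n D"
  shows "\<exists>r. single e x - r \<in> J \<and> keys r \<subseteq> S_exp n D m M"
proof -
  define E where "E = {e'. keys e' \<subseteq> PD n D \<and> degree e' = degree e}"
  have finE: "finite E" unfolding E_def by (rule finite_degree[OF finite_PD[OF D]])
  have "\<exists>r. single e' x - r \<in> J \<and> keys r \<subseteq> S_exp n D m M" if "e' \<in> E" for e' x
    using that
  proof (induction "card {f\<in>E. f < e'}" arbitrary: e' x rule: less_induct)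
    case less
    show ?case
    proof (cases "e' \<in> S_exp n D m M")
      case True
      then show ?thesis
        by (intro exI[of _ "single e' x"]) (auto simp: stable_idealD(2)[OF J])
    next
      case False
      have e': "keys e' \<subseteq> PD n D" using less.prems by (simp add: E_def)
      then have "\<not> (\<forall>Q \<subseteq> PD n D. (\<Sum>\<alpha>\<in>Q. lookup e' \<alpha>) \<le> M + (\<Sum>d\<in>D. m d * width (Q \<inter> Pd n d)))"
        using False unfolding S_exp_def by blast
      then obtain Q where Q: "Q \<subseteq> PD n D" "(\<Sum>\<alpha>\<in>Q. lookup e' \<alpha>) > M + (\<Sum>d\<in>D. m d * width (Q \<inter> Pd n d))"
        by (meson not_le)
      have "layered n D Q" by (intro layered.intro D Q(1))
      from layered.straighten[OF this J rel e' Q(2)]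
      obtain p c where pc0: "c \<noteq> 0 \<and> single e' c + p \<in> J \<and>
        (\<forall>f\<in>keys p. f < e' \<and> degree f = degree e' \<and> keys f \<subseteq> PD n D)"
        by blast
      then have pc: "c \<noteq> 0" "single e' c + p \<in> J"
        "\<And>f. f \<in> keys p \<Longrightarrow> f < e' \<and> degree f = degree e' \<and> keys f \<subseteq> PD n D"
        by blast+
      let ?k = "- (x / c)"
      have "\<exists>r. single f (?k * lookup p f) - r \<in> J \<and> keys r \<subseteq> S_exp n D m M"
        if f: "f \<in> keys p" for f
      proof (rule less.hyps)
        show fE: "f \<in> E" using pc(3)[OF f] less.prems by (simp add: E_def)
        have "f < e'" using pc(3)[OF f] by blast
        then have "{g\<in>E. g < f} \<subseteq> {g\<in>E. g < e'}" "f \<in> {g\<in>E. g < e'}" "f \<notin> {g\<in>E. g < f}"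
          using fE by auto
        then have "{g\<in>E. g < f} \<subset> {g\<in>E. g < e'}" by blast
        then show "card {g\<in>E. g < f} < card {g\<in>E. g < e'}" using finE by (intro psubset_card_mono) auto
      qed
      then have "\<forall>f\<in>keys p. \<exists>r. single f (?k * lookup p f) - r \<in> J
          \<and> keys r \<subseteq> S_exp n D m M" by blast
      from bchoice[OF this] obtain r where r:
        "\<And>f. f \<in> keys p \<Longrightarrow> single f (?k * lookup p f) - r f \<in> J"
        "\<And>f. f \<in> keys p \<Longrightarrow> keys (r f) \<subseteq> S_exp n D m M" by blast
      let ?r = "\<Sum>f\<in>keys p. r f"
      have "(\<Sum>f\<in>keys p. single f (?k * lookup p f) - r f) \<in> J"
        by (rule stable_ideal_sum[OF J r(1)])
      also have "(\<Sum>f\<in>keys p. single f (?k * lookup p f) - r f)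
          = single 0 ?k * p - ?r"
      proof -
        have "(\<Sum>f\<in>keys p. single f (?k * lookup p f))
           = single 0 ?k * (\<Sum>f\<in>keys p. single f (lookup p f))"
          by (simp only: sum_distrib_left mult_single add_0)
        also have "(\<Sum>f\<in>keys p. single f (lookup p f)) = p"
          by (rule poly_mapping_expand[symmetric])
        finally show ?thesis by (simp only: sum_subtractf)
      qed
      finally have 1: "single 0 ?k * p - ?r \<in> J" .
      have "single 0 (x / c) * (single e' c + p) \<in> J" by (rule stable_ideal_scale[OF J pc(2)])
      from stable_idealD(3)[OF J this 1]
      have "single 0 (x / c) * (single e' c + p) + (single 0 ?k * p - ?r) \<in> J" .
      also have "single 0 (x / c) * (single e' c + p) + (single 0 ?k * p - ?r)
          = single e' x - ?r"
      proof -
        have "single 0 (x / c) * single e' c = single e' x"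
          using pc(1) by (simp add: mult_single)
        moreover have "single 0 ?k * p = - (single 0 (x / c) * p)"
          by (simp only: single_uminus mult_minus_left)
        ultimately show ?thesis by (simp only: distrib_left) simp
      qed
      finally have "single e' x - ?r \<in> J" .
      moreover have "keys ?r \<subseteq> S_exp n D m M"
        using keys_sum[of r "keys p"] r(2) by blast
      ultimately show ?thesis by blast
    qed
  qed
  then show ?thesis using e by (simp add: E_def)
qed

theorem standard_form:
  assumes D: "D \<subseteq> {1..<n}" and J: "stable_ideal n D J" and rel: "relations n D m M \<subseteq> J"
    and p: "p \<in> Sym n D"
  shows "\<exists>r. p - r \<in> J \<and> keys r \<subseteq> S_exp n D m M"
proof -
  have "\<exists>r. single f (lookup p f) - r \<in> J \<and> keys r \<subseteq> S_exp n D m M"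
    if "f \<in> keys p" for f
    using monomial_standard_form[OF D J rel] p that by (auto simp: Sym_def)
  then have "\<forall>f\<in>keys p. \<exists>r. single f (lookup p f) - r \<in> J
      \<and> keys r \<subseteq> S_exp n D m M" by blast
  from bchoice[OF this] obtain r where r:
    "\<And>f. f \<in> keys p \<Longrightarrow> single f (lookup p f) - r f \<in> J"
    "\<And>f. f \<in> keys p \<Longrightarrow> keys (r f) \<subseteq> S_exp n D m M" by blast
  let ?r = "\<Sum>f\<in>keys p. r f"
  have "(\<Sum>f\<in>keys p. single f (lookup p f) - r f) \<in> J"
    by (rule stable_ideal_sum[OF J r(1)])
  then have "p - ?r \<in> J" by (simp only: sum_subtractf poly_mapping_expand[symmetric])
  moreover have "keys ?r \<subseteq> S_exp n D m M"
    using keys_sum[of r "keys p"] r(2) by blast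
  ultimately show ?thesis by blast
qed

section \<open>A tensor model of the highest weight module\<close>

type_synonym slot = "nat \<times> nat \<times> nat"
type_synonym vec = "(slot \<Rightarrow> nat) \<Rightarrow> complex"

text \<open>A word of length \<open>d\<close> is a function on \<open>{1..d}\<close>; continued by the identity it can be compared with a
  permutation.  \<open>sg d\<close> gives the coordinates of \<open>e_1 \<and> \<dots> \<and> e_d\<close> in the tensor power.\<close>

definition extend_id :: "nat \<Rightarrow> (nat \<Rightarrow> nat) \<Rightarrow> nat \<Rightarrow> nat" where
  "extend_id d g = (\<lambda>r. if r \<in> {1..d} then g r else r)"

definition sg :: "nat \<Rightarrow> (nat \<Rightarrow> nat) \<Rightarrow> complex" where
  "sg d g = (if extend_id d g permutes {1..d} then of_int (sign (extend_id d g)) else 0)"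

lemma sg_nonzero:
  assumes nz: "sg d g \<noteq> 0"
  shows "extend_id d g permutes {1..d}"
proof (rule ccontr)
  assume "\<not> extend_id d g permutes {1..d}"
  from if_not_P[OF this] have "sg d g = 0" unfolding sg_def .
  with nz show False by contradiction
qed

lemma sg_perm:
  assumes "sg d g \<noteq> 0"
  shows "inj_on g {1..d}" "g ` {1..d} = {1..d}"
proof -
  have p: "extend_id d g permutes {1..d}" using assms by (rule sg_nonzero)
  have "g ` {1..d} = extend_id d g ` {1..d}" by (rule image_cong) (auto simp: extend_id_def)
  then show "g ` {1..d} = {1..d}" using permutes_image[OF p] by simp
  have "inj_on g {1..d} = inj_on (extend_id d g) {1..d}"
    by (rule inj_on_cong) (simp only: extend_id_def if_True)
  then show "inj_on g {1..d}" using permutes_inj_on[OF p] by (simp only:)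
qed

lemma sg_id: "(\<And>r. r \<in> {1..d} \<Longrightarrow> g r = r) \<Longrightarrow> sg d g = 1"
proof -
  assume "\<And>r. r \<in> {1..d} \<Longrightarrow> g r = r"
  then have "extend_id d g = id" by (auto simp: extend_id_def)
  then show ?thesis by (simp add: sg_def permutes_id sign_id)
qed

lemma sg_swap:
  assumes "r \<in> {1..d}" "r' \<in> {1..d}" "r \<noteq> r'"
  shows "sg d (g \<circ> Transposition.transpose r r') = - sg d g"
proof -
  have e: "extend_id d (g \<circ> Transposition.transpose r r') = extend_id d g \<circ> Transposition.transpose r r'"
    using assms by (auto simp: extend_id_def Transposition.transpose_def fun_eq_iff)
  have t: "Transposition.transpose r r' permutes {1..d}" using assms by (intro permutes_swap_id)
  show ?thesis
  proof (cases "extend_id d g permutes {1..d}")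
    case True
    then have "permutation (extend_id d g)" by (auto simp: permutation_permutes)
    then show ?thesis
      using True permutes_compose[OF t True] assms(3)
      by (simp add: sg_def e sign_compose permutation_swap_id sign_swap_id)
  next
    case False
    have "\<not> extend_id d g \<circ> Transposition.transpose r r' permutes {1..d}"
    proof
      assume "extend_id d g \<circ> Transposition.transpose r r' permutes {1..d}"
      from permutes_compose[OF t this] have "extend_id d g permutes {1..d}" by (simp add: comp_assoc)
      then show False using False by simp
    qed
    then show ?thesis using False by (simp add: sg_def e)
  qed
qed

text \<open>In coordinates: \<open>E_{i,j}\<close> with \<open>i \<le> d\<close> kills \<open>e_1 \<and> \<dots> \<and> e_d\<close>.  At most two summands are nonzero, and
  these differ by a transposition.\<close>

lemma sg_replace:
  assumes i: "i \<in> {1..d}" and ij: "i \<noteq> j"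
  shows "(\<Sum>r\<in>{1..d}. if g r = i then sg d (g(r := j)) else 0) = 0"
proof (cases "\<exists>r\<in>{1..d}. g r = i \<and> sg d (g(r := j)) \<noteq> 0")
  case False
  then show ?thesis by (intro sum.neutral) auto
next
  case True
  then obtain r where r: "r \<in> {1..d}" "g r = i" "sg d (g(r := j)) \<noteq> 0" by blast
  have inj: "inj_on (g(r := j)) {1..d}" and img: "(g(r := j)) ` {1..d} = {1..d}" using sg_perm[OF r(3)] by blast+
  obtain r' where r': "r' \<in> {1..d}" "(g(r := j)) r' = i" using i img by (metis imageE)
  have ne: "r' \<noteq> r" and gr': "g r' = i" using r' ij by (auto split: if_splits)
  have only: "x = r \<or> x = r'" if x: "x \<in> {1..d}" "g x = i" for x
  proof (cases "x = r")
    case False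
    then have "(g(r := j)) x = (g(r := j)) r'" using x gr' ne by (simp only: fun_upd_apply if_False)
    from inj_onD[OF inj this x(1) r'(1)] show ?thesis by (rule disjI2)
  qed (rule disjI1)
  have "(\<Sum>x\<in>{1..d}. if g x = i then sg d (g(x := j)) else 0) = (\<Sum>x\<in>{r, r'}. if g x = i then sg d (g(x := j)) else 0)"
  proof (rule sum.mono_neutral_right)
    show "\<forall>x\<in>{1..d} - {r, r'}. (if g x = i then sg d (g(x := j)) else 0) = 0"
      using only by (metis (no_types, lifting) DiffE insert_iff)
    show "{r, r'} \<subseteq> {1..d}" using r(1) r'(1) by simp
  qed simp
  also have "\<dots> = sg d (g(r := j)) + sg d (g(r' := j))" using ne r(2) gr' by simp
  also have "g(r' := j) = g(r := j) \<circ> Transposition.transpose r r'"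
    using r(2) gr' ne by (auto simp: Transposition.transpose_def fun_eq_iff)
  also have "sg d (g(r := j) \<circ> Transposition.transpose r r') = - sg d (g(r := j))"
    by (rule sg_swap[OF r(1) r'(1)]) (use ne in simp)
  also have "sg d (g(r := j)) + - sg d (g(r := j)) = 0" by (rule add.right_inverse)
  finally show ?thesis .
qed

text \<open>The tensor product of \<open>m d\<close> copies of the \<open>d\<close>-th exterior power of the natural module, for \<open>d \<in> D\<close>,
  sits inside a tensor power of the natural module.  The tensor factors of the latter are the slots
  \<open>(d, t, r)\<close>: the \<open>r\<close>-th position, \<open>1 \<le> r \<le> d\<close>, of the \<open>t\<close>-th copy for \<open>d\<close>.  A word puts a letter into
  every slot, and vectors are given by their coordinates with respect to words.\<close>

locale model =
  fixes n :: nat and D :: "nat set" and m :: "nat \<Rightarrow> nat"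
  assumes D: "D \<subseteq> {1..<n}"
begin

definition factors :: "(nat \<times> nat) set" where "factors = (SIGMA d:D. {..<m d})"
definition slots :: "slot set" where "slots = (SIGMA d:D. {..<m d} \<times> {1..d})"
definition wds :: "(slot \<Rightarrow> nat) set" where "wds = slots \<rightarrow>\<^sub>E {1..n}"

definition act :: "complex mat \<Rightarrow> vec \<Rightarrow> vec" where
  "act x v w = (if w \<in> wds then \<Sum>c\<in>slots. \<Sum>j\<in>{1..n}. ent x (w c) j * v (w(c := j)) else 0)"

definition top :: vec where
  "top w = (if w \<in> wds then \<Prod>(d, t)\<in>factors. sg d (\<lambda>r. w (d, t, r)) else 0)"

lemma finD: "finite D" using D finite_subset by blast
lemma fin_factors: "finite factors" using finD by (simp add: factors_def)
lemma fin_slots: "finite slots" using finD by (simp add: slots_def)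
lemma fin_wds: "finite wds" unfolding wds_def using fin_slots by (intro finite_PiE) auto

lemma wds_letter: "w \<in> wds \<Longrightarrow> c \<in> slots \<Longrightarrow> 1 \<le> w c \<and> w c \<le> n"
  unfolding wds_def using PiE_mem[of w slots "\<lambda>_. {1..n}" c] by simp

lemma wds_upd: "w \<in> wds \<Longrightarrow> c \<in> slots \<Longrightarrow> 1 \<le> j \<Longrightarrow> j \<le> n \<Longrightarrow> w(c := j) \<in> wds"
  unfolding wds_def by (auto simp: PiE_def extensional_def)

lemma slots_iff: "(d, t, r) \<in> slots \<longleftrightarrow> (d, t) \<in> factors \<and> r \<in> {1..d}"
  by (auto simp: slots_def factors_def)

lemma slots_factors: "slots = (\<lambda>(\<kappa>, r). (fst \<kappa>, snd \<kappa>, r)) ` (SIGMA \<kappa>:factors. {1..fst \<kappa>})"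
  by (force simp: slots_def factors_def image_iff)

lemma sum_slots: "(\<Sum>c\<in>slots. f c) = (\<Sum>\<kappa>\<in>factors. \<Sum>r\<in>{1..fst \<kappa>}. f (fst \<kappa>, snd \<kappa>, r))"
proof -
  have "inj_on (\<lambda>(\<kappa>, r). (fst \<kappa>, snd \<kappa>, r)) (SIGMA \<kappa>:factors. {1..fst \<kappa>})" by (auto simp: inj_on_def)
  then show ?thesis
    unfolding slots_factors using fin_factors
    by (subst sum.reindex) (auto simp: sum.Sigma case_prod_beta)
qed

lemma act_outside: "w \<notin> wds \<Longrightarrow> act x v w = 0"
  by (simp add: act_def)

lemma top_outside: "w \<notin> wds \<Longrightarrow> top w = 0"
  by (simp add: top_def)

lemma act_Emat:
  assumes w: "w \<in> wds" and ij: "1 \<le> i" "i \<le> n" "1 \<le> j" "j \<le> n"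
  shows "act (Emat n i j) v w = (\<Sum>c\<in>slots. if w c = i then v (w(c := j)) else 0)"
proof -
  have "(\<Sum>j'\<in>{1..n}. ent (Emat n i j) (w c) j' * v (w(c := j'))) = (if w c = i then v (w(c := j)) else 0)"
    if "c \<in> slots" for c
  proof -
    have "(\<Sum>j'\<in>{1..n}. ent (Emat n i j) (w c) j' * v (w(c := j')))
        = (\<Sum>j'\<in>{1..n}. if j' = j then (if w c = i then v (w(c := j)) else 0) else 0)"
      by (rule sum.cong) (use wds_letter[OF w that] in \<open>auto simp: ent_Emat\<close>)
    then show ?thesis using ij by simp
  qed
  then show ?thesis using w by (simp add: act_def)
qed

lemma ent_add: "x \<in> carrier_mat n n \<Longrightarrow> y \<in> carrier_mat n n \<Longrightarrow> 1 \<le> a \<Longrightarrow> a \<le> n \<Longrightarrow> 1 \<le> b \<Longrightarrow> b \<le> n \<Longrightarrow>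
    ent (x + y) a b = ent x a b + ent y a b"
  by (auto simp: ent_def)

lemma ent_smult: "x \<in> carrier_mat n n \<Longrightarrow> 1 \<le> a \<Longrightarrow> a \<le> n \<Longrightarrow> 1 \<le> b \<Longrightarrow> b \<le> n \<Longrightarrow>
    ent (s \<cdot>\<^sub>m x) a b = s * ent x a b"
  by (auto simp: ent_def)

lemma ent_mult: "x \<in> carrier_mat n n \<Longrightarrow> y \<in> carrier_mat n n \<Longrightarrow> 1 \<le> a \<Longrightarrow> a \<le> n \<Longrightarrow> 1 \<le> b \<Longrightarrow> b \<le> n \<Longrightarrow>
    ent (x * y) a b = (\<Sum>k\<in>{1..n}. ent x a k * ent y k b)"
proof -
  assume a: "x \<in> carrier_mat n n" "y \<in> carrier_mat n n" "1 \<le> a" "a \<le> n" "1 \<le> b" "b \<le> n"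
  then have "ent (x * y) a b = (\<Sum>k = 0..<n. x $$ (a - 1, k) * y $$ (k, b - 1))"
    by (auto simp: ent_def scalar_prod_def)
  also have "\<dots> = (\<Sum>k\<in>{1..n}. ent x a k * ent y k b)"
    by (rule sum.reindex_bij_witness[where i = "\<lambda>k. k - 1" and j = Suc]) (auto simp: ent_def)
  finally show ?thesis .
qed

lemma act_add: "x \<in> carrier_mat n n \<Longrightarrow> y \<in> carrier_mat n n \<Longrightarrow> act (x + y) v = (\<lambda>w. act x v w + act y v w)"
proof
  fix w assume x: "x \<in> carrier_mat n n" and y: "y \<in> carrier_mat n n"
  show "act (x + y) v w = act x v w + act y v w"
  proof (cases "w \<in> wds")
    case True
    have "(\<Sum>c\<in>slots. \<Sum>j\<in>{1..n}. ent (x + y) (w c) j * v (w(c := j)))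
       = (\<Sum>c\<in>slots. \<Sum>j\<in>{1..n}. ent x (w c) j * v (w(c := j)) + ent y (w c) j * v (w(c := j)))"
      by (intro sum.cong refl) (use wds_letter[OF True] x y in \<open>simp add: ent_add distrib_right\<close>)
    then show ?thesis using True by (simp add: act_def sum.distrib)
  qed (simp add: act_outside)
qed

lemma act_smult: "x \<in> carrier_mat n n \<Longrightarrow> act (s \<cdot>\<^sub>m x) v = (\<lambda>w. s * act x v w)"
proof
  fix w assume x: "x \<in> carrier_mat n n"
  show "act (s \<cdot>\<^sub>m x) v w = s * act x v w"
  proof (cases "w \<in> wds")
    case True
    have "(\<Sum>c\<in>slots. \<Sum>j\<in>{1..n}. ent (s \<cdot>\<^sub>m x) (w c) j * v (w(c := j)))
       = (\<Sum>c\<in>slots. \<Sum>j\<in>{1..n}. s * (ent x (w c) j * v (w(c := j))))"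
      by (intro sum.cong refl) (use wds_letter[OF True] x in \<open>simp add: ent_smult mult.assoc\<close>)
    then show ?thesis using True by (simp add: act_def sum_distrib_left)
  qed (simp add: act_outside)
qed

lemma act_vadd: "act x (\<lambda>w. u w + v w) = (\<lambda>w. act x u w + act x v w)"
  by (rule ext) (simp add: act_def distrib_left sum.distrib)

lemma act_vsmult: "act x (\<lambda>w. s * v w) = (\<lambda>w. s * act x v w)"
  by (rule ext) (simp add: act_def sum_distrib_left mult.left_commute)

lemma act_vzero: "act x (\<lambda>w. 0) = (\<lambda>w. 0)"
  by (rule ext) (simp add: act_def)

text \<open>The contributions in which \<open>x\<close> and \<open>y\<close> act on different slots cancel; on one slot the difference
  is given by the commutator.\<close>

lemma act_commutator:
  assumes x: "x \<in> carrier_mat n n" and y: "y \<in> carrier_mat n n"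
  shows "act (commutator x y) v = (\<lambda>w. act x (act y v) w - act y (act x v) w)"
proof
  fix w
  show "act (commutator x y) v w = act x (act y v) w - act y (act x v) w"
  proof (cases "w \<in> wds")
    case False then show ?thesis by (simp add: act_outside)
  next
    case w: True
    let ?N = "{1..n}"
    define off where "off x y = (\<Sum>c\<in>slots. \<Sum>j\<in>?N. \<Sum>c'\<in>slots - {c}. \<Sum>j'\<in>?N.
        ent x (w c) j * (ent y (w c') j' * v (w(c := j, c' := j'))))" for x y
    define on where "on x y = (\<Sum>c\<in>slots. \<Sum>j'\<in>?N. ent (x * y) (w c) j' * v (w(c := j')))" for x y
    have comp: "act x (act y v) w = on x y + off x y" if xy: "x \<in> carrier_mat n n" "y \<in> carrier_mat n n" for x y
    proof -
      have "act x (act y v) w = (\<Sum>c\<in>slots. \<Sum>j\<in>?N. ent x (w c) j * act y v (w(c := j)))"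
        using w by (simp add: act_def[of x])
      also have "\<dots> = (\<Sum>c\<in>slots. \<Sum>j\<in>?N. ent x (w c) j * (\<Sum>j'\<in>?N. ent y j j' * v (w(c := j')))
           + (\<Sum>c'\<in>slots - {c}. \<Sum>j'\<in>?N. ent x (w c) j * (ent y (w c') j' * v (w(c := j, c' := j')))))"
      proof (intro sum.cong refl)
        fix c j assume c: "c \<in> slots" and j: "j \<in> ?N"
        have "act y v (w(c := j)) = (\<Sum>c'\<in>slots. \<Sum>j'\<in>?N. ent y ((w(c := j)) c') j' * v (w(c := j, c' := j')))"
          using wds_upd[OF w c] j by (simp add: act_def)
        also have "\<dots> = (\<Sum>j'\<in>?N. ent y j j' * v (w(c := j')))
            + (\<Sum>c'\<in>slots - {c}. \<Sum>j'\<in>?N. ent y (w c') j' * v (w(c := j, c' := j')))"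
          using c fin_slots by (subst sum.remove[of _ c]) (auto intro!: sum.cong)
        finally show "ent x (w c) j * act y v (w(c := j)) = ent x (w c) j * (\<Sum>j'\<in>?N. ent y j j' * v (w(c := j')))
           + (\<Sum>c'\<in>slots - {c}. \<Sum>j'\<in>?N. ent x (w c) j * (ent y (w c') j' * v (w(c := j, c' := j'))))"
          by (simp only: distrib_left sum_distrib_left)
      qed
      also have "\<dots> = (\<Sum>c\<in>slots. \<Sum>j\<in>?N. ent x (w c) j * (\<Sum>j'\<in>?N. ent y j j' * v (w(c := j')))) + off x y"
        by (simp only: sum.distrib off_def)
      also have "(\<Sum>c\<in>slots. \<Sum>j\<in>?N. ent x (w c) j * (\<Sum>j'\<in>?N. ent y j j' * v (w(c := j')))) = on x y"
        unfolding on_def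
      proof (rule sum.cong[OF refl])
        fix c assume c: "c \<in> slots"
        have "(\<Sum>j\<in>?N. ent x (w c) j * (\<Sum>j'\<in>?N. ent y j j' * v (w(c := j'))))
           = (\<Sum>j'\<in>?N. \<Sum>j\<in>?N. ent x (w c) j * ent y j j' * v (w(c := j')))"
          by (subst sum.swap) (simp only: sum_distrib_left mult.assoc)
        also have "\<dots> = (\<Sum>j'\<in>?N. ent (x * y) (w c) j' * v (w(c := j')))"
          by (intro sum.cong refl) (use wds_letter[OF w c] xy in \<open>simp add: ent_mult sum_distrib_right\<close>)
        finally show "(\<Sum>j\<in>?N. ent x (w c) j * (\<Sum>j'\<in>?N. ent y j j' * v (w(c := j')))) = (\<Sum>j'\<in>?N. ent (x * y) (w c) j' * v (w(c := j')))" .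
      qed
      finally show ?thesis .
    qed
    have off_sym: "off x y = off y x"
    proof -
      let ?P = "SIGMA c:slots. ?N \<times> (SIGMA c':slots - {c}. ?N)"
      have flat: "off x y = (\<Sum>(c, j, c', j')\<in>?P. ent x (w c) j * (ent y (w c') j' * v (w(c := j, c' := j'))))" for x y
        unfolding off_def using fin_slots by (simp add: sum.Sigma sum.cartesian_product case_prod_beta)
      show ?thesis unfolding flat
      proof (rule sum.reindex_bij_witness[where i = "\<lambda>(c, j, c', j'). (c', j', c, j)" and j = "\<lambda>(c, j, c', j'). (c', j', c, j)"])
        fix z assume z: "z \<in> ?P"
        obtain c j c' j' where zz: "z = (c, j, c', j')" by (rule prod_cases4)
        have "c' \<noteq> c" using z by (simp add: zz)
        then have "w(c' := j', c := j) = w(c := j, c' := j')" by (rule fun_upd_twist)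
        then show "(case case z of (c, j, c', j') \<Rightarrow> (c', j', c, j) of
            (c, j, c', j') \<Rightarrow> ent y (w c) j * (ent x (w c') j' * v (w(c := j, c' := j'))))
          = (case z of (c, j, c', j') \<Rightarrow> ent x (w c) j * (ent y (w c') j' * v (w(c := j, c' := j'))))"
          by (simp add: zz)
      qed auto
    qed
    have "act (commutator x y) v w = (\<Sum>c\<in>slots. \<Sum>j\<in>?N. ent (x * y) (w c) j * v (w(c := j)) - ent (y * x) (w c) j * v (w(c := j)))"
    proof -
      have "ent (commutator x y) a b = ent (x * y) a b - ent (y * x) a b" if "1 \<le> a" "a \<le> n" "1 \<le> b" "b \<le> n" for a b
      proof -
        have "a - 1 < dim_row (y * x)" "b - 1 < dim_col (y * x)" using that x y by auto
        then show ?thesis unfolding commutator_def ent_def by (rule index_minus_mat(1))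
      qed
      then show ?thesis using w wds_letter[OF w] by (simp add: act_def left_diff_distrib)
    qed
    also have "\<dots> = on x y - on y x" by (simp add: on_def sum_subtractf)
    finally show ?thesis using comp[OF x y] comp[OF y x] off_sym by simp
  qed
qed

subsection \<open>The highest weight vector\<close>

lemma top_upd:
  assumes w: "w \<in> wds" and \<kappa>: "(d, t) \<in> factors" and r: "r \<in> {1..d}" and j: "1 \<le> j" "j \<le> n"
  shows "top (w((d, t, r) := j)) = sg d ((\<lambda>r. w (d, t, r))(r := j)) * (\<Prod>(d', t')\<in>factors - {(d, t)}. sg d' (\<lambda>r. w (d', t', r)))"
proof -
  have "w((d, t, r) := j) \<in> wds" using wds_upd[OF w _ j] \<kappa> r by (simp add: slots_iff)
  then have "top (w((d, t, r) := j)) = (\<Prod>(d', t')\<in>factors. sg d' (\<lambda>r'. (w((d, t, r) := j)) (d', t', r')))"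
    by (simp add: top_def)
  also have "\<dots> = sg d (\<lambda>r'. (w((d, t, r) := j)) (d, t, r'))
      * (\<Prod>(d', t')\<in>factors - {(d, t)}. sg d' (\<lambda>r'. (w((d, t, r) := j)) (d', t', r')))"
    using prod.remove[OF fin_factors \<kappa>, of "\<lambda>(d', t'). sg d' (\<lambda>r'. (w((d, t, r) := j)) (d', t', r'))"] by simp
  also have "(\<lambda>r'. (w((d, t, r) := j)) (d, t, r')) = (\<lambda>r. w (d, t, r))(r := j)" by auto
  also have "(\<Prod>(d', t')\<in>factors - {(d, t)}. sg d' (\<lambda>r'. (w((d, t, r) := j)) (d', t', r')))
      = (\<Prod>(d', t')\<in>factors - {(d, t)}. sg d' (\<lambda>r. w (d', t', r)))"
  proof (rule prod.cong[OF refl])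
    fix \<kappa>' assume "\<kappa>' \<in> factors - {(d, t)}"
    then have "(w((d, t, r) := j)) (fst \<kappa>', snd \<kappa>', r') = w (fst \<kappa>', snd \<kappa>', r')" for r'
      by (cases \<kappa>') auto
    then show "(case \<kappa>' of (d', t') \<Rightarrow> sg d' (\<lambda>r'. (w((d, t, r) := j)) (d', t', r')))
        = (case \<kappa>' of (d', t') \<Rightarrow> sg d' (\<lambda>r. w (d', t', r)))" by (simp only: case_prod_beta)
  qed
  finally show ?thesis .
qed

lemma factor_replace:
  assumes w: "w \<in> wds" and \<kappa>: "(d, t) \<in> factors" and i: "1 \<le> i" "i \<le> d" and j: "1 \<le> j" "j \<le> n" "i \<noteq> j"
  shows "(\<Sum>r\<in>{1..d}. if w (d, t, r) = i then top (w((d, t, r) := j)) else 0) = 0"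
proof -
  let ?g = "\<lambda>r. w (d, t, r)" and ?R = "\<Prod>(d', t')\<in>factors - {(d, t)}. sg d' (\<lambda>r. w (d', t', r))"
  have "(\<Sum>r\<in>{1..d}. if w (d, t, r) = i then top (w((d, t, r) := j)) else 0)
      = (\<Sum>r\<in>{1..d}. (if ?g r = i then sg d (?g(r := j)) else 0) * ?R)"
    by (rule sum.cong[OF refl]) (use top_upd[OF w \<kappa> _ j(1,2)] in auto)
  also have "\<dots> = 0"
    unfolding sum_distrib_right[symmetric] using sg_replace[of i d j ?g] i j by simp
  finally show ?thesis .
qed

lemma top_perm:
  assumes "top w \<noteq> 0" "(d, t) \<in> factors"
  shows "inj_on (\<lambda>r. w (d, t, r)) {1..d}" "(\<lambda>r. w (d, t, r)) ` {1..d} = {1..d}"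
proof -
  have "w \<in> wds" using assms(1) top_outside by blast
  then have "(\<Prod>(d, t)\<in>factors. sg d (\<lambda>r. w (d, t, r))) \<noteq> 0" using assms(1) by (simp add: top_def)
  then have "sg d (\<lambda>r. w (d, t, r)) \<noteq> 0" using assms(2) fin_factors by (auto simp: prod_zero_iff)
  then show "inj_on (\<lambda>r. w (d, t, r)) {1..d}" "(\<lambda>r. w (d, t, r)) ` {1..d} = {1..d}"
    using sg_perm by blast+
qed

text \<open>On the orbit of \<open>top\<close> under \<open>E_{i,j}\<close> only the factors with \<open>j \<le> d < i\<close> contribute: in the others the
  letter \<open>i\<close> belongs to the factor already, or the letter \<open>j\<close> does not occur.\<close>

definition act_on :: "nat \<Rightarrow> nat \<Rightarrow> vec \<Rightarrow> vec" where
  "act_on i j v w = (if w \<in> wds then \<Sum>c\<in>{c\<in>slots. j \<le> fst c \<and> fst c < i}. if w c = i then v (w(c := j)) else 0 else 0)"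

lemma act_on_at:
  "w \<in> wds \<Longrightarrow> act_on i j v w = (\<Sum>c\<in>{c\<in>slots. j \<le> fst c \<and> fst c < i}. if w c = i then v (w(c := j)) else 0)"
  by (simp add: act_on_def)

lemma act_on_power:
  assumes ij: "1 \<le> i" "i \<le> n" "1 \<le> j" "j \<le> n" "i \<noteq> j"
  shows "(act (Emat n i j) ^^ a) top = (act_on i j ^^ a) top \<and>
    (\<forall>w d t. w \<in> wds \<longrightarrow> (d, t) \<in> factors \<longrightarrow> \<not> (j \<le> d \<and> d < i) \<longrightarrow>
      (\<Sum>r\<in>{1..d}. if w (d, t, r) = i then (act_on i j ^^ a) top (w((d, t, r) := j)) else 0) = 0)"
proof (induction a)
  case 0
  have "(\<Sum>r\<in>{1..d}. if w (d, t, r) = i then top (w((d, t, r) := j)) else 0) = 0"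
    if "w \<in> wds" "(d, t) \<in> factors" "d < j" for w d t
  proof (rule sum.neutral, clarify)
    fix r assume r: "r \<in> {1..d}"
    have "top (w((d, t, r) := j)) = 0"
    proof (rule ccontr)
      assume "top (w((d, t, r) := j)) \<noteq> 0"
      from top_perm(2)[OF this that(2)] have "(w((d, t, r) := j)) (d, t, r) \<in> {1..d}" using r by blast
      then show False using that(3) by simp
    qed
    then show "(if w (d, t, r) = i then top (w((d, t, r) := j)) else 0) = 0" by simp
  qed
  then have "(\<Sum>r\<in>{1..d}. if w (d, t, r) = i then top (w((d, t, r) := j)) else 0) = 0"
    if "w \<in> wds" "(d, t) \<in> factors" "\<not> (j \<le> d \<and> d < i)" for w d t
    using that factor_replace[OF that(1,2) ij(1) _ ij(3,4,5)] by (cases "d < j") simp_all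
  then show ?case unfolding funpow_0 by blast
next
  case (Suc a)
  let ?v = "(act_on i j ^^ a) top"
  have van: "(\<Sum>r\<in>{1..d}. if w (d, t, r) = i then ?v (w((d, t, r) := j)) else 0) = 0"
    if "w \<in> wds" "(d, t) \<in> factors" "\<not> (j \<le> d \<and> d < i)" for w d t
    using conjunct2[OF Suc.IH] that by blast
  have "act (Emat n i j) ?v w = act_on i j ?v w" for w
  proof (cases "w \<in> wds")
    case True
    let ?f = "\<lambda>c. if w c = i then ?v (w(c := j)) else 0"
    have "act (Emat n i j) ?v w = (\<Sum>\<kappa>\<in>factors. \<Sum>r\<in>{1..fst \<kappa>}. ?f (fst \<kappa>, snd \<kappa>, r))"
      unfolding act_Emat[OF True ij(1-4)] by (rule sum_slots)
    also have "\<dots> = (\<Sum>\<kappa>\<in>factors. if j \<le> fst \<kappa> \<and> fst \<kappa> < i then \<Sum>r\<in>{1..fst \<kappa>}. ?f (fst \<kappa>, snd \<kappa>, r) else 0)"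
      by (rule sum.cong[OF refl]) (use van[OF True] in auto)
    also have "\<dots> = (\<Sum>\<kappa>\<in>factors. \<Sum>r\<in>{1..fst \<kappa>}. if j \<le> fst \<kappa> \<and> fst \<kappa> < i then ?f (fst \<kappa>, snd \<kappa>, r) else 0)"
      by (intro sum.cong refl) auto
    also have "\<dots> = (\<Sum>c\<in>slots. if j \<le> fst c \<and> fst c < i then ?f c else 0)"
      using sum_slots[of "\<lambda>c. if j \<le> fst c \<and> fst c < i then ?f c else 0"] by simp
    also have "\<dots> = (\<Sum>c\<in>{c\<in>slots. j \<le> fst c \<and> fst c < i}. ?f c)"
      using fin_slots by (simp only: sum.inter_filter)
    finally show ?thesis using True by (simp add: act_on_def)
  qed (simp add: act_outside act_on_def)
  then have 1: "(act (Emat n i j) ^^ Suc a) top = (act_on i j ^^ Suc a) top" using Suc.IH by auto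
  have 2: "(\<Sum>r\<in>{1..d}. if w (d, t, r) = i then act_on i j ?v (w((d, t, r) := j)) else 0) = 0"
    if w: "w \<in> wds" and \<kappa>: "(d, t) \<in> factors" and nd: "\<not> (j \<le> d \<and> d < i)" for w d t
  proof -
    let ?S = "{c\<in>slots. j \<le> fst c \<and> fst c < i}"
    have "(\<Sum>r\<in>{1..d}. if w (d, t, r) = i then act_on i j ?v (w((d, t, r) := j)) else 0)
        = (\<Sum>r\<in>{1..d}. \<Sum>c\<in>?S. if w c = i then (if w (d, t, r) = i then ?v (w(c := j, (d, t, r) := j)) else 0) else 0)"
    proof (rule sum.cong[OF refl])
      fix r assume r: "r \<in> {1..d}"
      have w': "w((d, t, r) := j) \<in> wds" using wds_upd[OF w] \<kappa> r ij by (simp add: slots_iff)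
      have ne: "c \<noteq> (d, t, r)" if "c \<in> ?S" for c using that nd by auto
      have "act_on i j ?v (w((d, t, r) := j)) = (\<Sum>c\<in>?S. if w c = i then ?v (w(c := j, (d, t, r) := j)) else 0)"
        unfolding act_on_at[OF w']
      proof (rule sum.cong[OF refl])
        fix c assume "c \<in> ?S"
        note c = ne[OF this]
        show "(if (w((d, t, r) := j)) c = i then ?v (w((d, t, r) := j, c := j)) else 0)
            = (if w c = i then ?v (w(c := j, (d, t, r) := j)) else 0)"
          by (simp only: fun_upd_other[OF c] fun_upd_twist[OF c])
      qed
      then show "(if w (d, t, r) = i then act_on i j ?v (w((d, t, r) := j)) else 0)
         = (\<Sum>c\<in>?S. if w c = i then (if w (d, t, r) = i then ?v (w(c := j, (d, t, r) := j)) else 0) else 0)"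
        by (cases "w (d, t, r) = i") (simp_all only: if_True if_False if_cancel sum.neutral_const simp_thms)
    qed
    also have "\<dots> = (\<Sum>c\<in>?S. \<Sum>r\<in>{1..d}. if w c = i then (if w (d, t, r) = i then ?v (w(c := j, (d, t, r) := j)) else 0) else 0)"
      by (rule sum.swap)
    also have "\<dots> = 0"
    proof (rule sum.neutral, rule ballI)
      fix c assume c: "c \<in> ?S"
      have cs: "c \<in> slots" and cb: "j \<le> fst c \<and> fst c < i" using c by blast+
      have "w(c := j) \<in> wds" by (rule wds_upd[OF w cs ij(3,4)])
      from van[OF this \<kappa> nd]
      have "(\<Sum>r\<in>{1..d}. if (w(c := j)) (d, t, r) = i then ?v (w(c := j, (d, t, r) := j)) else 0) = 0" .
      moreover have "(w(c := j)) (d, t, r) = w (d, t, r)" for r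
      proof -
        have "(d, t, r) \<noteq> c" using cb nd by (metis fst_conv)
        then show ?thesis by (rule fun_upd_other)
      qed
      ultimately show "(\<Sum>r\<in>{1..d}. if w c = i then (if w (d, t, r) = i then ?v (w(c := j, (d, t, r) := j)) else 0) else 0) = 0"
        by (cases "w c = i") auto
    qed
    finally show ?thesis .
  qed
  have 3: "(act_on i j ^^ Suc a) top = act_on i j ?v" by simp
  show ?case unfolding 3 using 1[unfolded 3] 2 by blast
qed

lemma act_on_support:
  assumes ij: "i \<noteq> j" "1 \<le> j" "j \<le> n" and nz: "(act_on i j ^^ a) v w \<noteq> 0" and w: "w \<in> wds"
  shows "\<exists>T\<subseteq>{c\<in>slots. j \<le> fst c \<and> fst c < i}. card T = a \<and> v (\<lambda>c. if c \<in> T then j else w c) \<noteq> 0 \<and> (\<forall>c\<in>T. w c = i)"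
  using nz w
proof (induction a arbitrary: w)
  case 0
  then show ?case by (intro exI[of _ "{}"]) auto
next
  case (Suc a)
  let ?S = "{c\<in>slots. j \<le> fst c \<and> fst c < i}"
  have "(\<Sum>c\<in>?S. if w c = i then (act_on i j ^^ a) v (w(c := j)) else 0) \<noteq> 0"
    using Suc.prems(1) unfolding funpow.simps comp_apply act_on_at[OF Suc.prems(2)] .
  then obtain c where c0: "c \<in> ?S" and "(if w c = i then (act_on i j ^^ a) v (w(c := j)) else 0) \<noteq> 0"
    by (rule sum.not_neutral_contains_not_neutral)
  then have c: "c \<in> ?S" "w c = i" "(act_on i j ^^ a) v (w(c := j)) \<noteq> 0"
    by (simp_all only: simp_thms split: if_split_asm)
  have "w(c := j) \<in> wds" using wds_upd[OF Suc.prems(2)] c(1) ij by auto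
  from Suc.IH[OF c(3) this] obtain T where T: "T \<subseteq> ?S" "card T = a"
    "v (\<lambda>x. if x \<in> T then j else (w(c := j)) x) \<noteq> 0" "\<forall>x\<in>T. (w(c := j)) x = i" by blast
  have cT: "c \<notin> T" using T(4) ij(1) by auto
  have finT: "finite T" by (rule finite_subset[OF T(1)]) (simp add: fin_slots)
  have e: "(\<lambda>x. if x \<in> T then j else (w(c := j)) x) = (\<lambda>x. if x \<in> insert c T then j else w x)" by auto
  have "w x = i" if "x \<in> insert c T" for x using T(4) that c(2) cT by (cases "x = c") auto
  moreover have "insert c T \<subseteq> ?S" using T(1) c(1) by (simp only: insert_subset)
  moreover have "card (insert c T) = Suc a" using finT cT T(2) by simp
  ultimately show ?case using T(3)[unfolded e] by blast
qed

text \<open>Every factor with \<open>j \<le> d < i\<close> contains the letter \<open>j\<close> once, so that the replacement can be made at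
  most once in each of them.\<close>

lemma act_power_top:
  assumes ij: "1 \<le> i" "i \<le> n" "1 \<le> j" "j \<le> n" "i \<noteq> j"
    and a: "a > (\<Sum>d\<in>D. m d * (if j \<le> d \<and> d < i then 1 else 0))"
  shows "(act (Emat n i j) ^^ a) top = (\<lambda>_. 0)"
proof (rule ext, rule ccontr)
  fix w assume nz: "(act (Emat n i j) ^^ a) top w \<noteq> 0"
  then have nz': "(act_on i j ^^ a) top w \<noteq> 0" using act_on_power[OF ij] by simp
  have w: "w \<in> wds"
  proof (cases a)
    case 0 then show ?thesis using a by simp
  next
    case (Suc a')
    then show ?thesis using nz act_outside by fastforce
  qed
  obtain T where T: "T \<subseteq> {c\<in>slots. j \<le> fst c \<and> fst c < i}" "card T = a"
    "top (\<lambda>c. if c \<in> T then j else w c) \<noteq> 0" using act_on_support[OF ij(5) ij(3,4) nz' w] by blast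
  let ?p = "\<lambda>c :: slot. (fst c, fst (snd c))"
  have "inj_on ?p T"
  proof (rule inj_onI)
    fix c c' assume c: "c \<in> T" "c' \<in> T" "?p c = ?p c'"
    obtain d t r where cd: "c = (d, t, r)" by (cases c)
    obtain r' where cd': "c' = (d, t, r')" using c(3) cd by (cases c') auto
    have "(d, t) \<in> factors" "r \<in> {1..d}" "r' \<in> {1..d}" using T(1) c cd cd' by (auto simp: slots_iff)
    moreover have "(if (d, t, r) \<in> T then j else w (d, t, r)) = (if (d, t, r') \<in> T then j else w (d, t, r'))"
      using c cd cd' by simp
    ultimately have "r = r'" using inj_onD[OF top_perm(1)[OF T(3), of d t]] by blast
    then show "c = c'" using cd cd' by simp
  qed
  moreover have "?p ` T \<subseteq> (SIGMA d:{d\<in>D. j \<le> d \<and> d < i}. {..<m d})"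
    using T(1) by (auto simp: slots_def)
  ultimately have "card T \<le> card (SIGMA d:{d\<in>D. j \<le> d \<and> d < i}. {..<m d})"
    using finD by (intro card_inj_on_le) auto
  also have "\<dots> = (\<Sum>d\<in>D. m d * (if j \<le> d \<and> d < i then 1 else 0))"
    using finD by (simp add: sum.inter_filter) (intro sum.cong refl, auto)
  finally show False using T(2) a by simp
qed

lemma act_top_0:
  assumes ij: "1 \<le> i" "i \<le> n" "1 \<le> j" "j \<le> n" "i \<noteq> j" and none: "\<not> (\<exists>d\<in>D. j \<le> d \<and> d < i)"
  shows "act (Emat n i j) top = (\<lambda>_. 0)"
proof -
  have "(\<Sum>d\<in>D. m d * (if j \<le> d \<and> d < i then 1 else 0)) = 0" using none by (intro sum.neutral) auto
  then show ?thesis using act_power_top[OF ij, of 1] by simp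
qed

lemma act_coroot_top:
  assumes k: "k \<in> {1..<n}"
  shows "act (Emat n k k - Emat n (k + 1) (k + 1)) top = (\<lambda>w. of_nat (weight_pair D m (k, k)) * top w)"
proof
  fix w
  let ?H = "Emat n k k - Emat n (k + 1) (k + 1)"
  show "act ?H top w = of_nat (weight_pair D m (k, k)) * top w"
  proof (cases "w \<in> wds")
    case w: True
    have entH: "ent ?H a b = (if a = b then (if a = k then 1 else 0) - (if a = k + 1 then 1 else 0) else 0)"
      if "1 \<le> a" "a \<le> n" "1 \<le> b" "b \<le> n" for a b
    proof -
      have "ent ?H a b = ent (Emat n k k) a b - ent (Emat n (k + 1) (k + 1)) a b"
        using that by (auto simp: ent_def Emat_def)
      then show ?thesis using that by (simp add: ent_Emat)
    qed
    have "act ?H top w = (\<Sum>c\<in>slots. ((if w c = k then 1 else 0) - (if w c = k + 1 then 1 else 0)) * top w)"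
    proof -
      have "(\<Sum>j\<in>{1..n}. ent ?H (w c) j * top (w(c := j))) = ((if w c = k then 1 else 0) - (if w c = k + 1 then 1 else 0)) * top w"
        if c: "c \<in> slots" for c
      proof -
        have "(\<Sum>j\<in>{1..n}. ent ?H (w c) j * top (w(c := j)))
           = (\<Sum>j\<in>{1..n}. if j = w c then ((if w c = k then 1 else 0) - (if w c = k + 1 then 1 else 0)) * top w else 0)"
          by (rule sum.cong[OF refl]) (use wds_letter[OF w c] entH in auto)
        then show ?thesis using wds_letter[OF w c] by simp
      qed
      then show ?thesis using w by (simp add: act_def)
    qed
    also have "\<dots> = of_nat (weight_pair D m (k, k)) * top w"
    proof (cases "top w = 0")
      case False
      have cnt: "(\<Sum>r\<in>{1..d}. if w (d, t, r) = x then 1 else (0::complex)) = (if x \<le> d then 1 else 0)"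
        if "(d, t) \<in> factors" "1 \<le> x" for d t x
      proof -
        have "(\<Sum>y\<in>(\<lambda>r. w (d, t, r)) ` {1..d}. if y = x then 1 else 0) = (\<Sum>r\<in>{1..d}. if w (d, t, r) = x then 1 else (0::complex))"
          using sum.reindex[OF top_perm(1)[OF False that(1)], of "\<lambda>y. if y = x then 1 else (0::complex)"]
          by (simp only: comp_def)
        then show ?thesis using top_perm(2)[OF False that(1)] that(2) by simp
      qed
      have "(\<Sum>c\<in>slots. (if w c = k then 1 else 0) - (if w c = k + 1 then 1 else (0::complex)))
         = (\<Sum>\<kappa>\<in>factors. (if k \<le> fst \<kappa> then 1 else 0) - (if k + 1 \<le> fst \<kappa> then 1 else 0))"
        unfolding sum_slots by (rule sum.cong[OF refl]) (use cnt k in \<open>auto simp: sum_subtractf\<close>)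
      also have "\<dots> = (\<Sum>\<kappa>\<in>factors. if fst \<kappa> = k then 1 else 0)" by (rule sum.cong) auto
      also have "\<dots> = (\<Sum>d\<in>D. of_nat (m d) * (if d = k then 1 else 0))"
      proof -
        have "(\<Sum>\<kappa>\<in>factors. if fst \<kappa> = k then 1 else (0::complex)) = (\<Sum>(d, t)\<in>(SIGMA d:D. {..<m d}). if d = k then 1 else 0)"
          unfolding factors_def by (rule sum.cong) auto
        also have "\<dots> = (\<Sum>d\<in>D. \<Sum>t\<in>{..<m d}. if d = k then 1 else 0)" using finD by (subst sum.Sigma) auto
        finally show ?thesis by simp
      qed
      also have "\<dots> = of_nat (weight_pair D m (k, k))"
        by (auto simp: weight_pair_def intro!: sum.cong)
      finally show ?thesis by (simp add: sum_distrib_right[symmetric])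
    qed simp
    finally show ?thesis .
  qed (simp add: act_outside top_outside)
qed

subsection \<open>The hermitian form\<close>

text \<open>A contravariant hermitian form: \<open>x\<close> and its conjugate transpose \<open>adj x\<close> act by adjoint operators.\<close>

definition ip :: "vec \<Rightarrow> vec \<Rightarrow> complex" where
  "ip u v = (\<Sum>w\<in>wds. u w * cnj (v w))"

definition adj :: "complex mat \<Rightarrow> complex mat" where
  "adj x = mat n n (\<lambda>(i, j). cnj (x $$ (j, i)))"

lemma adj_sl: "x \<in> sl n \<Longrightarrow> adj x \<in> sl n"
proof -
  assume "x \<in> sl n"
  then have "cnj (\<Sum>i<n. x $$ (i, i)) = 0" by (simp add: sl_def)
  then show ?thesis by (simp add: sl_def adj_def)
qed

lemma ip_act: "ip (act x u) v = ip u (act (adj x) v)"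
proof -
  have "ip (act x u) v = (\<Sum>w\<in>wds. \<Sum>c\<in>slots. \<Sum>j\<in>{1..n}. ent x (w c) j * u (w(c := j)) * cnj (v w))"
    unfolding ip_def by (rule sum.cong) (auto simp: act_def sum_distrib_right)
  also have "\<dots> = (\<Sum>c\<in>slots. \<Sum>w\<in>wds. \<Sum>j\<in>{1..n}. ent x (w c) j * u (w(c := j)) * cnj (v w))"
    by (rule sum.swap)
  also have "\<dots> = (\<Sum>c\<in>slots. \<Sum>w\<in>wds. \<Sum>j\<in>{1..n}. u w * cnj (ent (adj x) (w c) j * v (w(c := j))))"
  proof (rule sum.cong[OF refl])
    fix c assume c: "c \<in> slots"
    have "(\<Sum>(w, j)\<in>wds \<times> {1..n}. ent x (w c) j * u (w(c := j)) * cnj (v w))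
       = (\<Sum>(w, j)\<in>wds \<times> {1..n}. u w * cnj (ent (adj x) (w c) j * v (w(c := j))))"
    proof (rule sum.reindex_bij_witness[where i = "\<lambda>(w, j). (w(c := j), w c)" and j = "\<lambda>(w, j). (w(c := j), w c)"])
      show "(case case z of (w, j) \<Rightarrow> (w(c := j), w c) of (w, j) \<Rightarrow> (w(c := j), w c)) = z" for z :: "(slot \<Rightarrow> nat) \<times> nat"
        by (cases z) simp
      then show "(case case z of (w, j) \<Rightarrow> (w(c := j), w c) of (w, j) \<Rightarrow> (w(c := j), w c)) = z" for z :: "(slot \<Rightarrow> nat) \<times> nat" .
      show "(case z of (w, j) \<Rightarrow> (w(c := j), w c)) \<in> wds \<times> {1..n}" if z: "z \<in> wds \<times> {1..n}" for z
      proof -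
        obtain w j where wj: "z = (w, j)" by (cases z)
        have w: "w \<in> wds" and j: "1 \<le> j" "j \<le> n" using z by (simp_all add: wj)
        show ?thesis using wds_upd[OF w c j] wds_letter[OF w c] by (simp add: wj)
      qed
      then show "(case z of (w, j) \<Rightarrow> (w(c := j), w c)) \<in> wds \<times> {1..n}" if z: "z \<in> wds \<times> {1..n}" for z
        using z .
      fix z assume z: "z \<in> wds \<times> {1..n}"
      obtain w j where wj: "z = (w, j)" by (cases z)
      have b: "1 \<le> w c" "w c \<le> n" "1 \<le> j" "j \<le> n" using wds_letter[of w c] c z wj by auto
      then show "(case case z of (w, j) \<Rightarrow> (w(c := j), w c) of (w, j) \<Rightarrow> u w * cnj (ent (adj x) (w c) j * v (w(c := j))))
          = (case z of (w, j) \<Rightarrow> ent x (w c) j * u (w(c := j)) * cnj (v w))"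
        by (auto simp: wj ent_def adj_def)
    qed
    then show "(\<Sum>w\<in>wds. \<Sum>j\<in>{1..n}. ent x (w c) j * u (w(c := j)) * cnj (v w))
       = (\<Sum>w\<in>wds. \<Sum>j\<in>{1..n}. u w * cnj (ent (adj x) (w c) j * v (w(c := j))))"
      using fin_wds by (simp add: sum.cartesian_product)
  qed
  also have "\<dots> = (\<Sum>w\<in>wds. \<Sum>c\<in>slots. \<Sum>j\<in>{1..n}. u w * cnj (ent (adj x) (w c) j * v (w(c := j))))"
    by (rule sum.swap)
  also have "\<dots> = ip u (act (adj x) v)"
    unfolding ip_def by (rule sum.cong) (auto simp: act_def sum_distrib_left)
  finally show ?thesis .
qed

lemma ip_self_0:
  assumes "ip v v = 0" "w \<in> wds"
  shows "v w = 0"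
proof -
  have "ip v v = of_real (\<Sum>w\<in>wds. (cmod (v w))\<^sup>2)"
    by (simp add: ip_def complex_norm_square[symmetric])
  then have "(\<Sum>w\<in>wds. (cmod (v w))\<^sup>2) = 0" using assms(1) by (metis of_real_eq_0_iff)
  then have "\<forall>w\<in>wds. (cmod (v w))\<^sup>2 = 0" using fin_wds by (subst (asm) sum_nonneg_eq_0_iff) auto
  then show ?thesis using assms(2) by simp
qed

definition word0 :: "slot \<Rightarrow> nat" where "word0 = (\<lambda>c\<in>slots. snd (snd c))"

lemma top_word0: "top word0 = 1"
proof -
  have "word0 \<in> wds" using D by (fastforce simp: word0_def wds_def slots_def)
  moreover have "sg d (\<lambda>r. word0 (d, t, r)) = 1" if "(d, t) \<in> factors" for d t
    by (rule sg_id) (use that in \<open>auto simp: word0_def slots_iff\<close>)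
  ultimately show ?thesis by (auto simp: top_def intro!: prod.neutral)
qed

lemma top_nonzero: "top \<noteq> (\<lambda>_. 0)"
  using top_word0 by (metis zero_neq_one)

end

section \<open>The least exponent seen by a word\<close>

definition roots_content :: "(nat \<times> nat) list \<Rightarrow> (nat \<times> nat \<Rightarrow>\<^sub>0 nat)" where
  "roots_content as = sum_list (map (\<lambda>\<alpha>. single \<alpha> 1) as)"

lemma roots_content_Nil [simp]: "roots_content [] = 0"
  and roots_content_Cons: "roots_content (\<alpha> # as) = single \<alpha> 1 + roots_content as"
  by (simp_all add: roots_content_def)

lemma degree_roots_content: "degree (roots_content as) = length as"
proof (induction as)
  case Nil
  then show ?case by (simp add: degree_def)
qed (simp add: roots_content_Cons degree_add)

lemma lookup_sum_single:
  assumes "finite A"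
  shows "lookup (\<Sum>\<alpha>\<in>A. single (f \<alpha>) (1::nat)) k = card {\<alpha>\<in>A. f \<alpha> = k}"
proof -
  have "lookup (\<Sum>\<alpha>\<in>A. single (f \<alpha>) (1::nat)) k = (\<Sum>\<alpha>\<in>A. if f \<alpha> = k then 1 else 0)"
    unfolding lookup_sum lookup_single when_def ..
  also have "\<dots> = card {\<alpha>\<in>A. f \<alpha> = k}" using assms by (simp add: sum.inter_filter[symmetric])
  finally show ?thesis .
qed

lemma lookup_sum_singles:
  assumes "finite K"
  shows "lookup (\<Sum>\<alpha>\<in>K. single \<alpha> (f \<alpha>)) \<beta> = (if \<beta> \<in> K then f \<beta> :: nat else 0)"
proof -
  have "lookup (\<Sum>\<alpha>\<in>K. single \<alpha> (f \<alpha>)) \<beta> = (\<Sum>\<alpha>\<in>K. if \<alpha> = \<beta> then f \<beta> else 0)"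
    unfolding lookup_sum by (rule sum.cong) (auto simp: lookup_single when_def)
  then show ?thesis using assms by simp
qed

text \<open>Consider the smallest row whose entry is moved.  The rows above it keep their columns, and the
  columns of an antichain decrease with the rows.  So the entry moves to the left, which makes the
  array larger.\<close>

lemma antichain_lex_min:
  assumes fin: "finite A" and ac: "antichain A" and perm: "inj_on g (snd ` A)" "g ` snd ` A = snd ` A"
  shows "(\<Sum>\<alpha>\<in>A. single \<alpha> (1::nat)) \<le> (\<Sum>\<alpha>\<in>A. single (fst \<alpha>, g (snd \<alpha>)) 1)"
    and "(\<Sum>\<alpha>\<in>A. single \<alpha> (1::nat)) = (\<Sum>\<alpha>\<in>A. single (fst \<alpha>, g (snd \<alpha>)) 1) \<Longrightarrow> \<forall>j\<in>snd ` A. g j = j"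
proof -
  let ?l = "\<Sum>\<alpha>\<in>A. single \<alpha> (1::nat)" and ?r = "\<Sum>\<alpha>\<in>A. single (fst \<alpha>, g (snd \<alpha>)) (1::nat)"
  have anti: "fst \<alpha> < fst \<beta> \<longleftrightarrow> snd \<beta> < snd \<alpha>" if "\<alpha> \<in> A" "\<beta> \<in> A" for \<alpha> \<beta>
  proof (cases "\<alpha> = \<beta>")
    case False
    then have "\<not> P_le \<alpha> \<beta>" "\<not> P_le \<beta> \<alpha>" using ac that unfolding antichain_def by blast+
    then show ?thesis unfolding P_le_def by linarith
  qed simp
  have fst_inj: "\<alpha> = \<beta>" if "\<alpha> \<in> A" "\<beta> \<in> A" "fst \<alpha> = fst \<beta>" for \<alpha> \<beta>
  proof -
    have "P_le \<alpha> \<beta> \<or> P_le \<beta> \<alpha>" using that(3) unfolding P_le_def by linarith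
    then show ?thesis using ac that(1,2) unfolding antichain_def by metis
  qed
  (* the first position where the arrays differ is ?k below *)
  have less: "?l < ?r" if "\<not> (\<forall>j\<in>snd ` A. g j = j)"
  proof -
    define B where "B = {\<alpha>\<in>A. g (snd \<alpha>) \<noteq> snd \<alpha>}"
    have "finite (fst ` B)" using fin by (simp add: B_def)
    moreover have "fst ` B \<noteq> {}" using that unfolding B_def by blast
    ultimately have "Min (fst ` B) \<in> fst ` B" by (rule Min_in)
    then obtain \<alpha>0 where a0: "\<alpha>0 \<in> B" "fst \<alpha>0 = Min (fst ` B)" by (metis imageE)
    have mn: "fst \<alpha>0 \<le> fst \<alpha>" if "\<alpha> \<in> B" for \<alpha> using a0(2) that fin by (simp add: Min_le B_def)
    have a0A: "\<alpha>0 \<in> A" and ga0: "g (snd \<alpha>0) \<noteq> snd \<alpha>0" using a0(1) by (auto simp: B_def)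
    have fixed: "g (snd \<alpha>) = snd \<alpha>" if "\<alpha> \<in> A" "fst \<alpha> < fst \<alpha>0" for \<alpha>
      using mn[of \<alpha>] that by (force simp: B_def)
    let ?k = "(fst \<alpha>0, g (snd \<alpha>0))"
    have "g (snd \<alpha>0) \<in> snd ` A" using perm(2) a0A by blast
    then obtain \<beta> where b: "\<beta> \<in> A" "snd \<beta> = g (snd \<alpha>0)" by (metis imageE)
    have "\<not> fst \<beta> < fst \<alpha>0"
    proof
      assume "fst \<beta> < fst \<alpha>0"
      then have "g (snd \<beta>) = g (snd \<alpha>0)" using fixed b by metis
      then have "snd \<beta> = snd \<alpha>0" using inj_onD[OF perm(1)] b(1) a0A by blast
      then show False using b(2) ga0 by simp
    qed
    moreover have "fst \<beta> \<noteq> fst \<alpha>0" using fst_inj[OF b(1) a0A] b(2) ga0 by auto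
    ultimately have lt: "g (snd \<alpha>0) < snd \<alpha>0" using anti[OF a0A b(1)] b(2) by simp
    have l0: "lookup ?l ?k = 0"
    proof -
      have "{\<alpha>\<in>A. \<alpha> = ?k} = {}"
      proof -
        have False if "?k \<in> A"
        proof -
          have "?k = \<alpha>0" using fst_inj[OF that a0A] by simp
          then have "snd ?k = snd \<alpha>0" by (rule arg_cong)
          then show False using lt by simp
        qed
        then show ?thesis by auto
      qed
      then show ?thesis by (simp only: lookup_sum_single[OF fin] card.empty)
    qed
    have r0: "lookup ?r ?k > 0"
    proof -
      have "\<alpha>0 \<in> {\<alpha>\<in>A. (fst \<alpha>, g (snd \<alpha>)) = ?k}" using a0A by simp
      then have "{\<alpha>\<in>A. (fst \<alpha>, g (snd \<alpha>)) = ?k} \<noteq> {}" by blast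
      moreover have "finite {\<alpha>\<in>A. (fst \<alpha>, g (snd \<alpha>)) = ?k}" by (rule finite_subset[OF _ fin]) blast
      ultimately have "card {\<alpha>\<in>A. (fst \<alpha>, g (snd \<alpha>)) = ?k} > 0" by (simp only: card_gt_0_iff simp_thms)
      then show ?thesis by (simp only: lookup_sum_single[OF fin])
    qed
    have below: "lookup ?l k = lookup ?r k" if k: "k < ?k" for k
    proof -
      have "\<alpha> = k \<longleftrightarrow> (fst \<alpha>, g (snd \<alpha>)) = k" if a: "\<alpha> \<in> A" for \<alpha>
      proof (cases "fst \<alpha> = fst k")
        case True
        show ?thesis
        proof (cases "fst k < fst \<alpha>0")
          case True
          then have "g (snd \<alpha>) = snd \<alpha>" using fixed[OF a] \<open>fst \<alpha> = fst k\<close> by simp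
          then show ?thesis by (simp add: prod_eq_iff)
        next
          case False
          have "fst k \<le> fst \<alpha>0" using k by (auto simp: less_prod_def)
          then have kk: "fst k = fst \<alpha>0" "snd k < g (snd \<alpha>0)" using False k by (auto simp: less_prod_def)
          have "\<alpha> = \<alpha>0" using fst_inj[OF a a0A] True kk(1) by simp
          then show ?thesis using kk(2) lt by (auto simp: prod_eq_iff)
        qed
      qed (auto simp: prod_eq_iff)
      then have "{\<alpha>\<in>A. \<alpha> = k} = {\<alpha>\<in>A. (fst \<alpha>, g (snd \<alpha>)) = k}" by blast
      then show ?thesis by (simp only: lookup_sum_single[OF fin])
    qed
    have "lookup ?l ?k < lookup ?r ?k" unfolding l0 by (rule r0)
    then show ?thesis
      unfolding less_poly_mapping.rep_eq less_fun_def using below by blast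
  qed
  show "?l \<le> ?r"
  proof (cases "\<forall>j\<in>snd ` A. g j = j")
    case True
    then have "?l = ?r" by (intro sum.cong) auto
    then show ?thesis by simp
  qed (use less in \<open>simp add: less_imp_le\<close>)
  show "?l = ?r \<Longrightarrow> \<forall>j\<in>snd ` A. g j = j" using less by fastforce
qed

lemma sum_in_Nats: "(\<And>x. x \<in> K \<Longrightarrow> f x \<in> \<nat>) \<Longrightarrow> sum f K \<in> \<nat>"
  by (induction K rule: infinite_finite_induct) (auto intro: Nats_add)

lemma sum_Nats_nonzero:
  fixes f :: "'a \<Rightarrow> complex"
  assumes fin: "finite K" and N: "\<And>x. x \<in> K \<Longrightarrow> f x \<in> \<nat>" and x: "x \<in> K" "f x \<noteq> 0"
  shows "sum f K \<noteq> 0"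
proof -
  have nn: "0 \<le> Re z" if "z \<in> \<nat>" for z :: complex using that by (auto elim!: Nats_cases)
  have "Re (f x) \<noteq> 0" using N[OF x(1)] x(2) by (auto elim!: Nats_cases)
  then have "0 < Re (f x)" using nn[OF N[OF x(1)]] by simp
  moreover have "Re (f x) \<le> (\<Sum>y\<in>K. Re (f y))" by (rule member_le_sum[OF x(1) _ fin]) (rule nn, rule N, simp)
  ultimately have "Re (sum f K) > 0" unfolding Re_sum by (rule less_le_trans)
  then show ?thesis by (metis less_irrefl zero_complex.simps(1))
qed

lemma antichain_snd_inj: "antichain A \<Longrightarrow> inj_on snd A"
  unfolding antichain_def inj_on_def P_le_def by (metis nat_le_linear order_refl)

lemma sum_le_sum_eq:
  fixes f g :: "'a \<Rightarrow> (nat \<times> nat \<Rightarrow>\<^sub>0 nat)"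
  assumes "finite K" "\<And>x. x \<in> K \<Longrightarrow> f x \<le> g x" "sum f K = sum g K" "x \<in> K"
  shows "f x = g x"
proof (rule ccontr)
  assume "f x \<noteq> g x"
  then have "f x < g x" using assms(2)[OF assms(4)] by simp
  then have "sum f K < sum g K" using assms(1,2,4) by (intro sum_strict_mono_ex1) auto
  then show False using assms(3) by simp
qed

context model
begin

abbreviation act_roots :: "(nat \<times> nat) list \<Rightarrow> vec" where
  "act_roots as \<equiv> foldr (\<lambda>\<alpha>. act (Emat n (fst \<alpha>) (snd \<alpha>))) as top"

text \<open>The slots whose letter does not occur in the corresponding factor of \<open>top\<close>.  Every matrix unit
  repairs at most one of them, so their number is a lower bound for the degree of a product of
  matrices that takes \<open>top\<close> to a vector seeing the word (\<open>act_list_degree\<close>).\<close>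

definition big :: "(slot \<Rightarrow> nat) \<Rightarrow> slot set" where "big w = {c\<in>slots. w c > fst c}"

lemma finite_big: "finite (big w)"
  using fin_slots by (simp add: big_def)

lemma top_big: "top w \<noteq> 0 \<Longrightarrow> big w = {}"
proof (rule ccontr)
  assume nz: "top w \<noteq> 0" and "big w \<noteq> {}"
  then obtain c where c: "c \<in> slots" "w c > fst c" by (auto simp: big_def)
  obtain d t r where dtr: "c = (d, t, r)" by (rule prod_cases3)
  have "(d, t) \<in> factors" "r \<in> {1..d}" using c(1) by (simp_all add: dtr slots_iff)
  then have "w (d, t, r) \<in> {1..d}" using top_perm(2)[OF nz] by blast
  then show False using c(2) by (simp add: dtr)
qed

lemma big_upd: "big w \<subseteq> insert c (big (w(c := j)))"
  by (auto simp: big_def)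

lemma card_big_upd: "card (big w) \<le> Suc (card (big (w(c := j))))"
  using card_mono[OF _ big_upd] card_insert_le_m1 finite_big
  by (metis card_insert_if finite_insert le_SucI)

lemma act_list_degree:
  assumes "foldr act xs top w \<noteq> 0"
  shows "card (big w) \<le> length xs"
  using assms
proof (induction xs arbitrary: w)
  case Nil
  then show ?case by (simp add: top_big)
next
  case (Cons x xs)
  let ?v = "foldr act xs top"
  have "act x ?v w \<noteq> 0" using Cons.prems by simp
  then have "w \<in> wds" using act_outside by blast
  have "\<exists>c\<in>slots. \<exists>j\<in>{1..n}. ?v (w(c := j)) \<noteq> 0"
  proof (rule ccontr)
    assume "\<not> ?thesis"
    then have "(\<Sum>c\<in>slots. \<Sum>j\<in>{1..n}. ent x (w c) j * ?v (w(c := j))) = 0" by (intro sum.neutral ballI) auto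
    then show False using \<open>act x ?v w \<noteq> 0\<close> \<open>w \<in> wds\<close> by (simp add: act_def)
  qed
  then obtain c j where "?v (w(c := j)) \<noteq> 0" by blast
  from le_trans[OF card_big_upd Suc_le_mono[THEN iffD2, OF Cons.IH[OF this]]]
  show ?case unfolding length_Cons .
qed

text \<open>The expansion of a product of matrix units on \<open>top\<close>, read off at the word \<open>w\<close>: the factors
  successively replace a letter of \<open>w\<close>, until a word \<open>w0\<close> is reached at which \<open>top\<close> is evaluated.\<close>

fun reach :: "(nat \<times> nat) list \<Rightarrow> (slot \<Rightarrow> nat) \<Rightarrow> (slot \<Rightarrow> nat) \<Rightarrow> bool" where
  "reach [] w w0 \<longleftrightarrow> w0 = w"
| "reach (\<alpha> # as) w w0 \<longleftrightarrow> (\<exists>c\<in>slots. w c = fst \<alpha> \<and> reach as (w(c := snd \<alpha>)) w0)"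

lemma PD_range: "\<alpha> \<in> PD n D \<Longrightarrow> 1 \<le> fst \<alpha> \<and> fst \<alpha> \<le> n \<and> 1 \<le> snd \<alpha> \<and> snd \<alpha> \<le> n"
  by (cases \<alpha>) (auto simp: PD_def Pd_def Pos_def)

lemma act_roots_Cons:
  assumes "w \<in> wds" "\<alpha> \<in> PD n D"
  shows "act_roots (\<alpha> # as) w = (\<Sum>c\<in>slots. if w c = fst \<alpha> then act_roots as (w(c := snd \<alpha>)) else 0)"
  using act_Emat[OF assms(1), of "fst \<alpha>" "snd \<alpha>"] PD_range[OF assms(2)] by simp

lemma act_roots_nonzero:
  assumes "w \<in> wds" "set as \<subseteq> PD n D" "act_roots as w \<noteq> 0"
  shows "\<exists>w0. reach as w w0 \<and> top w0 \<noteq> 0"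
  using assms
proof (induction as arbitrary: w)
  case (Cons \<alpha> as)
  have a: "\<alpha> \<in> PD n D" using Cons.prems(2) by simp
  have "(\<Sum>c\<in>slots. if w c = fst \<alpha> then act_roots as (w(c := snd \<alpha>)) else 0) \<noteq> 0"
    using Cons.prems(3) act_roots_Cons[OF Cons.prems(1) a] by simp
  then obtain c where c: "c \<in> slots" "(if w c = fst \<alpha> then act_roots as (w(c := snd \<alpha>)) else 0) \<noteq> 0"
    by (rule sum.not_neutral_contains_not_neutral)
  then have c': "w c = fst \<alpha>" "act_roots as (w(c := snd \<alpha>)) \<noteq> 0" by (auto split: if_splits)
  have "w(c := snd \<alpha>) \<in> wds" using wds_upd[OF Cons.prems(1) c(1)] PD_range[OF a] by blast
  moreover have "set as \<subseteq> PD n D" using Cons.prems(2) by simp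
  ultimately obtain w0 where "reach as (w(c := snd \<alpha>)) w0" "top w0 \<noteq> 0" using Cons.IH c'(2) by blast
  then show ?case unfolding reach.simps(2) using c(1) c'(1) by blast
qed auto

lemma act_roots_Nats:
  assumes "w \<in> wds" "set as \<subseteq> PD n D" "\<And>w0. reach as w w0 \<Longrightarrow> top w0 \<in> \<nat>"
  shows "act_roots as w \<in> \<nat>"
  using assms
proof (induction as arbitrary: w)
  case (Cons \<alpha> as)
  have a: "\<alpha> \<in> PD n D" using Cons.prems(2) by simp
  have "(if w c = fst \<alpha> then act_roots as (w(c := snd \<alpha>)) else 0) \<in> \<nat>" if c: "c \<in> slots" for c
  proof (cases "w c = fst \<alpha>")
    case True
    have "w(c := snd \<alpha>) \<in> wds" using wds_upd[OF Cons.prems(1) c] PD_range[OF a] by blast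
    then have "act_roots as (w(c := snd \<alpha>)) \<in> \<nat>" using Cons.IH Cons.prems(2,3) c True by auto
    then show ?thesis using True by simp
  qed simp
  then show ?case unfolding act_roots_Cons[OF Cons.prems(1) a] by (rule sum_in_Nats)
qed auto

lemma act_roots_pos:
  assumes "w \<in> wds" "set as \<subseteq> PD n D" "\<And>w0. reach as w w0 \<Longrightarrow> top w0 \<in> \<nat>" "reach as w w1" "top w1 \<noteq> 0"
  shows "act_roots as w \<noteq> 0"
  using assms
proof (induction as arbitrary: w)
  case (Cons \<alpha> as)
  have a: "\<alpha> \<in> PD n D" and as: "set as \<subseteq> PD n D" using Cons.prems(2) by simp_all
  have wd: "w(c := snd \<alpha>) \<in> wds" if "c \<in> slots" for c
    using wds_upd[OF Cons.prems(1) that] PD_range[OF a] by blast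
  have nat: "top w0 \<in> \<nat>" if "c \<in> slots" "w c = fst \<alpha>" "reach as (w(c := snd \<alpha>)) w0" for c w0
    using Cons.prems(3)[of w0] that unfolding reach.simps(2) by blast
  have N: "(if w c = fst \<alpha> then act_roots as (w(c := snd \<alpha>)) else 0) \<in> \<nat>" if c: "c \<in> slots" for c
  proof (cases "w c = fst \<alpha>")
    case True
    have "act_roots as (w(c := snd \<alpha>)) \<in> \<nat>" using act_roots_Nats[OF wd[OF c] as] nat[OF c True] by blast
    then show ?thesis unfolding if_P[OF True] .
  next
    case False
    then show ?thesis by (simp only: if_False Nats_0)
  qed
  obtain c where c: "c \<in> slots" "w c = fst \<alpha>" "reach as (w(c := snd \<alpha>)) w1"
    using Cons.prems(4) unfolding reach.simps(2) by blast
  have "act_roots as (w(c := snd \<alpha>)) \<noteq> 0"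
    using Cons.IH[OF wd[OF c(1)] as _ c(3) Cons.prems(5)] nat[OF c(1,2)] by blast
  then have "(if w c = fst \<alpha> then act_roots as (w(c := snd \<alpha>)) else 0) \<noteq> 0" unfolding if_P[OF c(2)] .
  then show ?case
    unfolding act_roots_Cons[OF Cons.prems(1) a]
    using sum_Nats_nonzero[where f = "\<lambda>c. if w c = fst \<alpha> then act_roots as (w(c := snd \<alpha>)) else 0", OF fin_slots N c(1)]
    by blast
qed auto

text \<open>If the degree is as small as possible, every replacement is made in another slot of \<open>big w\<close>, and
  the final word determines the content of the product.\<close>

lemma reach_content:
  assumes "w \<in> wds" "set as \<subseteq> PD n D" "reach as w w0" "top w0 \<noteq> 0" "length as \<le> card (big w)"
  shows "length as = card (big w) \<and> roots_content as = (\<Sum>c\<in>big w. single (w c, w0 c) 1) \<and>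
    (\<forall>c\<in>slots - big w. w0 c = w c)"
  using assms
proof (induction as arbitrary: w)
  case Nil
  then have "big w = {}" using top_big by simp
  then show ?case using Nil by simp
next
  case (Cons \<alpha> as)
  then obtain c where c: "c \<in> slots" "w c = fst \<alpha>" "reach as (w(c := snd \<alpha>)) w0" by auto
  let ?w = "w(c := snd \<alpha>)"
  have a: "\<alpha> \<in> PD n D" and as: "set as \<subseteq> PD n D" using Cons.prems(2) by simp_all
  have w': "?w \<in> wds" using wds_upd[OF Cons.prems(1) c(1)] PD_range[OF a] by blast
  have "length as \<le> card (big ?w)" using Cons.prems(5) card_big_upd[of w c "snd \<alpha>"] by simp
  note ih = Cons.IH[OF w' as c(3) Cons.prems(4) this]
  have IH: "length as = card (big ?w)" "roots_content as = (\<Sum>c\<in>big ?w. single (?w c, w0 c) 1)"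
    "\<forall>c\<in>slots - big ?w. w0 c = ?w c" by (rule conjunct1[OF ih], rule conjunct1[OF conjunct2[OF ih]], rule conjunct2[OF conjunct2[OF ih]])
  have "card (big ?w) < card (big w)" using IH(1) Cons.prems(5) by simp
  then have "\<not> big w \<subseteq> big ?w" using card_mono[OF finite_big] by (metis not_less)
  then have cb: "c \<in> big w" "c \<notin> big ?w" using big_upd[of w c "snd \<alpha>"] by blast+
  have other: "x \<in> big ?w \<longleftrightarrow> x \<in> big w" if "x \<noteq> c" for x using that by (simp add: big_def)
  have bw: "big w = insert c (big ?w)"
  proof (rule Set.set_eqI)
    fix x show "x \<in> big w \<longleftrightarrow> x \<in> insert c (big ?w)"
      by (cases "x = c") (simp_all only: cb(1) insert_iff other simp_thms)
  qed
  have w0c: "w0 c = snd \<alpha>" using IH(3) c(1) cb(2) by simp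
  have ne: "x \<noteq> c" if "x \<in> big ?w" for x using that cb(2) by blast
  have "(\<Sum>c\<in>big ?w. single (?w c, w0 c) (1::nat)) = (\<Sum>c\<in>big ?w. single (w c, w0 c) 1)"
    by (rule sum.cong) (use ne in simp_all)
  then have "roots_content (\<alpha> # as) = (\<Sum>c\<in>big w. single (w c, w0 c) 1)"
    unfolding bw sum.insert[OF finite_big cb(2)] roots_content_Cons IH(2) using c(2) w0c by simp
  moreover have "length (\<alpha> # as) = card (big w)"
    unfolding bw card_insert_disjoint[OF finite_big cb(2)] using IH(1) by simp
  moreover have "w0 x = w x" if x: "x \<in> slots - big w" for x
  proof -
    have "x \<noteq> c" using x cb(1) by blast
    then show ?thesis using IH(3) x bw by auto
  qed
  ultimately show ?case by blast
qed

definition family :: "(nat \<Rightarrow> nat \<Rightarrow> (nat \<times> nat) set) \<Rightarrow> bool" where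
  "family A \<longleftrightarrow> (\<forall>d t. (d, t) \<in> factors \<longrightarrow> A d t \<subseteq> Pd n d \<and> antichain (A d t))"

text \<open>For every \<open>(i, j)\<close> in the antichain of a factor, the letter \<open>j\<close> of the standard word is replaced by
  \<open>i\<close>.  The exponent \<open>least A\<close>, the sum of the indicators of the antichains, undoes these
  replacements; the next lemmas show that no smaller exponent of this degree is seen by the word.\<close>

definition word :: "(nat \<Rightarrow> nat \<Rightarrow> (nat \<times> nat) set) \<Rightarrow> slot \<Rightarrow> nat" where
  "word A = (\<lambda>c\<in>slots. case c of (d, t, j) \<Rightarrow> if j \<in> snd ` A d t then THE i. (i, j) \<in> A d t else j)"

definition least :: "(nat \<Rightarrow> nat \<Rightarrow> (nat \<times> nat) set) \<Rightarrow> nat \<times> nat \<Rightarrow>\<^sub>0 nat" where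
  "least A = (\<Sum>(d, t)\<in>factors. \<Sum>\<alpha>\<in>A d t. single \<alpha> 1)"

context
  fixes A :: "nat \<Rightarrow> nat \<Rightarrow> (nat \<times> nat) set"
  assumes fam: "family A"
begin

lemma A: "(d, t) \<in> factors \<Longrightarrow> A d t \<subseteq> Pd n d \<and> antichain (A d t)"
  using fam by (simp add: family_def)

lemma A_bounds: "(d, t) \<in> factors \<Longrightarrow> \<alpha> \<in> A d t \<Longrightarrow> 1 \<le> snd \<alpha> \<and> snd \<alpha> \<le> d \<and> d < fst \<alpha> \<and> fst \<alpha> \<le> n"
  using A[of d t] by (cases \<alpha>) (auto simp: Pd_def Pos_def)

lemma A_finite: "(d, t) \<in> factors \<Longrightarrow> finite (A d t)"
proof -
  assume "(d, t) \<in> factors"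
  then have "A d t \<subseteq> {..n} \<times> {..n}" using A_bounds[of d t] by fastforce
  then show ?thesis by (rule finite_subset) simp
qed

lemma word_big: "(d, t) \<in> factors \<Longrightarrow> \<alpha> \<in> A d t \<Longrightarrow> (d, t, snd \<alpha>) \<in> slots \<and> word A (d, t, snd \<alpha>) = fst \<alpha>"
proof -
  assume \<kappa>: "(d, t) \<in> factors" and a: "\<alpha> \<in> A d t"
  have s: "(d, t, snd \<alpha>) \<in> slots" using A_bounds[OF \<kappa> a] \<kappa> by (simp add: slots_iff)
  have "(THE i. (i, snd \<alpha>) \<in> A d t) = fst \<alpha>"
  proof (rule the_equality)
    show "(fst \<alpha>, snd \<alpha>) \<in> A d t" using a by simp
    fix i assume "(i, snd \<alpha>) \<in> A d t"
    from inj_onD[OF antichain_snd_inj _ this a] A[OF \<kappa>] show "i = fst \<alpha>" by (metis fst_conv snd_conv)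
  qed
  moreover have "snd \<alpha> \<in> snd ` A d t" using a by (rule imageI)
  ultimately show ?thesis using s by (simp add: word_def)
qed

lemma word_small: "(d, t, j) \<in> slots \<Longrightarrow> j \<notin> snd ` A d t \<Longrightarrow> word A (d, t, j) = j"
  by (simp add: word_def)

lemma big_word: "big (word A) = (\<lambda>(\<kappa>, \<alpha>). (fst \<kappa>, snd \<kappa>, snd \<alpha>)) ` (SIGMA \<kappa>:factors. A (fst \<kappa>) (snd \<kappa>))" (is "_ = ?f ` ?S")
proof
  show "?f ` ?S \<subseteq> big (word A)"
  proof
    fix c assume "c \<in> ?f ` ?S"
    then obtain d t \<alpha> where c: "c = (d, t, snd \<alpha>)" "(d, t) \<in> factors" "\<alpha> \<in> A d t" by auto
    then show "c \<in> big (word A)" using word_big[OF c(2,3)] A_bounds[OF c(2,3)] by (simp add: big_def)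
  qed
  show "big (word A) \<subseteq> ?f ` ?S"
  proof
    fix c assume c: "c \<in> big (word A)"
    obtain d t j where cc: "c = (d, t, j)" by (rule prod_cases3)
    have s: "(d, t, j) \<in> slots" "word A (d, t, j) > d" using c by (simp_all add: big_def cc)
    have \<kappa>: "(d, t) \<in> factors" "j \<le> d" using s(1) by (simp_all add: slots_iff)
    have "j \<in> snd ` A d t" using word_small[OF s(1)] s(2) \<kappa>(2) by (metis not_less)
    then obtain \<alpha> where "\<alpha> \<in> A d t" "j = snd \<alpha>" by (rule imageE)
    then show "c \<in> ?f ` ?S" using \<kappa>(1) by (intro image_eqI[of _ _ "((d, t), \<alpha>)"]) (simp_all add: cc)
  qed
qed

lemma inj_big: "inj_on (\<lambda>(\<kappa>, \<alpha>). (fst \<kappa>, snd \<kappa>, snd \<alpha>)) (SIGMA \<kappa>:factors. A (fst \<kappa>) (snd \<kappa>))"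
proof (rule inj_onI)
  fix x y assume x: "x \<in> (SIGMA \<kappa>:factors. A (fst \<kappa>) (snd \<kappa>))" and y: "y \<in> (SIGMA \<kappa>:factors. A (fst \<kappa>) (snd \<kappa>))"
    and e: "(case x of (\<kappa>, \<alpha>) \<Rightarrow> (fst \<kappa>, snd \<kappa>, snd \<alpha>)) = (case y of (\<kappa>, \<alpha>) \<Rightarrow> (fst \<kappa>, snd \<kappa>, snd \<alpha>))"
  obtain d t \<alpha> where xx: "x = ((d, t), \<alpha>)" by (metis prod.exhaust)
  obtain d' t' \<beta> where yy: "y = ((d', t'), \<beta>)" by (metis prod.exhaust)
  have eq: "d' = d" "t' = t" "snd \<alpha> = snd \<beta>" using e by (simp_all add: xx yy)
  have "(d, t) \<in> factors" "\<alpha> \<in> A d t" "\<beta> \<in> A d t" using x y eq by (simp_all add: xx yy)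
  then have "\<alpha> = \<beta>" using inj_onD[OF antichain_snd_inj eq(3)] A by blast
  then show "x = y" using eq by (simp add: xx yy)
qed

lemma sum_big: "(\<Sum>c\<in>big (word A). F c) = (\<Sum>(d, t)\<in>factors. \<Sum>\<alpha>\<in>A d t. F (d, t, snd \<alpha>))"
proof -
  have "(\<Sum>c\<in>big (word A). F c) = (\<Sum>(\<kappa>, \<alpha>)\<in>(SIGMA \<kappa>:factors. A (fst \<kappa>) (snd \<kappa>)). F (fst \<kappa>, snd \<kappa>, snd \<alpha>))"
    unfolding big_word sum.reindex[OF inj_big] by (simp add: case_prod_beta comp_def)
  also have "\<dots> = (\<Sum>\<kappa>\<in>factors. \<Sum>\<alpha>\<in>A (fst \<kappa>) (snd \<kappa>). F (fst \<kappa>, snd \<kappa>, snd \<alpha>))"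
    using fin_factors A_finite by (subst sum.Sigma) auto
  finally show ?thesis by (simp add: case_prod_beta)
qed

lemma degree_sum: "finite K \<Longrightarrow> degree (\<Sum>x\<in>K. f x) = (\<Sum>x\<in>K. degree (f x))"
proof (induction K rule: finite_induct)
  case empty
  then show ?case by (simp add: degree_def)
qed (simp add: degree_add)

lemma degree_least: "degree (least A) = card (big (word A))"
proof -
  have "card (big (word A)) = (\<Sum>(d, t)\<in>factors. \<Sum>\<alpha>\<in>A d t. 1)" using sum_big[of "\<lambda>_. 1"] unfolding card_eq_sum .
  also have "\<dots> = degree (least A)"
    unfolding least_def using fin_factors A_finite
    by (subst degree_sum) (auto simp: degree_sum intro!: sum.cong)
  finally show ?thesis ..
qed

lemma word_wds: "word A \<in> wds"
proof -
  have "word A c \<in> {1..n}" if c: "c \<in> slots" for c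
  proof -
    obtain d t j where cc: "c = (d, t, j)" by (rule prod_cases3)
    have \<kappa>: "(d, t) \<in> factors" "1 \<le> j" "j \<le> d" using c by (simp_all add: slots_iff cc)
    have "d \<le> n" using \<kappa>(1) D by (auto simp: factors_def)
    show ?thesis
    proof (cases "j \<in> snd ` A d t")
      case True
      then obtain \<alpha> where "\<alpha> \<in> A d t" "j = snd \<alpha>" by (rule imageE)
      then show ?thesis using word_big[OF \<kappa>(1)] A_bounds[OF \<kappa>(1)] cc by fastforce
    next
      case False
      then show ?thesis using word_small c \<kappa>(2,3) \<open>d \<le> n\<close> by (simp add: cc)
    qed
  qed
  then show ?thesis unfolding wds_def by (intro PiE_I) (simp_all add: word_def)
qed

text \<open>The final word gives a permutation of the columns of every antichain, so \<open>antichain_lex_min\<close>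
  bounds the content.  In the case of equality all permutations are trivial, and there are no signs
  that could lead to cancellation.\<close>

lemma reach_word:
  assumes as: "set as \<subseteq> PD n D" "length as = degree (least A)" and r: "reach as (word A) w0" "top w0 \<noteq> 0"
  shows "least A \<le> roots_content as" and "least A = roots_content as \<Longrightarrow> top w0 = 1"
proof -
  have rc: "roots_content as = (\<Sum>c\<in>big (word A). single (word A c, w0 c) 1)"
    and small: "\<forall>c\<in>slots - big (word A). w0 c = word A c"
    using reach_content[OF word_wds as(1) r] as(2) by (simp_all add: degree_least)
  let ?g = "\<lambda>\<kappa> j. w0 (fst \<kappa>, snd \<kappa>, j)"
  have rc': "roots_content as = (\<Sum>\<kappa>\<in>factors. \<Sum>\<alpha>\<in>A (fst \<kappa>) (snd \<kappa>). single (fst \<alpha>, ?g \<kappa> (snd \<alpha>)) 1)"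
  proof -
    have "roots_content as = (\<Sum>(d, t)\<in>factors. \<Sum>\<alpha>\<in>A d t. single (word A (d, t, snd \<alpha>), w0 (d, t, snd \<alpha>)) 1)"
      unfolding rc by (rule sum_big)
    also have "\<dots> = (\<Sum>\<kappa>\<in>factors. \<Sum>\<alpha>\<in>A (fst \<kappa>) (snd \<kappa>). single (fst \<alpha>, ?g \<kappa> (snd \<alpha>)) 1)"
      unfolding case_prod_beta by (intro sum.cong refl) (use word_big in auto)
    finally show ?thesis .
  qed
  have le': "least A = (\<Sum>\<kappa>\<in>factors. \<Sum>\<alpha>\<in>A (fst \<kappa>) (snd \<kappa>). single \<alpha> 1)"
    by (simp add: least_def case_prod_beta)
  have rest: "?g \<kappa> j = j" if \<kappa>: "\<kappa> \<in> factors" and j: "j \<in> {1..fst \<kappa>}" "j \<notin> snd ` A (fst \<kappa>) (snd \<kappa>)" for \<kappa> j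
  proof -
    have s: "(fst \<kappa>, snd \<kappa>, j) \<in> slots" using \<kappa> j(1) by (simp add: slots_iff)
    have wj: "word A (fst \<kappa>, snd \<kappa>, j) = j" by (rule word_small[OF s j(2)])
    then have "(fst \<kappa>, snd \<kappa>, j) \<notin> big (word A)" using j(1) by (simp add: big_def)
    then show ?thesis using small s wj by simp
  qed
  have perm: "inj_on (?g \<kappa>) (snd ` A (fst \<kappa>) (snd \<kappa>)) \<and> ?g \<kappa> ` snd ` A (fst \<kappa>) (snd \<kappa>) = snd ` A (fst \<kappa>) (snd \<kappa>)"
    if \<kappa>: "\<kappa> \<in> factors" for \<kappa>
  proof -
    let ?J = "snd ` A (fst \<kappa>) (snd \<kappa>)"
    have k2: "(fst \<kappa>, snd \<kappa>) \<in> factors" using \<kappa> by simp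
    have J: "?J \<subseteq> {1..fst \<kappa>}" using A_bounds[OF k2] by auto
    have inj: "inj_on (?g \<kappa>) {1..fst \<kappa>}" and img: "?g \<kappa> ` {1..fst \<kappa>} = {1..fst \<kappa>}"
      using top_perm[OF r(2) k2] by blast+
    have "?g \<kappa> j \<in> ?J" if j: "j \<in> ?J" for j
    proof (rule ccontr)
      assume nj: "?g \<kappa> j \<notin> ?J"
      have jd: "j \<in> {1..fst \<kappa>}" using j J by blast
      have gj: "?g \<kappa> j \<in> {1..fst \<kappa>}" using jd img by blast
      have "?g \<kappa> (?g \<kappa> j) = ?g \<kappa> j" by (rule rest[OF \<kappa> gj nj])
      then have "?g \<kappa> j = j" using inj_onD[OF inj _ gj jd] by blast
      then show False using nj j by simp
    qed
    then have sub: "?g \<kappa> ` ?J \<subseteq> ?J" by blast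
    have inj': "inj_on (?g \<kappa>) ?J" using inj J by (rule inj_on_subset)
    have "finite ?J" using J finite_subset by blast
    then show ?thesis using endo_inj_surj[OF _ sub inj'] inj' by blast
  qed
  let ?l = "\<lambda>\<kappa>. \<Sum>\<alpha>\<in>A (fst \<kappa>) (snd \<kappa>). single \<alpha> (1::nat)"
    and ?r = "\<lambda>\<kappa>. \<Sum>\<alpha>\<in>A (fst \<kappa>) (snd \<kappa>). single (fst \<alpha>, ?g \<kappa> (snd \<alpha>)) (1::nat)"
  have le: "?l \<kappa> \<le> ?r \<kappa>" and eq: "?l \<kappa> = ?r \<kappa> \<Longrightarrow> \<forall>j\<in>snd ` A (fst \<kappa>) (snd \<kappa>). ?g \<kappa> j = j"
    if \<kappa>: "\<kappa> \<in> factors" for \<kappa>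
  proof -
    have k2: "(fst \<kappa>, snd \<kappa>) \<in> factors" using \<kappa> by simp
    note fin = A_finite[OF k2] and ac = conjunct2[OF A[OF k2]] and p = conjunct1[OF perm[OF \<kappa>]] conjunct2[OF perm[OF \<kappa>]]
    show "?l \<kappa> \<le> ?r \<kappa>" by (rule antichain_lex_min(1)[OF fin ac p])
    show "?l \<kappa> = ?r \<kappa> \<Longrightarrow> \<forall>j\<in>snd ` A (fst \<kappa>) (snd \<kappa>). ?g \<kappa> j = j" by (rule antichain_lex_min(2)[OF fin ac p])
  qed
  show "least A \<le> roots_content as" unfolding le' rc' by (rule sum_mono) (rule le)
  assume "least A = roots_content as"
  then have tot: "sum ?l factors = sum ?r factors" unfolding le' rc' .
  have "sg d (\<lambda>j. w0 (d, t, j)) = 1" if \<kappa>: "(d, t) \<in> factors" for d t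
  proof (rule sg_id)
    fix j assume j: "j \<in> {1..d}"
    have "?l (d, t) = ?r (d, t)" by (rule sum_le_sum_eq[OF fin_factors le tot \<kappa>])
    from eq[OF \<kappa> this] rest[OF \<kappa>] j show "w0 (d, t, j) = j" by (cases "j \<in> snd ` A d t") auto
  qed
  moreover have "w0 \<in> wds" using r(2) top_outside by blast
  ultimately show "top w0 = 1" by (auto simp: top_def intro!: prod.neutral)
qed

theorem act_roots_word:
  assumes as: "set as \<subseteq> PD n D" "length as = degree (least A)" and le: "roots_content as \<le> least A"
    and nz: "act_roots as (word A) \<noteq> 0"
  shows "roots_content as = least A"
proof -
  obtain w0 where r: "reach as (word A) w0" "top w0 \<noteq> 0" using act_roots_nonzero[OF word_wds as(1) nz] by blast
  show "roots_content as = least A" using reach_word(1)[OF as r] le by (rule order.antisym[rotated])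
qed

end

lemma reach_word0:
  assumes "family A" "roots_content as = least A"
  shows "reach as (word A) word0"
  using assms
proof (induction as arbitrary: A)
  case Nil
  have lk: "lookup (least A) k = (\<Sum>(d, t)\<in>factors. card {\<alpha>\<in>A d t. \<alpha> = k})" for k
  proof -
    have "lookup (least A) k = (\<Sum>x\<in>factors. lookup (case x of (d, t) \<Rightarrow> \<Sum>\<alpha>\<in>A d t. single \<alpha> (1::nat)) k)"
      unfolding least_def by (rule lookup_sum)
    also have "\<dots> = (\<Sum>(d, t)\<in>factors. card {\<alpha>\<in>A d t. \<alpha> = k})"
    proof (rule sum.cong[OF refl])
      fix x assume x: "x \<in> factors"
      obtain d t where xx: "x = (d, t)" by (cases x)
      show "lookup (case x of (d, t) \<Rightarrow> \<Sum>\<alpha>\<in>A d t. single \<alpha> (1::nat)) k = (case x of (d, t) \<Rightarrow> card {\<alpha>\<in>A d t. \<alpha> = k})"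
        unfolding xx case_prod_conv
        by (rule lookup_sum_single) (rule A_finite[OF Nil.prems(1) x[unfolded xx]])
    qed
    finally show ?thesis .
  qed
  have "A d t = {}" if \<kappa>: "(d, t) \<in> factors" for d t
  proof (rule ccontr)
    assume "A d t \<noteq> {}"
    then obtain k where k: "k \<in> A d t" by blast
    have "lookup (least A) k = 0" using Nil.prems(2) by (simp flip: Nil.prems(2))
    then have "(case (d, t) of (d, t) \<Rightarrow> card {\<alpha>\<in>A d t. \<alpha> = k}) = 0"
      unfolding lk using fin_factors \<kappa> by (simp only: sum_eq_0_iff)
    moreover have "{\<alpha>\<in>A d t. \<alpha> = k} = {k}" using k by blast
    ultimately show False by (simp only: case_prod_conv card.insert card.empty finite.emptyI simp_thms) simp
  qed
  then have "word A = word0" unfolding word_def word0_def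
    by (intro restrict_ext) (auto simp: slots_iff)
  then show ?case by simp
next
  case (Cons \<alpha> as)
  have "lookup (least A) \<alpha> \<noteq> 0"
    unfolding Cons.prems(2)[symmetric] by (simp add: roots_content_Cons lookup_add)
  moreover have "lookup (least A) \<alpha> = (\<Sum>x\<in>factors. lookup (\<Sum>\<beta>\<in>A (fst x) (snd x). single \<beta> (1::nat)) \<alpha>)"
    unfolding least_def case_prod_beta by (rule lookup_sum)
  ultimately have "(\<Sum>x\<in>factors. lookup (\<Sum>\<beta>\<in>A (fst x) (snd x). single \<beta> (1::nat)) \<alpha>) \<noteq> 0"
    by simp
  then obtain x where x: "x \<in> factors" "lookup (\<Sum>\<beta>\<in>A (fst x) (snd x). single \<beta> (1::nat)) \<alpha> \<noteq> 0"
    by (rule sum.not_neutral_contains_not_neutral)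
  obtain d t where xx: "x = (d, t)" by (cases x)
  have \<kappa>: "(d, t) \<in> factors" using x(1) xx by simp
  have "\<exists>\<beta>\<in>A d t. \<beta> = \<alpha>"
  proof (rule ccontr)
    assume "\<not> ?thesis"
    then have "{\<beta>\<in>A d t. \<beta> = \<alpha>} = {}" by blast
    then have "lookup (\<Sum>\<beta>\<in>A d t. single \<beta> (1::nat)) \<alpha> = 0"
      unfolding lookup_sum_single[OF A_finite[OF Cons.prems(1) \<kappa>], of "\<lambda>x. x"] by (simp only: card.empty)
    then show False using x(2) xx by simp
  qed
  then have a: "\<alpha> \<in> A d t" by simp
  define A' where "A' = (\<lambda>d' t'. if d' = d \<and> t' = t then A d t - {\<alpha>} else A d' t')"
  have A': "family A'"
    unfolding family_def
  proof (intro allI impI)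
    fix d' t' assume "(d', t') \<in> factors"
    from A[OF Cons.prems(1) this] show "A' d' t' \<subseteq> Pd n d' \<and> antichain (A' d' t')"
      by (auto simp: A'_def antichain_def)
  qed
  have fA: "finite (A d t)" by (rule A_finite[OF Cons.prems(1) \<kappa>])
  have "least A = single \<alpha> 1 + least A'"
  proof -
    let ?s = "\<lambda>A \<kappa>. \<Sum>\<alpha>\<in>A (fst \<kappa>) (snd \<kappa>). single \<alpha> (1::nat)"
    have l: "least A = ?s A (d, t) + (\<Sum>\<kappa>\<in>factors - {(d, t)}. ?s A \<kappa>)"
      unfolding least_def case_prod_beta by (rule sum.remove[OF fin_factors \<kappa>])
    have l': "least A' = ?s A' (d, t) + (\<Sum>\<kappa>\<in>factors - {(d, t)}. ?s A' \<kappa>)"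
      unfolding least_def case_prod_beta by (rule sum.remove[OF fin_factors \<kappa>])
    have r: "(\<Sum>\<kappa>\<in>factors - {(d, t)}. ?s A' \<kappa>) = (\<Sum>\<kappa>\<in>factors - {(d, t)}. ?s A \<kappa>)"
    proof (rule sum.cong[OF refl])
      fix \<kappa>' assume "\<kappa>' \<in> factors - {(d, t)}"
      then have "A' (fst \<kappa>') (snd \<kappa>') = A (fst \<kappa>') (snd \<kappa>')" unfolding A'_def by (cases \<kappa>') auto
      then show "?s A' \<kappa>' = ?s A \<kappa>'" by simp
    qed
    have "?s A (d, t) = single \<alpha> 1 + ?s A' (d, t)"
      using sum.remove[OF fA a, of "\<lambda>\<alpha>. single \<alpha> (1::nat)"] by (simp add: A'_def)
    then show ?thesis unfolding l l' r by (simp only: add.assoc)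
  qed
  then have "roots_content as = least A'" using Cons.prems(2) by (simp add: roots_content_Cons)
  from Cons.IH[OF A' this] have "reach as (word A') word0" .
  moreover have "word A' = (word A)((d, t, snd \<alpha>) := snd \<alpha>)"
  proof
    fix c
    have s: "(d, t, snd \<alpha>) \<in> slots" using word_big[OF Cons.prems(1) \<kappa> a] by blast
    show "word A' c = ((word A)((d, t, snd \<alpha>) := snd \<alpha>)) c"
    proof (cases "c \<in> slots")
      case False
      then have "c \<noteq> (d, t, snd \<alpha>)" using s by blast
      then show ?thesis using False by (simp add: word_def)
    next
      case c: True
      obtain d' t' j where cc: "c = (d', t', j)" by (rule prod_cases3)
      have \<kappa>': "(d', t') \<in> factors" using c by (simp add: cc slots_iff)
      show ?thesis
      proof (cases "d' = d \<and> t' = t")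
        case False
        then have e: "A' d' t' = A d' t'" and ne: "c \<noteq> (d, t, snd \<alpha>)" by (auto simp: A'_def cc)
        have "word A' c = word A c" using c by (simp add: word_def cc e)
        then show ?thesis unfolding fun_upd_other[OF ne] .
      next
        case True
        then have e: "c = (d, t, j)" and Adt: "A' d t = A d t - {\<alpha>}" by (simp_all add: cc A'_def)
        have inj: "inj_on snd (A d t)" using antichain_snd_inj A[OF Cons.prems(1) \<kappa>] by blast
        show ?thesis
        proof (cases "j = snd \<alpha>")
          case True
          have "j \<notin> snd ` A' d t" using inj a unfolding Adt True by (auto dest: inj_onD)
          from word_small[OF A' c[unfolded e] this] show ?thesis using True e by simp
        next
          case j: False
          have ne: "c \<noteq> (d, t, snd \<alpha>)" using j e by simp
          show ?thesis
          proof (cases "j \<in> snd ` A d t")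
            case True
            then obtain \<beta> where b: "\<beta> \<in> A d t" "j = snd \<beta>" by (rule imageE)
            then have "\<beta> \<in> A' d t" using j Adt by auto
            from word_big[OF A' \<kappa> this] word_big[OF Cons.prems(1) \<kappa> b(1)] show ?thesis using ne b(2) e by simp
          next
            case False
            then have "j \<notin> snd ` A' d t" using Adt by auto
            from word_small[OF A' c[unfolded e] this] word_small[OF Cons.prems(1) c[unfolded e] False]
            show ?thesis using ne e by simp
          qed
        qed
      qed
    qed
  qed
  moreover have "(d, t, snd \<alpha>) \<in> slots \<and> word A (d, t, snd \<alpha>) = fst \<alpha>" by (rule word_big[OF Cons.prems(1) \<kappa> a])
  ultimately show ?case unfolding reach.simps(2) by metis
qed

text \<open>All contributions are nonnegative, and the replacement that leads back to the standard word
  contributes \<open>1\<close>.\<close>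

theorem act_roots_least:
  assumes A: "family A"
    and as: "set as \<subseteq> PD n D" "roots_content as = least A"
  shows "act_roots as (word A) \<noteq> 0"
proof (rule act_roots_pos[OF word_wds[OF A] as(1) _ reach_word0[OF A as(2)]])
  have len: "length as = degree (least A)" unfolding as(2)[symmetric] degree_roots_content ..
  fix w0 assume r: "reach as (word A) w0"
  show "top w0 \<in> \<nat>"
  proof (cases "top w0 = 0")
    case False
    show ?thesis using reach_word(2)[OF A as(1) len r False as(2)[symmetric]] by simp
  qed simp
qed (simp_all add: top_word0)

end

section \<open>Comparison of the irreducible module with the tensor model\<close>

lemma sl_zero: "0\<^sub>m n n \<in> sl n"
  by (simp add: sl_def)

lemma sl_add: "x \<in> sl n \<Longrightarrow> y \<in> sl n \<Longrightarrow> x + y \<in> sl n"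
  by (auto simp: sl_def sum.distrib)

lemma sl_smult: "x \<in> sl n \<Longrightarrow> c \<cdot>\<^sub>m x \<in> sl n"
  by (auto simp: sl_def sum_distrib_left[symmetric])

lemma sl_carrier: "x \<in> sl n \<Longrightarrow> x \<in> carrier_mat n n"
  by (simp add: sl_def)

lemma sl_commutator: "x \<in> sl n \<Longrightarrow> y \<in> sl n \<Longrightarrow> commutator x y \<in> sl n"
  using sum_diag_mult_commute[of x n y]
  by (auto simp: sl_def commutator_def sum_subtractf simp del: index_mult_mat(1))

lemma sl_coroot: "k \<in> {1..<n} \<Longrightarrow> Emat n k k - Emat n (k + 1) (k + 1) \<in> sl n"
proof -
  assume k: "k \<in> {1..<n}"
  have one: "(\<Sum>i<n. if i + 1 = r then 1 else (0::complex)) = 1" if "1 \<le> r" "r \<le> n" for r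
  proof -
    have "(\<Sum>i<n. if i + 1 = r then 1 else (0::complex)) = (\<Sum>i<n. if i = r - 1 then 1 else 0)"
      by (rule sum.cong) (use that in auto)
    then show ?thesis using that by simp
  qed
  have "(\<Sum>i<n. (Emat n k k - Emat n (k + 1) (k + 1)) $$ (i, i))
      = (\<Sum>i<n. (if i + 1 = k then 1 else 0) - (if i + 1 = k + 1 then 1 else 0))"
    by (rule sum.cong) (auto simp: Emat_def)
  also have "\<dots> = 0" unfolding sum_subtractf using one[of k] one[of "k + 1"] k by simp
  finally show ?thesis unfolding sl_def by (simp only: minus_carrier_mat[OF Emat_carrier] mem_Collect_eq simp_thms)
qed

text \<open>A spanning set of \<open>sl n\<close> adapted to highest weight vectors.\<close>

lemma sl_induct [consumes 1, case_names zero add smult Emat coroot]: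
  assumes x: "x \<in> sl n"
    and zero: "P (0\<^sub>m n n)" and add: "\<And>y z. y \<in> sl n \<Longrightarrow> z \<in> sl n \<Longrightarrow> P y \<Longrightarrow> P z \<Longrightarrow> P (y + z)"
    and smult: "\<And>c y. y \<in> sl n \<Longrightarrow> P y \<Longrightarrow> P (c \<cdot>\<^sub>m y)"
    and E: "\<And>i j. 1 \<le> i \<Longrightarrow> i \<le> n \<Longrightarrow> 1 \<le> j \<Longrightarrow> j \<le> n \<Longrightarrow> i \<noteq> j \<Longrightarrow> ent x i j \<noteq> 0 \<Longrightarrow> P (Emat n i j)"
    and H: "\<And>k. k \<in> {1..<n} \<Longrightarrow> P (Emat n k k - Emat n (k + 1) (k + 1))"
  shows "P x"
proof (cases "n = 0")
  case True
  then have "x = 0\<^sub>m n n" using sl_carrier[OF x] by (intro eq_matI) auto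
  then show ?thesis using zero by simp
next
  case n: False
  have xc: "x \<in> carrier_mat n n" by (rule sl_carrier[OF x])
  define off where "off S = mat n n (\<lambda>(a, b). if (a, b) \<in> S then x $$ (a, b) else 0)" for S
  have off: "off S \<in> sl n \<and> P (off S)" if "finite S" "S \<subseteq> {(a, b). a < n \<and> b < n \<and> a \<noteq> b}" for S
    using that
  proof (induction S rule: finite_induct)
    case empty
    have "off {} = 0\<^sub>m n n" by (rule eq_matI) (auto simp: off_def)
    then show ?case using zero sl_zero by simp
  next
    case (insert p S)
    obtain a b where p: "p = (a, b)" by (cases p)
    have ab: "a < n" "b < n" "a \<noteq> b" using insert.prems p by auto
    have IH: "off S \<in> sl n" "P (off S)" using insert by auto
    show ?case
    proof (cases "x $$ (a, b) = 0")
      case True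
      have "off (insert p S) = off S" by (rule eq_matI) (use True p in \<open>auto simp: off_def\<close>)
      then show ?thesis using IH by simp
    next
      case False
      have "off (insert p S) = off S + x $$ (a, b) \<cdot>\<^sub>m Emat n (a + 1) (b + 1)"
        by (rule eq_matI) (use p insert.hyps(2) in \<open>auto simp: off_def Emat_def\<close>)
      moreover have "P (Emat n (a + 1) (b + 1))" using E[of "a + 1" "b + 1"] ab False by (simp add: ent_def)
      moreover have "Emat n (a + 1) (b + 1) \<in> sl n" using ab by (intro Emat_sl) simp
      ultimately show ?thesis using IH add smult sl_add sl_smult by metis
    qed
  qed
  define dg where "dg K = mat n n (\<lambda>(a, b). if a = b then (if a < K then x $$ (a, a)
      else if a = K then - (\<Sum>r<K. x $$ (r, r)) else 0) else 0)" for K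
  have dg: "dg K \<in> sl n \<and> P (dg K)" if "K < n" for K
    using that
  proof (induction K)
    case 0
    have "dg 0 = 0\<^sub>m n n" by (rule eq_matI) (auto simp: dg_def)
    then show ?case using zero sl_zero by simp
  next
    case (Suc K)
    let ?H = "Emat n (Suc K) (Suc K) - Emat n (Suc K + 1) (Suc K + 1)"
    have "dg (Suc K) = dg K + (\<Sum>r<Suc K. x $$ (r, r)) \<cdot>\<^sub>m ?H"
    proof (rule eq_matI)
      fix a b assume "a < dim_row (dg K + (\<Sum>r<Suc K. x $$ (r, r)) \<cdot>\<^sub>m ?H)"
        "b < dim_col (dg K + (\<Sum>r<Suc K. x $$ (r, r)) \<cdot>\<^sub>m ?H)"
      then have ab: "a < n" "b < n" by (simp_all add: Emat_def)
      consider "a \<noteq> b" | "a = b" "a < K" | "a = b" "a = K" | "a = b" "a = Suc K" | "a = b" "a > Suc K" by linarith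
      then show "dg (Suc K) $$ (a, b) = (dg K + (\<Sum>r<Suc K. x $$ (r, r)) \<cdot>\<^sub>m ?H) $$ (a, b)"
        using ab by cases (auto simp: dg_def Emat_def)
    qed (simp_all add: dg_def Emat_def)
    moreover have "P ?H" "?H \<in> sl n" using H[of "Suc K"] sl_coroot[of "Suc K" n] Suc.prems by simp_all
    moreover have "dg K \<in> sl n \<and> P (dg K)" by (rule Suc.IH) (use Suc.prems in simp)
    ultimately show ?case using add smult sl_add sl_smult by simp
  qed
  let ?A = "{(a, b). a < n \<and> b < n \<and> a \<noteq> b}"
  have finA: "finite ?A" by (rule finite_subset[of _ "{..<n} \<times> {..<n}"]) auto
  have "x = off ?A + dg (n - 1)"
  proof (rule eq_matI)
    fix a b assume "a < dim_row (off ?A + dg (n - 1))" "b < dim_col (off ?A + dg (n - 1))"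
    then have ab: "a < n" "b < n" by (simp_all add: dg_def)
    have "(\<Sum>r<n. x $$ (r, r)) = 0" using x by (simp add: sl_def)
    moreover have "(\<Sum>r<n. x $$ (r, r)) = (\<Sum>r<n - 1. x $$ (r, r)) + x $$ (n - 1, n - 1)"
      using n by (cases n) simp_all
    ultimately have "(\<Sum>r<n - 1. x $$ (r, r)) + x $$ (n - 1, n - 1) = 0" by metis
    then have last: "- (\<Sum>r<n - 1. x $$ (r, r)) = x $$ (n - 1, n - 1)" by (rule minus_unique)
    consider "a \<noteq> b" | "a = b" "a < n - 1" | "a = b" "a = n - 1" using ab by linarith
    then show "x $$ (a, b) = (off ?A + dg (n - 1)) $$ (a, b)"
      using ab last by cases (simp_all add: off_def dg_def)
  qed (use xc in \<open>simp_all add: dg_def\<close>)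
  then show ?thesis using add off[OF finA] dg[of "n - 1"] n by simp
qed

lemma radical_sl: "x \<in> radical n D \<Longrightarrow> x \<in> sl n"
proof -
  assume x: "x \<in> radical n D"
  have "rpart n D x $$ (i, i) = 0" if "i < n" for i
    using that PD_bounds[of "i + 1" "i + 1" n D] by (auto simp: rpart_def)
  then show ?thesis using x by (simp add: radical_def sl_def)
qed

locale highest_weight_module = model n D m for n :: nat and D :: "nat set" and m :: "nat \<Rightarrow> nat" +
  fixes scale :: "complex \<Rightarrow> 'v::ab_group_add \<Rightarrow> 'v" and \<rho> :: "complex mat \<Rightarrow> 'v \<Rightarrow> 'v" and l :: 'v
  assumes irr: "irreducible_module n scale \<rho>" and hwv: "highest_weight_vector n D m scale \<rho> l"
begin

lemma slmod: "sl_module n scale \<rho>" using irr by (simp add: irreducible_module_def)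

sublocale V: vector_space scale using slmod by (simp add: sl_module_def)

lemma \<rho>_linear: "x \<in> sl n \<Longrightarrow> Vector_Spaces.linear scale scale (\<rho> x)"
  using slmod by (simp add: sl_module_def)

lemma \<rho>_add: "x \<in> sl n \<Longrightarrow> \<rho> x (a + b) = \<rho> x a + \<rho> x b"
  using Vector_Spaces.linear_iff[THEN iffD1, OF \<rho>_linear] by blast

lemma \<rho>_scale: "x \<in> sl n \<Longrightarrow> \<rho> x (scale c a) = scale c (\<rho> x a)"
  using Vector_Spaces.linear_iff[THEN iffD1, OF \<rho>_linear] by blast

lemma \<rho>_0: "x \<in> sl n \<Longrightarrow> \<rho> x 0 = 0"
  using \<rho>_scale[of x 0 0] by simp

lemma \<rho>_sum: "x \<in> sl n \<Longrightarrow> \<rho> x (\<Sum>i\<in>I. f i) = (\<Sum>i\<in>I. \<rho> x (f i))"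
  by (induction I rule: infinite_finite_induct) (auto simp: \<rho>_0 \<rho>_add)

lemma \<rho>_madd: "x \<in> sl n \<Longrightarrow> y \<in> sl n \<Longrightarrow> \<rho> (x + y) v = \<rho> x v + \<rho> y v"
  using slmod by (simp add: sl_module_def)

lemma \<rho>_msmult: "x \<in> sl n \<Longrightarrow> \<rho> (c \<cdot>\<^sub>m x) v = scale c (\<rho> x v)"
  using slmod by (simp add: sl_module_def)

lemma \<rho>_mzero: "\<rho> (0\<^sub>m n n) v = 0"
  using \<rho>_msmult[OF sl_zero, of 0 v] by simp

lemma \<rho>_swap: "x \<in> sl n \<Longrightarrow> y \<in> sl n \<Longrightarrow> \<rho> x (\<rho> y v) = \<rho> y (\<rho> x v) + \<rho> (commutator x y) v"
  using slmod by (simp add: sl_module_def)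

lemma hw_raise: "1 \<le> i \<Longrightarrow> i < j \<Longrightarrow> j \<le> n \<Longrightarrow> \<rho> (Emat n i j) l = 0"
  using hwv by (simp add: highest_weight_vector_def)

lemma hw_coroot: "k \<in> {1..<n} \<Longrightarrow> \<rho> (Emat n k k - Emat n (k + 1) (k + 1)) l = scale (of_nat (weight_pair D m (k, k))) l"
  using hwv unfolding highest_weight_vector_def by blast

lemma act_mzero: "act (0\<^sub>m n n) v = (\<lambda>w. 0)"
  using act_smult[OF sl_carrier[OF sl_zero], of 0 v] by simp

lemma act_vsum: "act x (\<lambda>w. \<Sum>i\<in>I. f i w) = (\<lambda>w. \<Sum>i\<in>I. act x (f i) w)"
  by (induction I rule: infinite_finite_induct) (auto simp: act_vzero act_vadd)

text \<open>
  The vectors \<open>l\<close> and \<open>top\<close> are highest weight vectors of the same weight.  \<open>Low k\<close> contains pairs of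
  vectors that are obtained from \<open>(l, top)\<close> in the same way by lowering operators, \<open>k\<close> being the
  amount by which the height of the weight has decreased; \<open>Tot\<close> consists of the sums of such pairs.
  It is the submodule generated by \<open>(l, top)\<close> (\<open>Tot_act\<close>), and the aim is that it is the graph of
  an isomorphism (\<open>Tot_0_left\<close>, \<open>Tot_0_right\<close>).\<close>

inductive Low :: "nat \<Rightarrow> 'v \<Rightarrow> vec \<Rightarrow> bool" where
  Low_top: "Low 0 l top"
| Low_zero: "Low k 0 (\<lambda>_. 0)"
| Low_add: "Low k a b \<Longrightarrow> Low k a' b' \<Longrightarrow> Low k (a + a') (\<lambda>w. b w + b' w)"
| Low_scale: "Low k a b \<Longrightarrow> Low k (scale c a) (\<lambda>w. c * b w)"
| Low_lower: "Low k a b \<Longrightarrow> 1 \<le> j \<Longrightarrow> j < i \<Longrightarrow> i \<le> n \<Longrightarrow>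
    Low (k + (i - j)) (\<rho> (Emat n i j) a) (act (Emat n i j) b)"

definition Tot :: "'v \<Rightarrow> vec \<Rightarrow> bool" where
  "Tot a b \<longleftrightarrow> (\<exists>K A B. (\<forall>k. Low k (A k) (B k)) \<and> (\<forall>k\<ge>K. A k = 0 \<and> B k = (\<lambda>_. 0)) \<and>
     a = (\<Sum>k<K. A k) \<and> b = (\<lambda>w. \<Sum>k<K. B k w))"

lemma Tot_Low:
  assumes "Low k a b"
  shows "Tot a b"
  unfolding Tot_def
proof (intro exI conjI allI impI)
  let ?A = "\<lambda>i. if i = k then a else 0" and ?B = "\<lambda>i. if i = k then b else (\<lambda>_. 0)"
  show "Low i (?A i) (?B i)" for i using assms Low_zero by simp
  show "?A i = 0" "?B i = (\<lambda>_. 0)" if "Suc k \<le> i" for i using that by simp_all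
  show "a = (\<Sum>i<Suc k. ?A i)" by simp
  show "b = (\<lambda>w. \<Sum>i<Suc k. ?B i w)" by (rule ext) simp
qed

lemma Tot_zero: "Tot 0 (\<lambda>_. 0)" by (rule Tot_Low[OF Low_zero])

lemma Tot_add:
  assumes "Tot a b" "Tot a' b'"
  shows "Tot (a + a') (\<lambda>w. b w + b' w)"
proof -
  obtain K A B where 1: "\<forall>k. Low k (A k) (B k)" "\<forall>k\<ge>K. A k = 0 \<and> B k = (\<lambda>_. 0)"
    "a = (\<Sum>k<K. A k)" "b = (\<lambda>w. \<Sum>k<K. B k w)" using assms(1) unfolding Tot_def by blast
  obtain K' A' B' where 2: "\<forall>k. Low k (A' k) (B' k)" "\<forall>k\<ge>K'. A' k = 0 \<and> B' k = (\<lambda>_. 0)"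
    "a' = (\<Sum>k<K'. A' k)" "b' = (\<lambda>w. \<Sum>k<K'. B' k w)" using assms(2) unfolding Tot_def by blast
  let ?K = "max K K'"
  have "a = (\<Sum>k<?K. A k)" unfolding 1(3) by (rule sum.mono_neutral_left) (use 1(2) in auto)
  moreover have "a' = (\<Sum>k<?K. A' k)" unfolding 2(3) by (rule sum.mono_neutral_left) (use 2(2) in auto)
  moreover have "b w = (\<Sum>k<?K. B k w)" for w unfolding 1(4) by (rule sum.mono_neutral_left) (use 1(2) in auto)
  moreover have "b' w = (\<Sum>k<?K. B' k w)" for w unfolding 2(4) by (rule sum.mono_neutral_left) (use 2(2) in auto)
  ultimately show ?thesis
    unfolding Tot_def using 1(1,2) 2(1,2)
    by (intro exI[of _ ?K] exI[of _ "\<lambda>k. A k + A' k"] exI[of _ "\<lambda>k w. B k w + B' k w"])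
      (simp add: Low_add sum.distrib)
qed

lemma Tot_scale:
  assumes "Tot a b"
  shows "Tot (scale c a) (\<lambda>w. c * b w)"
proof -
  obtain K A B where 1: "\<forall>k. Low k (A k) (B k)" "\<forall>k\<ge>K. A k = 0 \<and> B k = (\<lambda>_. 0)"
    "a = (\<Sum>k<K. A k)" "b = (\<lambda>w. \<Sum>k<K. B k w)" using assms(1) unfolding Tot_def by blast
  then show ?thesis
    unfolding Tot_def
    by (intro exI[of _ K] exI[of _ "\<lambda>k. scale c (A k)"] exI[of _ "\<lambda>k w. c * B k w"])
      (simp add: Low_scale V.scale_sum_right sum_distrib_left)
qed

lemma Tot_diff: "Tot a b \<Longrightarrow> Tot a' b' \<Longrightarrow> Tot (a - a') (\<lambda>w. b w - b' w)"
  using Tot_add[OF _ Tot_scale[of a' b' "-1"], of a b] by simp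

lemma Tot_sum: "(\<And>i. i \<in> I \<Longrightarrow> Tot (f i) (g i)) \<Longrightarrow> Tot (\<Sum>i\<in>I. f i) (\<lambda>w. \<Sum>i\<in>I. g i w)"
  by (induction I rule: infinite_finite_induct) (simp_all add: Tot_zero Tot_add)

lemma Tot_image:
  assumes x: "x \<in> sl n" and low: "\<And>k a b. Low k a b \<Longrightarrow> Tot (\<rho> x a) (act x b)" and "Tot a b"
  shows "Tot (\<rho> x a) (act x b)"
proof -
  obtain K A B where 1: "\<forall>k. Low k (A k) (B k)" "a = (\<Sum>k<K. A k)" "b = (\<lambda>w. \<Sum>k<K. B k w)"
    using assms(3) unfolding Tot_def by blast
  show ?thesis unfolding 1(2,3) \<rho>_sum[OF x] act_vsum by (rule Tot_sum) (use low 1(1) in blast)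
qed

lemma Tot_lower: "1 \<le> j \<Longrightarrow> j < i \<Longrightarrow> i \<le> n \<Longrightarrow> Tot a b \<Longrightarrow> Tot (\<rho> (Emat n i j) a) (act (Emat n i j) b)"
  by (rule Tot_image[OF Emat_sl]) (simp, rule Tot_Low, rule Low_lower)

text \<open>Lowering operators suffice to generate: any element of \<open>sl n\<close> can be moved past them to the
  highest weight vectors, on which raising operators vanish and coroots act by the same scalars.\<close>

lemma Low_act: "Low k a b \<Longrightarrow> x \<in> sl n \<Longrightarrow> Tot (\<rho> x a) (act x b)"
proof (induction arbitrary: x rule: Low.induct)
  case Low_top
  then show ?case
  proof (induction rule: sl_induct)
    case zero
    then show ?case using Tot_zero by (simp add: \<rho>_mzero act_mzero)
  next
    case (add y z)
    then show ?case using Tot_add[of "\<rho> y l" "act y top" "\<rho> z l" "act z top"]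
      by (simp add: \<rho>_madd act_add sl_carrier)
  next
    case (smult c y)
    then show ?case using Tot_scale[of "\<rho> y l" "act y top" c]
      by (simp add: \<rho>_msmult act_smult sl_carrier)
  next
    case (Emat i j)
    show ?case
    proof (cases "j < i")
      case True
      then show ?thesis using Tot_Low[OF Low_lower[OF Low.Low_top, of j i]] Emat by simp
    next
      case False
      then have ij: "i < j" using Emat by simp
      have "act (Emat n i j) top = (\<lambda>_. 0)" using act_top_0[of i j] Emat ij by simp
      then show ?thesis using hw_raise[of i j] Tot_zero Emat ij by simp
    qed
  next
    case (coroot k)
    then show ?case
      using Tot_scale[OF Tot_Low[OF Low.Low_top], of "of_nat (weight_pair D m (k, k))"]
      by (simp only: hw_coroot act_coroot_top)
  qed
next
  case (Low_zero k)
  then show ?case using Tot_zero by (simp add: \<rho>_0 act_vzero)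
next
  case (Low_add k a b a' b')
  then show ?case using Tot_add[of "\<rho> x a" "act x b" "\<rho> x a'" "act x b'"] by (simp add: \<rho>_add act_vadd)
next
  case (Low_scale k a b c)
  then show ?case using Tot_scale[of "\<rho> x a" "act x b" c] by (simp add: \<rho>_scale act_vsmult)
next
  case (Low_lower k a b j i)
  let ?E = "Emat n i j"
  have E: "?E \<in> sl n" using Low_lower.hyps by (intro Emat_sl) simp
  have c: "act x (act ?E b) = (\<lambda>w. act ?E (act x b) w + act (commutator x ?E) b w)"
    using act_commutator[OF sl_carrier[OF Low_lower.prems] sl_carrier[OF E], of b] by (simp add: fun_eq_iff)
  show ?case unfolding \<rho>_swap[OF Low_lower.prems E] c
    using Low_lower.hyps Low_lower.prems E by (intro Tot_add Tot_lower Low_lower.IH sl_commutator)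
qed

lemma Tot_act: "x \<in> sl n \<Longrightarrow> Tot a b \<Longrightarrow> Tot (\<rho> x a) (act x b)"
  by (rule Tot_image) (auto intro: Low_act)

text \<open>A diagonal matrix whose eigenvalues on the weight spaces measure the height: lowering by a root
  of height \<open>k\<close> subtracts \<open>2 * k\<close>.\<close>

definition hmat :: "complex mat" where
  "hmat = mat n n (\<lambda>(a, b). if a = b then of_int (int n - 1 - 2 * int a) else 0)"

lemma hmat_sl: "hmat \<in> sl n"
proof -
  have "(\<Sum>a<k. int n - 1 - 2 * int a) = int k * (int n - int k)" for k
    by (induction k) (simp_all add: algebra_simps)
  from this[of n] have "(\<Sum>a<n. int n - 1 - 2 * int a) = 0" by simp
  then have "of_int (\<Sum>a<n. int n - 1 - 2 * int a) = (0 :: complex)" by (simp only: of_int_0)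
  then show ?thesis by (simp add: sl_def hmat_def)
qed

lemma adj_hmat: "adj hmat = hmat"
  by (rule eq_matI) (auto simp: adj_def hmat_def)

lemma ent_hmat: "1 \<le> i \<Longrightarrow> i \<le> n \<Longrightarrow> 1 \<le> j \<Longrightarrow> j \<le> n \<Longrightarrow> ent hmat i j = (if i = j then of_int (int n + 1 - 2 * int i) else 0)"
  by (auto simp: ent_def hmat_def)

lemma commutator_hmat:
  assumes "1 \<le> j" "j < i" "i \<le> n"
  shows "commutator hmat (Emat n i j) = (- (2 * of_nat (i - j))) \<cdot>\<^sub>m Emat n i j"
proof (rule eq_matI)
  fix a b assume "a < dim_row ((- (2 * of_nat (i - j))) \<cdot>\<^sub>m Emat n i j)" "b < dim_col ((- (2 * of_nat (i - j))) \<cdot>\<^sub>m Emat n i j)"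
  then have ab: "a < n" "b < n" by (simp_all add: Emat_def)
  have "commutator hmat (Emat n i j) $$ (a, b) = ent (commutator hmat (Emat n i j)) (a + 1) (b + 1)" by (simp add: ent_def)
  also have "\<dots> = (if b + 1 = j then ent hmat (a + 1) i else 0) - (if a + 1 = i then ent hmat j (b + 1) else 0)"
    by (rule ent_commutator_Emat) (use ab assms sl_carrier[OF hmat_sl] in simp_all)
  also have "\<dots> = ((- (2 * of_nat (i - j))) \<cdot>\<^sub>m Emat n i j) $$ (a, b)"
    using ab assms by (auto simp: ent_hmat Emat_def of_nat_diff)
  finally show "commutator hmat (Emat n i j) $$ (a, b) = ((- (2 * of_nat (i - j))) \<cdot>\<^sub>m Emat n i j) $$ (a, b)" .
qed (simp_all add: commutator_def Emat_def hmat_def)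

lemma hmat_eigen: "\<exists>\<Lambda>. \<rho> hmat l = scale \<Lambda> l \<and> act hmat top = (\<lambda>w. \<Lambda> * top w)"
  using hmat_sl
proof (induction rule: sl_induct)
  case zero
  show ?case by (rule exI[of _ 0]) (simp add: \<rho>_mzero act_mzero)
next
  case (add y z)
  then obtain p q where "\<rho> y l = scale p l" "act y top = (\<lambda>w. p * top w)" "\<rho> z l = scale q l" "act z top = (\<lambda>w. q * top w)" by blast
  then show ?case using add(1,2)
    by (intro exI[of _ "p + q"]) (simp add: \<rho>_madd act_add sl_carrier V.scale_left_distrib distrib_right)
next
  case (smult c y)
  then obtain p where "\<rho> y l = scale p l" "act y top = (\<lambda>w. p * top w)" by blast
  then show ?case using smult(1)
    by (intro exI[of _ "c * p"]) (simp add: \<rho>_msmult act_smult sl_carrier mult.assoc)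
next
  case (Emat i j)
  then show ?case by (simp add: ent_hmat)
next
  case (coroot k)
  then show ?case using hw_coroot[OF coroot] act_coroot_top[OF coroot] by blast
qed

text \<open>The common eigenvalue on both highest weight vectors.\<close>

definition hw :: complex where
  "hw = (SOME \<Lambda>. \<rho> hmat l = scale \<Lambda> l \<and> act hmat top = (\<lambda>w. \<Lambda> * top w))"

lemma hw: "\<rho> hmat l = scale hw l" "act hmat top = (\<lambda>w. hw * top w)"
  using someI_ex[OF hmat_eigen] unfolding hw_def by blast+

lemma Low_eigen: "Low k a b \<Longrightarrow> \<rho> hmat a = scale (hw - 2 * of_nat k) a \<and> act hmat b = (\<lambda>w. (hw - 2 * of_nat k) * b w)"
proof (induction rule: Low.induct)
  case Low_top
  then show ?case by (simp add: hw)
next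
  case (Low_zero k)
  then show ?case by (simp add: \<rho>_0[OF hmat_sl] act_vzero)
next
  case (Low_add k a b a' b')
  then show ?case by (simp add: \<rho>_add[OF hmat_sl] act_vadd V.scale_right_distrib distrib_left)
next
  case (Low_scale k a b c)
  have "scale c (scale x a) = scale x (scale c a)" "c * (x * y) = x * (c * y)" for x y
    by (simp_all add: mult.commute mult.left_commute)
  then show ?case using Low_scale.IH by (simp only: \<rho>_scale[OF hmat_sl] act_vsmult)
next
  case (Low_lower k a b j i)
  let ?E = "Emat n i j" and ?c = "- (2 * of_nat (i - j)) :: complex"
  have E: "?E \<in> sl n" using Low_lower.hyps by (intro Emat_sl) simp
  note cm = commutator_hmat[OF Low_lower.hyps(2-4)]
  have e: "hw - 2 * of_nat (k + (i - j)) = (hw - 2 * of_nat k) + ?c" by simp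
  have "\<rho> hmat (\<rho> ?E a) = scale (hw - 2 * of_nat k) (\<rho> ?E a) + scale ?c (\<rho> ?E a)"
    using Low_lower.IH by (simp only: \<rho>_swap[OF hmat_sl E] cm \<rho>_scale[OF E] \<rho>_msmult[OF E])
  moreover have "act hmat (act ?E b) w = (hw - 2 * of_nat k) * act ?E b w + ?c * act ?E b w" for w
  proof -
    have "act (commutator hmat ?E) b w = act hmat (act ?E b) w - act ?E (act hmat b) w"
      using act_commutator[OF sl_carrier[OF hmat_sl] sl_carrier[OF E], of b] by (simp add: fun_eq_iff)
    moreover have "act (commutator hmat ?E) b w = ?c * act ?E b w"
      unfolding cm act_smult[OF sl_carrier[OF E]] ..
    moreover have "act ?E (act hmat b) w = (hw - 2 * of_nat k) * act ?E b w"
      using Low_lower.IH by (simp only: act_vsmult)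
    ultimately show ?thesis by (simp add: algebra_simps)
  qed
  ultimately show ?case unfolding e by (simp only: V.scale_left_distrib distrib_right)
qed

lemma eigenvectors_independent:
  assumes "\<forall>k<K. \<rho> hmat (A k) = scale (hw - 2 * of_nat k) (A k)" "(\<Sum>k<K. A k) = 0"
  shows "\<forall>k<K. A k = 0"
  using assms
proof (induction K arbitrary: A)
  case (Suc K)
  let ?A = "\<lambda>k. scale (2 * of_nat K - 2 * of_nat k) (A k)"
  have sum: "(\<Sum>k<K. A k) + A K = 0" using Suc.prems(2) by simp
  have "(\<Sum>k<K. \<rho> hmat (A k)) + \<rho> hmat (A K) = 0"
    using arg_cong[OF sum, of "\<rho> hmat"] by (simp add: \<rho>_add[OF hmat_sl] \<rho>_sum[OF hmat_sl] \<rho>_0[OF hmat_sl])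
  then have "(\<Sum>k<K. scale (hw - 2 * of_nat k) (A k)) + scale (hw - 2 * of_nat K) (A K) = 0"
    using Suc.prems(1) by simp
  moreover have "scale (hw - 2 * of_nat K) (\<Sum>k<K. A k) + scale (hw - 2 * of_nat K) (A K) = 0"
    using arg_cong[OF sum, of "scale (hw - 2 * of_nat K)"] by (simp add: V.scale_right_distrib)
  ultimately have diff: "(\<Sum>k<K. scale (hw - 2 * of_nat k) (A k)) - scale (hw - 2 * of_nat K) (\<Sum>k<K. A k) = 0"
    by (simp only: add_eq_0_iff2 diff_self)
  have "?A k = scale (hw - 2 * of_nat k) (A k) - scale (hw - 2 * of_nat K) (A k)" for k
    by (subst V.scale_left_diff_distrib[symmetric]) simp
  then have s0: "(\<Sum>k<K. ?A k) = 0"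
    using diff by (simp only: V.scale_sum_right sum_subtractf)
  have ev: "\<forall>k<K. \<rho> hmat (?A k) = scale (hw - 2 * of_nat k) (?A k)"
  proof (intro allI impI)
    fix k assume "k < K"
    then have "\<rho> hmat (A k) = scale (hw - 2 * of_nat k) (A k)" using Suc.prems(1) by simp
    moreover have "scale x (scale y a) = scale y (scale x a)" for x y a by (simp only: V.scale_scale mult.commute)
    ultimately show "\<rho> hmat (?A k) = scale (hw - 2 * of_nat k) (?A k)" by (simp only: \<rho>_scale[OF hmat_sl])
  qed
  have z: "\<forall>k<K. ?A k = 0" by (rule Suc.IH[OF ev s0])
  have "A k = 0" if k: "k < K" for k
  proof -
    have "scale (2 * of_nat K - 2 * of_nat k) (A k) = 0" using z k by blast
    moreover have "(2 * of_nat K - 2 * of_nat k :: complex) \<noteq> 0" using k by simp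
    ultimately show ?thesis unfolding V.scale_eq_0_iff by blast
  qed
  then have "\<forall>k<K. A k = 0" by blast
  then show ?case using sum by (simp add: less_Suc_eq)
qed simp

lemma ip_vsum: "ip (\<lambda>w. \<Sum>i\<in>I. f i w) v = (\<Sum>i\<in>I. ip (f i) v)"
  unfolding ip_def sum_distrib_right by (rule sum.swap)

lemma ip_scale_left: "ip (\<lambda>w. c * u w) v = c * ip u v"
  by (simp add: ip_def sum_distrib_left mult.assoc)

lemma ip_scale_right: "ip u (\<lambda>w. c * v w) = cnj c * ip u v"
  by (simp add: ip_def sum_distrib_left mult.left_commute)

lemma ip_add_right: "ip u (\<lambda>w. v w + v' w) = ip u v + ip u v'"
  by (simp add: ip_def distrib_left sum.distrib)

lemma hw_real: "cnj hw = hw"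
proof -
  have "ip top top \<noteq> 0"
  proof
    assume "ip top top = 0"
    then have "top w = 0" for w using ip_self_0 top_outside by (cases "w \<in> wds") blast+
    then show False using top_nonzero by auto
  qed
  moreover have "hw * ip top top = cnj hw * ip top top"
    using ip_act[of hmat top top] by (simp only: adj_hmat hw ip_scale_left ip_scale_right)
  ultimately show ?thesis by simp
qed

lemma Low_0: "Low k a b \<Longrightarrow> k = 0 \<Longrightarrow> \<exists>c. a = scale c l \<and> b = (\<lambda>w. c * top w)"
proof (induction rule: Low.induct)
  case Low_top
  then show ?case by (intro exI[of _ 1]) simp
next
  case (Low_zero k)
  then show ?case by (intro exI[of _ 0]) simp
next
  case (Low_add k a b a' b')
  then obtain c c' where "a = scale c l" "b = (\<lambda>w. c * top w)" "a' = scale c' l" "b' = (\<lambda>w. c' * top w)" by blast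
  then show ?case by (intro exI[of _ "c + c'"]) (simp add: V.scale_left_distrib distrib_right)
next
  case (Low_scale k a b c)
  then obtain c' where "a = scale c' l" "b = (\<lambda>w. c' * top w)" by blast
  then show ?case by (intro exI[of _ "c * c'"]) (simp add: mult.assoc)
qed simp

text \<open>The components of \<open>0\<close> for the different eigenvalues of \<open>hmat\<close> vanish.  So the component of height
  \<open>0\<close> of \<open>b\<close> vanishes as well, and the other ones are orthogonal to \<open>top\<close>.\<close>

lemma Tot_0_ip_top:
  assumes "Tot 0 b"
  shows "ip b top = 0"
proof -
  obtain K A B where 1: "\<forall>k. Low k (A k) (B k)" "(\<Sum>k<K. A k) = 0" "b = (\<lambda>w. \<Sum>k<K. B k w)"
    using assms unfolding Tot_def by metis
  have A0: "\<forall>k<K. A k = 0" using eigenvectors_independent[of K A] Low_eigen 1(1,2) by blast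
  have "ip (B k) top = 0" if k: "k < K" for k
  proof (cases "k = 0")
    case True
    then obtain c where c: "A k = scale c l" "B k = (\<lambda>w. c * top w)" using Low_0 1(1) by blast
    have "l \<noteq> 0" using hwv by (simp add: highest_weight_vector_def)
    then have "c = 0" using c(1) A0 k by (simp add: V.scale_eq_0_iff)
    then show ?thesis using c(2) by (simp add: ip_def)
  next
    case False
    have "ip (act hmat (B k)) top = ip (B k) (act hmat top)" using ip_act[of hmat] by (simp only: adj_hmat)
    moreover have "act hmat (B k) = (\<lambda>w. (hw - 2 * of_nat k) * B k w)" using Low_eigen 1(1) by blast
    ultimately have "(hw - 2 * of_nat k) * ip (B k) top = hw * ip (B k) top"
      by (simp only: hw ip_scale_left ip_scale_right hw_real)
    then have "2 * of_nat k * ip (B k) top = 0" by (simp only: left_diff_distrib diff_eq_eq) simp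
    then show ?thesis using False by simp
  qed
  then show ?thesis unfolding 1(3) ip_vsum by (simp add: sum.neutral)
qed

lemma adj_adj: "x \<in> carrier_mat n n \<Longrightarrow> adj (adj x) = x"
  by (rule eq_matI) (auto simp: adj_def)

lemma Low_ip: "Low k a b \<Longrightarrow> Tot 0 b' \<Longrightarrow> ip b' b = 0"
proof (induction arbitrary: b' rule: Low.induct)
  case Low_top
  then show ?case by (rule Tot_0_ip_top)
next
  case (Low_zero k)
  then show ?case by (simp add: ip_def)
next
  case (Low_add k a b a' b'')
  then show ?case by (simp add: ip_add_right)
next
  case (Low_scale k a b c)
  then show ?case by (simp add: ip_scale_right)
next
  case (Low_lower k a b j i)
  have E: "Emat n i j \<in> sl n" using Low_lower.hyps by (intro Emat_sl) simp
  have "Tot (\<rho> (adj (Emat n i j)) 0) (act (adj (Emat n i j)) b')"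
    by (rule Tot_act[OF adj_sl[OF E] Low_lower.prems])
  then have "Tot 0 (act (adj (Emat n i j)) b')" by (simp only: \<rho>_0[OF adj_sl[OF E]])
  then have "ip (act (adj (Emat n i j)) b') b = 0" by (rule Low_lower.IH)
  then show ?case unfolding ip_act adj_adj[OF sl_carrier[OF E]] .
qed

lemma Low_outside: "Low k a b \<Longrightarrow> w \<notin> wds \<Longrightarrow> b w = 0"
  by (induction rule: Low.induct) (simp_all add: top_outside act_outside)

text \<open>By contravariance \<open>b\<close> is orthogonal to everything generated by \<open>top\<close>, hence to itself.\<close>

theorem Tot_0_left:
  assumes "Tot 0 b"
  shows "b = (\<lambda>_. 0)"
proof -
  obtain K A B where 1: "\<forall>k. Low k (A k) (B k)" "b = (\<lambda>w. \<Sum>k<K. B k w)"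
    using assms unfolding Tot_def by metis
  have "cnj (ip b b) = (\<Sum>k<K. cnj (ip b (B k)))"
  proof -
    have cs: "cnj (ip u v) = ip v u" for u v by (simp add: ip_def mult.commute)
    show ?thesis unfolding cs using ip_vsum[of B "{..<K}" b] unfolding 1(2) by simp
  qed
  also have "\<dots> = 0"
  proof (rule sum.neutral, rule ballI)
    fix k
    have "ip b (B k) = 0" using Low_ip[OF _ assms] 1(1) by blast
    then show "cnj (ip b (B k)) = 0" by simp
  qed
  finally have "ip b b = 0" by simp
  moreover have "b w = 0" if "w \<notin> wds" for w
    unfolding 1(2) using Low_outside 1(1) that by (intro sum.neutral) blast
  ultimately have "b w = 0" for w using ip_self_0[of b w] by (cases "w \<in> wds") simp_all
  then show ?thesis by (rule ext)
qed

text \<open>These vectors form a submodule, which is not everything because it does not contain \<open>l\<close>.\<close>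

theorem Tot_0_right:
  assumes "Tot a (\<lambda>_. 0)"
  shows "a = 0"
proof -
  let ?W = "{a. Tot a (\<lambda>_. 0)}"
  have "Modules.module.subspace scale ?W"
  proof (rule V.subspaceI)
    show "0 \<in> ?W" using Tot_zero by simp
    show "x + y \<in> ?W" if "x \<in> ?W" "y \<in> ?W" for x y
      using Tot_add[of x "\<lambda>_. 0" y "\<lambda>_. 0"] that by simp
    show "scale c x \<in> ?W" if "x \<in> ?W" for c x
      using Tot_scale[of x "\<lambda>_. 0" c] that by simp
  qed
  moreover have "\<forall>x\<in>sl n. \<forall>w\<in>?W. \<rho> x w \<in> ?W"
  proof (intro ballI)
    fix x w assume "x \<in> sl n" "w \<in> ?W"
    then show "\<rho> x w \<in> ?W" using Tot_act[of x w "\<lambda>_. 0"] by (simp add: act_vzero)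
  qed
  moreover have "\<forall>W. Modules.module.subspace scale W \<and> (\<forall>x\<in>sl n. \<forall>w\<in>W. \<rho> x w \<in> W) \<longrightarrow> W = {0} \<or> W = UNIV"
    using irr unfolding irreducible_module_def by (elim conjE) assumption
  ultimately have "?W = {0} \<or> ?W = UNIV" by (simp only: simp_thms)
  moreover have "?W \<noteq> UNIV"
  proof
    assume "?W = UNIV"
    then have "Tot l (\<lambda>_. 0)" by blast
    from Tot_diff[OF Tot_Low[OF Low_top] this] have "Tot 0 top" by simp
    then show False using Tot_0_left top_nonzero by blast
  qed
  ultimately show ?thesis using assms by blast
qed

subsection \<open>Consequences for the irreducible module\<close>

lemma parabolic_scales_hwv:
  assumes x: "x \<in> parabolic n D"
  shows "\<exists>c. \<rho> x l = scale c l"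
proof -
  have "x \<in> sl n" using parabolicD(1)[OF D x] .
  then show ?thesis
  proof (induction rule: sl_induct)
    case zero
    show ?case by (rule exI[of _ 0]) (simp add: \<rho>_mzero)
  next
    case (add y z)
    then obtain p q where "\<rho> y l = scale p l" "\<rho> z l = scale q l" by blast
    then show ?case using add(1,2) by (intro exI[of _ "p + q"]) (simp add: \<rho>_madd V.scale_left_distrib)
  next
    case (smult c y)
    then obtain p where "\<rho> y l = scale p l" by blast
    then show ?case using smult(1) by (intro exI[of _ "c * p"]) (simp add: \<rho>_msmult)
  next
    case (Emat i j)
    have "\<rho> (Emat n i j) l = 0"
    proof (cases "i < j")
      case True
      then show ?thesis using hw_raise Emat by simp
    next
      case False
      then have ij: "j < i" using Emat by simp
      have "(i, j) \<notin> PD n D" using parabolicD(3)[OF D x] Emat by blast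
      then have "\<not> (\<exists>d\<in>D. j \<le> d \<and> d < i)" using Emat ij by (auto simp: PD_def Pd_def Pos_def)
      then have "act (Emat n i j) top = (\<lambda>_. 0)" using act_top_0[of i j] Emat by simp
      moreover have "Tot (\<rho> (Emat n i j) l) (act (Emat n i j) top)"
        by (rule Tot_act[OF Emat_sl[OF Emat(5)] Tot_Low[OF Low_top]])
      ultimately show ?thesis using Tot_0_right by simp
    qed
    then show ?case by (intro exI[of _ 0]) simp
  next
    case (coroot k)
    then show ?case using hw_coroot by blast
  qed
qed

lemma Tot_power: "x \<in> sl n \<Longrightarrow> Tot ((\<rho> x ^^ a) l) ((act x ^^ a) top)"
  by (induction a) (simp_all add: Tot_Low[OF Low_top] Tot_act)

lemma root_power_kills_hwv:
  assumes "(i, j) \<in> PD n D" "a > (\<Sum>d\<in>D. m d * (if j \<le> d \<and> d < i then 1 else 0))"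
  shows "(\<rho> (Emat n i j) ^^ a) l = 0"
proof -
  have b: "1 \<le> j" "j < i" "i \<le> n" using PD_bounds[OF assms(1)] by simp_all
  then have "(act (Emat n i j) ^^ a) top = (\<lambda>_. 0)" using assms(2) by (intro act_power_top) simp_all
  then have "Tot ((\<rho> (Emat n i j) ^^ a) l) (\<lambda>_. 0)" using Tot_power[OF Emat_sl, of i j a] b(2) by simp
  then show ?thesis by (rule Tot_0_right)
qed

lemma Tot_list: "set xs \<subseteq> sl n \<Longrightarrow> Tot (foldr \<rho> xs l) (foldr act xs top)"
  by (induction xs) (simp_all add: Tot_Low[OF Low_top] Tot_act)

text \<open>Products of fewer than \<open>K\<close> radical elements see only words with fewer than \<open>K\<close> big letters.\<close>

lemma filt_degree:
  assumes "u \<in> filt n D scale \<rho> l K"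
  shows "\<exists>b. Tot u b \<and> (\<forall>w. b w \<noteq> 0 \<longrightarrow> card (big w) < K)"
proof (cases K)
  case 0
  then show ?thesis using assms Tot_zero by auto
next
  case (Suc k)
  have "u \<in> V.span {foldr \<rho> as l | as. set as \<subseteq> radical n D \<and> length as \<le> k}" using assms Suc by simp
  then show ?thesis
  proof (induction rule: V.span_induct_alt)
    case base
    show ?case using Tot_zero by auto
  next
    case (step c x y)
    obtain as where as: "x = foldr \<rho> as l" "set as \<subseteq> radical n D" "length as \<le> k" using step(1) by blast
    obtain b where b: "Tot y b" "\<forall>w. b w \<noteq> 0 \<longrightarrow> card (big w) < K" using step(2) by blast
    let ?b = "\<lambda>w. c * foldr act as top w + b w"
    have "set as \<subseteq> sl n" using as(2) radical_sl by blast
    then have "Tot (scale c x + y) ?b" unfolding as(1) by (intro Tot_add Tot_scale Tot_list b(1))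
    moreover have "card (big w) < K" if "?b w \<noteq> 0" for w
    proof (cases "b w = 0")
      case True
      then have "foldr act as top w \<noteq> 0" using that by simp
      then show ?thesis using act_list_degree[of as w] as(3) Suc by simp
    qed (use b(2) in blast)
    ultimately show ?case by blast
  qed
qed

abbreviation \<rho>_roots :: "(nat \<times> nat) list \<Rightarrow> 'v" where
  "\<rho>_roots as \<equiv> foldr (\<lambda>\<alpha>. \<rho> (Emat n (fst \<alpha>) (snd \<alpha>))) as l"

lemma Tot_roots: "set as \<subseteq> PD n D \<Longrightarrow> Tot (\<rho>_roots as) (act_roots as)"
proof (induction as)
  case (Cons \<alpha> as)
  have "\<alpha> \<in> PD n D" using Cons.prems by simp
  then have "Emat n (fst \<alpha>) (snd \<alpha>) \<in> sl n" using PD_bounds[of "fst \<alpha>" "snd \<alpha>" n D] by (intro Emat_sl) simp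
  then show ?case using Cons by (simp add: Tot_act)
qed (simp add: Tot_Low[OF Low_top])

text \<open>Compare the coefficients of the model at the word of \<open>A\<close>.  Terms of smaller degree do not see
  this word, and among the exponents at most \<open>least A\<close> only \<open>least A\<close> does.\<close>

theorem leading_coefficient_zero:
  assumes A: "family A" and finE: "finite E"
    and ls: "\<And>e. e \<in> E \<Longrightarrow> set (ls e) \<subseteq> PD n D \<and> roots_content (ls e) = e \<and> e \<le> least A \<and> degree e = degree (least A)"
    and e0: "least A \<in> E"
    and mem: "(\<Sum>e\<in>E. scale (c e) (\<rho>_roots (ls e))) \<in> filt n D scale \<rho> l (degree (least A))"
  shows "c (least A) = 0"
proof -
  obtain b where b: "Tot (\<Sum>e\<in>E. scale (c e) (\<rho>_roots (ls e))) b" "\<forall>w. b w \<noteq> 0 \<longrightarrow> card (big w) < degree (least A)"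
    using filt_degree[OF mem] by blast
  have "Tot (\<Sum>e\<in>E. scale (c e) (\<rho>_roots (ls e))) (\<lambda>w. \<Sum>e\<in>E. c e * act_roots (ls e) w)"
    by (intro Tot_sum Tot_scale Tot_roots) (use ls in blast)
  from Tot_diff[OF this b(1)] have "Tot 0 (\<lambda>w. (\<Sum>e\<in>E. c e * act_roots (ls e) w) - b w)" by simp
  from Tot_0_left[OF this] have eq: "(\<Sum>e\<in>E. c e * act_roots (ls e) w) = b w" for w by (simp add: fun_eq_iff)
  have "b (word A) = 0" using b(2) degree_least[OF A] by force
  then have "(\<Sum>e\<in>E. c e * act_roots (ls e) (word A)) = 0" using eq by simp
  moreover have "c e * act_roots (ls e) (word A) = 0" if e: "e \<in> E - {least A}" for e
  proof (rule ccontr)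
    assume nz: "c e * act_roots (ls e) (word A) \<noteq> 0"
    have "e \<in> E" using e by blast
    note L = ls[OF this]
    have len: "length (ls e) = degree (least A)" using L degree_roots_content[of "ls e"] by simp
    have "roots_content (ls e) = least A" using act_roots_word[OF A _ len] L nz by simp
    then show False using L e by simp
  qed
  ultimately have "c (least A) * act_roots (ls (least A)) (word A) = 0"
    using sum.remove[OF finE e0, of "\<lambda>e. c e * act_roots (ls e) (word A)"] by (simp add: sum.neutral)
  moreover have "act_roots (ls (least A)) (word A) \<noteq> 0" using act_roots_least[OF A] ls[OF e0] by blast
  ultimately show ?thesis by simp
qed

end

section \<open>Partial derivatives and prolongation of ideals\<close>

lemma Sym_zero: "0 \<in> Sym n D"
  by (simp add: Sym_def)

lemma Sym_add: "p \<in> Sym n D \<Longrightarrow> q \<in> Sym n D \<Longrightarrow> p + q \<in> Sym n D"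
  unfolding Sym_def using Poly_Mapping.keys_add[of p q] by blast

lemma Sym_sum: "(\<And>i. i \<in> I \<Longrightarrow> f i \<in> Sym n D) \<Longrightarrow> (\<Sum>i\<in>I. f i) \<in> Sym n D"
  by (induction I rule: infinite_finite_induct) (simp_all add: Sym_zero Sym_add)

lemma Sym_mult: "p \<in> Sym n D \<Longrightarrow> q \<in> Sym n D \<Longrightarrow> p * q \<in> Sym n D"
  unfolding Sym_def mem_Collect_eq
proof
  fix e assume p: "\<forall>e\<in>keys p. keys e \<subseteq> PD n D"
    and q: "\<forall>e\<in>keys q. keys e \<subseteq> PD n D" and "e \<in> keys (p * q)"
  then obtain a b where "e = a + b" "a \<in> keys p" "b \<in> keys q"
    using Poly_Mapping.keys_mult[of p q] by blast
  then show "keys e \<subseteq> PD n D" using p q Poly_Mapping.keys_add[of a b] by blast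
qed

lemma Sym_fvar: "\<alpha> \<in> PD n D \<Longrightarrow> fvar \<alpha> \<in> Sym n D"
  unfolding fvar_def by (rule Sym_single) simp

lemma fvar_times_single: "fvar \<alpha> * single e c = single (single \<alpha> 1 + e) c"
  by (simp add: fvar_def mult_single)

lemma split_exponent:
  fixes e :: "nat \<times> nat \<Rightarrow>\<^sub>0 nat"
  assumes "\<alpha> \<in> keys e"
  shows "e = single \<alpha> 1 + (e - single \<alpha> 1)"
    "keys (e - single \<alpha> 1) \<subseteq> keys e"
proof -
  show "e = single \<alpha> 1 + (e - single \<alpha> 1)"
    by (rule poly_mapping_eqI) (use assms in \<open>auto simp: lookup_add lookup_minus lookup_single when_def in_keys_iff\<close>)
  show "keys (e - single \<alpha> 1) \<subseteq> keys e"
    by (auto simp: in_keys_iff lookup_minus)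
qed

lemma Sym_induct [consumes 1, case_names const add var]:
  assumes "p \<in> Sym n D" and const: "\<And>c. P (single 0 c)"
    and add: "\<And>p q. p \<in> Sym n D \<Longrightarrow> q \<in> Sym n D \<Longrightarrow> P p \<Longrightarrow> P q \<Longrightarrow> P (p + q)"
    and var: "\<And>\<alpha> q. \<alpha> \<in> PD n D \<Longrightarrow> q \<in> Sym n D \<Longrightarrow> P q \<Longrightarrow> P (fvar \<alpha> * q)"
  shows "P p"
proof -
  have mono: "P (single e c)" if "keys e \<subseteq> PD n D" for e c
    using that
  proof (induction "degree e" arbitrary: e)
    case 0
    have "e = 0"
    proof (rule ccontr)
      assume "e \<noteq> 0"
      then obtain \<alpha> where "\<alpha> \<in> keys e" using keys_eq_empty[of e] by blast
      then have "degree e = 1 + degree (e - single \<alpha> 1)"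
        by (subst split_exponent(1)[of \<alpha> e], assumption) (simp only: degree_add degree_single)
      then show False using 0 by simp
    qed
    then show ?case using const by simp
  next
    case (Suc k)
    have "e \<noteq> 0" using Suc.hyps(2) by (auto simp: degree_def)
    then obtain \<alpha> where a: "\<alpha> \<in> keys e" using keys_eq_empty[of e] by blast
    let ?e = "e - single \<alpha> 1"
    have e: "e = single \<alpha> 1 + ?e" and k: "keys ?e \<subseteq> PD n D"
      using split_exponent[OF a] Suc.prems by blast+
    have "degree e = 1 + degree ?e" by (subst e) (simp only: degree_add degree_single)
    then have "P (single ?e c)" using Suc.hyps k by simp
    then have "P (fvar \<alpha> * single ?e c)"
      using var a Suc.prems Sym_single[OF k] by blast
    then show ?case unfolding fvar_times_single e[symmetric] .
  qed
  have "(\<Sum>e\<in>K. single e (lookup p e)) \<in> Sym n D \<and>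
      P (\<Sum>e\<in>K. single e (lookup p e))" if "finite K" "K \<subseteq> keys p" for K
    using that
  proof (induction K rule: finite_induct)
    case empty
    then show ?case using const[of 0] Sym_zero by simp
  next
    case (insert e K)
    have "keys e \<subseteq> PD n D" using insert.prems assms(1) by (auto simp: Sym_def)
    then have "single e (lookup p e) \<in> Sym n D" "P (single e (lookup p e))"
      using mono Sym_single by blast+
    then show ?case using insert add Sym_add by simp
  qed
  from this[OF finite_keys order_refl] show ?thesis using poly_mapping_expand[of p] by simp
qed

definition pd :: "nat \<times> nat \<Rightarrow> pol \<Rightarrow> pol" where
  "pd \<alpha> = extend (\<lambda>e c. single (e - single \<alpha> 1) (of_nat (lookup e \<alpha>) * c))"

lemma pd_single: "pd \<alpha> (single e c) =
    single (e - single \<alpha> 1) (of_nat (lookup e \<alpha>) * c)"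
  unfolding pd_def by (rule extend_single) simp

lemma pd_add: "pd \<alpha> (p + q) = pd \<alpha> p + pd \<alpha> q"
  unfolding pd_def by (rule extend_add) (simp_all add: distrib_left single_add)

lemma derivation_pd: "derivation (pd \<alpha>)"
proof (rule derivation_on_singles[OF pd_add])
  fix e e' :: "nat \<times> nat \<Rightarrow>\<^sub>0 nat" and c c' :: complex
  let ?a = "single \<alpha> (1::nat)"
  have *: "single (a + b - ?a) (of_nat (lookup a \<alpha>) * x :: complex)
      = single ((a - ?a) + b) (of_nat (lookup a \<alpha>) * x)" for a b x
  proof (cases "lookup a \<alpha> = 0")
    case False
    then have "a + b - ?a = (a - ?a) + b" by (intro minus_single_add) simp
    then show ?thesis by (rule arg_cong)
  qed simp
  have "pd \<alpha> (single e c * single e' c') =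
      single (e + e' - ?a) (of_nat (lookup e \<alpha>) * (c * c'))
      + single (e' + e - ?a) (of_nat (lookup e' \<alpha>) * (c * c'))"
    by (simp add: mult_single pd_single lookup_add distrib_right single_add add.commute)
  also have "\<dots> = single ((e - ?a) + e') (of_nat (lookup e \<alpha>) * (c * c'))
      + single ((e' - ?a) + e) (of_nat (lookup e' \<alpha>) * (c * c'))"
    by (simp only: *)
  also have "\<dots> = pd \<alpha> (single e c) * single e' c'
      + single e c * pd \<alpha> (single e' c')"
    by (simp add: mult_single pd_single add.commute mult.assoc mult.left_commute)
  finally show "pd \<alpha> (single e c * single e' c') =
      pd \<alpha> (single e c) * single e' c' + single e c * pd \<alpha> (single e' c')" .
qed

lemma pd_mult: "pd \<alpha> (p * q) = pd \<alpha> p * q + p * pd \<alpha> q"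
  using derivation_pd by (simp add: derivation_def)

lemma pd_zero: "pd \<alpha> 0 = 0" by (rule derivation_zero[OF derivation_pd])

lemma pd_sum: "pd \<alpha> (\<Sum>i\<in>I. f i) = (\<Sum>i\<in>I. pd \<alpha> (f i))"
  by (induction I rule: infinite_finite_induct) (simp_all add: pd_zero pd_add)

lemma pd_const: "pd \<alpha> (single 0 c) = 0"
  by (simp add: pd_single)

lemma pd_fvar: "pd \<alpha> (fvar \<beta>) = (if \<alpha> = \<beta> then 1 else 0)"
  by (simp add: fvar_def pd_single lookup_single)

lemma lookup_pd: "lookup (pd \<alpha> p) e =
    of_nat (Suc (lookup e \<alpha>)) * lookup p (e + single \<alpha> 1)"
proof -
  let ?a = "single \<alpha> (1::nat)"
  have s: "lookup (pd \<alpha> (single f c)) e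
      = of_nat (Suc (lookup e \<alpha>)) * lookup (single f c) (e + ?a)" for f c
  proof (cases "lookup f \<alpha> = 0")
    case True
    then have "f \<noteq> e + ?a" by (auto simp: lookup_add)
    then show ?thesis using True by (simp add: pd_single lookup_single)
  next
    case False
    then have "f = ?a + (f - ?a)" using split_exponent(1)[of \<alpha> f] by (simp add: in_keys_iff)
    then have iff: "f - ?a = e \<longleftrightarrow> f = e + ?a" by (metis add.commute add_diff_cancel_left')
    show ?thesis
    proof (cases "f = e + ?a")
      case True
      have "lookup f \<alpha> = Suc (lookup e \<alpha>)" using True by (simp add: lookup_add)
      then show ?thesis using iff True by (simp add: pd_single lookup_single)
    next
      case False
      then show ?thesis using iff by (simp add: pd_single lookup_single)
    qed
  qed
  have "lookup (pd \<alpha> p) e = lookup (pd \<alpha> (\<Sum>f\<in>keys p. single f (lookup p f))) e"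
    using poly_mapping_expand[of p] by simp
  also have "\<dots> = of_nat (Suc (lookup e \<alpha>)) *
      lookup (\<Sum>f\<in>keys p. single f (lookup p f)) (e + ?a)"
    unfolding pd_sum lookup_sum s by (simp only: sum_distrib_left)
  finally show ?thesis using poly_mapping_expand[of p] by simp
qed

lemma Sym_pd: "p \<in> Sym n D \<Longrightarrow> pd \<alpha> p \<in> Sym n D"
proof (induction rule: Sym_induct)
  case (const c)
  show ?case by (simp add: pd_const Sym_zero)
next
  case (add p q)
  then show ?case by (simp add: pd_add Sym_add)
next
  case (var \<beta> q)
  then show ?case using Sym_const[of 1 n D] by (auto simp: pd_mult pd_fvar intro!: Sym_add Sym_mult Sym_fvar Sym_zero)
qed

lemma Sym_lin_form: "lin_form n D y \<in> Sym n D"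
  unfolding lin_form_def by (intro Sym_sum) (auto intro!: Sym_mult Sym_fvar)

lemma Sym_deriv: "p \<in> Sym n D \<Longrightarrow> deriv n D x p \<in> Sym n D"
proof (induction rule: Sym_induct)
  case (const c)
  show ?case by (simp add: deriv_const Sym_zero)
next
  case (add p q)
  then show ?case by (simp add: deriv_add Sym_add)
next
  case (var \<beta> q)
  then show ?case by (auto simp: deriv_mult deriv_fvar intro!: Sym_add Sym_mult Sym_fvar Sym_lin_form)
qed

lemma derivation_vanishes:
  assumes g: "derivation g" and "\<And>c. g (single 0 c) = 0" "\<And>\<beta>. \<beta> \<in> PD n D \<Longrightarrow> g (fvar \<beta>) = 0" "p \<in> Sym n D"
  shows "g p = 0"
  using assms(4)
  by (induction rule: Sym_induct) (use assms in \<open>simp_all add: derivation_def\<close>)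

lemma derivation_commutator:
  assumes "derivation f" "derivation g"
  shows "derivation (\<lambda>p. f (g p) - g (f p))"
  using assms unfolding derivation_def by (auto simp: algebra_simps)

lemma derivation_times: "derivation f \<Longrightarrow> derivation (\<lambda>p. c * f p)"
  unfolding derivation_def by (auto simp: algebra_simps)

text \<open>The derivation of \<open>x\<close> has linear coefficients, so that its commutator with a partial derivative is
  a combination of partial derivatives with constant coefficients.  This is why prolongation
  preserves stability.\<close>

lemma pd_deriv:
  assumes D: "D \<subseteq> {1..<n}" and a: "\<alpha> \<in> PD n D" and p: "p \<in> Sym n D"
  shows "pd \<alpha> (deriv n D x p) = deriv n D x (pd \<alpha> p) +
    (\<Sum>\<beta>\<in>PD n D. pd \<alpha> (deriv n D x (fvar \<beta>)) * pd \<beta> p)"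
proof -
  let ?c = "\<lambda>\<beta>. pd \<alpha> (deriv n D x (fvar \<beta>))"
  let ?g = "\<lambda>p. (pd \<alpha> (deriv n D x p) - deriv n D x (pd \<alpha> p)) - (\<Sum>\<beta>\<in>PD n D. ?c \<beta> * pd \<beta> p)"
  have "derivation ?g"
    by (intro derivation_diff derivation_commutator derivation_sum derivation_times derivation_pd derivation_deriv)
  moreover have "?g (single 0 c) = 0" for c
    by (simp add: pd_const deriv_const pd_zero derivation_zero[OF derivation_deriv])
  moreover have "?g (fvar \<gamma>) = 0" if g: "\<gamma> \<in> PD n D" for \<gamma>
  proof -
    have "deriv n D x (pd \<alpha> (fvar \<gamma>)) = 0"
      using deriv_const[of n D x 1] derivation_zero[OF derivation_deriv] by (simp add: pd_fvar)
    moreover have "(\<Sum>\<beta>\<in>PD n D. ?c \<beta> * pd \<beta> (fvar \<gamma>)) = (\<Sum>\<beta>\<in>PD n D. if \<beta> = \<gamma> then ?c \<gamma> else 0)"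
      by (rule sum.cong[OF refl]) (simp add: pd_fvar)
    ultimately show ?thesis using g finite_PD[OF D] by simp
  qed
  ultimately have "?g p = 0" by (rule derivation_vanishes[OF _ _ _ p])
  then show ?thesis by (simp add: algebra_simps)
qed

lemma pd_deriv_fvar_const: "pd \<alpha> (deriv n D x (fvar \<beta>)) \<in> Sym n D"
  unfolding deriv_fvar by (intro Sym_pd Sym_lin_form)

lemma stable_idealI:
  assumes sub: "J \<subseteq> Sym n D" and zero: "0 \<in> J" and add: "\<And>p q. p \<in> J \<Longrightarrow> q \<in> J \<Longrightarrow> p + q \<in> J"
    and mult: "\<And>c p. c \<in> Sym n D \<Longrightarrow> p \<in> J \<Longrightarrow> c * p \<in> J"
    and der: "\<And>x p. x \<in> parabolic n D \<Longrightarrow> p \<in> J \<Longrightarrow> deriv n D x p \<in> J"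
  shows "stable_ideal n D J"
proof -
  let ?R = "Sym_ring n D"
  have neg: "- p \<in> Sym n D" if "p \<in> Sym n D" for p using that by (simp add: Sym_def)
  have one: "1 \<in> Sym n D" using Sym_const[of 1 n D] by simp
  have ring: "ring ?R"
  proof (rule ringI)
    show "abelian_group ?R"
    proof (rule abelian_groupI)
      fix p assume "p \<in> carrier ?R"
      then show "\<exists>q\<in>carrier ?R. q \<oplus>\<^bsub>?R\<^esub> p = \<zero>\<^bsub>?R\<^esub>"
        using neg by (intro bexI[of _ "- p"]) (simp_all add: Sym_ring_def)
    qed (simp_all add: Sym_ring_def Sym_zero Sym_add add.assoc add.commute)
    show "Group.monoid ?R"
      by (rule monoidI) (simp_all add: Sym_ring_def Sym_mult one mult.assoc)
  qed (simp_all add: Sym_ring_def distrib_left distrib_right)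
  have negJ: "- p \<in> J" if "p \<in> J" for p
    using mult[OF Sym_const[of "-1"] that] by (simp add: single_uminus)
  have "additive_subgroup J ?R"
  proof (rule additive_subgroup.intro, rule group.subgroupI)
    show grp: "group (add_monoid ?R)" by (rule abelian_group.a_group[OF ring.is_abelian_group[OF ring]])
    fix p assume p: "p \<in> J"
    have "inv\<^bsub>add_monoid ?R\<^esub> p = - p"
      by (rule group.inv_equality[OF grp]) (use p negJ sub in \<open>auto simp: Sym_ring_def\<close>)
    then show "inv\<^bsub>add_monoid ?R\<^esub> p \<in> J" using negJ p by simp
  qed (use sub zero add in \<open>auto simp: Sym_ring_def\<close>)
  then have "ideal J ?R"
  proof (intro idealI ring additive_subgroup.a_subgroup)
    fix p c assume pc: "p \<in> J" "c \<in> carrier ?R"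
    then have "c * p \<in> J" using mult by (simp add: Sym_ring_def)
    then show "c \<otimes>\<^bsub>?R\<^esub> p \<in> J" "p \<otimes>\<^bsub>?R\<^esub> c \<in> J" by (simp_all add: Sym_ring_def mult.commute)
  qed
  then show ?thesis using der by (simp add: stable_ideal_def)
qed

lemma stable_ideal_Int: "stable_ideal n D I \<Longrightarrow> stable_ideal n D J \<Longrightarrow> stable_ideal n D (I \<inter> J)"
  by (rule stable_idealI) (auto dest: stable_idealD)

text \<open>In the tensor product with \<open>V\<close>, the component at \<open>v\<close> of \<open>p (l \<otimes> v)\<close> is \<open>p l\<close>, and the component at
  the basis vector with label \<open>\<alpha>\<close> is \<open>(pd \<alpha> p) l\<close>.  So this is the annihilator of \<open>l \<otimes> v\<close> if \<open>I\<close>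
  is the annihilator of \<open>l\<close>.\<close>

definition prolong :: "nat \<Rightarrow> nat set \<Rightarrow> pol set \<Rightarrow> pol set" where
  "prolong n D I = {p\<in>I. \<forall>\<alpha>\<in>PD n D. pd \<alpha> p \<in> I}"

lemma stable_ideal_prolong:
  assumes D: "D \<subseteq> {1..<n}" and I: "stable_ideal n D I"
  shows "stable_ideal n D (prolong n D I)"
proof (rule stable_idealI)
  show "prolong n D I \<subseteq> Sym n D" using stable_idealD(1)[OF I] by (auto simp: prolong_def)
  show "0 \<in> prolong n D I" using stable_idealD(2)[OF I] by (simp add: prolong_def pd_zero)
  show "p + q \<in> prolong n D I" if "p \<in> prolong n D I" "q \<in> prolong n D I" for p q
    using that stable_idealD(3)[OF I] by (simp add: prolong_def pd_add)
  show "c * p \<in> prolong n D I" if "c \<in> Sym n D" "p \<in> prolong n D I" for c p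
    using that stable_idealD(3,4)[OF I] Sym_pd by (simp add: prolong_def pd_mult)
  show "deriv n D x p \<in> prolong n D I" if x: "x \<in> parabolic n D" and p: "p \<in> prolong n D I" for x p
  proof -
    have pI: "p \<in> I" and dp: "\<And>\<alpha>. \<alpha> \<in> PD n D \<Longrightarrow> pd \<alpha> p \<in> I" using p by (simp_all add: prolong_def)
    have pS: "p \<in> Sym n D" using pI stable_idealD(1)[OF I] by blast
    have "pd \<alpha> (deriv n D x p) \<in> I" if a: "\<alpha> \<in> PD n D" for \<alpha>
      unfolding pd_deriv[OF D a pS] using a dp x
      by (intro stable_idealD(3)[OF I] stable_idealD(5)[OF I] stable_ideal_sum[OF I] stable_idealD(4)[OF I] pd_deriv_fvar_const)
    then show ?thesis using stable_idealD(5)[OF I x pI] by (simp add: prolong_def)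
  qed
qed

lemma pd_prod:
  assumes "finite K"
  shows "pd \<alpha> (\<Prod>i\<in>K. g i) = (\<Sum>i\<in>K. pd \<alpha> (g i) * (\<Prod>j\<in>K - {i}. g j))"
  using assms
proof (induction K rule: finite_induct)
  case empty
  then show ?case using pd_const[of \<alpha> 1] by simp
next
  case (insert k K)
  have "g k * (\<Prod>j\<in>K - {i}. g j) = (\<Prod>j\<in>insert k K - {i}. g j)" if i: "i \<in> K" for i
  proof -
    have "insert k K - {i} = insert k (K - {i})" using i insert.hyps(2) by blast
    then show ?thesis using insert.hyps by simp
  qed
  then have "g k * pd \<alpha> (\<Prod>i\<in>K. g i) = (\<Sum>i\<in>K. pd \<alpha> (g i) * (\<Prod>j\<in>insert k K - {i}. g j))"
    unfolding insert.IH sum_distrib_left by (intro sum.cong refl) (simp only: mult.left_commute[of "g k"])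
  moreover have "insert k K - {k} = K" using insert.hyps(2) by blast
  ultimately show ?case using insert.hyps by (simp add: pd_mult)
qed

text \<open>A partial derivative of a monomial is a combination of monomials with one exponent lowered by
  one, and the bound of the relations decreases by one with \<open>M\<close>.\<close>

lemma relations_prolong:
  assumes I: "stable_ideal n D I" and rel: "relations n D m M \<subseteq> I"
  shows "relations n D m (Suc M) \<subseteq> prolong n D I"
proof
  fix p assume "p \<in> relations n D m (Suc M)"
  then obtain r :: nat and \<beta> and a :: "nat \<Rightarrow> nat" where p: "p = (\<Prod>i<r. fvar (root_pos (\<beta> i)) ^ a i)" and r: "1 \<le> r"
    and b: "\<forall>i<r. \<beta> i \<in> pos_roots n \<and> root_pos (\<beta> i) \<in> PD n D"
    and s: "(\<Sum>i<r. a i) > Suc M + (\<Sum>i<r. weight_pair D m (\<beta> i))" unfolding relations_def by blast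
  have mem: "(\<Prod>i<r. fvar (root_pos (\<beta> i)) ^ a' i) \<in> I" if "(\<Sum>i<r. a' i) > M + (\<Sum>i<r. weight_pair D m (\<beta> i))" for a'
    by (rule subsetD[OF rel]) (use r b that in \<open>unfold relations_def, blast\<close>)
  have "pd \<alpha> p \<in> I" for \<alpha>
    unfolding p pd_prod[OF finite_lessThan]
  proof (rule stable_ideal_sum[OF I])
    fix i assume i: "i \<in> {..<r}"
    let ?g = "\<lambda>i. fvar (root_pos (\<beta> i))"
    show "pd \<alpha> (?g i ^ a i) * (\<Prod>j\<in>{..<r} - {i}. ?g j ^ a j) \<in> I"
    proof (cases "a i")
      case 0
      then show ?thesis using pd_const[of \<alpha> 1] stable_idealD(2)[OF I] by simp
    next
      case (Suc k)
      define a' where "a' = a(i := k)"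
      have "(\<Sum>j<r. a j) = a i + (\<Sum>j\<in>{..<r} - {i}. a j)" using i by (intro sum.remove) simp_all
      moreover have "(\<Sum>j<r. a' j) = a' i + (\<Sum>j\<in>{..<r} - {i}. a' j)" using i by (intro sum.remove) simp_all
      moreover have "(\<Sum>j\<in>{..<r} - {i}. a' j) = (\<Sum>j\<in>{..<r} - {i}. a j)" by (rule sum.cong) (auto simp: a'_def)
      ultimately have "(\<Sum>j<r. a' j) > M + (\<Sum>i<r. weight_pair D m (\<beta> i))" using s Suc by (simp add: a'_def)
      then have m': "(\<Prod>j<r. ?g j ^ a' j) \<in> I" by (rule mem)
      have "(\<Prod>j<r. ?g j ^ a' j) = ?g i ^ a' i * (\<Prod>j\<in>{..<r} - {i}. ?g j ^ a' j)" using i by (intro prod.remove) simp_all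
      moreover have "(\<Prod>j\<in>{..<r} - {i}. ?g j ^ a' j) = (\<Prod>j\<in>{..<r} - {i}. ?g j ^ a j)" by (rule prod.cong) (auto simp: a'_def)
      ultimately have e: "(\<Prod>j<r. ?g j ^ a' j) = ?g i ^ k * (\<Prod>j\<in>{..<r} - {i}. ?g j ^ a j)" by (simp add: a'_def)
      have "pd \<alpha> (?g i ^ a i) = of_nat (Suc k) * ?g i ^ k * pd \<alpha> (?g i)" unfolding Suc by (rule derivation_power[OF derivation_pd])
      then have "pd \<alpha> (?g i ^ a i) * (\<Prod>j\<in>{..<r} - {i}. ?g j ^ a j) = (of_nat (Suc k) * pd \<alpha> (?g i)) * (\<Prod>j<r. ?g j ^ a' j)"
        unfolding e by (simp only: mult.assoc mult.commute mult.left_commute)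
      moreover have "of_nat (Suc k) * pd \<alpha> (?g i) \<in> Sym n D"
        using b i by (intro Sym_mult Sym_pd Sym_fvar) (simp_all only: of_nat_pol Sym_const lessThan_iff simp_thms)
      ultimately show ?thesis using stable_idealD(4)[OF I _ m'] by simp
    qed
  qed
  moreover have "p \<in> I" unfolding p by (rule mem) (use s in simp)
  ultimately show "p \<in> prolong n D I" by (simp add: prolong_def)
qed

section \<open>The filtration\<close>

lemma ppart_in_parabolic:
  assumes D: "D \<subseteq> {1..<n}" and x: "x \<in> sl n"
  shows "ppart n D x \<in> parabolic n D"
proof -
  have xc: "x \<in> carrier_mat n n" by (rule sl_carrier[OF x])
  have e: "ppart n D x $$ (a, b) = (if (a + 1, b + 1) \<in> PD n D then 0 else x $$ (a, b))" if "a < n" "b < n" for a b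
    using that xc by (simp add: ppart_def rpart_def)
  have "ppart n D x \<in> carrier_mat n n" unfolding ppart_def rpart_def by (rule minus_carrier_mat) simp
  moreover have "(\<Sum>a<n. ppart n D x $$ (a, a)) = (\<Sum>a<n. x $$ (a, a))"
    by (rule sum.cong) (use e PD_bounds in fastforce)+
  moreover have "ent (ppart n D x) i j = 0" if ij: "(i, j) \<in> PD n D" for i j
  proof -
    have "1 \<le> j" "j < i" "i \<le> n" using PD_bounds[OF ij] by simp_all
    then show ?thesis using e[of "i - 1" "j - 1"] ij by (simp add: ent_def)
  qed
  ultimately show ?thesis using x by (auto simp: parabolic_eq[OF D] sl_def)
qed

lemma rpart_radical: "rpart n D x \<in> radical n D"
  unfolding radical_def by (auto simp: rpart_def intro!: eq_matI)

lemma ppart_rpart: "x \<in> carrier_mat n n \<Longrightarrow> ppart n D x + rpart n D x = x"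
  by (rule eq_matI) (auto simp: ppart_def rpart_def)

lemma Emat_radical: "(i, j) \<in> PD n D \<Longrightarrow> Emat n i j \<in> radical n D"
  by (simp add: radical_def rpart_Emat)

lemma roots_content_eq_remove1:
  "\<alpha> \<in> set bs \<Longrightarrow> roots_content bs = single \<alpha> 1 + roots_content (remove1 \<alpha> bs)"
  by (induction bs) (auto simp: roots_content_Cons add.left_commute)

lemma lookup_roots_content: "lookup (roots_content as) \<alpha> = count_list as \<alpha>"
  by (induction as) (simp_all add: roots_content_Cons lookup_add lookup_single)

lemma keys_roots_content: "keys (roots_content as) = set as"
  by (auto simp: in_keys_iff lookup_roots_content count_list_0_iff)

lemma exists_roots_list: "keys e \<subseteq> P \<Longrightarrow> \<exists>as. set as \<subseteq> P \<and> roots_content as = e"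
proof (induction "degree e" arbitrary: e)
  case 0
  have "e = 0"
  proof (rule ccontr)
    assume "e \<noteq> 0"
    then obtain \<alpha> where "\<alpha> \<in> keys e" using keys_eq_empty[of e] by blast
    then have "degree e = 1 + degree (e - single \<alpha> 1)"
      by (subst split_exponent(1)[of \<alpha> e], assumption) (simp only: degree_add degree_single)
    then show False using 0 by simp
  qed
  then show ?case by (intro exI[of _ "[]"]) simp
next
  case (Suc k)
  have "e \<noteq> 0" using Suc.hyps(2) by (auto simp: degree_def)
  then obtain \<alpha> where a: "\<alpha> \<in> keys e" using keys_eq_empty[of e] by blast
  let ?e = "e - single \<alpha> 1"
  have e: "e = single \<alpha> 1 + ?e" and k: "keys ?e \<subseteq> P"
    using split_exponent[OF a] Suc.prems by blast+
  have "degree e = 1 + degree ?e" by (subst e) (simp only: degree_add degree_single)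
  then have "k = degree ?e" using Suc.hyps(2) by (simp only: plus_1_eq_Suc nat.inject)
  from Suc.hyps(1)[OF this k] obtain as where as: "set as \<subseteq> P" "roots_content as = ?e" by blast
  have "roots_content (\<alpha> # as) = e" unfolding roots_content_Cons as(2) e[symmetric] ..
  moreover have "set (\<alpha> # as) \<subseteq> P" using as(1) a Suc.prems by auto
  ultimately show ?case by blast
qed

declare filt.simps(2) [simp del]

context highest_weight_module
begin

abbreviation F :: "nat \<Rightarrow> 'v set" where "F \<equiv> filt n D scale \<rho> l"

lemma F_subspace: "V.subspace (F k)"
  by (cases k) (simp_all add: V.subspace_single_0 filt.simps(2))

lemma F_zero: "0 \<in> F k" by (rule V.subspace_0[OF F_subspace])
lemma F_add: "u \<in> F k \<Longrightarrow> v \<in> F k \<Longrightarrow> u + v \<in> F k" by (rule V.subspace_add[OF F_subspace])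
lemma F_diff: "u \<in> F k \<Longrightarrow> v \<in> F k \<Longrightarrow> u - v \<in> F k" by (rule V.subspace_diff[OF F_subspace])
lemma F_scale: "u \<in> F k \<Longrightarrow> scale c u \<in> F k" by (rule V.subspace_scale[OF F_subspace])
lemma F_sum: "(\<And>i. i \<in> I \<Longrightarrow> f i \<in> F k) \<Longrightarrow> (\<Sum>i\<in>I. f i) \<in> F k" by (rule V.subspace_sum[OF F_subspace])

lemma F_list: "set as \<subseteq> radical n D \<Longrightarrow> length as \<le> k \<Longrightarrow> foldr \<rho> as l \<in> F (Suc k)"
  unfolding filt.simps(2) by (auto intro!: V.span_base)

lemma F_Suc: "u \<in> F k \<Longrightarrow> u \<in> F (Suc k)"
proof (cases k)
  case (Suc k')
  assume "u \<in> F k"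
  moreover have "F (Suc k') \<subseteq> F (Suc (Suc k'))" unfolding filt.simps by (rule V.span_mono) auto
  ultimately show ?thesis using Suc by blast
qed (simp add: V.span_zero filt.simps(2))

lemma F_induct [consumes 1, case_names zero list add scale]:
  assumes "u \<in> F k" "P 0" "\<And>as. set as \<subseteq> radical n D \<Longrightarrow> length as < k \<Longrightarrow> P (foldr \<rho> as l)"
    "\<And>u v. P u \<Longrightarrow> P v \<Longrightarrow> P (u + v)" "\<And>c u. P u \<Longrightarrow> P (scale c u)"
  shows "P u"
proof (cases k)
  case 0
  then show ?thesis using assms(1,2) by simp
next
  case (Suc k')
  have "u \<in> V.span {foldr \<rho> as l | as. set as \<subseteq> radical n D \<and> length as \<le> k'}" using assms(1) Suc by (simp add: filt.simps(2))
  then show ?thesis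
  proof (induction rule: V.span_induct_alt)
    case base
    show ?case by (rule assms(2))
  next
    case (step c x y)
    then obtain as where "x = foldr \<rho> as l" "set as \<subseteq> radical n D" "length as \<le> k'" by blast
    then show ?case using assms(3-5) step Suc by simp
  qed
qed

lemma F_radical: "x \<in> radical n D \<Longrightarrow> u \<in> F k \<Longrightarrow> \<rho> x u \<in> F (Suc k)"
proof -
  assume x: "x \<in> radical n D" and "u \<in> F k"
  have s: "x \<in> sl n" by (rule radical_sl[OF x])
  from \<open>u \<in> F k\<close> show ?thesis
  proof (induction rule: F_induct)
    case zero
    show ?case using \<rho>_0[OF s] F_zero by simp
  next
    case (list as)
    then show ?case using F_list[of "x # as" k] x by simp
  next
    case (add u v)
    then show ?case using F_add by (simp add: \<rho>_add[OF s])
  next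
    case (scale c u)
    then show ?case using F_scale by (simp add: \<rho>_scale[OF s])
  qed
qed

lemma \<rho>_split: "x \<in> sl n \<Longrightarrow> \<rho> x u = \<rho> (ppart n D x) u + \<rho> (rpart n D x) u"
  using \<rho>_madd[OF parabolicD(1)[OF D ppart_in_parabolic[OF D]] radical_sl[OF rpart_radical], of x D x u]
  by (simp add: ppart_rpart sl_carrier)

text \<open>Commuting an element of the parabolic subalgebra past a radical factor produces an element of
  \<open>sl n\<close> in its place, so the number of radical factors does not grow; on \<open>l\<close> the parabolic
  subalgebra acts by scalars.\<close>

lemma F_parabolic_list:
  "x \<in> parabolic n D \<Longrightarrow> set as \<subseteq> radical n D \<Longrightarrow> \<rho> x (foldr \<rho> as l) \<in> F (Suc (length as))"
proof (induction as arbitrary: x)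
  case Nil
  obtain c where "\<rho> x l = scale c l" using parabolic_scales_hwv[OF Nil.prems(1)] by blast
  then show ?case using F_scale[OF F_list[of "[]" 0]] by simp
next
  case (Cons a as)
  let ?v = "foldr \<rho> as l" and ?c = "commutator x a"
  have a: "a \<in> radical n D" and as: "set as \<subseteq> radical n D" using Cons.prems(2) by simp_all
  have xs: "x \<in> sl n" using parabolicD(1)[OF D Cons.prems(1)] .
  have as': "a \<in> sl n" by (rule radical_sl[OF a])
  have cs: "?c \<in> sl n" by (rule sl_commutator[OF xs as'])
  have 1: "\<rho> a (\<rho> x ?v) \<in> F (Suc (Suc (length as)))" by (rule F_radical[OF a Cons.IH[OF Cons.prems(1) as]])
  have 2: "\<rho> (ppart n D ?c) ?v \<in> F (Suc (Suc (length as)))"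
    by (rule F_Suc[OF Cons.IH[OF ppart_in_parabolic[OF D cs] as]])
  have 3: "\<rho> (rpart n D ?c) ?v \<in> F (Suc (Suc (length as)))"
    by (rule F_radical[OF rpart_radical F_list[OF as order_refl]])
  have "\<rho> x (\<rho> a ?v) = \<rho> a (\<rho> x ?v) + (\<rho> (ppart n D ?c) ?v + \<rho> (rpart n D ?c) ?v)"
    unfolding \<rho>_swap[OF xs as'] \<rho>_split[OF cs] ..
  then show ?case using F_add[OF 1 F_add[OF 2 3]] by simp
qed

lemma F_Suc_le: "u \<in> F k \<Longrightarrow> k \<le> k' \<Longrightarrow> u \<in> F k'"
proof (induction k')
  case (Suc k')
  then show ?case using F_Suc by (cases "k = Suc k'") auto
qed simp

lemma F_parabolic:
  assumes x: "x \<in> parabolic n D" and "u \<in> F k"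
  shows "\<rho> x u \<in> F k"
proof -
  have s: "x \<in> sl n" using parabolicD(1)[OF D x] .
  from assms(2) show ?thesis
  proof (induction rule: F_induct)
    case zero
    show ?case using \<rho>_0[OF s] F_zero by simp
  next
    case (list as)
    then show ?case using F_Suc_le[OF F_parabolic_list[OF x list(1)], of k] by simp
  next
    case (add u v)
    then show ?case using F_add by (simp add: \<rho>_add[OF s])
  next
    case (scale c u)
    then show ?case using F_scale by (simp add: \<rho>_scale[OF s])
  qed
qed

lemma F_sl: "x \<in> sl n \<Longrightarrow> u \<in> F k \<Longrightarrow> \<rho> x u \<in> F (Suc k)"
  unfolding \<rho>_split
  by (intro F_add F_radical[OF rpart_radical] F_Suc[OF F_parabolic] ppart_in_parabolic[OF D])

lemma root_sl: "\<alpha> \<in> PD n D \<Longrightarrow> Emat n (fst \<alpha>) (snd \<alpha>) \<in> sl n"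
  using PD_bounds[of "fst \<alpha>" "snd \<alpha>" n D] by (intro Emat_sl) simp

lemma root_radical: "\<alpha> \<in> PD n D \<Longrightarrow> Emat n (fst \<alpha>) (snd \<alpha>) \<in> radical n D"
  by (rule Emat_radical) simp

lemma F_roots: "set as \<subseteq> PD n D \<Longrightarrow> \<rho>_roots as \<in> F (Suc (length as))"
proof (induction as)
  case Nil
  then show ?case using F_list[of "[]" 0] by simp
next
  case (Cons \<alpha> as)
  then show ?case using F_radical[OF root_radical[of \<alpha>]] by simp
qed

lemma \<rho>_diff: "x \<in> sl n \<Longrightarrow> \<rho> x (a - b) = \<rho> x a - \<rho> x b"
  by (metis \<rho>_add add_diff_cancel_right' diff_add_cancel)

lemma roots_move_front:
  assumes "\<alpha> \<in> set bs" "set bs \<subseteq> PD n D"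
  shows "\<rho>_roots bs - \<rho>_roots (\<alpha> # remove1 \<alpha> bs) \<in> F (length bs)"
  using assms
proof (induction bs)
  case (Cons b bs)
  let ?E = "\<lambda>\<alpha>. Emat n (fst \<alpha>) (snd \<alpha>)"
  have b: "b \<in> PD n D" and bs: "set bs \<subseteq> PD n D" using Cons.prems(2) by simp_all
  have a: "\<alpha> \<in> PD n D" using Cons.prems by blast
  show ?case
  proof (cases "b = \<alpha>")
    case True
    then show ?thesis using F_zero[of "length (b # bs)"] by simp
  next
    case False
    then have abs: "\<alpha> \<in> set bs" using Cons.prems(1) by simp
    let ?v = "\<rho>_roots (remove1 \<alpha> bs)"
    have len: "Suc (length (remove1 \<alpha> bs)) = length bs" using abs by (simp add: length_remove1) (metis Suc_pred length_pos_if_in_set)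
    have v: "?v \<in> F (length bs)" using F_roots[of "remove1 \<alpha> bs"] bs set_remove1_subset[of \<alpha> bs] len by simp
    have "\<rho> (?E b) (\<rho>_roots bs - \<rho> (?E \<alpha>) ?v) \<in> F (Suc (length bs))"
      using F_radical[OF root_radical[OF b] Cons.IH[OF abs bs]] by simp
    moreover have "\<rho> (commutator (?E b) (?E \<alpha>)) ?v \<in> F (Suc (length bs))"
      by (rule F_sl[OF sl_commutator[OF root_sl[OF b] root_sl[OF a]] v])
    ultimately have "\<rho> (?E b) (\<rho>_roots bs - \<rho> (?E \<alpha>) ?v) + \<rho> (commutator (?E b) (?E \<alpha>)) ?v \<in> F (Suc (length bs))"
      by (rule F_add)
    moreover have "\<rho> (?E b) (\<rho>_roots bs - \<rho> (?E \<alpha>) ?v) + \<rho> (commutator (?E b) (?E \<alpha>)) ?v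
        = \<rho> (?E b) (\<rho>_roots bs) - \<rho> (?E \<alpha>) (\<rho> (?E b) ?v)"
      unfolding \<rho>_diff[OF root_sl[OF b]] \<rho>_swap[OF root_sl[OF b] root_sl[OF a]] by simp
    moreover have "remove1 \<alpha> (b # bs) = b # remove1 \<alpha> bs" using False by simp
    ultimately show ?thesis by simp
  qed
qed simp

text \<open>The factors of a product can be permuted at the cost of commutators, which have fewer factors.\<close>

lemma roots_congruent:
  assumes "set as \<subseteq> PD n D" "set bs \<subseteq> PD n D" "roots_content as = roots_content bs"
  shows "\<rho>_roots as - \<rho>_roots bs \<in> F (length as)"
  using assms
proof (induction as arbitrary: bs)
  case Nil
  then have "bs = []" using keys_roots_content[of bs] by simp
  then show ?case by simp
next
  case (Cons \<alpha> as)
  let ?E = "Emat n (fst \<alpha>) (snd \<alpha>)" and ?bs = "remove1 \<alpha> bs"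
  have a: "\<alpha> \<in> PD n D" and as: "set as \<subseteq> PD n D" using Cons.prems(1) by simp_all
  have ab: "\<alpha> \<in> set bs" using keys_roots_content[of "\<alpha> # as"] keys_roots_content[of bs] Cons.prems(3) by auto
  have len: "length bs = Suc (length as)"
    using degree_roots_content[of "\<alpha> # as"] degree_roots_content[of bs] Cons.prems(3) by simp
  have "roots_content as = roots_content ?bs"
    using Cons.prems(3) roots_content_eq_remove1[OF ab] by (simp add: roots_content_Cons)
  moreover have "set ?bs \<subseteq> PD n D" using set_remove1_subset[of \<alpha> bs] Cons.prems(2) by blast
  ultimately have "\<rho>_roots as - \<rho>_roots ?bs \<in> F (length as)" using Cons.IH[OF as] by simp
  then have "\<rho> ?E (\<rho>_roots as - \<rho>_roots ?bs) \<in> F (Suc (length as))" by (rule F_radical[OF root_radical[OF a]])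
  then have 1: "\<rho>_roots (\<alpha> # as) - \<rho>_roots (\<alpha> # ?bs) \<in> F (Suc (length as))"
    by (simp add: \<rho>_diff[OF root_sl[OF a]])
  have 2: "\<rho>_roots bs - \<rho>_roots (\<alpha> # ?bs) \<in> F (Suc (length as))"
    using roots_move_front[OF ab Cons.prems(2)] len by simp
  have "\<rho>_roots (\<alpha> # as) - \<rho>_roots bs = (\<rho>_roots (\<alpha> # as) - \<rho>_roots (\<alpha> # ?bs)) - (\<rho>_roots bs - \<rho>_roots (\<alpha> # ?bs))" by simp
  then show ?case using F_diff[OF 1 2] by simp
qed

subsection \<open>Evaluation of homogeneous components\<close>

text \<open>Some order of the factors of a monomial.  Other orders give the same vector modulo the filtration
  (\<open>roots_congruent\<close>).\<close>

definition ls :: "(nat \<times> nat \<Rightarrow>\<^sub>0 nat) \<Rightarrow> (nat \<times> nat) list" where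
  "ls e = (SOME as. set as \<subseteq> PD n D \<and> roots_content as = e)"

lemma ls: "keys e \<subseteq> PD n D \<Longrightarrow> set (ls e) \<subseteq> PD n D \<and> roots_content (ls e) = e"
  unfolding ls_def by (rule someI_ex[OF exists_roots_list])

text \<open>The component of degree \<open>k\<close> of \<open>p\<close>, applied to \<open>l\<close>.  Only its class modulo \<open>F k\<close> is independent of
  choices.\<close>

definition ev :: "nat \<Rightarrow> pol \<Rightarrow> 'v" where
  "ev k p = (\<Sum>e\<in>keys p. if degree e = k then scale (lookup p e) (\<rho>_roots (ls e)) else 0)"

lemma ev_superset:
  assumes "finite K" "keys p \<subseteq> K"
  shows "ev k p = (\<Sum>e\<in>K. if degree e = k then scale (lookup p e) (\<rho>_roots (ls e)) else 0)"
  unfolding ev_def by (rule sum.mono_neutral_left) (use assms in \<open>auto simp: in_keys_iff\<close>)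

lemma ev_single: "ev k (single e c) = (if degree e = k then scale c (\<rho>_roots (ls e)) else 0)"
  by (subst ev_superset[of "{e}"]) simp_all

lemma ev_add: "ev k (p + q) = ev k p + ev k q"
proof -
  let ?K = "keys p \<union> keys q"
  have *: "ev k r = (\<Sum>e\<in>?K. if degree e = k then scale (lookup r e) (\<rho>_roots (ls e)) else 0)"
    if "keys r \<subseteq> ?K" for r
    by (rule ev_superset) (use that in auto)
  have "ev k (p + q) = (\<Sum>e\<in>?K. (if degree e = k then scale (lookup p e) (\<rho>_roots (ls e)) else 0)
      + (if degree e = k then scale (lookup q e) (\<rho>_roots (ls e)) else 0))"
    unfolding *[OF Poly_Mapping.keys_add] by (rule sum.cong) (simp_all add: lookup_add V.scale_left_distrib)
  then show ?thesis unfolding sum.distrib using *[of p] *[of q] by simp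
qed

lemma ev_zero: "ev k 0 = 0"
  by (simp add: ev_def)

lemma ev_sum: "ev k (\<Sum>i\<in>I. f i) = (\<Sum>i\<in>I. ev k (f i))"
  by (induction I rule: infinite_finite_induct) (simp_all add: ev_zero ev_add)

lemma ev_scale: "ev k (single 0 c * p) = scale c (ev k p)"
proof -
  let ?K = "keys p"
  have "single 0 c * p = single 0 c * (\<Sum>e\<in>?K. single e (lookup p e))"
    using poly_mapping_expand[of p] by simp
  also have "\<dots> = (\<Sum>e\<in>?K. single e (c * lookup p e))"
    by (simp add: sum_distrib_left mult_single)
  finally have "ev k (single 0 c * p) = (\<Sum>e\<in>?K. if degree e = k then scale (c * lookup p e) (\<rho>_roots (ls e)) else 0)"
    by (simp add: ev_sum ev_single)
  also have "\<dots> = (\<Sum>e\<in>?K. scale c (if degree e = k then scale (lookup p e) (\<rho>_roots (ls e)) else 0))"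
    by (rule sum.cong) simp_all
  finally show ?thesis by (simp add: ev_def V.scale_sum_right)
qed

lemma ev_const: "ev k (single 0 c) = (if k = 0 then scale c l else 0)"
proof -
  have "ls 0 = []" using ls[of 0] keys_roots_content[of "ls 0"] by simp
  moreover have "degree 0 = 0" by (simp add: degree_def)
  ultimately show ?thesis by (simp add: ev_single)
qed

lemma ev_F: "p \<in> Sym n D \<Longrightarrow> ev k p \<in> F (Suc k)"
  unfolding ev_def
proof (rule F_sum)
  fix e assume p: "p \<in> Sym n D" and e: "e \<in> keys p"
  then have "keys e \<subseteq> PD n D" by (simp add: Sym_def)
  from ls[OF this] have L: "set (ls e) \<subseteq> PD n D" "length (ls e) = degree e"
    using degree_roots_content[of "ls e"] by simp_all
  show "(if degree e = k then scale (lookup p e) (\<rho>_roots (ls e)) else 0) \<in> F (Suc k)"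
    using F_scale[OF F_roots[OF L(1)]] L(2) F_zero by (cases "degree e = k") auto
qed

lemma ev_fvar:
  assumes a: "\<alpha> \<in> PD n D" and p: "p \<in> Sym n D"
  shows "ev (Suc k) (fvar \<alpha> * p) - \<rho> (Emat n (fst \<alpha>) (snd \<alpha>)) (ev k p) \<in> F (Suc k)" (is "?L p \<in> _")
    and "ev 0 (fvar \<alpha> * p) = 0"
proof -
  let ?E = "Emat n (fst \<alpha>) (snd \<alpha>)" and ?s = "\<lambda>e. single e (lookup p e)"
  have deg: "degree (single \<alpha> (Suc 0) + e) = Suc (degree e)" for e by (simp add: degree_add)
  have single: "?L (single e c) \<in> F (Suc k)" if e: "keys e \<subseteq> PD n D" for e c
  proof (cases "degree e = k")
    case False
    then show ?thesis using F_zero \<rho>_0[OF root_sl[OF a]] unfolding fvar_times_single by (simp add: ev_single deg)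
  next
    case True
    have k': "keys (single \<alpha> 1 + e) \<subseteq> PD n D"
      using Poly_Mapping.keys_add[of "single \<alpha> 1" e] e a by fastforce
    have len: "length (ls (single \<alpha> 1 + e)) = Suc k"
      using degree_roots_content[of "ls (single \<alpha> 1 + e)"] ls[OF k'] deg True by simp
    have "\<rho>_roots (ls (single \<alpha> 1 + e)) - \<rho>_roots (\<alpha> # ls e) \<in> F (Suc k)"
      using roots_congruent[of "ls (single \<alpha> 1 + e)" "\<alpha> # ls e"] ls[OF k'] ls[OF e] a len
      by (simp add: roots_content_Cons)
    from F_scale[OF this, of c] show ?thesis
      unfolding fvar_times_single by (simp add: ev_single deg True \<rho>_scale[OF root_sl[OF a]] V.scale_right_diff_distrib)
  qed
  have expand: "?L p = (\<Sum>e\<in>keys p. ?L (?s e))"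
  proof -
    have "?L p = ?L (\<Sum>e\<in>keys p. ?s e)" using poly_mapping_expand[of p] by simp
    then show ?thesis by (simp only: sum_distrib_left ev_sum \<rho>_sum[OF root_sl[OF a]] sum_subtractf)
  qed
  show "?L p \<in> F (Suc k)" unfolding expand by (rule F_sum, rule single) (use p in \<open>simp add: Sym_def\<close>)
  have "ev 0 (fvar \<alpha> * p) = ev 0 (\<Sum>e\<in>keys p. fvar \<alpha> * ?s e)"
    using poly_mapping_expand[of p] by (simp only: sum_distrib_left[symmetric])
  then show "ev 0 (fvar \<alpha> * p) = 0" unfolding ev_sum fvar_times_single by (simp add: ev_single deg)
qed

lemma \<rho>_rpart:
  assumes "x \<in> sl n"
  shows "\<rho> (rpart n D x) u = (\<Sum>\<beta>\<in>PD n D. scale (ent x (fst \<beta>) (snd \<beta>)) (\<rho> (Emat n (fst \<beta>) (snd \<beta>)) u))"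
proof -
  define R where "R S = mat n n (\<lambda>(a, b). if (a + 1, b + 1) \<in> S then x $$ (a, b) else 0)" for S
  have "R S \<in> sl n \<and> \<rho> (R S) u = (\<Sum>\<beta>\<in>S. scale (ent x (fst \<beta>) (snd \<beta>)) (\<rho> (Emat n (fst \<beta>) (snd \<beta>)) u))"
    if "finite S" "S \<subseteq> PD n D" for S
    using that
  proof (induction S rule: finite_induct)
    case empty
    have "R {} = 0\<^sub>m n n" by (rule eq_matI) (auto simp: R_def)
    then show ?case using sl_zero \<rho>_mzero by simp
  next
    case (insert \<beta> S)
    let ?E = "Emat n (fst \<beta>) (snd \<beta>)"
    have b: "\<beta> \<in> PD n D" using insert.prems by simp
    have bd: "1 \<le> snd \<beta>" "snd \<beta> < fst \<beta>" "fst \<beta> \<le> n" using PD_bounds[of "fst \<beta>" "snd \<beta>" n D] b by simp_all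
    have R: "R (insert \<beta> S) = R S + ent x (fst \<beta>) (snd \<beta>) \<cdot>\<^sub>m ?E"
    proof (rule eq_matI)
      fix a c assume "a < dim_row (R S + ent x (fst \<beta>) (snd \<beta>) \<cdot>\<^sub>m ?E)" "c < dim_col (R S + ent x (fst \<beta>) (snd \<beta>) \<cdot>\<^sub>m ?E)"
      then have ac: "a < n" "c < n" by (simp_all add: Emat_def)
      show "R (insert \<beta> S) $$ (a, c) = (R S + ent x (fst \<beta>) (snd \<beta>) \<cdot>\<^sub>m ?E) $$ (a, c)"
      proof (cases "(a + 1, c + 1) = \<beta>")
        case True
        then have "fst \<beta> = a + 1" "snd \<beta> = c + 1" by (metis fst_conv, metis snd_conv)
        then show ?thesis using ac True insert.hyps(2) by (simp add: R_def Emat_def ent_def)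
      next
        case False
        then have "\<not> (a + 1 = fst \<beta> \<and> c + 1 = snd \<beta>)" by (metis prod.collapse)
        then show ?thesis using ac False by (auto simp: R_def Emat_def)
      qed
    qed (simp_all add: R_def Emat_def)
    have IH: "R S \<in> sl n" "\<rho> (R S) u = (\<Sum>\<beta>\<in>S. scale (ent x (fst \<beta>) (snd \<beta>)) (\<rho> (Emat n (fst \<beta>) (snd \<beta>)) u))"
      using insert by auto
    have E: "?E \<in> sl n" by (rule root_sl[OF b])
    show ?case
      unfolding R \<rho>_madd[OF IH(1) sl_smult[OF E]] \<rho>_msmult[OF E] IH(2)
      using insert.hyps sl_add[OF IH(1) sl_smult[OF E]] by (simp add: add.commute)
  qed
  from this[OF finite_PD[OF D] order_refl] have "\<rho> (R (PD n D)) u = (\<Sum>\<beta>\<in>PD n D. scale (ent x (fst \<beta>) (snd \<beta>)) (\<rho> (Emat n (fst \<beta>) (snd \<beta>)) u))" ..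
  moreover have "R (PD n D) = rpart n D x" by (simp add: R_def rpart_def)
  ultimately show ?thesis by simp
qed

lemma deriv_fvar_commutator:
  assumes x: "x \<in> parabolic n D" and a: "\<alpha> \<in> PD n D"
  shows "deriv n D x (fvar \<alpha>) = (\<Sum>\<beta>\<in>PD n D. single 0 (ent (commutator x (Emat n (fst \<alpha>) (snd \<alpha>))) (fst \<beta>) (snd \<beta>)) * fvar \<beta>)"
proof -
  obtain i j where ij: "\<alpha> = (i, j)" by (cases \<alpha>)
  have "ent (deg_bracket n D x (Emat n i j)) (fst \<beta>) (snd \<beta>) = ent (commutator x (Emat n i j)) (fst \<beta>) (snd \<beta>)"
    if b: "\<beta> \<in> PD n D" for \<beta>
    using ent_deg_bracket[OF D x a[unfolded ij], of "fst \<beta>" "snd \<beta>"]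
      ent_commutator_Emat[OF parabolicD(2)[OF D x], of "fst \<beta>" "snd \<beta>" i j]
      PD_bounds[of "fst \<beta>" "snd \<beta>" n D] PD_bounds[OF a[unfolded ij]] b by simp
  then show ?thesis unfolding ij deriv_fvar lin_form_def case_prod_beta by simp
qed

text \<open>On the associated graded module \<open>x\<close> acts by \<open>x (p l) = (x p) l + p (x l)\<close>, and \<open>x l\<close> is the multiple \<open>c l\<close>.\<close>

lemma ev_deriv:
  assumes x: "x \<in> parabolic n D" and c: "\<rho> x l = scale c l" and p: "p \<in> Sym n D"
  shows "ev k (deriv n D x p) - (\<rho> x (ev k p) - scale c (ev k p)) \<in> F k"
  using p
proof (induction arbitrary: k rule: Sym_induct)
  case (const a)
  have s: "x \<in> sl n" using parabolicD(1)[OF D x] .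
  show ?case using F_zero by (simp add: deriv_const ev_zero ev_const \<rho>_scale[OF s] c \<rho>_0[OF s] mult.commute)
next
  case (add p q)
  have s: "x \<in> sl n" using parabolicD(1)[OF D x] .
  show ?case using F_add[OF add.IH(1)[of k] add.IH(2)[of k]]
    by (simp add: deriv_add ev_add \<rho>_add[OF s] V.scale_right_distrib algebra_simps)
next
  case (var \<alpha> q)
  have s: "x \<in> sl n" using parabolicD(1)[OF D x] .
  let ?E = "\<lambda>\<beta>. Emat n (fst \<beta>) (snd \<beta>)"
  let ?C = "commutator x (?E \<alpha>)"
  let ?e = "\<lambda>\<beta>. ent ?C (fst \<beta>) (snd \<beta>)"
  have Ea: "?E \<alpha> \<in> sl n" by (rule root_sl[OF var(1)])
  have Cs: "?C \<in> sl n" by (rule sl_commutator[OF s Ea])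
  have der: "deriv n D x (fvar \<alpha> * q) = (\<Sum>\<beta>\<in>PD n D. single 0 (?e \<beta>) * (fvar \<beta> * q)) + fvar \<alpha> * deriv n D x q"
    unfolding deriv_mult deriv_fvar_commutator[OF x var(1)] sum_distrib_right mult.assoc ..
  have dq: "deriv n D x q \<in> Sym n D" by (rule Sym_deriv[OF var(2)])
  show ?case
  proof (cases k)
    case 0
    have "ev 0 (deriv n D x (fvar \<alpha> * q)) = 0"
      unfolding der ev_add ev_sum ev_scale by (simp add: ev_fvar(2)[OF _ var(2)] ev_fvar(2)[OF var(1) dq] sum.neutral)
    then show ?thesis using 0 ev_fvar(2)[OF var(1,2)] F_zero by (simp add: \<rho>_0[OF s])
  next
    case (Suc k')
    let ?u = "ev k' q"
    have u: "?u \<in> F k" using ev_F[OF var(2)] Suc by simp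
    have 1: "(\<Sum>\<beta>\<in>PD n D. scale (?e \<beta>) (ev k (fvar \<beta> * q) - \<rho> (?E \<beta>) ?u)) \<in> F k"
      unfolding Suc by (intro F_sum F_scale ev_fvar(1) var(2))
    have 2: "ev k (fvar \<alpha> * deriv n D x q) - \<rho> (?E \<alpha>) (ev k' (deriv n D x q)) \<in> F k"
      unfolding Suc by (rule ev_fvar(1)[OF var(1) dq])
    have 3: "\<rho> (?E \<alpha>) (ev k' (deriv n D x q) - (\<rho> x ?u - scale c ?u)) \<in> F k"
      unfolding Suc by (rule F_radical[OF root_radical[OF var(1)] var(3)])
    have 4: "ev k (fvar \<alpha> * q) - \<rho> (?E \<alpha>) ?u \<in> F k" unfolding Suc by (rule ev_fvar(1)[OF var(1,2)])
    have 5: "\<rho> x (ev k (fvar \<alpha> * q) - \<rho> (?E \<alpha>) ?u) \<in> F k" by (rule F_parabolic[OF x 4])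
    have 6: "scale c (ev k (fvar \<alpha> * q) - \<rho> (?E \<alpha>) ?u) \<in> F k" by (rule F_scale[OF 4])
    have 7: "\<rho> (ppart n D ?C) ?u \<in> F k" by (rule F_parabolic[OF ppart_in_parabolic[OF D Cs] u])
    have sw: "\<rho> x (\<rho> (?E \<alpha>) ?u) = \<rho> (?E \<alpha>) (\<rho> x ?u) + (\<rho> (ppart n D ?C) ?u + (\<Sum>\<beta>\<in>PD n D. scale (?e \<beta>) (\<rho> (?E \<beta>) ?u)))"
      unfolding \<rho>_swap[OF s Ea] \<rho>_split[OF Cs] \<rho>_rpart[OF Cs] ..
    have evd: "ev k (deriv n D x (fvar \<alpha> * q)) = (\<Sum>\<beta>\<in>PD n D. scale (?e \<beta>) (ev k (fvar \<beta> * q))) + ev k (fvar \<alpha> * deriv n D x q)"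
      unfolding der ev_add ev_sum ev_scale ..
    define A where "A = ev k (fvar \<alpha> * q)"
    define B where "B = ev k' (deriv n D x q)"
    define S where "S = (\<Sum>\<beta>\<in>PD n D. scale (?e \<beta>) (ev k (fvar \<beta> * q)))"
    define T where "T = (\<Sum>\<beta>\<in>PD n D. scale (?e \<beta>) (\<rho> (?E \<beta>) ?u))"
    define G where "G = ev k (fvar \<alpha> * deriv n D x q)"
    have "(S - T) + (G - \<rho> (?E \<alpha>) B) + (\<rho> (?E \<alpha>) B - (\<rho> (?E \<alpha>) (\<rho> x ?u) - scale c (\<rho> (?E \<alpha>) ?u)))
        - (\<rho> x A - \<rho> x (\<rho> (?E \<alpha>) ?u)) + (scale c A - scale c (\<rho> (?E \<alpha>) ?u)) - \<rho> (ppart n D ?C) ?u \<in> F k"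
    proof (rule F_diff, rule F_add, rule F_diff, rule F_add, rule F_add)
      show "S - T \<in> F k" using 1 by (simp only: S_def T_def V.scale_right_diff_distrib sum_subtractf)
      show "G - \<rho> (?E \<alpha>) B \<in> F k" using 2 by (simp only: G_def B_def)
      show "\<rho> (?E \<alpha>) B - (\<rho> (?E \<alpha>) (\<rho> x ?u) - scale c (\<rho> (?E \<alpha>) ?u)) \<in> F k"
        using 3 by (simp only: B_def \<rho>_diff[OF Ea] \<rho>_scale[OF Ea])
      show "\<rho> x A - \<rho> x (\<rho> (?E \<alpha>) ?u) \<in> F k" using 5 by (simp only: A_def \<rho>_diff[OF s])
      show "scale c A - scale c (\<rho> (?E \<alpha>) ?u) \<in> F k" using 6 by (simp only: A_def V.scale_right_diff_distrib)
      show "\<rho> (ppart n D ?C) ?u \<in> F k" by (rule 7)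
    qed
    moreover have "(S - T) + (G - \<rho> (?E \<alpha>) B) + (\<rho> (?E \<alpha>) B - (\<rho> (?E \<alpha>) (\<rho> x ?u) - scale c (\<rho> (?E \<alpha>) ?u)))
        - (\<rho> x A - \<rho> x (\<rho> (?E \<alpha>) ?u)) + (scale c A - scale c (\<rho> (?E \<alpha>) ?u)) - \<rho> (ppart n D ?C) ?u
        = (S + G) - (\<rho> x A - scale c A)"
      unfolding sw T_def[symmetric] by (simp add: algebra_simps)
    ultimately show ?thesis unfolding evd by (simp only: S_def G_def A_def)
  qed
qed

subsection \<open>The annihilator\<close>

definition graded_annihilator :: "pol set" where
  "graded_annihilator = {p\<in>Sym n D. \<forall>k. ev k p \<in> F k}"

lemma graded_annihilator_fvar:
  assumes a: "\<alpha> \<in> PD n D" and p: "p \<in> graded_annihilator"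
  shows "fvar \<alpha> * p \<in> graded_annihilator"
proof -
  have pS: "p \<in> Sym n D" and pF: "\<And>k. ev k p \<in> F k" using p by (simp_all add: graded_annihilator_def)
  have "ev k (fvar \<alpha> * p) \<in> F k" for k
  proof (cases k)
    case 0
    then show ?thesis using ev_fvar(2)[OF a pS] by simp
  next
    case (Suc k')
    have "ev k (fvar \<alpha> * p) - \<rho> (Emat n (fst \<alpha>) (snd \<alpha>)) (ev k' p) \<in> F k" unfolding Suc by (rule ev_fvar(1)[OF a pS])
    moreover have "\<rho> (Emat n (fst \<alpha>) (snd \<alpha>)) (ev k' p) \<in> F k" unfolding Suc by (rule F_radical[OF root_radical[OF a] pF])
    ultimately show ?thesis using F_add by fastforce
  qed
  then show ?thesis using Sym_mult[OF Sym_fvar[OF a] pS] by (simp add: graded_annihilator_def)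
qed

lemma stable_graded_annihilator: "stable_ideal n D graded_annihilator"
proof (rule stable_idealI)
  show "graded_annihilator \<subseteq> Sym n D" by (auto simp: graded_annihilator_def)
  show "0 \<in> graded_annihilator" using Sym_zero F_zero by (simp add: graded_annihilator_def ev_zero)
  show add: "p + q \<in> graded_annihilator" if "p \<in> graded_annihilator" "q \<in> graded_annihilator" for p q
    using that Sym_add F_add by (simp add: graded_annihilator_def ev_add)
  show "c * p \<in> graded_annihilator" if "c \<in> Sym n D" "p \<in> graded_annihilator" for c p
    using that(1)
  proof (induction rule: Sym_induct)
    case (const a)
    then show ?case using that(2) Sym_mult F_scale by (simp add: graded_annihilator_def ev_scale)
  next
    case (add a b)
    then show ?case using \<open>\<And>q p. p \<in> graded_annihilator \<Longrightarrow> q \<in> graded_annihilator \<Longrightarrow> p + q \<in> graded_annihilator\<close>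
      by (simp add: distrib_right)
  next
    case (var \<alpha> q)
    then show ?case using graded_annihilator_fvar by (simp add: mult.assoc)
  qed
  show "deriv n D x p \<in> graded_annihilator" if x: "x \<in> parabolic n D" and p: "p \<in> graded_annihilator" for x p
  proof -
    have pS: "p \<in> Sym n D" and pF: "\<And>k. ev k p \<in> F k" using p by (simp_all add: graded_annihilator_def)
    obtain c where c: "\<rho> x l = scale c l" using parabolic_scales_hwv[OF x] by blast
    have "ev k (deriv n D x p) \<in> F k" for k
    proof -
      have "\<rho> x (ev k p) - scale c (ev k p) \<in> F k" by (rule F_diff[OF F_parabolic[OF x pF] F_scale[OF pF]])
      from F_add[OF ev_deriv[OF x c pS, of k] this] show ?thesis by simp
    qed
    then show ?thesis using Sym_deriv[OF pS] by (simp add: graded_annihilator_def)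
  qed
qed

lemma roots_content_replicate: "roots_content (replicate a \<alpha>) = single \<alpha> a"
  by (induction a) (simp_all add: roots_content_Cons single_add[symmetric])

lemma \<rho>_roots_replicate: "\<rho>_roots (replicate a \<alpha>) = (\<rho> (Emat n (fst \<alpha>) (snd \<alpha>)) ^^ a) l"
  by (induction a) simp_all

lemma fvar_power_graded_annihilator:
  assumes a: "\<alpha> \<in> PD n D" and big: "a > (\<Sum>d\<in>D. m d * (if snd \<alpha> \<le> d \<and> d < fst \<alpha> then 1 else 0))"
  shows "fvar \<alpha> ^ a \<in> graded_annihilator"
proof -
  let ?e = "single \<alpha> a"
  have ke: "keys ?e \<subseteq> PD n D" using a by simp
  have len: "length (ls ?e) = a" using degree_roots_content[of "ls ?e"] ls[OF ke] by simp
  have "\<rho>_roots (ls ?e) - \<rho>_roots (replicate a \<alpha>) \<in> F (length (ls ?e))"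
    by (rule roots_congruent) (use ls[OF ke] a in \<open>auto simp: roots_content_replicate\<close>)
  moreover have "(\<rho> (Emat n (fst \<alpha>) (snd \<alpha>)) ^^ a) l = 0"
    by (rule root_power_kills_hwv) (use a big in simp_all)
  then have "\<rho>_roots (replicate a \<alpha>) = 0" unfolding \<rho>_roots_replicate .
  ultimately have "\<rho>_roots (ls ?e) \<in> F a" using len by simp
  then have "ev k (fvar \<alpha> ^ a) \<in> F k" for k unfolding fvar_power using F_zero by (cases "a = k") (auto simp: ev_single)
  moreover have "fvar \<alpha> ^ a \<in> Sym n D" unfolding fvar_power by (rule Sym_single[OF ke])
  ultimately show ?thesis by (simp add: graded_annihilator_def)
qed

lemma weight_pair_root: "\<beta> \<in> pos_roots n \<Longrightarrow>
  weight_pair D m \<beta> = (\<Sum>d\<in>D. m d * (if snd (root_pos \<beta>) \<le> d \<and> d < fst (root_pos \<beta>) then 1 else 0))"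
  by (cases \<beta>) (auto simp: weight_pair_def root_pos_def intro!: sum.cong)

text \<open>For \<open>M = 0\<close> one of the exponents is too large by itself, so it is enough to consider a power of a
  single root vector.\<close>

lemma relations_graded_annihilator: "relations n D m 0 \<subseteq> graded_annihilator"
proof
  fix p assume "p \<in> relations n D m 0"
  then obtain r :: nat and \<beta> and a :: "nat \<Rightarrow> nat" where p: "p = (\<Prod>i<r. fvar (root_pos (\<beta> i)) ^ a i)"
    and b: "\<forall>i<r. \<beta> i \<in> pos_roots n \<and> root_pos (\<beta> i) \<in> PD n D"
    and s: "(\<Sum>i<r. a i) > 0 + (\<Sum>i<r. weight_pair D m (\<beta> i))" unfolding relations_def by blast
  obtain i where i: "i < r" "a i > weight_pair D m (\<beta> i)"
  proof (rule ccontr)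
    assume "\<not> thesis"
    then have "a i \<le> weight_pair D m (\<beta> i)" if "i < r" for i using that \<open>\<And>i. i < r \<Longrightarrow> weight_pair D m (\<beta> i) < a i \<Longrightarrow> thesis\<close> by (meson not_less)
    then have "(\<Sum>i<r. a i) \<le> (\<Sum>i<r. weight_pair D m (\<beta> i))" by (intro sum_mono) simp
    then show False using s by simp
  qed
  let ?g = "\<lambda>i. fvar (root_pos (\<beta> i)) ^ a i"
  have "?g i \<in> graded_annihilator"
    using fvar_power_graded_annihilator[of "root_pos (\<beta> i)" "a i"] weight_pair_root[of "\<beta> i"] b i by simp
  moreover have "(\<Prod>j\<in>{..<r} - {i}. ?g j) \<in> Sym n D"
  proof -
    have pw: "fvar \<alpha> ^ k \<in> Sym n D" if "\<alpha> \<in> PD n D" for \<alpha> k unfolding fvar_power by (rule Sym_single) (use that in simp)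
    have "finite K \<Longrightarrow> K \<subseteq> {..<r} \<Longrightarrow> (\<Prod>j\<in>K. ?g j) \<in> Sym n D" for K
      by (induction K rule: finite_induct) (use Sym_const[of 1 n D] pw b in \<open>simp_all add: Sym_mult\<close>)
    then show ?thesis by simp
  qed
  ultimately have "(\<Prod>j\<in>{..<r} - {i}. ?g j) * ?g i \<in> graded_annihilator" by (intro stable_idealD(4)[OF stable_graded_annihilator])
  moreover have "p = ?g i * (\<Prod>j\<in>{..<r} - {i}. ?g j)" unfolding p using i(1) by (intro prod.remove) simp_all
  ultimately show "p \<in> graded_annihilator" by (simp add: mult.commute)
qed

definition Ann :: "nat \<Rightarrow> pol set" where
  "Ann M = (prolong n D ^^ M) graded_annihilator"

lemma stable_Ann: "stable_ideal n D (Ann M)"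
  unfolding Ann_def by (induction M) (simp_all add: stable_graded_annihilator stable_ideal_prolong[OF D])

lemma relations_Ann: "relations n D m M \<subseteq> Ann M"
proof (induction M)
  case 0
  show ?case unfolding Ann_def using relations_graded_annihilator by simp
next
  case (Suc M)
  show ?case using relations_prolong[OF stable_Ann Suc] unfolding Ann_def by simp
qed

end

section \<open>Independence modulo the annihilator\<close>

lemma lookup_iterated_pd:
  "\<exists>c. c \<noteq> 0 \<and> lookup (foldr pd as p) e = c * lookup p (e + roots_content as)"
proof (induction as arbitrary: e)
  case Nil
  show ?case by (intro exI[of _ 1]) simp
next
  case (Cons \<alpha> as)
  obtain c where c: "c \<noteq> 0" "lookup (foldr pd as p) (e + single \<alpha> 1)
      = c * lookup p (e + single \<alpha> 1 + roots_content as)" using Cons.IH by blast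
  have "of_nat (Suc (lookup e \<alpha>)) * c \<noteq> 0" using c(1) by (simp del: of_nat_Suc)
  moreover have "lookup (foldr pd (\<alpha> # as) p) e = of_nat (Suc (lookup e \<alpha>)) * c * lookup p (e + roots_content (\<alpha> # as))"
    unfolding foldr_Cons comp_apply lookup_pd c(2) roots_content_Cons by (simp only: mult.assoc add.assoc)
  ultimately show ?case by blast
qed

context highest_weight_module
begin

lemma Ann_Suc: "Ann (Suc M) = prolong n D (Ann M)"
  by (simp add: Ann_def)

lemma Ann_0: "Ann 0 = graded_annihilator"
  by (simp add: Ann_def)

lemma Ann_mono: "p \<in> Ann (M + k) \<Longrightarrow> p \<in> Ann M"
  by (induction k) (simp_all add: Ann_Suc prolong_def)

lemma Ann_Sym: "Ann M \<subseteq> Sym n D"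
  by (rule stable_idealD(1)[OF stable_Ann])

lemma Ann_iterated_pd: "set as \<subseteq> PD n D \<Longrightarrow> p \<in> Ann (M + length as) \<Longrightarrow> foldr pd as p \<in> Ann M"
proof (induction as arbitrary: M)
  case (Cons \<alpha> as)
  have "p \<in> Ann (Suc M + length as)" using Cons.prems(2) by simp
  then have "foldr pd as p \<in> Ann (Suc M)" using Cons.IH Cons.prems(1) by simp
  then show ?case using Cons.prems(1) by (simp add: Ann_Suc prolong_def)
qed simp

lemma lookup_least:
  assumes "family A"
  shows "lookup (least A) \<alpha> = (\<Sum>d\<in>D. \<Sum>\<tau><m d. if \<alpha> \<in> A d \<tau> then 1 else 0)"
proof -
  have "lookup (least A) \<alpha> = (\<Sum>x\<in>factors. lookup (case x of (d, t) \<Rightarrow> \<Sum>\<alpha>\<in>A d t. single \<alpha> (1::nat)) \<alpha>)"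
    unfolding least_def by (rule lookup_sum)
  also have "\<dots> = (\<Sum>(d, t)\<in>factors. if \<alpha> \<in> A d t then 1 else 0)"
  proof (rule sum.cong[OF refl])
    fix x assume x: "x \<in> factors"
    obtain d t where xx: "x = (d, t)" by (cases x)
    have "lookup (\<Sum>\<alpha>\<in>A d t. single \<alpha> (1::nat)) \<alpha> = card {\<beta>\<in>A d t. \<beta> = \<alpha>}"
      by (rule lookup_sum_single) (rule A_finite[OF assms x[unfolded xx]])
    also have "{\<beta>\<in>A d t. \<beta> = \<alpha>} = (if \<alpha> \<in> A d t then {\<alpha>} else {})" by auto
    finally show "lookup (case x of (d, t) \<Rightarrow> \<Sum>\<alpha>\<in>A d t. single \<alpha> (1::nat)) \<alpha> = (case x of (d, t) \<Rightarrow> if \<alpha> \<in> A d t then 1 else 0)"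
      unfolding xx case_prod_conv by (simp split: if_splits)
  qed
  also have "\<dots> = (\<Sum>d\<in>D. \<Sum>\<tau><m d. if \<alpha> \<in> A d \<tau> then 1 else 0)"
    unfolding factors_def using finD by (subst sum.Sigma[symmetric]) auto
  finally show ?thesis .
qed

text \<open>Differentiate away the part \<open>t\<close> of the largest exponent \<open>s\<close>.  What remains is annihilated in the
  associated graded module itself, and its exponents are at most \<open>s - t\<close>, a sum of indicators of
  antichains.\<close>

theorem Ann_independent:
  assumes p: "p \<in> Ann M" and keys: "keys p \<subseteq> S_exp n D m M"
  shows "p = 0"
proof (rule ccontr)
  assume nz: "p \<noteq> 0"
  define s where "s = Max (keys p)"
  have sk: "s \<in> keys p" unfolding s_def using nz by (intro Max_in) simp_all
  have smax: "e \<le> s" if "e \<in> keys p" for e unfolding s_def using that by (intro Max_ge) simp_all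
  have sP: "keys s \<subseteq> PD n D"
    and le: "\<And>Q. Q \<subseteq> PD n D \<Longrightarrow> (\<Sum>\<alpha>\<in>Q. lookup s \<alpha>) \<le> M + (\<Sum>d\<in>D. m d * width (Q \<inter> Pd n d))"
    using keys sk by (auto simp: S_exp_def)
  from decompose[OF D le] obtain t A where tM: "(\<Sum>\<alpha>\<in>PD n D. t \<alpha>) \<le> M"
    and A: "\<forall>d\<in>D. \<forall>\<tau><m d. A d \<tau> \<subseteq> Pd n d \<and> antichain (A d \<tau>)"
    and st: "\<forall>\<alpha>\<in>PD n D. lookup s \<alpha> = t \<alpha> + (\<Sum>d\<in>D. \<Sum>\<tau><m d. if \<alpha> \<in> A d \<tau> then 1 else 0)" by blast
  have fam: "family A" unfolding family_def factors_def using A by blast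
  define t' where "t' = (\<Sum>\<alpha>\<in>PD n D. single \<alpha> (t \<alpha>))"
  have finP: "finite (PD n D)" by (rule finite_PD[OF D])
  have lt: "lookup t' \<alpha> = (if \<alpha> \<in> PD n D then t \<alpha> else 0)" for \<alpha>
    unfolding t'_def by (rule lookup_sum_singles[OF finP])
  have t'P: "keys t' \<subseteq> PD n D" by (auto simp: in_keys_iff lt split: if_splits)
  have degt: "degree t' \<le> M" using degree_superset[OF finP t'P] tM by (simp add: lt)
  have s_eq: "s = least A + t'"
  proof (rule poly_mapping_eqI)
    fix \<alpha>
    show "lookup s \<alpha> = lookup (least A + t') \<alpha>"
    proof (cases "\<alpha> \<in> PD n D")
      case True
      then show ?thesis using st by (simp add: lookup_add lt lookup_least[OF fam])
    next
      case False
      have "\<alpha> \<notin> A d \<tau>" if "d \<in> D" "\<tau> < m d" for d \<tau> using A that False by (auto simp: PD_def)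
      then have "lookup (least A) \<alpha> = 0" unfolding lookup_least[OF fam] by (intro sum.neutral ballI) simp
      moreover have "lookup s \<alpha> = 0" using sP False by (auto simp: in_keys_iff)
      ultimately show ?thesis using False by (simp add: lookup_add lt)
    qed
  qed
  obtain as where as: "set as \<subseteq> PD n D" "roots_content as = t'" using exists_roots_list[OF t'P] by blast
  have len: "length as \<le> M" using degree_roots_content[of as] as(2) degt by simp
  define q where "q = foldr pd as p"
  have "p \<in> Ann (M - length as + length as)" using p len by simp
  then have "q \<in> Ann (M - length as)" unfolding q_def by (rule Ann_iterated_pd[OF as(1)])
  then have qA: "q \<in> graded_annihilator" using Ann_mono[of q 0 "M - length as"] by (simp add: Ann_0)
  have qS: "q \<in> Sym n D" and qF: "ev (degree (least A)) q \<in> F (degree (least A))"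
    using qA by (simp_all add: graded_annihilator_def)
  have kq: "e + t' \<in> keys p" if "e \<in> keys q" for e
    using lookup_iterated_pd[of as p e] that as(2) by (auto simp: q_def in_keys_iff)
  define E where "E = {e\<in>keys q. degree e = degree (least A)}"
  have "least A \<in> keys q"
    using lookup_iterated_pd[of as p "least A"] sk as(2) s_eq by (auto simp: q_def in_keys_iff)
  then have E0: "least A \<in> E" by (simp add: E_def)
  have "set (ls e) \<subseteq> PD n D \<and> roots_content (ls e) = e \<and> e \<le> least A \<and> degree e = degree (least A)" if e: "e \<in> E" for e
  proof -
    have ek: "e \<in> keys q" "degree e = degree (least A)" using e by (simp_all add: E_def)
    have "keys e \<subseteq> PD n D" using qS ek(1) by (simp add: Sym_def)
    moreover have "e \<le> least A" using smax[OF kq[OF ek(1)]] unfolding s_eq by simp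
    ultimately show ?thesis using ls ek(2) by blast
  qed
  moreover have "(\<Sum>e\<in>E. scale (lookup q e) (\<rho>_roots (ls e))) = ev (degree (least A)) q"
    unfolding E_def ev_def by (simp add: sum.inter_filter)
  ultimately have "lookup q (least A) = 0"
    using qF by (intro leading_coefficient_zero[OF fam _ _ E0, of ls]) (simp_all add: E_def)
  then show False using \<open>least A \<in> keys q\<close> by (simp add: in_keys_iff)
qed

theorem Ann_least:
  assumes J: "stable_ideal n D J" and rel: "relations n D m M \<subseteq> J"
  shows "Ann M \<subseteq> J"
proof
  fix p assume p: "p \<in> Ann M"
  have I: "stable_ideal n D (J \<inter> Ann M)" by (rule stable_ideal_Int[OF J stable_Ann])
  have "relations n D m M \<subseteq> J \<inter> Ann M" using rel relations_Ann by blast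
  from standard_form[OF D I this, of p] p Ann_Sym obtain r where r: "p - r \<in> J \<inter> Ann M" "keys r \<subseteq> S_exp n D m M" by blast
  have "r = p - (p - r)" by simp
  then have "r \<in> Ann M" using stable_ideal_diff[OF stable_Ann p] r(1) by (metis IntD2)
  then have "r = 0" using Ann_independent r(2) by blast
  then show "p \<in> J" using r(1) by simp
qed

end

section \<open>Bases of linear images of the polynomial ring\<close>

lemma finsum_image:
  fixes G (structure)
  assumes G: "abelian_monoid G" and X: "\<And>p. p \<in> Sym n D \<Longrightarrow> X p \<in> carrier G"
    and add: "\<And>p q. p \<in> Sym n D \<Longrightarrow> q \<in> Sym n D \<Longrightarrow> X (p + q) = X p \<oplus> X q" and zero: "X 0 = \<zero>"
    and fin: "finite I" and f: "\<And>i. i \<in> I \<Longrightarrow> f i \<in> Sym n D"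
  shows "(\<Oplus>i\<in>I. X (f i)) = X (\<Sum>i\<in>I. f i)"
  using fin f
proof (induction I rule: finite_induct)
  case empty
  then show ?case by (simp add: abelian_monoid.finsum_empty[OF G] zero)
next
  case (insert i I)
  have "(\<Oplus>i\<in>insert i I. X (f i)) = X (f i) \<oplus> (\<Oplus>i\<in>I. X (f i))"
    by (rule abelian_monoid.finsum_insert[OF G]) (use insert X in auto)
  also have "\<dots> = X (f i) \<oplus> X (\<Sum>i\<in>I. f i)" using insert by simp
  also have "\<dots> = X (f i + (\<Sum>i\<in>I. f i))" using insert.prems by (intro add[symmetric] Sym_sum) simp_all
  finally show ?case using insert.hyps by simp
qed

text \<open>The submodules generated by the cyclic vectors are images of \<open>Sym n D\<close> under linear maps.  Their
  vector space structure is transported from there.\<close>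

locale linear_image =
  fixes n :: nat and D :: "nat set" and L :: "(complex, 't) module" (structure) and X :: "pol \<Rightarrow> 't"
  assumes carrier: "carrier L = X ` Sym n D" and zero: "X 0 = \<zero>"
    and add: "\<And>p q. p \<in> Sym n D \<Longrightarrow> q \<in> Sym n D \<Longrightarrow> X (p + q) = X p \<oplus> X q"
    and smult: "\<And>c p. p \<in> Sym n D \<Longrightarrow> X (single 0 c * p) = c \<odot> X p"
begin

lemma const_times: "p \<in> Sym n D \<Longrightarrow> single 0 c * p \<in> Sym n D"
  by (rule Sym_mult) simp_all

lemma vectorspace: "vectorspace class_ring L"
proof -
  have abgr: "abelian_group L"
  proof (rule abelian_groupI)
    show "\<zero> \<in> carrier L" unfolding carrier zero[symmetric] by (rule imageI[OF Sym_zero])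
  next
    fix x y assume "x \<in> carrier L" "y \<in> carrier L"
    then obtain p q where p: "p \<in> Sym n D" "x = X p" and q: "q \<in> Sym n D" "y = X q" unfolding carrier by blast
    show "x \<oplus> y \<in> carrier L" unfolding p q add[OF p(1) q(1), symmetric] carrier by (rule imageI[OF Sym_add[OF p(1) q(1)]])
    show "x \<oplus> y = y \<oplus> x" unfolding p q add[OF p(1) q(1), symmetric] add[OF q(1) p(1), symmetric] by (simp only: add.commute)
    fix z assume "z \<in> carrier L"
    then obtain r where r: "r \<in> Sym n D" "z = X r" unfolding carrier by blast
    show "x \<oplus> y \<oplus> z = x \<oplus> (y \<oplus> z)"
      unfolding p q r add[OF p(1) q(1), symmetric] add[OF q(1) r(1), symmetric]
        add[OF Sym_add[OF p(1) q(1)] r(1), symmetric] add[OF p(1) Sym_add[OF q(1) r(1)], symmetric]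
      by (simp only: add.assoc)
  next
    fix x assume "x \<in> carrier L"
    then obtain p where p: "p \<in> Sym n D" "x = X p" unfolding carrier by blast
    show "\<zero> \<oplus> x = x" unfolding p zero[symmetric] add[OF Sym_zero p(1), symmetric] by simp
    have m: "single 0 (- 1) * p \<in> Sym n D" by (rule const_times[OF p(1)])
    have "single 0 (- 1) * p + p = 0" by (simp add: single_uminus)
    then have "X (single 0 (- 1) * p) \<oplus> x = \<zero>" unfolding p add[OF m p(1), symmetric] zero[symmetric] by simp
    then show "\<exists>y\<in>carrier L. y \<oplus> x = \<zero>" unfolding carrier using m by blast
  qed
  have "Module.module class_ring L"
  proof (rule moduleI)
    show "cring (class_ring :: complex ring)" using class_field[where 'a = complex] by (simp add: field_def domain_def)
    show "abelian_group L" by (rule abgr)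
    fix a :: complex and x assume "x \<in> carrier L"
    then obtain p where p: "p \<in> Sym n D" "x = X p" unfolding carrier by blast
    show "a \<odot> x \<in> carrier L" unfolding p smult[OF p(1), symmetric] carrier by (rule imageI[OF const_times[OF p(1)]])
    show "\<one>\<^bsub>class_ring\<^esub> \<odot> x = x"
    proof -
      have "X (single 0 1 * p) = X p" by simp
      then show ?thesis unfolding p using smult[OF p(1), of 1] by simp
    qed
    fix b :: complex
    show "(a \<oplus>\<^bsub>class_ring\<^esub> b) \<odot> x = a \<odot> x \<oplus> b \<odot> x"
    proof -
      have "X (single 0 (a + b) * p) = X (single 0 a * p + single 0 b * p)"
        by (simp only: single_add distrib_right)
      then show ?thesis unfolding p using add[OF const_times[OF p(1)] const_times[OF p(1)]] smult[OF p(1)] by simp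
    qed
    show "(a \<otimes>\<^bsub>class_ring\<^esub> b) \<odot> x = a \<odot> (b \<odot> x)"
    proof -
      have "X (single 0 (a * b) * p) = X (single 0 a * (single 0 b * p))"
        by (simp add: mult_single mult.assoc[symmetric])
      then show ?thesis unfolding p using smult[OF const_times[OF p(1)]] smult[OF p(1)] by simp
    qed
    fix y assume "y \<in> carrier L"
    then obtain q where q: "q \<in> Sym n D" "y = X q" unfolding carrier by blast
    show "a \<odot> (x \<oplus> y) = a \<odot> x \<oplus> a \<odot> y"
    proof -
      have "X (single 0 a * (p + q)) = X (single 0 a * p + single 0 a * q)"
        by (simp only: distrib_left)
      then show ?thesis
        unfolding p q using add[OF const_times[OF p(1)] const_times[OF q(1)]] add[OF p(1) q(1)] smult[OF Sym_add[OF p(1) q(1)]]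
          smult[OF p(1)] smult[OF q(1)] by simp
    qed
  qed
  then show ?thesis using class_field by (simp add: vectorspace_def)
qed

lemma finsum: "finite I \<Longrightarrow> (\<And>i. i \<in> I \<Longrightarrow> f i \<in> Sym n D) \<Longrightarrow> (\<Oplus>i\<in>I. X (f i)) = X (\<Sum>i\<in>I. f i)"
proof (rule finsum_image)
  interpret vectorspace class_ring L by (rule vectorspace)
  show "abelian_monoid L" by unfold_locales
qed (auto simp: carrier add zero)

context
  fixes S :: "(nat \<times> nat \<Rightarrow>\<^sub>0 nat) set"
  assumes S: "\<And>e. e \<in> S \<Longrightarrow> keys e \<subseteq> PD n D"
    and spanning: "\<And>p. p \<in> Sym n D \<Longrightarrow> \<exists>r. keys r \<subseteq> S \<and> X p = X r"
    and independent: "\<And>r. keys r \<subseteq> S \<Longrightarrow> X r = \<zero> \<Longrightarrow> r = 0"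
begin

abbreviation b :: "(nat \<times> nat \<Rightarrow>\<^sub>0 nat) \<Rightarrow> 't" where "b e \<equiv> X (single e 1)"

lemma b_combination:
  assumes "finite K" "K \<subseteq> S"
  shows "(\<Oplus>e\<in>K. c e \<odot> b e) = X (\<Sum>e\<in>K. single e (c e))"
proof -
  have e: "single e (1::complex) \<in> Sym n D" if "e \<in> K" for e using S assms(2) that by (intro Sym_single) blast
  have "(\<Oplus>e\<in>K. c e \<odot> b e) = (\<Oplus>e\<in>K. X (single 0 (c e) * single e 1))"
  proof -
    interpret vectorspace class_ring L by (rule vectorspace)
    show ?thesis
    proof (rule finsum_cong'[OF refl])
      show "(\<lambda>e. X (single 0 (c e) * single e 1)) \<in> K \<rightarrow> carrier L"
        unfolding carrier using const_times[OF e] by blast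
    qed (use smult[OF e] in simp)
  qed
  also have "\<dots> = X (\<Sum>e\<in>K. single 0 (c e) * single e 1)"
    by (rule finsum[OF assms(1)]) (rule const_times[OF e])
  finally show ?thesis by (simp add: mult_single)
qed

lemma b_inj: "inj_on b S"
proof (rule inj_onI)
  fix e f assume ef: "e \<in> S" "f \<in> S" "b e = b f"
  show "e = f"
  proof (rule ccontr)
    assume ne: "e \<noteq> f"
    let ?c = "\<lambda>x. if x = e then 1 else - 1 :: complex"
    let ?r = "\<Sum>x\<in>{e, f}. single x (?c x)"
    have r: "?r = single e 1 + single f (- 1)" using ne by simp
    have s: "single e (1::complex) \<in> Sym n D" "single f (1::complex) \<in> Sym n D"
      using S ef(1,2) by (intro Sym_single; blast)+
    have "single f (- 1 :: complex) = single 0 (- 1) * single f 1" by (simp add: mult_single)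
    then have "X ?r = b e \<oplus> (- 1) \<odot> b f"
      unfolding r using add[OF s(1) const_times[OF s(2)]] smult[OF s(2)] by simp
    also have "\<dots> = X (single e 1 + single 0 (- 1) * single e 1)"
      using add[OF s(1) const_times[OF s(1)]] smult[OF s(1)] ef(3) by simp
    also have "\<dots> = \<zero>" by (simp add: mult_single single_uminus zero)
    finally have "X ?r = \<zero>" .
    moreover have "keys ?r \<subseteq> S" unfolding r using Poly_Mapping.keys_add[of "single e (1::complex)" "single f (-1)"] ef(1,2) by auto
    ultimately have "?r = 0" using independent by blast
    then have "lookup ?r e = 0" by simp
    then show False unfolding r using ne by (simp add: lookup_add lookup_single)
  qed
qed

theorem basis: "vectorspace.basis class_ring L (b ` S)"
proof -
  interpret vectorspace class_ring L by (rule vectorspace)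
  have sub: "b ` S \<subseteq> carrier L" unfolding carrier using S Sym_single by blast
  have comb: "lincomb a (b ` K) = X (\<Sum>e\<in>K. single e (a (b e)))" if K: "finite K" "K \<subseteq> S" for a K
  proof -
    have "lincomb a (b ` K) = (\<Oplus>v\<in>b ` K. a v \<odot> v)" by (rule lincomb_def)
    also have "\<dots> = (\<Oplus>e\<in>K. a (b e) \<odot> b e)"
    proof (rule finsum_reindex)
      show "(\<lambda>v. a v \<odot> v) \<in> b ` K \<rightarrow> carrier L" using sub K(2) by (auto intro!: smult_closed)
      show "inj_on b K" using b_inj K(2) by (rule inj_on_subset)
    qed
    finally show ?thesis unfolding b_combination[OF K] .
  qed
  have "\<not> lin_dep (b ` S)"
  proof
    assume "lin_dep (b ` S)"
    then obtain A a v where A: "finite A" "A \<subseteq> b ` S" "lincomb a A = \<zero>" "v \<in> A" "a v \<noteq> 0"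
      unfolding lin_dep_def by auto
    obtain K where K: "K \<subseteq> S" "finite K" "A = b ` K" using finite_subset_image[OF A(1,2)] by blast
    let ?r = "\<Sum>e\<in>K. single e (a (b e))"
    have lr: "lookup ?r e = (if e \<in> K then a (b e) else 0)" for e
    proof -
      have "lookup ?r e = (\<Sum>f\<in>K. if f = e then a (b e) else 0)"
        unfolding lookup_sum by (rule sum.cong) (auto simp: lookup_single when_def)
      then show ?thesis using K(2) by simp
    qed
    have "keys ?r \<subseteq> S" using K(1) by (auto simp: in_keys_iff lr split: if_splits)
    moreover have "X ?r = \<zero>" using A(3) comb[OF K(2,1)] unfolding K(3) by simp
    ultimately have "?r = 0" using independent by blast
    obtain e where e: "e \<in> K" "v = b e" using A(4) unfolding K(3) by blast
    have "a (b e) = lookup ?r e" using e(1) by (simp add: lr)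
    then show False using \<open>?r = 0\<close> A(5) e(2) by simp
  qed
  moreover have "span (b ` S) = carrier L"
  proof
    show "span (b ` S) \<subseteq> carrier L" by (rule span_is_subset2[OF sub])
    show "carrier L \<subseteq> span (b ` S)"
    proof
      fix x assume "x \<in> carrier L"
      then obtain p where "p \<in> Sym n D" "x = X p" unfolding carrier by blast
      then obtain r where r: "keys r \<subseteq> S" "x = X r" using spanning by blast
      define a where "a v = lookup r (inv_into S b v)" for v
      let ?K = "keys r"
      have "a (b e) = lookup r e" if "e \<in> ?K" for e
        unfolding a_def using inv_into_f_f[OF b_inj] that r(1) by auto
      then have "lincomb a (b ` ?K) = X (\<Sum>e\<in>?K. single e (lookup r e))"
        unfolding comb[OF finite_keys r(1)] by simp
      also have "\<dots> = x" unfolding r(2) using poly_mapping_expand[of r] by simp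
      finally have "lincomb a (b ` ?K) = x" .
      moreover have "finite (b ` ?K)" "b ` ?K \<subseteq> b ` S" using r(1) by auto
      ultimately show "x \<in> span (b ` S)" unfolding span_def
        by (intro CollectI exI[of _ a] exI[of _ "b ` ?K"]) simp
    qed
  qed
  ultimately show ?thesis using sub by (simp add: basis_def)
qed

end

end

section \<open>The module\<close>

lemma tensor_V_simps:
  "carrier (tensor_V n D M G) = V_words n D M \<rightarrow>\<^sub>E carrier G"
  "\<zero>\<^bsub>tensor_V n D M G\<^esub> = (\<lambda>w\<in>V_words n D M. \<zero>\<^bsub>G\<^esub>)"
  "s \<oplus>\<^bsub>tensor_V n D M G\<^esub> t = (\<lambda>w\<in>V_words n D M. s w \<oplus>\<^bsub>G\<^esub> t w)"
  "c \<odot>\<^bsub>tensor_V n D M G\<^esub> t = (\<lambda>w\<in>V_words n D M. c \<odot>\<^bsub>G\<^esub> t w)"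
  by (simp_all add: tensor_V_def Let_def)

lemma abelian_monoid_tensor_V:
  assumes G: "abelian_monoid G"
  shows "abelian_monoid (tensor_V n D M G)"
proof -
  interpret G: abelian_monoid G by (rule G)
  show ?thesis
  proof (rule abelian_monoidI)
    fix s assume s: "s \<in> carrier (tensor_V n D M G)"
    show "\<zero>\<^bsub>tensor_V n D M G\<^esub> \<oplus>\<^bsub>tensor_V n D M G\<^esub> s = s"
    proof (rule PiE_ext)
      show "s \<in> V_words n D M \<rightarrow>\<^sub>E carrier G" using s by (simp add: tensor_V_simps)
      then show "\<zero>\<^bsub>tensor_V n D M G\<^esub> \<oplus>\<^bsub>tensor_V n D M G\<^esub> s \<in> V_words n D M \<rightarrow>\<^sub>E carrier G"
        by (auto simp: tensor_V_simps)
      fix w assume "w \<in> V_words n D M"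
      then show "(\<zero>\<^bsub>tensor_V n D M G\<^esub> \<oplus>\<^bsub>tensor_V n D M G\<^esub> s) w = s w"
        using G.l_zero[of "s w"] PiE_mem[OF \<open>s \<in> V_words n D M \<rightarrow>\<^sub>E carrier G\<close>] by (simp add: tensor_V_simps)
    qed
    fix t assume t: "t \<in> carrier (tensor_V n D M G)"
    show "s \<oplus>\<^bsub>tensor_V n D M G\<^esub> t \<in> carrier (tensor_V n D M G)" using s t by (auto simp: tensor_V_simps)
    show "s \<oplus>\<^bsub>tensor_V n D M G\<^esub> t = t \<oplus>\<^bsub>tensor_V n D M G\<^esub> s"
      unfolding tensor_V_simps by (rule restrict_ext) (use s t in \<open>auto simp: tensor_V_simps intro!: G.a_comm\<close>)
    fix u assume u: "u \<in> carrier (tensor_V n D M G)"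
    show "s \<oplus>\<^bsub>tensor_V n D M G\<^esub> t \<oplus>\<^bsub>tensor_V n D M G\<^esub> u = s \<oplus>\<^bsub>tensor_V n D M G\<^esub> (t \<oplus>\<^bsub>tensor_V n D M G\<^esub> u)"
      unfolding tensor_V_simps by (rule restrict_ext) (use s t u in \<open>auto simp: tensor_V_simps intro!: G.a_assoc\<close>)
  qed (auto simp: tensor_V_simps)
qed

lemma finite_V_labels: "D \<subseteq> {1..<n} \<Longrightarrow> finite (V_labels n D)"
  using finite_PD by (auto simp: V_labels_def)

lemma V_words_upd: "w \<in> V_words n D M \<Longrightarrow> b \<in> V_labels n D \<Longrightarrow> w[k := b] \<in> V_words n D M"
  using set_update_subset_insert[of w k b] by (auto simp: V_words_def)

lemma commutator_zero: "z \<in> carrier_mat n n \<Longrightarrow> commutator (0\<^sub>m n n) z = 0\<^sub>m n n"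
  by (simp add: commutator_def)

lemma rpart_zero: "rpart n D (0\<^sub>m n n) = 0\<^sub>m n n"
  by (rule eq_matI) (auto simp: rpart_def)

lemma ppart_zero: "ppart n D (0\<^sub>m n n) = 0\<^sub>m n n"
  by (simp add: ppart_def rpart_zero)

lemma deg_bracket_zero: "y \<in> carrier_mat n n \<Longrightarrow> deg_bracket n D (0\<^sub>m n n) y = 0\<^sub>m n n"
proof -
  assume "y \<in> carrier_mat n n"
  have r: "rpart n D y \<in> carrier_mat n n" by (simp add: rpart_def)
  have "ppart n D y \<in> carrier_mat n n" unfolding ppart_def by (rule minus_carrier_mat[OF r])
  then show ?thesis using r by (simp add: deg_bracket_def ppart_zero rpart_zero commutator_zero)
qed

text \<open>The radical takes \<open>v\<close> to the basis vectors \<open>E_{i,j}\<close> and kills the latter.\<close>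

lemma V_coord_act:
  assumes \<alpha>: "(i, j) \<in> PD n D" and b: "b \<in> V_labels n D" and b': "b' \<in> V_labels n D"
  shows "V_coord b' (V_act n D (Emat n i j) (V_basis n b)) = (if b = None \<and> b' = Some (i, j) then 1 else 0)"
proof -
  define c :: complex where "c = (if b = None then 1 else 0)"
  obtain y where y: "V_basis n b = (c, y)" "y \<in> carrier_mat n n"
    by (cases b) (auto simp: V_basis_def c_def)
  have "V_act n D (Emat n i j) (V_basis n b) = (0, c \<cdot>\<^sub>m Emat n i j)"
    using right_add_zero_mat[of "c \<cdot>\<^sub>m Emat n i j" n n]
    by (simp add: V_act_def y(1) rpart_Emat[OF \<alpha>] ppart_Emat[OF \<alpha>] deg_bracket_zero[OF y(2)])
  moreover have "ent (c \<cdot>\<^sub>m Emat n i j) a e = (if (a, e) = (i, j) then c else 0)" if "(a, e) \<in> PD n D" for a e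
    using PD_bounds[OF that] PD_bounds[OF \<alpha>] by (auto simp: ent_def Emat_def)
  ultimately show ?thesis
    using b' by (cases b'; cases "b = None") (auto simp: V_coord_def V_labels_def c_def split: if_splits)
qed

text \<open>The iterated partial derivative along a word in the basis labels of \<open>V\<close>, the label \<open>None\<close> of \<open>v\<close>
  meaning no derivative.  It gives the coefficients of \<open>p\<close> applied to the cyclic vector of a tensor
  power (\<open>pol_act_Xi\<close>), and \<open>pdw_fvar\<close> corresponds to the Leibniz rule of the tensor action.\<close>

fun pdw :: "(nat \<times> nat) option list \<Rightarrow> pol \<Rightarrow> pol" where
  "pdw [] p = p"
| "pdw (b # w) p = pdw w (case b of None \<Rightarrow> p | Some \<alpha> \<Rightarrow> pd \<alpha> p)"

lemma pdw_add: "pdw w (p + q) = pdw w p + pdw w q"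
  by (induction w arbitrary: p q) (simp_all add: pd_add split: option.splits)

lemma pdw_zero: "pdw w 0 = 0"
  by (induction w) (simp_all add: pd_zero split: option.splits)

lemma pd_scale: "pd \<alpha> (single 0 c * p) = single 0 c * pd \<alpha> p"
  by (simp add: pd_mult pd_const)

lemma pdw_scale: "pdw w (single 0 c * p) = single 0 c * pdw w p"
  by (induction w arbitrary: p) (simp_all add: pd_scale split: option.splits)

lemma Sym_pdw: "p \<in> Sym n D \<Longrightarrow> pdw w p \<in> Sym n D"
  by (induction w arbitrary: p) (simp_all add: Sym_pd split: option.splits)

lemma pdw_one: "pdw w 1 = (if set w \<subseteq> {None} then 1 else 0)"
  using pd_const[of _ 1] by (induction w) (auto simp: pdw_zero split: option.splits)

lemma pdw_fvar: "pdw w (fvar \<alpha> * p) = fvar \<alpha> * pdw w p + (\<Sum>k<length w. if w ! k = Some \<alpha> then pdw (w[k := None]) p else 0)"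
proof (induction w arbitrary: p)
  case (Cons b w)
  show ?case
  proof (cases b)
    case None
    then show ?thesis using Cons by (simp add: sum.lessThan_Suc_shift del: sum.lessThan_Suc cong: if_cong)
  next
    case (Some \<beta>)
    have "pd \<beta> (fvar \<alpha> * p) = (if \<beta> = \<alpha> then p else 0) + fvar \<alpha> * pd \<beta> p" by (simp add: pd_mult pd_fvar)
    then show ?thesis using Some Cons by (simp add: sum.lessThan_Suc_shift pdw_add pdw_zero add.commute add.left_commute del: sum.lessThan_Suc cong: if_cong)
  qed
qed simp

context highest_weight_module
begin

abbreviation La :: "(complex, nat \<Rightarrow> 'v set) module" where "La \<equiv> gr n D scale \<rho> l"

lemma gr_simps:
  "carrier La = {g. (\<forall>k. \<exists>u\<in>F (Suc k). g k = u +o F k) \<and> finite {k. g k \<noteq> F k}}"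
  "\<zero>\<^bsub>La\<^esub> = F" "g \<oplus>\<^bsub>La\<^esub> h = (\<lambda>k. g k + h k)" "c \<odot>\<^bsub>La\<^esub> g = (\<lambda>k. scale c ` g k + F k)"
  by (simp_all add: gr_def Let_def)

lemma F_plus: "F k + F k = F k"
  using F_add F_zero by (auto simp: set_plus_def) (metis add.left_neutral)

lemma coset_add: "(u +o F k) + (v +o F k) = (u + v) +o F k"
  by (simp add: set_plus_rearrange F_plus)

lemma coset_self: "u \<in> u +o F k"
  using F_zero[of k] unfolding elt_set_plus_def by (metis (mono_tags, lifting) add.right_neutral mem_Collect_eq)

lemma coset_eq_iff: "u +o F k = v +o F k \<longleftrightarrow> u - v \<in> F k"
proof
  assume "u +o F k = v +o F k"
  then have "u \<in> v +o F k" using coset_self by blast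
  then show "u - v \<in> F k" by (auto simp: elt_set_plus_def)
next
  assume d: "u - v \<in> F k"
  have "\<exists>c\<in>F k. u + f = v + c" if "f \<in> F k" for f
    using F_add[OF d that] by (intro bexI[of _ "u - v + f"]) simp_all
  moreover have "\<exists>c\<in>F k. v + f = u + c" if "f \<in> F k" for f
    using F_diff[OF that d] by (intro bexI[of _ "f - (u - v)"]) simp_all
  ultimately show "u +o F k = v +o F k" unfolding elt_set_plus_def by auto
qed

lemma coset_F: "u +o F k = F k \<longleftrightarrow> u \<in> F k"
  using coset_eq_iff[of u k 0] by simp

lemma coset_image:
  assumes "\<And>a b. g (a + b) = g a + g b" "\<And>f. f \<in> F k \<Longrightarrow> g f \<in> F k'"
  shows "g ` (u +o F k) + F k' = g u +o F k'"
proof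
  show "g ` (u +o F k) + F k' \<subseteq> g u +o F k'"
  proof
    fix x assume "x \<in> g ` (u +o F k) + F k'"
    then obtain f f' where f: "f \<in> F k" "f' \<in> F k'" "x = g (u + f) + f'"
      by (auto simp: set_plus_def elt_set_plus_def)
    then have "x = g u + (g f + f')" using assms(1) by (simp add: add.assoc)
    then show "x \<in> g u +o F k'" using F_add assms(2) f(1,2) by (auto simp: elt_set_plus_def)
  qed
  show "g u +o F k' \<subseteq> g ` (u +o F k) + F k'"
    using coset_self[of u k] by (auto simp: set_plus_def elt_set_plus_def)
qed

lemma abelian_monoid_gr: "abelian_monoid La"
proof (rule abelian_monoidI)
  fix g assume g: "g \<in> carrier La"
  have gk: "\<exists>u\<in>F (Suc k). g k = u +o F k" for k using g by (simp add: gr_simps)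
  show "\<zero>\<^bsub>La\<^esub> \<oplus>\<^bsub>La\<^esub> g = g"
  proof -
    have "F k + g k = g k" for k
    proof -
      obtain u where "g k = u +o F k" using gk by blast
      moreover have "F k = 0 +o F k" by simp
      ultimately show ?thesis using coset_add[of 0 k u] by simp
    qed
    then show ?thesis by (simp add: gr_simps)
  qed
  fix h assume h: "h \<in> carrier La"
  have hk: "\<exists>u\<in>F (Suc k). h k = u +o F k" for k using h by (simp add: gr_simps)
  have "\<exists>u\<in>F (Suc k). g k + h k = u +o F k" for k
    using gk[of k] hk[of k] coset_add F_add by metis
  moreover have "finite {k. g k + h k \<noteq> F k}"
  proof (rule finite_subset)
    show "{k. g k + h k \<noteq> F k} \<subseteq> {k. g k \<noteq> F k} \<union> {k. h k \<noteq> F k}" using F_plus by auto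
    show "finite ({k. g k \<noteq> F k} \<union> {k. h k \<noteq> F k})" using g h by (simp add: gr_simps)
  qed
  ultimately show "g \<oplus>\<^bsub>La\<^esub> h \<in> carrier La" by (simp add: gr_simps)
  show "g \<oplus>\<^bsub>La\<^esub> h = h \<oplus>\<^bsub>La\<^esub> g" by (simp add: gr_simps add.commute)
  fix f assume "f \<in> carrier La"
  show "g \<oplus>\<^bsub>La\<^esub> h \<oplus>\<^bsub>La\<^esub> f = g \<oplus>\<^bsub>La\<^esub> (h \<oplus>\<^bsub>La\<^esub> f)" by (simp add: gr_simps add.assoc)
next
  have "\<exists>u\<in>F (Suc k). F k = u +o F k" for k by (rule bexI[OF _ F_zero]) simp
  then show "\<zero>\<^bsub>La\<^esub> \<in> carrier La" by (simp add: gr_simps)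
qed

text \<open>The result of applying \<open>p\<close> to the cyclic vector of the associated graded module.\<close>

definition cosets :: "pol \<Rightarrow> nat \<Rightarrow> 'v set" where
  "cosets p = (\<lambda>k. ev k p +o F k)"

lemma cosets_carrier: "p \<in> Sym n D \<Longrightarrow> cosets p \<in> carrier La"
proof -
  assume p: "p \<in> Sym n D"
  have "{k. cosets p k \<noteq> F k} \<subseteq> degree ` keys p"
  proof
    fix k assume "k \<in> {k. cosets p k \<noteq> F k}"
    then have "ev k p \<noteq> 0" by (auto simp: cosets_def)
    then obtain e where "e \<in> keys p" "(if degree e = k then scale (lookup p e) (\<rho>_roots (ls e)) else 0) \<noteq> 0"
      unfolding ev_def by (rule sum.not_neutral_contains_not_neutral)
    then show "k \<in> degree ` keys p" by (auto split: if_splits)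
  qed
  then have "finite {k. cosets p k \<noteq> F k}" by (rule finite_subset) simp
  then show ?thesis using ev_F[OF p] by (auto simp: gr_simps cosets_def)
qed

lemma cosets_add: "cosets (p + q) = cosets p \<oplus>\<^bsub>La\<^esub> cosets q"
  by (simp add: cosets_def gr_simps ev_add coset_add)

lemma cosets_zero: "cosets 0 = \<zero>\<^bsub>La\<^esub>"
  by (simp add: cosets_def gr_simps ev_zero)

lemma cosets_scale: "cosets (single 0 c * p) = c \<odot>\<^bsub>La\<^esub> cosets p"
proof -
  have "scale c ` (u +o F k) + F k = scale c u +o F k" for u k
    by (rule coset_image) (simp_all add: V.scale_right_distrib F_scale)
  then show ?thesis by (simp add: cosets_def gr_simps ev_scale)
qed

lemma cosets_eq_zero_iff: "p \<in> Sym n D \<Longrightarrow> cosets p = \<zero>\<^bsub>La\<^esub> \<longleftrightarrow> p \<in> graded_annihilator"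
  by (simp add: cosets_def gr_simps graded_annihilator_def fun_eq_iff coset_F)

lemma gr_vec_cosets: "gr_vec n D scale \<rho> l = cosets 1"
proof
  fix k
  have "ev k 1 = (if k = 0 then l else 0)" using ev_const[of k 1] by simp
  then show "gr_vec n D scale \<rho> l k = cosets 1 k" by (simp add: gr_vec_def cosets_def)
qed

lemma gr_act_cosets:
  assumes \<alpha>: "\<alpha> \<in> PD n D" and p: "p \<in> Sym n D"
  shows "gr_act n D scale \<rho> l (Emat n (fst \<alpha>) (snd \<alpha>)) (cosets p) = cosets (fvar \<alpha> * p)"
proof
  fix k
  let ?E = "Emat n (fst \<alpha>) (snd \<alpha>)"
  have pr: "ppart n D ?E = 0\<^sub>m n n" "rpart n D ?E = ?E" using ppart_Emat rpart_Emat \<alpha> by simp_all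
  have z: "\<rho> (0\<^sub>m n n) ` cosets p k = {0}" using coset_self[of "ev k p" k] by (auto simp: cosets_def \<rho>_mzero)
  show "gr_act n D scale \<rho> l ?E (cosets p) k = cosets (fvar \<alpha> * p) k"
  proof (cases k)
    case 0
    then show ?thesis using z by (simp add: gr_act_def pr cosets_def ev_fvar(2)[OF \<alpha> p])
  next
    case (Suc k')
    have img: "\<rho> ?E ` (ev k' p +o F k') + F k = \<rho> ?E (ev k' p) +o F k"
      unfolding Suc by (rule coset_image[OF \<rho>_add[OF root_sl[OF \<alpha>]] F_radical[OF root_radical[OF \<alpha>]]])
    have "\<rho> ?E (ev k' p) +o F k = ev k (fvar \<alpha> * p) +o F k"
      using ev_fvar(1)[OF \<alpha> p, of k'] coset_eq_iff[of "ev k (fvar \<alpha> * p)" k "\<rho> ?E (ev k' p)"] Suc by simp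
    then show ?thesis using z img Suc by (simp add: gr_act_def pr cosets_def)
  qed
qed

text \<open>The result of applying \<open>p\<close> to the cyclic vector of the tensor product with the \<open>M\<close>-th tensor power
  of \<open>V\<close>.\<close>

definition Xi :: "nat \<Rightarrow> pol \<Rightarrow> (nat \<times> nat) option list \<Rightarrow> nat \<Rightarrow> 'v set" where
  "Xi M p = (\<lambda>w\<in>V_words n D M. cosets (pdw w p))"

abbreviation T :: "nat \<Rightarrow> (complex, (nat \<times> nat) option list \<Rightarrow> nat \<Rightarrow> 'v set) module" where
  "T M \<equiv> tensor_V n D M La"

abbreviation tact :: "nat \<Rightarrow> complex mat \<Rightarrow> ((nat \<times> nat) option list \<Rightarrow> nat \<Rightarrow> 'v set) \<Rightarrow> (nat \<times> nat) option list \<Rightarrow> nat \<Rightarrow> 'v set" where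
  "tact M \<equiv> tensor_act n D M La (gr_act n D scale \<rho> l)"

lemma Xi_carrier: "p \<in> Sym n D \<Longrightarrow> Xi M p \<in> carrier (T M)"
  by (auto simp: Xi_def tensor_V_simps intro!: cosets_carrier Sym_pdw)

lemma Xi_add: "Xi M (p + q) = Xi M p \<oplus>\<^bsub>T M\<^esub> Xi M q"
  by (auto simp: Xi_def tensor_V_simps pdw_add cosets_add)

lemma Xi_zero: "Xi M 0 = \<zero>\<^bsub>T M\<^esub>"
  by (simp add: Xi_def tensor_V_simps pdw_zero cosets_zero)

lemma Xi_scale: "Xi M (single 0 c * p) = c \<odot>\<^bsub>T M\<^esub> Xi M p"
  by (auto simp: Xi_def tensor_V_simps pdw_scale cosets_scale)

lemma V_words_0: "V_words n D 0 = {[]}"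
  by (auto simp: V_words_def)

lemma V_words_Suc: "V_words n D (Suc M) = (\<lambda>(b, w). b # w) ` (V_labels n D \<times> V_words n D M)"
  by (auto simp: V_words_def length_Suc_conv image_iff)

lemma pdw_Ann: "(\<forall>w\<in>V_words n D M. pdw w p \<in> graded_annihilator) \<longleftrightarrow> p \<in> Ann M"
proof (induction M arbitrary: p)
  case 0
  show ?case by (simp add: V_words_0 Ann_0)
next
  case (Suc M)
  have "(\<forall>w\<in>V_words n D (Suc M). pdw w p \<in> graded_annihilator)
      \<longleftrightarrow> (\<forall>b\<in>V_labels n D. \<forall>w\<in>V_words n D M. pdw w (case b of None \<Rightarrow> p | Some \<alpha> \<Rightarrow> pd \<alpha> p) \<in> graded_annihilator)"
    unfolding V_words_Suc by auto
  also have "\<dots> \<longleftrightarrow> p \<in> Ann (Suc M)"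
    unfolding Suc.IH V_labels_def by (auto simp: Ann_Suc prolong_def)
  finally show ?case .
qed

lemma Xi_eq_zero_iff:
  assumes p: "p \<in> Sym n D"
  shows "Xi M p = \<zero>\<^bsub>T M\<^esub> \<longleftrightarrow> p \<in> Ann M"
proof -
  have "Xi M p = \<zero>\<^bsub>T M\<^esub> \<longleftrightarrow> (\<forall>w\<in>V_words n D M. cosets (pdw w p) = \<zero>\<^bsub>La\<^esub>)"
    unfolding Xi_def tensor_V_simps by (auto simp: restrict_def fun_eq_iff)
  then show ?thesis using cosets_eq_zero_iff[OF Sym_pdw[OF p]] pdw_Ann[of M p] by simp
qed

lemma finsum_cosets:
  assumes "finite I" "\<And>i. i \<in> I \<Longrightarrow> f i \<in> Sym n D"
  shows "(\<Oplus>\<^bsub>La\<^esub>i\<in>I. cosets (f i)) = cosets (\<Sum>i\<in>I. f i)"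
  by (rule finsum_image[OF abelian_monoid_gr cosets_carrier cosets_add cosets_zero assms])

lemma finsum_Xi:
  assumes "finite I" "\<And>i. i \<in> I \<Longrightarrow> f i \<in> Sym n D"
  shows "(\<Oplus>\<^bsub>T M\<^esub>i\<in>I. Xi M (f i)) = Xi M (\<Sum>i\<in>I. f i)"
  by (rule finsum_image[OF abelian_monoid_tensor_V[OF abelian_monoid_gr] Xi_carrier Xi_add Xi_zero assms])

lemma tensor_act_Xi:
  assumes \<alpha>: "\<alpha> \<in> PD n D" and p: "p \<in> Sym n D"
  shows "tact M (Emat n (fst \<alpha>) (snd \<alpha>)) (Xi M p) = Xi M (fvar \<alpha> * p)"
proof -
  let ?E = "Emat n (fst \<alpha>) (snd \<alpha>)"
  interpret La: abelian_monoid La by (rule abelian_monoid_gr)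
  have "gr_act n D scale \<rho> l ?E (Xi M p w) \<oplus>\<^bsub>La\<^esub>
     (\<Oplus>\<^bsub>La\<^esub>k\<in>{..<M}. \<Oplus>\<^bsub>La\<^esub>b\<in>V_labels n D. V_coord (w ! k) (V_act n D ?E (V_basis n b)) \<odot>\<^bsub>La\<^esub> Xi M p (w[k := b]))
     = cosets (pdw w (fvar \<alpha> * p))" if w: "w \<in> V_words n D M" for w
  proof -
    let ?c = "\<lambda>k b. V_coord (w ! k) (V_act n D ?E (V_basis n b))"
    have len: "length w = M" and sub: "set w \<subseteq> V_labels n D" using w by (simp_all add: V_words_def)
    let ?t = "\<lambda>k b. single 0 (?c k b) * pdw (w[k := b]) p"
    have tS: "?t k b \<in> Sym n D" for k b by (intro Sym_mult Sym_pdw p) simp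
    have inner: "(\<Oplus>\<^bsub>La\<^esub>b\<in>V_labels n D. ?c k b \<odot>\<^bsub>La\<^esub> Xi M p (w[k := b])) = cosets (if w ! k = Some \<alpha> then pdw (w[k := None]) p else 0)"
      if k: "k < M" for k
    proof -
      have "(\<Oplus>\<^bsub>La\<^esub>b\<in>V_labels n D. ?c k b \<odot>\<^bsub>La\<^esub> Xi M p (w[k := b])) = (\<Oplus>\<^bsub>La\<^esub>b\<in>V_labels n D. cosets (?t k b))"
      proof (rule La.finsum_cong'[OF refl])
        show "(\<lambda>b. cosets (?t k b)) \<in> V_labels n D \<rightarrow> carrier La" using cosets_carrier[OF tS] by blast
        fix b assume "b \<in> V_labels n D"
        then show "?c k b \<odot>\<^bsub>La\<^esub> Xi M p (w[k := b]) = cosets (?t k b)"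
          unfolding cosets_scale by (simp add: Xi_def V_words_upd[OF w])
      qed
      also have "\<dots> = cosets (\<Sum>b\<in>V_labels n D. ?t k b)" by (rule finsum_cosets[OF finite_V_labels[OF D] tS])
      also have "(\<Sum>b\<in>V_labels n D. ?t k b) = (\<Sum>b\<in>V_labels n D. if b = None then (if w ! k = Some \<alpha> then pdw (w[k := None]) p else 0) else 0)"
      proof (rule sum.cong[OF refl])
        fix b assume b: "b \<in> V_labels n D"
        have wk: "w ! k \<in> V_labels n D" using sub len k by auto
        have "?c k b = (if b = None \<and> w ! k = Some \<alpha> then 1 else 0)"
          using V_coord_act[of "fst \<alpha>" "snd \<alpha>" n D b "w ! k"] \<alpha> b wk by simp
        then show "?t k b = (if b = None then (if w ! k = Some \<alpha> then pdw (w[k := None]) p else 0) else 0)" by simp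
      qed
      also have "\<dots> = (if w ! k = Some \<alpha> then pdw (w[k := None]) p else 0)"
        using finite_V_labels[OF D] by (simp add: V_labels_def)
      finally show ?thesis .
    qed
    let ?s = "\<lambda>k. if w ! k = Some \<alpha> then pdw (w[k := None]) p else 0"
    have sS: "?s k \<in> Sym n D" for k using Sym_pdw[OF p] Sym_zero by simp
    have "(\<Oplus>\<^bsub>La\<^esub>k\<in>{..<M}. \<Oplus>\<^bsub>La\<^esub>b\<in>V_labels n D. ?c k b \<odot>\<^bsub>La\<^esub> Xi M p (w[k := b])) = (\<Oplus>\<^bsub>La\<^esub>k\<in>{..<M}. cosets (?s k))"
    proof (rule La.finsum_cong'[OF refl])
      show "(\<lambda>k. cosets (?s k)) \<in> {..<M} \<rightarrow> carrier La" using cosets_carrier[OF sS] by blast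
    qed (use inner in simp)
    also have "\<dots> = cosets (\<Sum>k<M. ?s k)" by (rule finsum_cosets[OF finite_lessThan sS])
    finally have outer: "(\<Oplus>\<^bsub>La\<^esub>k\<in>{..<M}. \<Oplus>\<^bsub>La\<^esub>b\<in>V_labels n D. ?c k b \<odot>\<^bsub>La\<^esub> Xi M p (w[k := b])) = cosets (\<Sum>k<M. ?s k)" .
    have "Xi M p w = cosets (pdw w p)" using w by (simp add: Xi_def)
    then have "gr_act n D scale \<rho> l ?E (Xi M p w) = cosets (fvar \<alpha> * pdw w p)"
      using gr_act_cosets[OF \<alpha> Sym_pdw[OF p]] by simp
    then show ?thesis unfolding outer pdw_fvar len by (simp only: cosets_add)
  qed
  then show ?thesis unfolding tensor_act_def Xi_def[of M "fvar \<alpha> * p"] by (intro restrict_ext)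
qed

lemma tensor_vec_Xi: "tensor_vec n D M La (gr_vec n D scale \<rho> l) = Xi M 1"
  unfolding tensor_vec_def Xi_def
proof (rule restrict_ext)
  fix w assume w: "w \<in> V_words n D M"
  then have len: "length w = M" by (simp add: V_words_def)
  have "w = replicate M None \<longleftrightarrow> set w \<subseteq> {None}"
  proof
    assume "set w \<subseteq> {None}"
    then have "replicate (length w) None = w" by (intro replicate_eqI[symmetric]) auto
    then show "w = replicate M None" using len by simp
  qed auto
  then show "(if w = replicate M None then gr_vec n D scale \<rho> l else \<zero>\<^bsub>La\<^esub>) = cosets (pdw w 1)"
    by (simp add: pdw_one gr_vec_cosets cosets_zero)
qed

lemma act_power_Xi:
  "\<alpha> \<in> PD n D \<Longrightarrow> p \<in> Sym n D \<Longrightarrow> (tact M (Emat n (fst \<alpha>) (snd \<alpha>)) ^^ k) (Xi M p) = Xi M (fvar \<alpha> ^ k * p) \<and> fvar \<alpha> ^ k * p \<in> Sym n D"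
  by (induction k) (simp_all add: tensor_act_Xi mult.assoc Sym_mult Sym_fvar)

lemma fold_act_Xi:
  "set L \<subseteq> PD n D \<Longrightarrow> p \<in> Sym n D \<Longrightarrow>
    fold (\<lambda>(i, j). tact M (Emat n i j) ^^ lookup e (i, j)) L (Xi M p)
      = Xi M (prod_list (map (\<lambda>\<alpha>. fvar \<alpha> ^ lookup e \<alpha>) L) * p)"
proof (induction L arbitrary: p)
  case (Cons \<alpha> L)
  have a: "\<alpha> \<in> PD n D" using Cons.prems(1) by simp
  show ?case using act_power_Xi[OF a Cons.prems(2), of "lookup e \<alpha>" M] Cons
    by (simp add: case_prod_beta mult.assoc mult.left_commute)
qed simp

lemma prod_fvar_single:
  assumes "finite K"
  shows "(\<Prod>\<alpha>\<in>K. fvar \<alpha> ^ s \<alpha>) = single (\<Sum>\<alpha>\<in>K. single \<alpha> (s \<alpha>)) 1"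
  using assms by (induction K rule: finite_induct) (simp_all add: fvar_power mult_single)

lemma prod_list_concat_map: "prod_list (map f (concat (map g xs))) = prod_list (map (\<lambda>x. prod_list (map f (g x))) xs)"
  for f :: "'x \<Rightarrow> pol"
  by (induction xs) simp_all

lemma mono_act_Xi:
  assumes e: "keys e \<subseteq> PD n D"
  shows "mono_act n D (tact M) e (Xi M 1) = Xi M (single e 1)"
proof -
  let ?f = "\<lambda>\<alpha>. fvar \<alpha> ^ lookup e \<alpha>"
  let ?L = "[(i, j). i \<leftarrow> [1..<n + 1], j \<leftarrow> [1..<i], (i, j) \<in> PD n D]"
  have L: "set ?L \<subseteq> PD n D" by auto
  have up: "prod_list (map g [a..<b]) = prod g {a..<b}" for g :: "nat \<Rightarrow> pol" and a b
    using prod.distinct_set_conv_list[of "[a..<b]" g] by simp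
  have "prod_list (map ?f ?L) = (\<Prod>i\<in>{1..<n + 1}. \<Prod>j\<in>{1..<i}. if (i, j) \<in> PD n D then ?f (i, j) else 1)"
  proof -
    have "prod_list (map ?f (if (i, j) \<in> PD n D then [(i, j)] else [])) = (if (i, j) \<in> PD n D then ?f (i, j) else 1)" for i j
      by simp
    then show ?thesis unfolding prod_list_concat_map up by simp
  qed
  also have "\<dots> = (\<Prod>\<alpha>\<in>(SIGMA i:{1..<n + 1}. {1..<i}). if \<alpha> \<in> PD n D then ?f \<alpha> else 1)"
    by (subst prod.Sigma) (auto intro!: prod.cong)
  also have "\<dots> = (\<Prod>\<alpha>\<in>PD n D. ?f \<alpha>)"
  proof (rule prod.mono_neutral_cong_right)
    show "PD n D \<subseteq> (SIGMA i:{1..<n + 1}. {1..<i})" by (auto simp: PD_def Pd_def Pos_def)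
  qed auto
  also have "\<dots> = single e 1"
  proof -
    have "(\<Sum>\<alpha>\<in>PD n D. single \<alpha> (lookup e \<alpha>)) = e"
      by (rule poly_mapping_eqI) (use e in \<open>auto simp: lookup_sum_singles[OF finite_PD[OF D]] in_keys_iff\<close>)
    then show ?thesis by (simp add: prod_fvar_single[OF finite_PD[OF D]])
  qed
  finally have "prod_list (map ?f ?L) = single e 1" .
  moreover have "(1 :: pol) \<in> Sym n D" using Sym_const[of 1 n D] by simp
  ultimately show ?thesis unfolding mono_act_def by (subst fold_act_Xi[OF L]) simp_all
qed

abbreviation lM :: "nat \<Rightarrow> (nat \<times> nat) option list \<Rightarrow> nat \<Rightarrow> 'v set" where
  "lM M \<equiv> tensor_vec n D M La (gr_vec n D scale \<rho> l)"

lemma pol_act_Xi: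
  assumes p: "p \<in> Sym n D"
  shows "pol_act n D (T M) (tact M) p (lM M) = Xi M p"
proof -
  interpret T: abelian_monoid "T M" by (rule abelian_monoid_tensor_V[OF abelian_monoid_gr])
  have k: "keys e \<subseteq> PD n D" if "e \<in> keys p" for e using p that by (simp add: Sym_def)
  have S: "single e c \<in> Sym n D" if "e \<in> keys p" for e c by (rule Sym_single[OF k[OF that]])
  have "pol_act n D (T M) (tact M) p (lM M) = (\<Oplus>\<^bsub>T M\<^esub>e\<in>keys p. Xi M (single e (lookup p e)))"
    unfolding pol_act_def tensor_vec_Xi
  proof (rule T.finsum_cong'[OF refl])
    show "(\<lambda>e. Xi M (single e (lookup p e))) \<in> keys p \<rightarrow> carrier (T M)"
      using Xi_carrier S by blast
    fix e assume e: "e \<in> keys p"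
    have "single e (lookup p e) = single 0 (lookup p e) * single e 1"
      by (simp add: mult_single)
    then show "lookup p e \<odot>\<^bsub>T M\<^esub> mono_act n D (tact M) e (Xi M 1) = Xi M (single e (lookup p e))"
      by (simp only: mono_act_Xi[OF k[OF e]] Xi_scale)
  qed
  also have "\<dots> = Xi M (\<Sum>e\<in>keys p. single e (lookup p e))"
    by (rule finsum_Xi[OF finite_keys S])
  finally show ?thesis using poly_mapping_expand[of p] by simp
qed

lemma annihilator_eq_Ann: "annihilator n D (T M) (tact M) (lM M) = Ann M"
  unfolding annihilator_def using Ann_Sym[of M] by (auto simp: pol_act_Xi Xi_eq_zero_iff)

abbreviation LM :: "nat \<Rightarrow> (complex, (nat \<times> nat) option list \<Rightarrow> nat \<Rightarrow> 'v set) module" where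
  "LM M \<equiv> cyclic_submodule n D (T M) (tact M) (lM M)"

lemma linear_image_Xi: "linear_image n D (LM M) (Xi M)"
proof
  show "carrier (LM M) = Xi M ` Sym n D"
    by (simp add: cyclic_submodule_def) (rule image_cong[OF refl pol_act_Xi])
qed (simp_all add: cyclic_submodule_def Xi_zero Xi_add Xi_scale)

lemma Xi_congruent:
  assumes "p \<in> Sym n D" "r \<in> Sym n D" "p - r \<in> Ann M"
  shows "Xi M p = Xi M r"
proof -
  interpret T: abelian_monoid "T M" by (rule abelian_monoid_tensor_V[OF abelian_monoid_gr])
  have "p - r \<in> Sym n D" using assms(3) Ann_Sym by blast
  then have z: "Xi M (p - r) = \<zero>\<^bsub>T M\<^esub>" using Xi_eq_zero_iff assms(3) by blast
  have "Xi M p = Xi M ((p - r) + r)" by simp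
  also have "\<dots> = Xi M r" unfolding Xi_add z by (rule T.l_zero[OF Xi_carrier[OF assms(2)]])
  finally show ?thesis .
qed

text \<open>The exponent of \<open>f_mono n D s\<close>.\<close>

definition expo :: "(nat \<times> nat \<Rightarrow> nat) \<Rightarrow> nat \<times> nat \<Rightarrow>\<^sub>0 nat" where
  "expo s = (\<Sum>\<alpha>\<in>PD n D. single \<alpha> (s \<alpha>))"

lemma lookup_expo: "lookup (expo s) \<beta> = (if \<beta> \<in> PD n D then s \<beta> else 0)"
  unfolding expo_def by (rule lookup_sum_singles[OF finite_PD[OF D]])

lemma f_mono_single: "f_mono n D s = single (expo s) 1"
  unfolding f_mono_def expo_def by (rule prod_fvar_single[OF finite_PD[OF D]])

lemma expo_keys: "keys (expo s) \<subseteq> PD n D"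
  by (auto simp: in_keys_iff lookup_expo split: if_splits)

lemma expo_inj: "inj_on expo (S_set n D m M)"
proof (rule inj_onI)
  fix s s' assume s: "s \<in> S_set n D m M" "s' \<in> S_set n D m M" and e: "expo s = expo s'"
  show "s = s'"
  proof (rule PiE_ext)
    show "s \<in> PD n D \<rightarrow>\<^sub>E UNIV" "s' \<in> PD n D \<rightarrow>\<^sub>E UNIV" using s unfolding S_set_def by blast+
    fix \<alpha> assume "\<alpha> \<in> PD n D"
    then show "s \<alpha> = s' \<alpha>" using arg_cong[OF e, of "\<lambda>x. lookup x \<alpha>"] by (simp add: lookup_expo)
  qed
qed

lemma expo_image: "expo ` S_set n D m M = S_exp n D m M"
proof
  have sums: "(\<Sum>\<alpha>\<in>Q. lookup (expo s) \<alpha>) = (\<Sum>\<alpha>\<in>Q. s \<alpha>)" if "Q \<subseteq> PD n D" for Q s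
    by (rule sum.cong) (use that in \<open>auto simp: lookup_expo\<close>)
  show "expo ` S_set n D m M \<subseteq> S_exp n D m M"
    using expo_keys sums by (auto simp: S_set_def S_exp_def)
  show "S_exp n D m M \<subseteq> expo ` S_set n D m M"
  proof
    fix e assume e: "e \<in> S_exp n D m M"
    let ?s = "\<lambda>\<alpha>\<in>PD n D. lookup e \<alpha>"
    have "expo ?s = e"
      by (rule poly_mapping_eqI) (use e in \<open>auto simp: lookup_expo S_exp_def in_keys_iff\<close>)
    moreover have "?s \<in> S_set n D m M"
    proof -
      have "(\<Sum>\<alpha>\<in>Q. ?s \<alpha>) = (\<Sum>\<alpha>\<in>Q. lookup e \<alpha>)" if "Q \<subseteq> PD n D" for Q
        by (rule sum.cong) (use that in auto)
      then show ?thesis using e by (auto simp: S_set_def S_exp_def)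
    qed
    ultimately show "e \<in> expo ` S_set n D m M" by (metis imageI)
  qed
qed

lemma pol_act_f_mono: "pol_act n D (T M) (tact M) (f_mono n D s) (lM M) = Xi M (single (expo s) 1)"
  unfolding f_mono_single by (rule pol_act_Xi[OF Sym_single[OF expo_keys]])

lemma monomials_basis:
  "inj_on (\<lambda>s. pol_act n D (T M) (tact M) (f_mono n D s) (lM M)) (S_set n D m M)"
  "vectorspace.basis class_ring (LM M) ((\<lambda>s. pol_act n D (T M) (tact M) (f_mono n D s) (lM M)) ` S_set n D m M)"
proof -
  let ?S = "S_exp n D m M" and ?b = "\<lambda>e. Xi M (single e 1)"
  have S: "keys e \<subseteq> PD n D" if "e \<in> ?S" for e using that by (simp add: S_exp_def)
  have rS: "r \<in> Sym n D" if "keys r \<subseteq> ?S" for r using that S by (auto simp: Sym_def)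
  have span: "\<exists>r. keys r \<subseteq> ?S \<and> Xi M p = Xi M r" if p: "p \<in> Sym n D" for p
    using standard_form[OF D stable_Ann relations_Ann p] Xi_congruent[OF p rS] by metis
  have indep: "r = 0" if r: "keys r \<subseteq> ?S" and z: "Xi M r = \<zero>\<^bsub>LM M\<^esub>" for r
  proof -
    have "Xi M r = \<zero>\<^bsub>T M\<^esub>" using z by (simp add: cyclic_submodule_def)
    then show ?thesis using Xi_eq_zero_iff[OF rS[OF r]] Ann_independent[OF _ r] by blast
  qed
  have "inj_on ?b ?S" by (rule linear_image.b_inj[OF linear_image_Xi S span indep])
  then have "inj_on (?b \<circ> expo) (S_set n D m M)"
    by (intro comp_inj_on expo_inj) (simp add: expo_image)
  then show "inj_on (\<lambda>s. pol_act n D (T M) (tact M) (f_mono n D s) (lM M)) (S_set n D m M)"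
    unfolding pol_act_f_mono comp_def .
  have "vectorspace.basis class_ring (LM M) (?b ` ?S)" by (rule linear_image.basis[OF linear_image_Xi S span indep])
  then show "vectorspace.basis class_ring (LM M) ((\<lambda>s. pol_act n D (T M) (tact M) (f_mono n D s) (lM M)) ` S_set n D m M)"
    unfolding pol_act_f_mono expo_image[symmetric] image_image .
qed

end

theorem theorem4p6:
  fixes n M :: nat and D :: "nat set" and m :: "nat \<Rightarrow> nat"
    and scale :: "complex \<Rightarrow> 'v::ab_group_add \<Rightarrow> 'v"
    and \<rho> :: "complex mat \<Rightarrow> 'v \<Rightarrow> 'v" and l :: 'v
  assumes "n \<ge> 2" and "D \<subseteq> {1..<n}"
    and "irreducible_module n scale \<rho>"
    and "highest_weight_vector n D m scale \<rho> l"
  shows "let La = gr n D scale \<rho> l;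
             T = tensor_V n D M La;
             act = tensor_act n D M La (gr_act n D scale \<rho> l);
             lM = tensor_vec n D M La (gr_vec n D scale \<rho> l);
             Ann = annihilator n D T act lM;
             LM = cyclic_submodule n D T act lM
         in
           (\<forall>p\<in>relations n D m M. pol_act n D T act p lM = \<zero>\<^bsub>T\<^esub>) \<and>
           stable_ideal n D Ann \<and> relations n D m M \<subseteq> Ann \<and>
           (\<forall>J. stable_ideal n D J \<and> relations n D m M \<subseteq> J \<longrightarrow> Ann \<subseteq> J) \<and>
           inj_on (\<lambda>s. pol_act n D T act (f_mono n D s) lM) (S_set n D m M) \<and>
           vectorspace.basis class_ring LM
             ((\<lambda>s. pol_act n D T act (f_mono n D s) lM) ` S_set n D m M)"
proof -
  interpret H: highest_weight_module n D m scale \<rho> l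
    by unfold_locales (use assms in blast)+
  have "\<forall>p\<in>relations n D m M. pol_act n D (H.T M) (H.tact M) p (H.lM M) = \<zero>\<^bsub>H.T M\<^esub>"
    using H.relations_Ann[of M] H.annihilator_eq_Ann[of M] unfolding annihilator_def by blast
  then show ?thesis
    unfolding Let_def H.annihilator_eq_Ann
    using H.stable_Ann H.relations_Ann H.Ann_least H.monomials_basis by blast
qed

end
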